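(* Let $X$ be a totally disconnected compact metrizable space, $T\colon X\to X$ a homeomorphism, $K$ a field, and $\mathcal A=C_K(X)\rtimes_T\mathbb Z$. Then every Sylvester matrix rank function on $\mathcal A$ is regular, i.e. $\mathbb P(\mathcal A)=\mathbb P_{\mathrm{reg}}(\mathcal A)$.
   Context: $C_K(X)$ is the algebra of locally constant functions $X\to K$, and $\mathcal A=C_K(X)\rtimes_T\mathbb Z$ is the algebraic crossed product: finite formal sums $\sum_{i\in\mathbb Z}f_it^i$ with $f_i\in C_K(X)$, multiplication determined by $tf=(f\circ T^{-1})t$, $t$ invertible. A Sylvester matrix rank function on a unital ring $R$ assigns to each matrix $M$ over $R$ a number $\mathrm{rk}(M)\ge0$ with: $\mathrm{rk}(0)=0$, $\mathrm{rk}(1)=1$; $\mathrm{rk}(M_1M_2)\le\min(\mathrm{rk}(M_1),\mathrm{rk}(M_2))$; $\mathrm{rk}(M_1\oplus M_2)=\mathrm{rk}(M_1)+\mathrm{rk}(M_2)$; $\mathrm{rk}\begin{pmatrix}M_1&M_3\\0&M_2\end{pmatrix}\ge\mathrm{rk}(M_1)+\mathrm{rk}(M_2)$. $\mathbb P(R)$ denotes the set of all Sylvester matrix rank functions on $R$, and $\mathbb P_{\mathrm{reg}}(R)$ the subset of those $\mathrm{rk}$ for which there exist a von Neumann regular ring $S$ with a Sylvester matrix rank function $\mathrm{rk}_S$ and a unital ring homomorphism $\varphi\colon R\to S$ with $\mathrm{rk}(M)=\mathrm{rk}_S(\varphi(M))$ for every matrix $M$ over $R$. *)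

theory Defs
  imports "HOL-Analysis.Analysis" "HOL-Algebra.Ring" "HOL-Algebra.RingHom"
begin

definition totally_disconnected_space :: "'x topology \<Rightarrow> bool" where
  "totally_disconnected_space X \<longleftrightarrow>
     (\<forall>S. S \<subseteq> topspace X \<and> connectedin X S \<longrightarrow> (\<exists>a. S \<subseteq> {a}))"

text \<open>Locally constant K-valued functions on X, normalised to be 0 outside the
  underlying set of X (so that each function on X has a unique representative).\<close>
definition loc_const_fun :: "'x topology \<Rightarrow> ('x \<Rightarrow> 'k::field) set" where
  "loc_const_fun X = {f. (\<forall>x\<in>topspace X. \<exists>U. openin X U \<and> x \<in> U \<and> (\<forall>y\<in>U. f y = f x))
                        \<and> (\<forall>x. x \<notin> topspace X \<longrightarrow> f x = 0)}"

definition Tpow :: "'x topology \<Rightarrow> ('x \<Rightarrow> 'x) \<Rightarrow> int \<Rightarrow> 'x \<Rightarrow> 'x" where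
  "Tpow X T i = (if 0 \<le> i then T ^^ nat i else (inv_into (topspace X) T) ^^ nat (- i))"

text \<open>An element \<open>\<Sum>i f_i t^i\<close> is represented by its coefficient function \<open>i \<mapsto> f_i\<close>
  (finitely supported).  The rule \<open>t f = (f \<circ> T^-1) t\<close> gives
  \<open>(f t^i)(g t^j) = f (g \<circ> T^-i) t^(i+j)\<close>.\<close>
definition crossed_product :: "'x topology \<Rightarrow> ('x \<Rightarrow> 'x) \<Rightarrow> (int \<Rightarrow> 'x \<Rightarrow> 'k::field) ring" where
  "crossed_product X T =
    \<lparr> carrier = {F. finite {i. F i \<noteq> (\<lambda>x. 0)} \<and> (\<forall>i. F i \<in> loc_const_fun X)},
      mult = (\<lambda>F G. \<lambda>n x. \<Sum>i\<in>{i. F i \<noteq> (\<lambda>x. 0)}. F i x * G (n - i) (Tpow X T (- i) x)),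
      one = (\<lambda>i x. if i = 0 \<and> x \<in> topspace X then 1 else 0),
      zero = (\<lambda>i x. 0),
      add = (\<lambda>F G. \<lambda>i x. F i x + G i x) \<rparr>"

definition mat_over :: "('a, 'b) ring_scheme \<Rightarrow> nat \<Rightarrow> nat \<Rightarrow> (nat \<Rightarrow> nat \<Rightarrow> 'a) set" where
  "mat_over R m n = {M. (\<forall>i<m. \<forall>j<n. M i j \<in> carrier R)
                       \<and> (\<forall>i j. (m \<le> i \<or> n \<le> j) \<longrightarrow> M i j = \<zero>\<^bsub>R\<^esub>)}"

definition mat_zero :: "('a, 'b) ring_scheme \<Rightarrow> nat \<Rightarrow> nat \<Rightarrow> 'a" where
  "mat_zero R = (\<lambda>i j. \<zero>\<^bsub>R\<^esub>)"

definition mat_one1 :: "('a, 'b) ring_scheme \<Rightarrow> nat \<Rightarrow> nat \<Rightarrow> 'a" where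
  "mat_one1 R = (\<lambda>i j. if i = 0 \<and> j = 0 then \<one>\<^bsub>R\<^esub> else \<zero>\<^bsub>R\<^esub>)"

definition mat_mult :: "('a, 'b) ring_scheme \<Rightarrow> nat \<Rightarrow> nat \<Rightarrow> nat \<Rightarrow>
    (nat \<Rightarrow> nat \<Rightarrow> 'a) \<Rightarrow> (nat \<Rightarrow> nat \<Rightarrow> 'a) \<Rightarrow> nat \<Rightarrow> nat \<Rightarrow> 'a" where
  "mat_mult R m n p M N = (\<lambda>i k. if i < m \<and> k < p
       then finsum R (\<lambda>j. M i j \<otimes>\<^bsub>R\<^esub> N j k) {..<n} else \<zero>\<^bsub>R\<^esub>)"

definition mat_block :: "('a, 'b) ring_scheme \<Rightarrow> nat \<Rightarrow> nat \<Rightarrow>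
    (nat \<Rightarrow> nat \<Rightarrow> 'a) \<Rightarrow> (nat \<Rightarrow> nat \<Rightarrow> 'a) \<Rightarrow> (nat \<Rightarrow> nat \<Rightarrow> 'a) \<Rightarrow> (nat \<Rightarrow> nat \<Rightarrow> 'a)
    \<Rightarrow> nat \<Rightarrow> nat \<Rightarrow> 'a" where
  "mat_block R m1 n1 A C D B = (\<lambda>i j.
      if i < m1 then (if j < n1 then A i j else C i (j - n1))
      else (if j < n1 then D (i - m1) j else B (i - m1) (j - n1)))"

definition sylvester_rank :: "('a, 'b) ring_scheme \<Rightarrow> (nat \<Rightarrow> nat \<Rightarrow> (nat \<Rightarrow> nat \<Rightarrow> 'a) \<Rightarrow> real) \<Rightarrow> bool" where
  "sylvester_rank R rk \<longleftrightarrow>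
     (\<forall>m n. \<forall>M\<in>mat_over R m n. 0 \<le> rk m n M)
   \<and> (\<forall>m n. rk m n (mat_zero R) = 0)
   \<and> rk 1 1 (mat_one1 R) = 1
   \<and> (\<forall>m n p. \<forall>M\<in>mat_over R m n. \<forall>N\<in>mat_over R n p.
        rk m p (mat_mult R m n p M N) \<le> min (rk m n M) (rk n p N))
   \<and> (\<forall>m1 n1 m2 n2. \<forall>M1\<in>mat_over R m1 n1. \<forall>M2\<in>mat_over R m2 n2.
        rk (m1 + m2) (n1 + n2) (mat_block R m1 n1 M1 (mat_zero R) (mat_zero R) M2)
          = rk m1 n1 M1 + rk m2 n2 M2)
   \<and> (\<forall>m1 n1 m2 n2. \<forall>M1\<in>mat_over R m1 n1. \<forall>M2\<in>mat_over R m2 n2. \<forall>M3\<in>mat_over R m1 n2.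
        rk m1 n1 M1 + rk m2 n2 M2
          \<le> rk (m1 + m2) (n1 + n2) (mat_block R m1 n1 M1 M3 (mat_zero R) M2))"

definition vn_regular :: "('a, 'b) ring_scheme \<Rightarrow> bool" where
  "vn_regular S \<longleftrightarrow> ring S \<and> (\<forall>a\<in>carrier S. \<exists>x\<in>carrier S. a \<otimes>\<^bsub>S\<^esub> x \<otimes>\<^bsub>S\<^esub> a = a)"

text \<open>Regular Sylvester rank functions (the set P_reg(R)).  Since HOL cannot quantify
  over types inside a formula, the carrier type 'c of the regular ring S is a parameter.\<close>
definition regular_rank :: "'c itself \<Rightarrow> ('a, 'b) ring_scheme
    \<Rightarrow> (nat \<Rightarrow> nat \<Rightarrow> (nat \<Rightarrow> nat \<Rightarrow> 'a) \<Rightarrow> real) \<Rightarrow> bool" where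
  "regular_rank (_ :: 'c itself) R rk \<longleftrightarrow>
     (\<exists>(S :: 'c ring) rkS \<phi>. vn_regular S \<and> sylvester_rank S rkS \<and> \<phi> \<in> ring_hom R S
        \<and> (\<forall>m n. \<forall>M\<in>mat_over R m n. rk m n M = rkS m n (\<lambda>i j. \<phi> (M i j))))"

end

theory Submission
  imports Defs "HOL-Computational_Algebra.Polynomial" "HOL-Library.Function_Algebras"
begin

text \<open>
  A Sylvester rank function extends to all finitely supported infinite matrices, so that shifts and
  block decompositions become ordinary ring operations. It is regular as soon as, on every finite set
  of square matrices and up to any error, it is a nonnegative combination of ranks \<open>krank \<circ> \<phi>\<close> with
  \<open>\<phi>\<close> a unital additive map into a matrix algebra over \<open>K\<close>. Multiplicativity of \<open>\<phi>\<close> is not needed: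
  in the limit rank on the product of all such matrix algebras, the rank of
  \<open>(1, b; a, a * b)\<close> already forces \<open>\<phi> (a * b)\<close> and \<open>\<phi> a * \<phi> b\<close> to agree up to rank \<open>0\<close>.
  The product is von Neumann regular, and the quasi-inverse closure of the image of the algebra,
  modulo elements of rank \<open>0\<close>, can be coded by terms over the carrier type of the algebra.

  For the crossed product the approximations come from Rokhlin towers. Fix \<open>N\<close> and let \<open>F\<close> be the
  closed invariant set of points fixed by \<open>T^(N!)\<close>. Away from a small clopen neighbourhood of \<open>F\<close>
  almost all of the rank lives on towers of height between \<open>N\<close> and \<open>2 N\<close>, on which the algebra acts
  by matrices over \<open>K\<close> up to boundary effects of relative size \<open>O(1 / N)\<close>. The part of the rank
  concentrated at \<open>F\<close>, an infimum over clopen neighbourhoods, decomposes over finitely many cyclic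
  towers; each of them carries a rank function on matrices over \<open>K[s]\<close> for which \<open>s\<close> has full rank.
  By the Smith normal form such a rank function is, on finitely many matrices, a nonnegative
  combination of ranks over quotients \<open>K[s] / (r)\<close> with \<open>r 0 \<noteq> 0\<close>, in which \<open>s\<close> is invertible.
\<close>

section \<open>Row-finite matrices and rank functions\<close>

text \<open>The obstacle is that ranks add up only for block diagonal matrices: cutting an element
  along a partition of the space is additive only if row cuts and column cuts are both disjoint. An
  element of degree at most \<open>D\<close> in \<open>t\<close> moves points at most
  \<open>D\<close> steps along orbits, so additivity holds for tower interiors, \<open>D\<close>
  levels away from both ends, at a cost of order \<open>D / N\<close>. Row-finite matrices come from
  the regular representation of the crossed product along orbits; they put the algebra and all
  matrices over it into type-class rings. Finitely supported matrices have no unit, so local units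
  replace it. The number \<open>N!\<close> appears because a point that it does not fix has no
  period below \<open>N\<close>, as a tower of height \<open>N\<close> requires, while all periods
  on \<open>F\<close> divide one number. Polynomials are forced by the periodic points: a full turn
  of a cyclic tower is multiplication by \<open>s\<close>. Negative turns are shifted away by a
  power of \<open>s\<close>, which is harmless because \<open>s\<close> has full rank and is
  inverted in each quotient. The coding by terms is forced by the demand that the regular ring live
  on the carrier type of the algebra.\<close>

typedef (overloaded) ('i, 'a::zero) rfm = "{f :: 'i \<Rightarrow> 'i \<Rightarrow> 'a. \<forall>i. finite {j. f i j \<noteq> 0}}"
  morphisms ent Rfm
  by (rule exI[of _ "\<lambda>i j. 0"]) simp

lemma ent_finite [simp]: "finite {j. ent A i j \<noteq> 0}"
  using ent[of A] by simp

lemma rfm_eqI: "(\<And>i j. ent A i j = ent B i j) ==> A = B"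
  by (metis ent_inject ext)

lemma ent_Rfm: "(\<And>i. finite {j. f i j \<noteq> 0}) ==> ent (Rfm f) = f"
  by (simp add: Rfm_inverse)

instantiation rfm :: (type, ring) ring
begin

definition "0 = Rfm (\<lambda>i j. 0)"
definition "A + B = Rfm (\<lambda>i j. ent A i j + ent B i j)"
definition "A - B = Rfm (\<lambda>i j. ent A i j - ent B i j)"
definition "- A = Rfm (\<lambda>i j. - ent A i j)"
definition "A * B = Rfm (\<lambda>i k. \<Sum>j | ent A i j \<noteq> 0. ent A i j * ent B j k)"

lemma ent_0 [simp]: "ent 0 i j = 0"
  unfolding zero_rfm_def by (subst ent_Rfm) auto

lemma ent_add [simp]: "ent (A + B) i j = ent A i j + ent B i j"
proof -
  have "finite {j. ent A i j + ent B i j \<noteq> 0}" for i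
    by (rule finite_subset[of _ "{j. ent A i j \<noteq> 0} \<union> {j. ent B i j \<noteq> 0}"]) auto
  then show ?thesis unfolding plus_rfm_def by (simp add: ent_Rfm)
qed

lemma ent_diff [simp]: "ent (A - B) i j = ent A i j - ent B i j"
proof -
  have "finite {j. ent A i j - ent B i j \<noteq> 0}" for i
    by (rule finite_subset[of _ "{j. ent A i j \<noteq> 0} \<union> {j. ent B i j \<noteq> 0}"]) auto
  then show ?thesis unfolding minus_rfm_def by (simp add: ent_Rfm)
qed

lemma ent_uminus [simp]: "ent (- A) i j = - ent A i j"
  unfolding uminus_rfm_def by (subst ent_Rfm) auto

lemma ent_times: "ent (A * B) i k = (\<Sum>j | ent A i j \<noteq> 0. ent A i j * ent B j k)"
proof -
  have "finite {k. (\<Sum>j | ent A i j \<noteq> 0. ent A i j * ent B j k) \<noteq> 0}" for i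
  proof (rule finite_subset)
    show "{k. (\<Sum>j | ent A i j \<noteq> 0. ent A i j * ent B j k) \<noteq> 0}
        \<subseteq> (\<Union>j\<in>{j. ent A i j \<noteq> 0}. {k. ent B j k \<noteq> 0})"
    proof
      fix k assume "k \<in> {k. (\<Sum>j | ent A i j \<noteq> 0. ent A i j * ent B j k) \<noteq> 0}"
      then obtain j where "ent A i j \<noteq> 0" "ent A i j * ent B j k \<noteq> 0"
        using sum.neutral by (metis (mono_tags, lifting) mem_Collect_eq)
      then show "k \<in> (\<Union>j\<in>{j. ent A i j \<noteq> 0}. {k. ent B j k \<noteq> 0})" by force
    qed
  qed auto
  then show ?thesis unfolding times_rfm_def by (subst ent_Rfm) auto
qed

lemma ent_mult:
  assumes "finite J" "\<And>j. j \<notin> J ==> ent A i j * ent B j k = 0"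
  shows "ent (A * B) i k = (\<Sum>j\<in>J. ent A i j * ent B j k)"
proof -
  have "(\<Sum>j | ent A i j \<noteq> 0. ent A i j * ent B j k)
      = (\<Sum>j \<in> {j. ent A i j \<noteq> 0} \<union> J. ent A i j * ent B j k)"
    by (rule sum.mono_neutral_left) (use assms in auto)
  also have "\<dots> = (\<Sum>j\<in>J. ent A i j * ent B j k)"
    by (rule sum.mono_neutral_right) (use assms in auto)
  finally show ?thesis by (simp add: ent_times)
qed

instance
proof
  fix A B C :: "('a, 'b) rfm"
  show "A * B * C = A * (B * C)"
  proof (rule rfm_eqI)
    fix i l
    let ?J = "{j. ent A i j \<noteq> 0}"
    let ?L = "\<Union>j\<in>?J. {k. ent B j k \<noteq> 0}"
    have L: "finite ?L" by auto
    have AB: "ent (A * B) i k = (\<Sum>j\<in>?J. ent A i j * ent B j k)" for k by (rule ent_mult) auto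
    have "ent (A * B * C) i l = (\<Sum>k\<in>?L. ent (A * B) i k * ent C k l)"
    proof (rule ent_mult[OF L])
      fix k assume k: "k \<notin> ?L"
      have "ent (A * B) i k = 0" unfolding AB by (rule sum.neutral) (use k in auto)
      then show "ent (A * B) i k * ent C k l = 0" by simp
    qed
    also have "\<dots> = (\<Sum>k\<in>?L. \<Sum>j\<in>?J. ent A i j * ent B j k * ent C k l)"
      by (simp add: AB sum_distrib_right)
    also have "\<dots> = (\<Sum>j\<in>?J. \<Sum>k\<in>?L. ent A i j * ent B j k * ent C k l)"
      by (rule sum.swap)
    also have "\<dots> = (\<Sum>j\<in>?J. ent A i j * ent (B * C) j l)"
    proof (rule sum.cong[OF refl])
      fix j assume j: "j \<in> ?J"
      have "ent (B * C) j l = (\<Sum>k\<in>?L. ent B j k * ent C k l)"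
        by (rule ent_mult[OF L]) (use j in auto)
      then show "(\<Sum>k\<in>?L. ent A i j * ent B j k * ent C k l) = ent A i j * ent (B * C) j l"
        by (simp add: sum_distrib_left mult.assoc)
    qed
    also have "\<dots> = ent (A * (B * C)) i l" by (rule ent_mult[symmetric]) auto
    finally show "ent (A * B * C) i l = ent (A * (B * C)) i l" .
  qed
  show "(A + B) * C = A * C + B * C"
  proof (rule rfm_eqI)
    fix i k
    let ?J = "{j. ent A i j \<noteq> 0} \<union> {j. ent B i j \<noteq> 0}"
    have "ent ((A + B) * C) i k = (\<Sum>j\<in>?J. ent (A + B) i j * ent C j k)" by (rule ent_mult) auto
    also have "\<dots> = (\<Sum>j\<in>?J. ent A i j * ent C j k) + (\<Sum>j\<in>?J. ent B i j * ent C j k)"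
      by (simp add: distrib_right sum.distrib)
    also have "(\<Sum>j\<in>?J. ent A i j * ent C j k) = ent (A * C) i k" by (rule ent_mult[symmetric]) auto
    also have "(\<Sum>j\<in>?J. ent B i j * ent C j k) = ent (B * C) i k" by (rule ent_mult[symmetric]) auto
    finally show "ent ((A + B) * C) i k = ent (A * C + B * C) i k" by simp
  qed
  show "A * (B + C) = A * B + A * C"
    by (rule rfm_eqI) (simp add: ent_times distrib_left sum.distrib)
qed (auto intro!: rfm_eqI simp: algebra_simps)

end

lemma ent_sum [simp]: "ent (sum f S) i j = (\<Sum>s\<in>S. ent (f s) i j)"
  by (induction S rule: infinite_finite_induct) auto

definition un :: "'i \<Rightarrow> 'i \<Rightarrow> 'a::ring \<Rightarrow> ('i, 'a) rfm" where
  "un i j a = Rfm (\<lambda>i' j'. if i' = i \<and> j' = j then a else 0)"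

text \<open>For infinite \<open>J\<close> and nonzero \<open>a\<close> the support is infinite; such
  diagonals serve as multipliers of finitely supported matrices, the cut \<open>chi\<close> being
  the main one.\<close>

definition dg :: "'i set \<Rightarrow> 'a::ring \<Rightarrow> ('i, 'a) rfm" where
  "dg J a = Rfm (\<lambda>i j. if i = j \<and> i \<in> J then a else 0)"

lemma ent_un: "ent (un i j a) i' j' = (if i' = i \<and> j' = j then a else 0)"
proof -
  have "finite {j'. (if i' = i \<and> j' = j then a else 0) \<noteq> 0}" for i'
    by (rule finite_subset[of _ "{j}"]) auto
  then show ?thesis unfolding un_def by (simp add: ent_Rfm)
qed

lemma ent_dg: "ent (dg J a) i j = (if i = j \<and> i \<in> J then a else 0)"
proof -
  have "finite {j. (if i = j \<and> i \<in> J then a else 0) \<noteq> 0}" for i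
    by (rule finite_subset[of _ "{i}"]) auto
  then show ?thesis unfolding dg_def by (simp add: ent_Rfm)
qed

lemma ent_un_mult: "ent (un i j a * M) i' k = (if i' = i then a * ent M j k else 0)"
  by (subst ent_mult[of "{j}"]) (auto simp: ent_un)

lemma ent_mult_un: "ent (M * un j k a) i k' = (if k' = k then ent M i j * a else 0)"
  by (subst ent_mult[of "{j}"]) (auto simp: ent_un)

lemma ent_dg_mult: "ent (dg J a * M) i k = (if i \<in> J then a * ent M i k else 0)"
  by (subst ent_mult[of "{i}"]) (auto simp: ent_dg)

lemma ent_mult_dg: "ent (M * dg J a) i k = (if k \<in> J then ent M i k * a else 0)"
  by (subst ent_mult[of "{k}"]) (auto simp: ent_dg)

lemma un_mult_un: "un i j a * un k l b = (if j = k then un i l (a * b) else 0)"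
  by (rule rfm_eqI) (simp add: ent_un_mult ent_un)

lemma dg_mult_un: "dg J a * un i j b = (if i \<in> J then un i j (a * b) else 0)"
  by (rule rfm_eqI) (simp add: ent_dg_mult ent_un)

lemma un_mult_dg: "un i j b * dg J a = (if j \<in> J then un i j (b * a) else 0)"
  by (rule rfm_eqI) (simp add: ent_mult_dg ent_un)

lemma dg_mult_dg: "dg J a * dg L b = dg (J \<inter> L) (a * b)"
  by (rule rfm_eqI) (auto simp: ent_dg_mult ent_dg)

lemma un_add: "un i j (a + b) = un i j a + un i j b"
  by (rule rfm_eqI) (simp add: ent_un)

lemma un_0 [simp]: "un i j 0 = 0"
  by (rule rfm_eqI) (simp add: ent_un)

lemma dg_add: "dg J (a + b) = dg J a + dg J b"
  by (rule rfm_eqI) (auto simp: ent_dg)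

lemma dg_0 [simp]: "dg J 0 = 0"
  by (rule rfm_eqI) (auto simp: ent_dg)

lemma dg_empty [simp]: "dg {} a = 0"
  by (rule rfm_eqI) (auto simp: ent_dg)

lemma dg_insert: "i \<notin> J ==> dg (insert i J) a = un i i a + dg J a"
  by (rule rfm_eqI) (auto simp: ent_dg ent_un)

text \<open>No unit is asked for, since finitely supported matrices over an infinite index set have
  none.\<close>

definition subring_set :: "'r::ring set \<Rightarrow> bool" where
  "subring_set C \<longleftrightarrow> 0 \<in> C \<and> (\<forall>a\<in>C. \<forall>b\<in>C. a + b \<in> C \<and> a * b \<in> C) \<and> (\<forall>a\<in>C. - a \<in> C)"

lemma subring_setD:
  assumes "subring_set C"
  shows "0 \<in> C" "a \<in> C ==> b \<in> C ==> a + b \<in> C" "a \<in> C ==> b \<in> C ==> a * b \<in> C"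
    "a \<in> C ==> - a \<in> C" "a \<in> C ==> b \<in> C ==> a - b \<in> C"
  using assms unfolding subring_set_def by (auto simp: diff_conv_add_uminus simp del: add_uminus_conv_diff)

lemma subring_set_sum: "subring_set C ==> (\<And>i. i \<in> I ==> f i \<in> C) ==> sum f I \<in> C"
  by (induction I rule: infinite_finite_induct) (auto simp: subring_setD)

lemma subring_set_UNIV [simp]: "subring_set UNIV"
  by (simp add: subring_set_def)

text \<open>\<open>R\<close> and \<open>L\<close> bound rows and columns and may be infinite; the
  support itself is finite. One type thus holds matrices of all sizes, and products need no matching
  of dimensions.\<close>

definition rmat :: "'i set \<Rightarrow> 'i set \<Rightarrow> 'a::ring set \<Rightarrow> ('i, 'a) rfm set" where
  "rmat R L C = {M. (\<exists>F. finite F \<and> F \<subseteq> R \<times> L \<and> (\<forall>i j. (i, j) \<notin> F --> ent M i j = 0))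
                  \<and> (\<forall>i j. ent M i j \<in> C)}"

lemma rmat_entry: "M \<in> rmat R L C ==> ent M i j \<in> C"
  by (simp add: rmat_def)

lemma rmat_outside: "M \<in> rmat R L C ==> i \<notin> R \<or> j \<notin> L ==> ent M i j = 0"
  unfolding rmat_def by blast

lemma rmatI:
  assumes "finite R'" "finite L'" "R' \<subseteq> R" "L' \<subseteq> L"
    "\<And>i j. i \<notin> R' \<or> j \<notin> L' ==> ent M i j = 0" "\<And>i j. ent M i j \<in> C"
  shows "M \<in> rmat R L C"
  unfolding rmat_def using assms by (auto intro!: exI[of _ "R' \<times> L'"])

lemma rmat_bound:
  assumes "M \<in> rmat R L C"
  obtains R' L' where "finite R'" "finite L'" "R' \<subseteq> R" "L' \<subseteq> L"
    "\<And>i j. i \<notin> R' \<or> j \<notin> L' ==> ent M i j = 0"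
proof -
  obtain F where F: "finite F" "F \<subseteq> R \<times> L" "\<forall>i j. (i, j) \<notin> F --> ent M i j = 0"
    using assms unfolding rmat_def by blast
  have "\<And>i j. i \<notin> fst ` F \<or> j \<notin> snd ` F ==> ent M i j = 0"
    using F(3) by (metis fst_conv image_eqI snd_conv)
  then show ?thesis using F by (intro that[of "fst ` F" "snd ` F"]) auto
qed

lemma rmat_mono:
  assumes "M \<in> rmat R L C" "R \<subseteq> R'" "L \<subseteq> L'" "C \<subseteq> C'"
  shows "M \<in> rmat R' L' C'"
proof -
  obtain R1 L1 where "finite R1" "finite L1" "R1 \<subseteq> R" "L1 \<subseteq> L"
    "\<And>i j. i \<notin> R1 \<or> j \<notin> L1 ==> ent M i j = 0" using rmat_bound[OF assms(1)] by metis
  then show ?thesis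
    by (intro rmatI[of R1 L1]) (use assms rmat_entry[OF assms(1)] in auto)
qed

lemma rmat_mult:
  assumes C: "subring_set C" and A: "A \<in> rmat R L C" and B: "B \<in> rmat L' S C"
  shows "A * B \<in> rmat R S C"
proof -
  obtain R1 L1 where 1: "finite R1" "finite L1" "R1 \<subseteq> R" "L1 \<subseteq> L"
    "\<And>i j. i \<notin> R1 \<or> j \<notin> L1 ==> ent A i j = 0" using rmat_bound[OF A] by metis
  obtain R2 L2 where 2: "finite R2" "finite L2" "R2 \<subseteq> L'" "L2 \<subseteq> S"
    "\<And>i j. i \<notin> R2 \<or> j \<notin> L2 ==> ent B i j = 0" using rmat_bound[OF B] by metis
  show ?thesis
  proof (rule rmatI[of R1 L2])
    show "ent (A * B) i j = 0" if "i \<notin> R1 \<or> j \<notin> L2" for i j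
      unfolding ent_times by (rule sum.neutral) (use that 1 2 in auto)
    show "ent (A * B) i j \<in> C" for i j
      unfolding ent_times by (rule subring_set_sum[OF C]) (use A B C in \<open>auto intro!: subring_setD rmat_entry\<close>)
  qed (use 1 2 in auto)
qed

lemma rmat_add:
  assumes C: "subring_set C" and A: "A \<in> rmat R L C" and B: "B \<in> rmat R L C"
  shows "A + B \<in> rmat R L C"
proof -
  obtain R1 L1 where 1: "finite R1" "finite L1" "R1 \<subseteq> R" "L1 \<subseteq> L"
    "\<And>i j. i \<notin> R1 \<or> j \<notin> L1 ==> ent A i j = 0" using rmat_bound[OF A] by metis
  obtain R2 L2 where 2: "finite R2" "finite L2" "R2 \<subseteq> R" "L2 \<subseteq> L"
    "\<And>i j. i \<notin> R2 \<or> j \<notin> L2 ==> ent B i j = 0" using rmat_bound[OF B] by metis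
  show ?thesis
    by (rule rmatI[of "R1 \<union> R2" "L1 \<union> L2"])
      (use 1 2 A B C in \<open>auto intro!: subring_setD(2) rmat_entry\<close>)
qed

lemma rmat_uminus:
  assumes "subring_set C" "A \<in> rmat R L C"
  shows "- A \<in> rmat R L C"
proof -
  obtain R1 L1 where "finite R1" "finite L1" "R1 \<subseteq> R" "L1 \<subseteq> L"
    "\<And>i j. i \<notin> R1 \<or> j \<notin> L1 ==> ent A i j = 0" using rmat_bound[OF assms(2)] by metis
  then show ?thesis
    by (intro rmatI[of R1 L1]) (use assms rmat_entry[OF assms(2)] in \<open>auto intro: subring_setD\<close>)
qed

lemma rmat_zero: "subring_set C ==> 0 \<in> rmat R L C"
  by (rule rmatI[of "{}" "{}"]) (auto simp: subring_setD)

lemma subring_set_rmat [simp]: "subring_set C ==> subring_set (rmat R R C)"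
  unfolding subring_set_def[of "rmat R R C"] by (auto intro: rmat_mult rmat_add rmat_uminus rmat_zero)

lemma rmat_un: "subring_set C ==> i \<in> R ==> j \<in> L ==> a \<in> C ==> un i j a \<in> rmat R L C"
  by (rule rmatI[of "{i}" "{j}"]) (auto simp: ent_un subring_setD)

lemma rmat_dg: "subring_set C ==> finite J ==> J \<subseteq> R ==> J \<subseteq> L ==> a \<in> C ==> dg J a \<in> rmat R L C"
  by (rule rmatI[of J J]) (auto simp: ent_dg subring_setD)

lemma rmat_sum:
  assumes "subring_set C" "\<And>i. i \<in> I ==> f i \<in> rmat R L C"
  shows "sum f I \<in> rmat R L C"
  using assms(2) by (induction I rule: infinite_finite_induct) (auto intro: rmat_zero rmat_add assms(1))

lemma dg_mult_absorb: "M \<in> rmat R L (C :: 'a::ring_1 set) ==> dg R 1 * M = M"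
  by (rule rfm_eqI) (auto simp: ent_dg_mult rmat_outside)

lemma mult_dg_absorb: "M \<in> rmat R L (C :: 'a::ring_1 set) ==> M * dg L 1 = M"
  by (rule rfm_eqI) (auto simp: ent_mult_dg rmat_outside)

text \<open>The Sylvester axioms without sizes. In \<open>tri\<close> the local units
  \<open>e\<close>, \<open>e'\<close> mark the rows and columns of \<open>a\<close>, and
  \<open>f\<close>, \<open>f'\<close> those of \<open>b\<close>; then \<open>c\<close> sits in the
  rows of \<open>a\<close> and the columns of \<open>b\<close>, the corner of a triangular matrix.
  There is no normalization, so restrictions and weighted sums of ranks qualify too.\<close>

locale arank =
  fixes C :: "'r::ring set" and rho :: "'r \<Rightarrow> real"
  assumes sub: "subring_set C"
    and nonneg: "a \<in> C ==> 0 \<le> rho a"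
    and zero: "rho 0 = 0"
    and mult_le_left: "a \<in> C ==> b \<in> C ==> rho (a * b) \<le> rho a"
    and mult_le_right: "a \<in> C ==> b \<in> C ==> rho (a * b) \<le> rho b"
    and add_le: "a \<in> C ==> b \<in> C ==> rho (a + b) \<le> rho a + rho b"
    and tri: "[|a \<in> C; b \<in> C; c \<in> C; e \<in> C; e' \<in> C; f \<in> C; f' \<in> C;
       e * a = a; a * e' = a; f * b = b; b * f' = b; e * c = c; c * f' = c;
       e * b = 0; f * a = 0; f * c = 0; a * f' = 0; b * e' = 0; c * e' = 0|]
       ==> rho a + rho b \<le> rho (a + b + c)"
begin

lemmas closed = subring_setD[OF sub]

lemma mult3_le: "a \<in> C ==> b \<in> C ==> c \<in> C ==> rho (a * b * c) \<le> rho b"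
  by (meson closed(3) mult_le_left mult_le_right order_trans)

text \<open>\<open>tri\<close> with zero corner gives one inequality, \<open>add_le\<close> the
  other.\<close>

lemma orth_add:
  assumes "a \<in> C" "b \<in> C" "e \<in> C" "e' \<in> C" "f \<in> C" "f' \<in> C"
    "e * a = a" "a * e' = a" "f * b = b" "b * f' = b"
    "e * b = 0" "f * a = 0" "a * f' = 0" "b * e' = 0"
  shows "rho (a + b) = rho a + rho b"
  using tri[of a b 0 e e' f f'] add_le[of a b] assms closed(1) by fastforce

text \<open>With no unit at hand, the sign is carried by a left local unit.\<close>

lemma rho_minus [simp]: "a \<in> C ==> e \<in> C ==> e * a = a ==> rho (- a) = rho a"
proof -
  assume a: "a \<in> C" "e \<in> C" "e * a = a"
  have "- a = (- e) * a" using a by simp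
  then have 1: "rho (- a) \<le> rho a" using mult_le_right[of "- e" a] a closed(4) by metis
  have "a = (- e) * (- a)" using a by simp
  then have "rho a \<le> rho (- a)" using mult_le_right[of "- e" "- a"] a closed(4) by metis
  with 1 show ?thesis by simp
qed

end

text \<open>The axioms compare values on elements related by ring equations, and an additive and
  multiplicative map transports such equations; local units go to local units.\<close>

lemma arank_pullback:
  assumes "arank C rho" and D: "subring_set D"
    and m: "\<And>a. a \<in> D ==> h a \<in> C"
    and add: "\<And>a b. a \<in> D ==> b \<in> D ==> h (a + b) = h a + h b"
    and mult: "\<And>a b. a \<in> D ==> b \<in> D ==> h (a * b) = h a * h b"
  shows "arank D (\<lambda>a. rho (h a))"
proof -
  interpret arank C rho by fact
  have h0: "h 0 = 0" using add[of 0 0] subring_setD(1)[OF D] by simp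
  note D' = subring_setD[OF D]
  show ?thesis
  proof
    fix a b c e e' f f'
    assume *: "a \<in> D" "b \<in> D" "c \<in> D" "e \<in> D" "e' \<in> D" "f \<in> D" "f' \<in> D"
       "e * a = a" "a * e' = a" "f * b = b" "b * f' = b" "e * c = c" "c * f' = c"
       "e * b = 0" "f * a = 0" "f * c = 0" "a * f' = 0" "b * e' = 0" "c * e' = 0"
    have "rho (h a) + rho (h b) \<le> rho (h a + h b + h c)"
      by (rule tri[of _ _ _ "h e" "h e'" "h f" "h f'"]) (use * m h0 in \<open>simp_all flip: mult\<close>)
    then show "rho (h a) + rho (h b) \<le> rho (h (a + b + c))" using * D' by (simp add: add)
  qed (use D m add mult h0 nonneg zero mult_le_left mult_le_right add_le in auto)
qed

lemma rmat_mult_un_0: "M \<in> rmat R L C ==> l \<notin> L ==> M * un l k a = 0"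
  by (rule rfm_eqI) (auto simp: ent_mult_un rmat_outside)

lemma un_mult_rmat_0: "M \<in> rmat R L C ==> l \<notin> R ==> un k l a * M = 0"
  by (rule rfm_eqI) (auto simp: ent_un_mult rmat_outside)

section \<open>Diagonal form over a Euclidean domain\<close>

definition minv :: "'i set \<Rightarrow> ('i, 'a::ring_1) rfm \<Rightarrow> ('i, 'a) rfm \<Rightarrow> bool" where
  "minv R P P' \<longleftrightarrow> P \<in> rmat R R UNIV \<and> P' \<in> rmat R R UNIV \<and> P * P' = dg R 1 \<and> P' * P = dg R 1"

lemma minv_dg: "finite R ==> minv R (dg R 1) (dg R 1)"
  by (simp add: minv_def rmat_dg dg_mult_dg)

lemma minv_mult:
  assumes "minv R P P'" "minv R Q Q'"
  shows "minv R (P * Q) (Q' * P')"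
proof -
  have a: "P \<in> rmat R R UNIV" "P' \<in> rmat R R UNIV" "Q \<in> rmat R R UNIV" "Q' \<in> rmat R R UNIV"
    "P * P' = dg R 1" "P' * P = dg R 1" "Q * Q' = dg R 1" "Q' * Q = dg R 1"
    using assms by (auto simp: minv_def)
  have "P * Q * (Q' * P') = P * (Q * Q') * P'" by (simp add: mult.assoc)
  also have "\<dots> = dg R 1" using a mult_dg_absorb by metis
  finally have 1: "P * Q * (Q' * P') = dg R 1" .
  have "Q' * P' * (P * Q) = Q' * (P' * P) * Q" by (simp add: mult.assoc)
  also have "\<dots> = dg R 1" using a mult_dg_absorb by metis
  finally have 2: "Q' * P' * (P * Q) = dg R 1" .
  show ?thesis unfolding minv_def using a 1 2 by (auto intro: rmat_mult)
qed

text \<open>Elementary operations: for square-zero \<open>S\<close>, the elements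
  \<open>1 - S\<close> and \<open>1 + S\<close> of the corner ring are inverse to each
  other.\<close>

lemma minv_elementary:
  assumes R: "finite R" and S: "S \<in> rmat R R UNIV" "S * S = 0"
  shows "minv R (dg R 1 - S) (dg R (1::'a::ring_1) + S)"
proof -
  have 1: "dg R 1 \<in> rmat R R (UNIV :: 'a set)" using R by (simp add: rmat_dg)
  have "dg R 1 - S = dg R 1 + (- S)" by simp
  also have "\<dots> \<in> rmat R R UNIV" by (intro rmat_add rmat_uminus S 1) auto
  finally have 2: "dg R 1 - S \<in> rmat R R UNIV" .
  have 3: "dg R 1 + S \<in> rmat R R UNIV" by (intro rmat_add S 1) auto
  have 4: "dg R 1 * S = S" "S * dg R 1 = S" "dg R 1 * dg R 1 = dg R (1::'a)"
    using S dg_mult_absorb mult_dg_absorb by (auto simp: dg_mult_dg)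
  show ?thesis unfolding minv_def using 2 3 4 S by (simp add: algebra_simps)
qed

lemma minv_extend:
  assumes "minv (R - {i}) P P'" "i \<in> R"
  shows "minv R (P + un i i 1) (P' + un i i (1::'a::ring_1))"
proof -
  have P: "P \<in> rmat (R - {i}) (R - {i}) UNIV" "P' \<in> rmat (R - {i}) (R - {i}) UNIV"
    "P * P' = dg (R - {i}) 1" "P' * P = dg (R - {i}) 1" using assms by (auto simp: minv_def)
  have z: "P * un i i 1 = 0" "un i i 1 * P = 0" "P' * un i i 1 = 0" "un i i 1 * P' = 0"
    using P by (auto intro: rmat_mult_un_0 un_mult_rmat_0)
  have d: "dg R 1 = un i i 1 + dg (R - {i}) (1::'a)"
    using dg_insert[of i "R - {i}" 1] assms(2) by (simp add: insert_absorb)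
  have m: "P \<in> rmat R R UNIV" "P' \<in> rmat R R UNIV" "un i i (1::'a) \<in> rmat R R UNIV"
    using P rmat_mono assms(2) by (auto intro: rmat_un) blast+
  show ?thesis unfolding minv_def d using m P z
    by (auto intro!: rmat_add simp: algebra_simps un_mult_un)
qed

text \<open>Among all nonzero entries of all matrices equivalent to \<open>M\<close>, take one of
  least norm. Every other entry of its row or column is a multiple of it, as otherwise one
  elementary operation would produce a nonzero remainder of smaller norm; so its row and column can
  be cleared.\<close>

lemma smith_pivot:
  fixes N :: "'a::idom \<Rightarrow> nat" and M :: "('i, 'a) rfm"
  assumes euc: "\<And>a b. b \<noteq> 0 ==> \<exists>q r. a = b * q + r \<and> (r = 0 \<or> N r < N b)"
    and fin: "finite R" "finite L" and M: "M \<in> rmat R L UNIV" and M0: "M \<noteq> 0"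
  shows "\<exists>P P' Q Q' i j a. minv R P P' \<and> minv L Q Q' \<and> i \<in> R \<and> j \<in> L \<and> a \<noteq> 0 \<and>
     P * M * Q - un i j a \<in> rmat (R - {i}) (L - {j}) UNIV"
proof -
  \<comment> \<open>A tuple records an equivalence with its inverses and the position of a nonzero
    entry, so that the minimum is taken over both.\<close>
  define good where "good = (\<lambda>(P, P', Q, Q', i, j). minv R P P' \<and> minv L Q Q' \<and> ent (P * M * Q) i j \<noteq> 0)"
  define sz where "sz = (\<lambda>(P, P' :: ('i, 'a) rfm, Q, Q' :: ('i, 'a) rfm, i, j). N (ent (P * M * Q) i j))"
  obtain i1 j1 where "ent M i1 j1 \<noteq> 0" using M0 rfm_eqI[of M 0] by auto
  then have "good (dg R 1, dg R 1, dg L 1, dg L 1, i1, j1)"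
    using M by (simp add: good_def minv_dg fin dg_mult_absorb mult_dg_absorb)
  then obtain z where z: "good z" "\<And>z'. good z' ==> sz z \<le> sz z'"
    using ex_has_least_nat[of good _ sz] by blast
  obtain P0 P0' Q0 Q0' i0 j0 where zz: "z = (P0, P0', Q0, Q0', i0, j0)" by (cases z) auto
  define M1 where "M1 = P0 * M * Q0"
  define a where "a = ent M1 i0 j0"
  have P0: "minv R P0 P0'" "minv L Q0 Q0'" and a0: "a \<noteq> 0"
    using z(1) by (auto simp: zz good_def a_def M1_def)
  have M1: "M1 \<in> rmat R L UNIV"
    unfolding M1_def using P0 M by (auto simp: minv_def intro!: rmat_mult)
  \<comment> \<open>Minimality passes to every matrix equivalent to \<open>M1\<close> by composing
    the equivalences.\<close>
  have min: "N a \<le> N (ent (P * M1 * Q) i j)"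
    if "minv R P P'" "minv L Q Q'" "ent (P * M1 * Q) i j \<noteq> 0" for P P' Q Q' i j
  proof -
    have e: "P * M1 * Q = (P * P0) * M * (Q0 * Q)" by (simp add: M1_def mult.assoc)
    have "good (P * P0, P0' * P', Q0 * Q, Q' * Q0', i, j)"
      using that P0 minv_mult unfolding good_def by (auto simp: e)
    from z(2)[OF this] show ?thesis unfolding e by (simp add: zz sz_def a_def M1_def)
  qed
  have ij: "i0 \<in> R" "j0 \<in> L" using a0 rmat_outside[OF M1, of i0 j0] unfolding a_def by auto
  have "\<forall>i. \<exists>q r. ent M1 i j0 = a * q + r \<and> (r = 0 \<or> N r < N a)" using euc[OF a0] by blast
  then obtain q r where qr: "\<And>i. ent M1 i j0 = a * q i + r i \<and> (r i = 0 \<or> N (r i) < N a)"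
    unfolding choice_iff by blast
  have "\<forall>j. \<exists>q r. ent M1 i0 j = a * q + r \<and> (r = 0 \<or> N r < N a)" using euc[OF a0] by blast
  then obtain q' r' where qr': "\<And>j. ent M1 i0 j = a * q' j + r' j \<and> (r' j = 0 \<or> N (r' j) < N a)"
    unfolding choice_iff by blast
  \<comment> \<open>\<open>S\<close> and \<open>S'\<close> hold the quotients for the pivot column
    and the pivot row. They are square-zero because the pivot position is left out.\<close>
  define S where "S = (\<Sum>i\<in>R - {i0}. un i i0 (q i))"
  define S' where "S' = (\<Sum>j\<in>L - {j0}. un j0 j (q' j))"
  have entS: "ent S i j = (if i \<in> R - {i0} \<and> j = i0 then q i else 0)" for i j
  proof -
    have "ent S i j = (\<Sum>s\<in>R - {i0}. if s = i then (if j = i0 then q s else 0) else 0)"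
      unfolding S_def ent_sum by (rule sum.cong) (auto simp: ent_un)
    then show ?thesis using fin by simp
  qed
  have entS': "ent S' i j = (if j \<in> L - {j0} \<and> i = j0 then q' j else 0)" for i j
  proof -
    have "ent S' i j = (\<Sum>s\<in>L - {j0}. if s = j then (if i = j0 then q' s else 0) else 0)"
      unfolding S'_def ent_sum by (rule sum.cong) (auto simp: ent_un)
    then show ?thesis using fin by simp
  qed
  have S: "S \<in> rmat R R UNIV" "S * S = 0"
  proof -
    show "S \<in> rmat R R UNIV" unfolding S_def using ij by (auto intro!: rmat_sum rmat_un)
    show "S * S = 0"
    proof (rule rfm_eqI)
      fix i j show "ent (S * S) i j = ent 0 i j"
        by (subst ent_mult[of "{i0}"]) (auto simp: entS)
    qed
  qed
  have S': "S' \<in> rmat L L UNIV" "S' * S' = 0"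
  proof -
    show "S' \<in> rmat L L UNIV" unfolding S'_def using ij by (auto intro!: rmat_sum rmat_un)
    show "S' * S' = 0"
    proof (rule rfm_eqI)
      fix i j show "ent (S' * S') i j = ent 0 i j"
        by (subst ent_mult[of "{j0}"]) (auto simp: entS')
    qed
  qed
  define P1 where "P1 = dg R 1 - S"
  define Q1 where "Q1 = dg L 1 - S'"
  have P1: "minv R P1 (dg R 1 + S)" unfolding P1_def by (rule minv_elementary[OF fin(1) S])
  have Q1: "minv L Q1 (dg L 1 + S')" unfolding Q1_def by (rule minv_elementary[OF fin(2) S'])
  have row: "ent (P1 * X) i j = ent X i j - (if i \<in> R - {i0} then q i * ent X i0 j else 0)"
    if "X \<in> rmat R L UNIV" for X i j
  proof -
    have "ent (S * X) i j = (if i \<in> R - {i0} then q i * ent X i0 j else 0)"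
      by (subst ent_mult[of "{i0}"]) (auto simp: entS)
    then show ?thesis using that by (simp add: P1_def left_diff_distrib dg_mult_absorb)
  qed
  have col: "ent (X * Q1) i j = ent X i j - (if j \<in> L - {j0} then ent X i j0 * q' j else 0)"
    if "X \<in> rmat R L UNIV" for X i j
  proof -
    have "ent (X * S') i j = (if j \<in> L - {j0} then ent X i j0 * q' j else 0)"
      by (subst ent_mult[of "{j0}"]) (auto simp: entS')
    then show ?thesis using that by (simp add: Q1_def right_diff_distrib mult_dg_absorb)
  qed
  have P1M1: "P1 * M1 \<in> rmat R L UNIV" using P1 M1 by (auto simp: minv_def intro: rmat_mult)
  have r0: "r i = 0" if "i \<in> R - {i0}" for i
  proof (rule ccontr)
    assume r: "r i \<noteq> 0"
    have e: "ent (P1 * M1 * dg L 1) i j0 = r i"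
      using that qr[of i] mult_dg_absorb[OF P1M1] row[OF M1, of i j0] by (simp add: a_def mult.commute)
    have "N a \<le> N (r i)" using min[OF P1 minv_dg[OF fin(2)], of i j0] e r by simp
    then show False using qr[of i] r by simp
  qed
  have r0': "r' j = 0" if "j \<in> L - {j0}" for j
  proof (rule ccontr)
    assume r: "r' j \<noteq> 0"
    have e: "ent (dg R 1 * M1 * Q1) i0 j = r' j"
      using that qr'[of j] dg_mult_absorb[OF M1] col[OF M1, of i0 j] by (simp add: a_def)
    have "N a \<le> N (r' j)" using min[OF minv_dg[OF fin(1)] Q1, of i0 j] e r by simp
    then show False using qr'[of j] r by simp
  qed
  define M2 where "M2 = P1 * M1 * Q1"
  have M2: "M2 \<in> rmat R L UNIV" unfolding M2_def using P1M1 Q1 by (auto simp: minv_def intro: rmat_mult)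
  have e1: "ent (P1 * M1) i j0 = (if i = i0 then a else 0)" for i
    using row[OF M1, of i j0] qr[of i] r0[of i] rmat_outside[OF M1, of i j0]
    by (auto simp: a_def mult.commute)
  have e2: "ent M2 i j0 = (if i = i0 then a else 0)" for i
    using col[OF P1M1, of i j0] e1 by (simp add: M2_def)
  have e3: "ent M2 i0 j = (if j = j0 then a else 0)" for j
    using col[OF P1M1, of i0 j] e1[of i0] row[OF M1, of i0 j] qr'[of j] r0'[of j] rmat_outside[OF M1, of i0 j]
    by (auto simp: M2_def a_def)
  have "M2 - un i0 j0 a \<in> rmat (R - {i0}) (L - {j0}) UNIV"
    by (rule rmatI[of "R - {i0}" "L - {j0}"])
      (use fin e2 e3 rmat_outside[OF M2] in \<open>auto simp: ent_un\<close>)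
  moreover have "M2 = (P1 * P0) * M * (Q0 * Q1)" by (simp add: M2_def M1_def mult.assoc)
  ultimately show ?thesis
    using minv_mult[OF P1 P0(1)] minv_mult[OF P0(2) Q1] ij a0 by metis
qed

text \<open>The positions in \<open>G\<close> need not lie on the diagonal. If both projections are
  injective on \<open>G\<close>, this is a diagonal matrix up to permutations, which need never be
  carried out.\<close>

definition gdiag :: "('i \<times> 'i) set \<Rightarrow> ('i \<times> 'i \<Rightarrow> 'a::ring) \<Rightarrow> ('i, 'a) rfm" where
  "gdiag G p = (\<Sum>g\<in>G. un (fst g) (snd g) (p g))"

text \<open>Induction on the number of rows, splitting off one pivot at a time. No divisibility
  between the diagonal entries is arranged, because they are only summed over one by one.\<close>

lemma smith:
  fixes N :: "'a::idom \<Rightarrow> nat" and M :: "('i, 'a) rfm"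
  assumes euc: "\<And>a b. b \<noteq> 0 ==> \<exists>q r. a = b * q + r \<and> (r = 0 \<or> N r < N b)"
    and "finite R" "finite L" "M \<in> rmat R L UNIV"
  shows "\<exists>P P' Q Q' G p. minv R P P' \<and> minv L Q Q' \<and> finite G \<and> G \<subseteq> R \<times> L \<and> inj_on fst G \<and> inj_on snd G
     \<and> (\<forall>g\<in>G. p g \<noteq> 0) \<and> P * M * Q = gdiag G p"
  using assms(2-4)
proof (induction "card R" arbitrary: R L M rule: less_induct)
  case less
  show ?case
  proof (cases "M = 0")
    case True
    show ?thesis
      by (rule exI[of _ "dg R 1"], rule exI[of _ "dg R 1"], rule exI[of _ "dg L 1"], rule exI[of _ "dg L 1"],
          rule exI[of _ "{}"]) (use True less.prems minv_dg in \<open>auto simp: gdiag_def\<close>)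
  next
    case False
    obtain P P' Q Q' i j a where
      1: "minv R P P'" "minv L Q Q'" "i \<in> R" "j \<in> L" "a \<noteq> 0" and
      M3: "P * M * Q - un i j a \<in> rmat (R - {i}) (L - {j}) UNIV"
      using smith_pivot[OF euc less.prems False] by blast
    define M3 where "M3 = P * M * Q - un i j a"
    have "card (R - {i}) < card R" using 1(3) less.prems(1) by (meson card_Diff1_less)
    from less.hyps[OF this _ _ M3] less.prems
    obtain P3 P3' Q3 Q3' G p where
      3: "minv (R - {i}) P3 P3'" "minv (L - {j}) Q3 Q3'" "finite G" "G \<subseteq> (R - {i}) \<times> (L - {j})"
      "inj_on fst G" "inj_on snd G" "\<forall>g\<in>G. p g \<noteq> 0" "P3 * M3 * Q3 = gdiag G p"
      unfolding M3_def by auto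
    have P3: "P3 \<in> rmat (R - {i}) (R - {i}) UNIV" "Q3 \<in> rmat (L - {j}) (L - {j}) UNIV"
      using 3 by (auto simp: minv_def)
    have M3': "M3 \<in> rmat (R - {i}) (L - {j}) UNIV" using M3 by (simp add: M3_def)
    have z: "P3 * un i j a = 0" "un i i 1 * M3 = 0" "M3 * un j j 1 = 0" "un i j a * Q3 = 0"
      using P3 M3' by (auto intro: rmat_mult_un_0 un_mult_rmat_0)
    have G: "(i, j) \<notin> G" using 3(4) by auto
    have "(P3 + un i i 1) * (un i j a + M3) * (Q3 + un j j 1) = un i j a + P3 * M3 * Q3"
      using z by (simp add: algebra_simps un_mult_un flip: mult.assoc) (simp add: mult.assoc z)
    also have "\<dots> = gdiag (insert (i, j) G) (p((i, j) := a))"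
    proof -
      have "gdiag G p = (\<Sum>g\<in>G. un (fst g) (snd g) ((p((i, j) := a)) g))"
        unfolding gdiag_def by (rule sum.cong) (use G in auto)
      then show ?thesis using 3(3,8) G by (simp add: gdiag_def)
    qed
    finally have "((P3 + un i i 1) * P) * M * (Q * (Q3 + un j j 1)) = gdiag (insert (i, j) G) (p((i, j) := a))"
      by (simp add: M3_def mult.assoc)
    moreover have "minv R ((P3 + un i i 1) * P) (P' * (P3' + un i i 1))"
      by (rule minv_mult[OF minv_extend[OF 3(1) 1(3)] 1(1)])
    moreover have "minv L (Q * (Q3 + un j j 1)) ((Q3' + un j j 1) * Q')"
      by (rule minv_mult[OF 1(2) minv_extend[OF 3(2) 1(4)]])
    moreover have "inj_on fst (insert (i, j) G)" "inj_on snd (insert (i, j) G)"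
      using 3(4-6) by (auto simp: inj_on_def)
    moreover have "\<forall>g\<in>insert (i, j) G. (p((i, j) := a)) g \<noteq> 0" using 3(7) 1(5) by auto
    moreover have "insert (i, j) G \<subseteq> R \<times> L" using 3(4) 1 by auto
    moreover have "finite (insert (i, j) G)" using 3(3) by simp
    ultimately show ?thesis by blast
  qed
qed

lemma ent_gdiag:
  assumes "finite G"
  shows "ent (gdiag G p) i j = (if (i, j) \<in> G then p (i, j) else 0)"
proof -
  have "ent (gdiag G p) i j = (\<Sum>g\<in>G. if g = (i, j) then p g else 0)"
    unfolding gdiag_def ent_sum by (rule sum.cong) (auto simp: ent_un prod_eq_iff)
  then show ?thesis using assms by simp
qed

text \<open>Injectivity in rows and columns makes the summands orthogonal, and matrix units move
  each entry to position \<open>(j0, j0)\<close> and back.\<close>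

lemma arank_gdiag:
  fixes rho :: "('i, 'a::ring_1) rfm \<Rightarrow> real"
  assumes ar: "arank (rmat J J UNIV) rho" and j0: "j0 \<in> J"
    and G: "finite G" "G \<subseteq> J \<times> J" "inj_on fst G" "inj_on snd G"
  shows "rho (gdiag G p) = (\<Sum>g\<in>G. rho (un j0 j0 (p g)))"
  using G
proof (induction G rule: finite_induct)
  interpret arank "rmat J J UNIV" rho by fact
  case empty
  show ?case by (simp add: gdiag_def zero)
next
  interpret arank "rmat J J UNIV" rho by fact
  case (insert g G)
  obtain i j where g: "g = (i, j)" by (cases g)
  have ij: "i \<in> J" "j \<in> J" using insert.prems g by auto
  have nG: "i \<notin> fst ` G" "j \<notin> snd ` G" using insert.prems insert.hyps g
    by (auto simp: inj_on_insert)
  have GJ: "fst ` G \<subseteq> J" "snd ` G \<subseteq> J" using insert.prems by auto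
  have dG: "gdiag G p \<in> rmat J J UNIV"
    unfolding gdiag_def using GJ by (auto intro!: rmat_sum rmat_un)
  have "rho (un i j (p g) + gdiag G p) = rho (un i j (p g)) + rho (gdiag G p)"
  proof (rule orth_add[of _ _ "un i i 1" "un j j 1" "dg (fst ` G) 1" "dg (snd ` G) 1"])
    show "dg (fst ` G) 1 * gdiag G p = gdiag G p" "gdiag G p * dg (snd ` G) 1 = gdiag G p"
      using insert.hyps by (auto intro!: rfm_eqI simp: ent_dg_mult ent_mult_dg ent_gdiag image_iff) force+
    show "un i i 1 * gdiag G p = 0" "gdiag G p * un j j 1 = 0"
      using insert.hyps nG
      by (auto intro!: rfm_eqI simp: ent_un_mult ent_mult_un ent_gdiag image_iff) force+
  qed (use ij GJ nG insert.hyps dG in \<open>auto intro!: rmat_un rmat_dg simp: un_mult_un dg_mult_un un_mult_dg\<close>)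
  moreover have "rho (un i j (p g)) = rho (un j0 j0 (p g))"
  proof (rule antisym)
    have "un i j (p g) = un i j0 1 * un j0 j0 (p g) * un j0 j 1" by (simp add: un_mult_un)
    then show "rho (un i j (p g)) \<le> rho (un j0 j0 (p g))"
      using mult3_le[of "un i j0 1" "un j0 j0 (p g)" "un j0 j 1"] ij j0 by (simp add: rmat_un)
    have "un j0 j0 (p g) = un j0 i 1 * un i j (p g) * un j j0 1" by (simp add: un_mult_un)
    then show "rho (un j0 j0 (p g)) \<le> rho (un i j (p g))"
      using mult3_le[of "un j0 i 1" "un i j (p g)" "un j j0 1"] ij j0 by (simp add: rmat_un)
  qed
  ultimately show ?case using insert by (simp add: gdiag_def g)
qed

lemma arank_minv:
  fixes rho :: "('i, 'a::ring_1) rfm \<Rightarrow> real"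
  assumes "arank (rmat J J UNIV) rho" "minv R P P'" "minv R Q Q'" "R \<subseteq> J" "M \<in> rmat R R UNIV"
  shows "rho (P * M * Q) = rho M"
proof (rule antisym)
  interpret arank "rmat J J UNIV" rho by fact
  have m: "P \<in> rmat J J UNIV" "P' \<in> rmat J J UNIV" "Q \<in> rmat J J UNIV" "Q' \<in> rmat J J UNIV" "M \<in> rmat J J UNIV"
    using assms(2-5) rmat_mono[OF _ assms(4) assms(4) subset_refl] by (auto simp: minv_def)
  show "rho (P * M * Q) \<le> rho M" by (rule mult3_le) (use m in auto)
  have "P' * (P * M * Q) * Q' = (P' * P) * M * (Q * Q')" by (simp add: mult.assoc)
  also have "\<dots> = M" using assms dg_mult_absorb[OF assms(5)] mult_dg_absorb[OF assms(5)]
    by (simp add: minv_def)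
  finally show "rho M \<le> rho (P * M * Q)"
    using mult3_le[of P' "P * M * Q" Q'] m closed by metis
qed

section \<open>Ranks of matrices over a field\<close>

text \<open>Rank as the least inner dimension of a factorization. This makes sense for arbitrary
  index types and gives the upper bounds for submatrices, sums and products at once; lower bounds go
  through \<open>factors_card\<close>.\<close>

definition factors_through :: "nat \<Rightarrow> ('i \<Rightarrow> 'j \<Rightarrow> 'k::field) \<Rightarrow> bool" where
  "factors_through r M \<longleftrightarrow> (\<exists>u v. \<forall>i j. M i j = (\<Sum>a<r. u a i * v a j))"

lemma factorsI: "(\<And>i j. M i j = (\<Sum>a<r. u a i * v a j)) ==> factors_through r M"
  unfolding factors_through_def by (rule exI[of _ u], rule exI[of _ v]) simp

text \<open>If no factorization exists, \<open>LEAST\<close> is an unspecified number; the lemmas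
  below therefore assume some factorization or finitely many nonzero rows.\<close>

definition krank :: "('i \<Rightarrow> 'j \<Rightarrow> 'k::field) \<Rightarrow> nat" where
  "krank M = (LEAST r. factors_through r M)"

lemma krank_le: "factors_through r M ==> krank M \<le> r"
  unfolding krank_def by (rule Least_le)

lemma factors_krank: "factors_through r M ==> factors_through (krank M) M"
  unfolding krank_def by (rule LeastI)

lemma factors_rows:
  assumes "finite R" "\<And>i j. i \<notin> R ==> M i j = 0"
  shows "factors_through (card R) M"
proof -
  obtain e where e: "bij_betw e {..<card R} R" using assms(1) ex_bij_betw_nat_finite[of R]
    by (auto simp: atLeast0LessThan)
  have "M i j = (\<Sum>a<card R. (if e a = i then 1 else 0) * M (e a) j)" for i j
  proof -
    have "(\<Sum>a<card R. (if e a = i then 1 else 0) * M (e a) j) = (\<Sum>k\<in>R. (if k = i then 1 else 0) * M k j)"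
      by (rule sum.reindex_bij_betw[OF e])
    also have "\<dots> = (\<Sum>k\<in>R. if k = i then M k j else 0)" by (rule sum.cong) auto
    also have "\<dots> = M i j" using assms by auto
    finally show ?thesis by simp
  qed
  then show ?thesis by (rule factorsI)
qed

lemma factors_transpose:
  assumes "factors_through r (\<lambda>j i. M i j)"
  shows "factors_through r M"
proof -
  obtain u v where "\<forall>j i. M i j = (\<Sum>a<r. u a j * v a i)"
    using assms unfolding factors_through_def by blast
  then have "\<And>i j. M i j = (\<Sum>a<r. v a i * u a j)" by (simp add: mult.commute)
  then show ?thesis by (rule factorsI)
qed

lemma factors_reindex: "factors_through r M ==> factors_through r (\<lambda>i j. M (f i) (g j))"
  unfolding factors_through_def
proof (elim exE)
  fix u v assume "\<forall>i j. M i j = (\<Sum>a<r. u a i * v a j)"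
  then show "\<exists>u v. \<forall>i j. M (f i) (g j) = (\<Sum>a<r. u a i * v a j)"
    by (intro exI[of _ "\<lambda>a i. u a (f i)"] exI[of _ "\<lambda>a j. v a (g j)"]) simp
qed

lemma factors_add:
  assumes "factors_through r M" "factors_through s M'"
  shows "factors_through (r + s) (\<lambda>i j. M i j + M' i j)"
proof -
  obtain u v u' v' where 1: "\<forall>i j. M i j = (\<Sum>a<r. u a i * v a j)" "\<forall>i j. M' i j = (\<Sum>a<s. u' a i * v' a j)"
    using assms unfolding factors_through_def by blast
  have "M i j + M' i j = (\<Sum>a<r + s. (if a < r then u a i else u' (a - r) i) * (if a < r then v a j else v' (a - r) j))" for i j
  proof -
    let ?f = "\<lambda>a. (if a < r then u a i else u' (a - r) i) * (if a < r then v a j else v' (a - r) j)"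
    have "(\<Sum>a<r + s. ?f a) = (\<Sum>a<r. ?f a) + (\<Sum>a<s. ?f (a + r))"
      using sum.atLeastLessThan_concat[of 0 r "r + s" ?f] sum.shift_bounds_nat_ivl[of ?f 0 r s]
      by (simp add: atLeast0LessThan add.commute)
    also have "(\<Sum>a<r. ?f a) = (\<Sum>a<r. u a i * v a j)" by (rule sum.cong) auto
    also have "(\<Sum>a<s. ?f (a + r)) = (\<Sum>a<s. u' a i * v' a j)" by (rule sum.cong) auto
    finally show ?thesis using 1 by simp
  qed
  then show ?thesis by (rule factorsI)
qed

lemma factors_left:
  fixes A B :: "('i, 'k::field) rfm"
  assumes "factors_through r (ent B)"
  shows "factors_through r (ent (A * B))"
proof -
  obtain u v where uv: "\<forall>i j. ent B i j = (\<Sum>a<r. u a i * v a j)"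
    using assms unfolding factors_through_def by blast
  have "ent (A * B) i k = (\<Sum>a<r. (\<Sum>j | ent A i j \<noteq> 0. ent A i j * u a j) * v a k)" for i k
  proof -
    have "ent (A * B) i k = (\<Sum>j | ent A i j \<noteq> 0. \<Sum>a<r. ent A i j * u a j * v a k)"
      unfolding ent_times using uv by (simp add: sum_distrib_left mult.assoc)
    also have "\<dots> = (\<Sum>a<r. \<Sum>j | ent A i j \<noteq> 0. ent A i j * u a j * v a k)" by (rule sum.swap)
    finally show ?thesis by (simp add: sum_distrib_right)
  qed
  then show ?thesis by (rule factorsI)
qed

lemma factors_right:
  fixes A B :: "('i, 'k::field) rfm"
  assumes "factors_through r (ent A)" and B: "B \<in> rmat S L C"
  shows "factors_through r (ent (A * B))"
proof -
  obtain R1 where R1: "finite R1" "\<And>i j. i \<notin> R1 ==> ent B i j = 0" using rmat_bound[OF B] by metis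
  obtain u v where uv: "\<forall>i j. ent A i j = (\<Sum>a<r. u a i * v a j)"
    using assms unfolding factors_through_def by blast
  have "ent (A * B) i k = (\<Sum>a<r. u a i * (\<Sum>j\<in>R1. v a j * ent B j k))" for i k
  proof -
    have "ent (A * B) i k = (\<Sum>j\<in>R1. ent A i j * ent B j k)" by (rule ent_mult) (use R1 in auto)
    also have "\<dots> = (\<Sum>j\<in>R1. \<Sum>a<r. u a i * v a j * ent B j k)"
      using uv by (simp add: sum_distrib_right)
    also have "\<dots> = (\<Sum>a<r. \<Sum>j\<in>R1. u a i * v a j * ent B j k)" by (rule sum.swap)
    finally show ?thesis by (simp add: sum_distrib_left mult.assoc)
  qed
  then show ?thesis by (rule factorsI)
qed

lemma rmat_factors:
  assumes "M \<in> rmat R L (C :: 'k::field set)"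
  shows "factors_through (krank (ent M)) (ent M)"
proof -
  obtain R1 where "finite R1" "\<And>i j. i \<notin> R1 ==> ent M i j = 0" using rmat_bound[OF assms] by metis
  then show ?thesis using factors_rows factors_krank by metis
qed

lemma krank_reindex: "factors_through r M ==> krank (\<lambda>i j. M (f i) (g j)) \<le> krank M"
  by (rule krank_le) (rule factors_reindex[OF factors_krank])

lemma krank_rows: "finite R ==> (\<And>i j. i \<notin> R ==> M i j = 0) ==> krank M \<le> card R"
  by (rule krank_le) (rule factors_rows)

lemma krank_zero [simp]: "krank (\<lambda>i j. 0) = 0"
  using krank_rows[of "{}" "\<lambda>i j. 0"] by simp

text \<open>Sequences over the field, needed for the dimension bound in \<open>factors_card\<close>;
  a space with \<open>r\<close> coordinates is modelled by sequences that vanish from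
  \<open>r\<close> on.\<close>

interpretation fun_vs: vector_space "\<lambda>(c::'k::field) (f :: nat \<Rightarrow> 'k) a. c * f a"
  by unfold_locales (auto simp: fun_eq_iff algebra_simps)

text \<open>The basic lower bound. A dependency among the rows of the left factor would be one among
  the rows of \<open>B\<close>; so independent rows of \<open>B\<close> force independent vectors
  with \<open>r\<close> coordinates.\<close>

lemma factors_card:
  fixes B :: "'h \<Rightarrow> 'g \<Rightarrow> 'k::field"
  assumes fac: "factors_through r B" and H: "finite H"
    and ind: "\<And>c. (\<And>g. (\<Sum>h\<in>H. c h * B h g) = 0) ==> (\<forall>h\<in>H. c h = 0)"
  shows "card H \<le> r"
proof -
  obtain u v where uv: "\<forall>i j. B i j = (\<Sum>a<r. u a i * v a j)"
    using fac unfolding factors_through_def by blast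
  define w where "w = (\<lambda>h a. if a < r then u a h else 0)"
  have wB: "(\<Sum>h\<in>H. c h * B h g) = 0" if "\<And>a. (\<Sum>h\<in>H. c h * w h a) = 0" for c g
  proof -
    have "(\<Sum>h\<in>H. c h * B h g) = (\<Sum>h\<in>H. \<Sum>a<r. c h * w h a * v a g)"
      using uv by (simp add: sum_distrib_left mult.assoc w_def)
    also have "\<dots> = (\<Sum>a<r. \<Sum>h\<in>H. c h * w h a * v a g)" by (rule sum.swap)
    also have "\<dots> = (\<Sum>a<r. (\<Sum>h\<in>H. c h * w h a) * v a g)" by (simp add: sum_distrib_right)
    finally show ?thesis using that by simp
  qed
  have indw: "\<forall>h\<in>H. c h = 0" if "\<And>a. (\<Sum>h\<in>H. c h * w h a) = 0" for c
    by (rule ind) (rule wB[OF that])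
  \<comment> \<open>Injectivity comes first, so that a dependency among the vectors in the image of
    \<open>w\<close> is one indexed by \<open>H\<close>.\<close>
  have inj: "inj_on w H"
  proof (rule inj_onI, rule ccontr)
    fix h h' assume hh: "h \<in> H" "h' \<in> H" "w h = w h'" "h \<noteq> h'"
    define c where "c = (\<lambda>k. if k = h then 1 else if k = h' then -1 else (0::'k))"
    have "(\<Sum>k\<in>H. c k * w k a) = 0" for a
    proof -
      have "(\<Sum>k\<in>H. c k * w k a) = (\<Sum>k\<in>{h, h'}. c k * w k a)"
        by (rule sum.mono_neutral_right) (use hh H in \<open>auto simp: c_def\<close>)
      then show ?thesis using hh by (simp add: c_def)
    qed
    from indw[OF this] hh(1) show False by (auto simp: c_def)
  qed
  have fs: "(\<Sum>v\<in>S. (\<lambda>a. f v * g v a)) = (\<lambda>a. \<Sum>v\<in>S. f v * g v a)" for S :: "'s set" and f :: "'s \<Rightarrow> 'k" and g :: "'s \<Rightarrow> nat \<Rightarrow> 'k"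
    by (induction S rule: infinite_finite_induct) (auto simp: fun_eq_iff)
  have indep: "fun_vs.independent (w ` H)"
  proof
    assume "fun_vs.dependent (w ` H)"
    then obtain c where c: "\<exists>x\<in>w ` H. c x \<noteq> 0" "(\<Sum>x\<in>w ` H. (\<lambda>a. c x * x a)) = 0"
      using fun_vs.dependent_finite[of "w ` H"] H by auto
    have "(\<Sum>h\<in>H. c (w h) * w h a) = 0" for a
    proof -
      have "(\<lambda>a. \<Sum>x\<in>w ` H. c x * x a) = 0" using c(2) unfolding fs .
      then have "(\<Sum>x\<in>w ` H. c x * x a) = 0" by (metis zero_fun_apply)
      then show ?thesis using inj by (simp add: sum.reindex)
    qed
    from indw[OF this] c(1) show False by auto
  qed
  define e :: "nat \<Rightarrow> nat \<Rightarrow> 'k" where "e = (\<lambda>b a. if a = b then 1 else 0)"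
  have "w ` H \<subseteq> fun_vs.span (e ` {..<r})"
  proof
    fix x assume "x \<in> w ` H"
    then obtain h where x: "x = w h" by auto
    have "(\<Sum>b<r. (\<lambda>a. w h b * e b a)) \<in> fun_vs.span (e ` {..<r})"
      by (intro fun_vs.span_sum fun_vs.span_scale fun_vs.span_base) auto
    moreover have "(\<Sum>b<r. (\<lambda>a. w h b * e b a)) = x"
      unfolding fs x by (auto simp: fun_eq_iff e_def w_def if_distrib[of "\<lambda>y. _ * y"] sum.delta cong: if_cong)
    ultimately show "x \<in> fun_vs.span (e ` {..<r})" by simp
  qed
  then have "card (w ` H) \<le> card (e ` {..<r})"
    using fun_vs.independent_span_bound[OF _ indep] by blast
  also have "\<dots> \<le> r" using card_image_le[of "{..<r}" e] by simp
  finally show ?thesis using inj by (simp add: card_image)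
qed

text \<open>A field is Euclidean for the constant norm 0, all remainders being 0; the impossible
  alternative keeps the shape that \<open>smith\<close> expects.\<close>

lemma field_euclid: "(b::'k::field) \<noteq> 0 ==> \<exists>q r. a = b * q + r \<and> (r = 0 \<or> (0::nat) < 0)"
  by (rule exI[of _ "a / b"], rule exI[of _ 0]) simp

lemma field_smith:
  fixes M :: "('i, 'k::field) rfm"
  assumes "finite R" "finite L" "M \<in> rmat R L UNIV"
  obtains P P' Q Q' G p where "minv R P P'" "minv L Q Q'" "finite G" "G \<subseteq> R \<times> L" "inj_on fst G" "inj_on snd G"
     "\<And>g. g \<in> G ==> p g \<noteq> 0" "P * M * Q = gdiag G p"
  using smith[of "\<lambda>_. 0", OF field_euclid assms] by metis

lemma krank_gdiag_le:
  fixes p :: "'i \<times> 'i \<Rightarrow> 'k::field"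
  assumes "finite G" "inj_on fst G"
  shows "factors_through (card G) (ent (gdiag G p))"
proof -
  have "factors_through (card (fst ` G)) (ent (gdiag G p))"
    by (rule factors_rows) (use assms in \<open>auto simp: ent_gdiag image_iff\<close>)
  then show ?thesis using assms by (simp add: card_image)
qed

text \<open>The column of \<open>g\<close> meets only the row of \<open>g\<close>, so it isolates
  one coefficient.\<close>

lemma gdiag_row_sum:
  fixes p :: "'i \<times> 'i \<Rightarrow> 'k::field"
  assumes "finite G" "inj_on snd G" "g \<in> G" "inj_on fst G"
  shows "(\<Sum>h\<in>G. c h * ent (gdiag G p) (fst h) (snd g)) = c g * p g"
proof -
  have "(\<Sum>h\<in>G. c h * ent (gdiag G p) (fst h) (snd g)) = (\<Sum>h\<in>G. if h = g then c g * p g else 0)"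
  proof (rule sum.cong[OF refl])
    fix h assume h: "h \<in> G"
    have "(fst h, snd g) \<in> G \<longleftrightarrow> fst h = fst g"
      using inj_onD[OF assms(2), of "(fst h, snd g)" g] assms(3) by (cases g) auto
    moreover have "fst h = fst g \<longleftrightarrow> h = g" using h assms(3,4) by (auto dest: inj_onD)
    ultimately show "c h * ent (gdiag G p) (fst h) (snd g) = (if h = g then c g * p g else 0)"
      using assms(1) by (auto simp: ent_gdiag)
  qed
  then show ?thesis using assms by simp
qed

text \<open>For the triangular inequality, \<open>a\<close> and \<open>b\<close> are brought to
  diagonal form with \<open>card G1\<close> and \<open>card G2\<close> nonzero entries. Multiplying
  \<open>a + b + c\<close> by the local units and the transforming matrices gives a block triangular
  matrix with these diagonal blocks, and its rows are independent.\<close>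

lemma krank_arank:
  "arank (rmat J J UNIV) (\<lambda>M :: ('i, 'k::field) rfm. real (krank (ent M)))"
proof
  fix a b c e e' f f' :: "('i, 'k) rfm"
  assume m: "a \<in> rmat J J UNIV" "b \<in> rmat J J UNIV" "c \<in> rmat J J UNIV"
    "e \<in> rmat J J UNIV" "e' \<in> rmat J J UNIV" "f \<in> rmat J J UNIV" "f' \<in> rmat J J UNIV"
    and r: "e * a = a" "a * e' = a" "f * b = b" "b * f' = b" "e * c = c" "c * f' = c"
       "e * b = 0" "f * a = 0" "f * c = 0" "a * f' = 0" "b * e' = 0" "c * e' = 0"
  define Z where "Z = a + b + c"
  have Z: "Z \<in> rmat J J UNIV" unfolding Z_def by (intro rmat_add m) auto
  obtain R1 L1 where R1: "finite R1" "finite L1" "a \<in> rmat R1 L1 UNIV"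
    using rmat_bound[OF m(1)] rmatI[of _ _ _ _ a UNIV] by (metis UNIV_I subset_refl)
  obtain R2 L2 where R2: "finite R2" "finite L2" "b \<in> rmat R2 L2 UNIV"
    using rmat_bound[OF m(2)] rmatI[of _ _ _ _ b UNIV] by (metis UNIV_I subset_refl)
  obtain P1 P1' Q1 Q1' G1 p1 where S1: "minv R1 P1 P1'" "minv L1 Q1 Q1'" "finite G1" "inj_on fst G1" "inj_on snd G1"
     "\<And>g. g \<in> G1 ==> p1 g \<noteq> 0" "P1 * a * Q1 = gdiag G1 p1" using field_smith[OF R1] by metis
  obtain P2 P2' Q2 Q2' G2 p2 where S2: "minv R2 P2 P2'" "minv L2 Q2 Q2'" "finite G2" "inj_on fst G2" "inj_on snd G2"
     "\<And>g. g \<in> G2 ==> p2 g \<noteq> 0" "P2 * b * Q2 = gdiag G2 p2" using field_smith[OF R2] by metis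
  have ka: "krank (ent a) \<le> card G1"
  proof -
    have "a = P1' * gdiag G1 p1 * Q1'"
    proof -
      have "P1' * gdiag G1 p1 * Q1' = (P1' * P1) * a * (Q1 * Q1')"
        by (simp add: S1(7)[symmetric] mult.assoc)
      then show ?thesis using S1(1,2) R1(3) by (simp add: minv_def dg_mult_absorb mult_dg_absorb)
    qed
    then show ?thesis using krank_le factors_right factors_left krank_gdiag_le[OF S1(3,4)] S1(2)
      unfolding minv_def by metis
  qed
  have kb: "krank (ent b) \<le> card G2"
  proof -
    have "b = P2' * gdiag G2 p2 * Q2'"
    proof -
      have "P2' * gdiag G2 p2 * Q2' = (P2' * P2) * b * (Q2 * Q2')"
        by (simp add: S2(7)[symmetric] mult.assoc)
      then show ?thesis using S2(1,2) R2(3) by (simp add: minv_def dg_mult_absorb mult_dg_absorb)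
    qed
    then show ?thesis using krank_le factors_right factors_left krank_gdiag_le[OF S2(3,4)] S2(2)
      unfolding minv_def by metis
  qed
  \<comment> \<open>\<open>X\<close> and \<open>W\<close> hold the row and column operations,
    \<open>True\<close> for the corner \<open>a\<close> and \<open>False\<close> for
    \<open>b\<close>. \<open>B\<close> is the resulting block matrix; its relevant rows are the
    disjoint union \<open>H\<close> of \<open>G1\<close> and \<open>G2\<close>.\<close>
  define X where "X = (\<lambda>s. if s then P1 * e else P2 * f)"
  define W where "W = (\<lambda>s. if s then e' * Q1 else f' * Q2)"
  define B :: "bool \<times> ('i \<times> 'i) \<Rightarrow> bool \<times> ('i \<times> 'i) \<Rightarrow> 'k" where "B = (\<lambda>(s, g) (s', g'). ent (X s * Z * W s') (fst g) (snd g'))"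
  have ZW: "e * Z * e' = a" "f * Z * f' = b" "f * Z * e' = 0"
    using r by (simp_all add: Z_def algebra_simps)
  have XW: "X True * Z * W True = gdiag G1 p1" "X False * Z * W False = gdiag G2 p2" "X False * Z * W True = 0"
  proof -
    have "X True * Z * W True = P1 * (e * Z * e') * Q1" by (simp add: X_def W_def mult.assoc)
    then show "X True * Z * W True = gdiag G1 p1" by (simp add: ZW S1)
    have "X False * Z * W False = P2 * (f * Z * f') * Q2" by (simp add: X_def W_def mult.assoc)
    then show "X False * Z * W False = gdiag G2 p2" by (simp add: ZW S2)
    have "X False * Z * W True = P2 * (f * Z * e') * Q1" by (simp add: X_def W_def mult.assoc)
    then show "X False * Z * W True = 0" by (simp add: ZW)
  qed
  obtain u v where uv: "\<forall>i j. ent Z i j = (\<Sum>a<krank (ent Z). u a i * v a j)"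
    using rmat_factors[OF Z] unfolding factors_through_def by blast
  obtain R0 where R0: "finite R0" "\<And>s k j. k \<notin> R0 ==> ent (W s) k j = 0"
  proof -
    have "W s \<in> rmat UNIV UNIV UNIV" for s
      unfolding W_def using m S1(2) S2(2) by (auto simp: minv_def intro!: rmat_mult rmat_mono[of _ _ _ _ UNIV UNIV UNIV])
    then have "\<exists>R. finite R \<and> (\<forall>k j. k \<notin> R --> ent (W s) k j = 0)" for s by (metis rmat_bound)
    then obtain R where "\<And>s. finite (R s) \<and> (\<forall>k j. k \<notin> R s --> ent (W s) k j = 0)" by metis
    then show ?thesis by (intro that[of "R True \<union> R False"]) (auto, metis (full_types))
  qed
  have fB: "factors_through (krank (ent Z)) B"
  proof -
    have "B x y = (\<Sum>a<krank (ent Z). (\<Sum>k | ent (X (fst x)) (fst (snd x)) k \<noteq> 0. ent (X (fst x)) (fst (snd x)) k * u a k)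
            * (\<Sum>l\<in>R0. v a l * ent (W (fst y)) l (snd (snd y))))" for x y
    proof -
      let ?X = "X (fst x)" and ?W = "W (fst y)" and ?i = "fst (snd x)" and ?j = "snd (snd y)"
      have "B x y = ent (?X * (Z * ?W)) ?i ?j" by (simp add: B_def case_prod_unfold mult.assoc)
      also have "\<dots> = (\<Sum>k | ent ?X ?i k \<noteq> 0. ent ?X ?i k * (\<Sum>l\<in>R0. ent Z k l * ent ?W l ?j))"
        unfolding ent_times[of ?X] by (intro sum.cong arg_cong2[of _ _ _ _ "(*)"] ent_mult) (use R0 in auto)
      also have "\<dots> = (\<Sum>k | ent ?X ?i k \<noteq> 0. \<Sum>l\<in>R0. \<Sum>a<krank (ent Z). ent ?X ?i k * u a k * (v a l * ent ?W l ?j))"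
        using uv by (simp add: sum_distrib_left sum_distrib_right mult.assoc)
      also have "\<dots> = (\<Sum>k | ent ?X ?i k \<noteq> 0. \<Sum>a<krank (ent Z). \<Sum>l\<in>R0. ent ?X ?i k * u a k * (v a l * ent ?W l ?j))"
        by (rule sum.cong[OF refl], rule sum.swap)
      also have "\<dots> = (\<Sum>a<krank (ent Z). \<Sum>k | ent ?X ?i k \<noteq> 0. \<Sum>l\<in>R0. ent ?X ?i k * u a k * (v a l * ent ?W l ?j))"
        by (rule sum.swap)
      finally show ?thesis by (simp add: sum_product)
    qed
    then show ?thesis unfolding factors_through_def
      by (intro exI[of _ "\<lambda>a x. \<Sum>k | ent (X (fst x)) (fst (snd x)) k \<noteq> 0. ent (X (fst x)) (fst (snd x)) k * u a k"]
          exI[of _ "\<lambda>a y. \<Sum>l\<in>R0. v a l * ent (W (fst y)) l (snd (snd y))"]) blast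
  qed
  define H where "H = {True} \<times> G1 \<union> {False} \<times> G2"
  have "card ({True} \<times> G1 \<union> {False} \<times> G2) = card ({True} \<times> G1) + card ({False} \<times> G2)"
    by (rule card_Un_disjoint) (use S1(3) S2(3) in auto)
  then have H: "finite H" "card H = card G1 + card G2"
    unfolding H_def using S1(3) S2(3) by (auto simp: card_cartesian_product)
  have Hsum: "(\<Sum>h\<in>H. F h) = (\<Sum>g\<in>G1. F (True, g)) + (\<Sum>g\<in>G2. F (False, g))" for F :: "_ \<Rightarrow> 'k"
  proof -
    have "(\<Sum>h\<in>H. F h) = (\<Sum>h\<in>{True} \<times> G1. F h) + (\<Sum>h\<in>{False} \<times> G2. F h)"
      unfolding H_def by (rule sum.union_disjoint) (use S1(3) S2(3) in auto)
    moreover have "{b} \<times> G = Pair b ` G" for b :: bool and G :: "('i \<times> 'i) set" by auto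
    ultimately show ?thesis by (simp add: sum.reindex inj_on_def)
  qed
  have "card H \<le> krank (ent Z)"
  proof (rule factors_card[OF fB H(1)])
    fix d assume d: "\<And>g. (\<Sum>h\<in>H. d h * B h g) = 0"
    \<comment> \<open>The lower left block is zero, so the \<open>True\<close> columns see only the
      \<open>True\<close> rows. The uncontrolled corner coming from \<open>c\<close> enters only the
      \<open>False\<close> columns, where these coefficients are already 0.\<close>
    have 1: "d (True, g) = 0" if "g \<in> G1" for g
    proof -
      have "0 = (\<Sum>h\<in>G1. d (True, h) * ent (gdiag G1 p1) (fst h) (snd g))"
        using d[of "(True, g)"] unfolding Hsum by (simp add: B_def XW)
      then show ?thesis using gdiag_row_sum[OF S1(3,5) that S1(4), of "\<lambda>h. d (True, h)" p1] S1(6)[OF that] by simp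
    qed
    have 2: "d (False, g) = 0" if "g \<in> G2" for g
    proof -
      have "0 = (\<Sum>h\<in>G2. d (False, h) * ent (gdiag G2 p2) (fst h) (snd g))"
        using d[of "(False, g)"] 1 unfolding Hsum by (simp add: B_def XW)
      then show ?thesis using gdiag_row_sum[OF S2(3,5) that S2(4), of "\<lambda>h. d (False, h)" p2] S2(6)[OF that] by simp
    qed
    show "\<forall>h\<in>H. d h = 0" using 1 2 by (auto simp: H_def)
  qed
  then show "real (krank (ent a)) + real (krank (ent b)) \<le> real (krank (ent (a + b + c)))"
    using ka kb H(2) by (simp add: Z_def)
next
  fix a b :: "('i, 'k) rfm"
  assume m: "a \<in> rmat J J UNIV" "b \<in> rmat J J UNIV"
  show "real (krank (ent (a * b))) \<le> real (krank (ent a))"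
    using krank_le factors_right[OF rmat_factors[OF m(1)] m(2)] by fastforce
  show "real (krank (ent (a * b))) \<le> real (krank (ent b))"
    using krank_le factors_left[OF rmat_factors[OF m(2)]] by fastforce
  have "ent (a + b) = (\<lambda>i j. ent a i j + ent b i j)" by (auto simp: fun_eq_iff)
  then show "real (krank (ent (a + b))) \<le> real (krank (ent a)) + real (krank (ent b))"
    using krank_le[OF factors_add[OF rmat_factors[OF m(1)] rmat_factors[OF m(2)]]]
    by (metis of_nat_add of_nat_le_iff)
next
  have "ent (0 :: ('i, 'k) rfm) = (\<lambda>i j. 0)" by (auto simp: fun_eq_iff)
  then show "real (krank (ent (0 :: ('i, 'k) rfm))) = 0" by simp
qed auto

lemma krank_gdiag:
  fixes p :: "'i \<times> 'i \<Rightarrow> 'k::field"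
  assumes "finite G" "inj_on fst G" "inj_on snd G" "\<And>g. g \<in> G ==> p g \<noteq> 0"
  shows "krank (ent (gdiag G p)) = card G"
proof (rule antisym)
  show "krank (ent (gdiag G p)) \<le> card G" by (rule krank_le[OF krank_gdiag_le[OF assms(1,2)]])
  have "factors_through (krank (ent (gdiag G p))) (\<lambda>(h :: 'i \<times> 'i) (g :: 'i \<times> 'i). ent (gdiag G p) (fst h) (snd g))"
    by (rule factors_reindex[OF factors_krank[OF krank_gdiag_le[OF assms(1,2)]]])
  then show "card G \<le> krank (ent (gdiag G p))"
  proof (rule factors_card[OF _ assms(1)])
    fix c assume c: "\<And>g :: 'i \<times> 'i. (\<Sum>h\<in>G. c h * ent (gdiag G p) (fst h) (snd g)) = 0"
    show "\<forall>h\<in>G. c h = 0"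
    proof
      fix g assume "g \<in> G"
      then show "c g = 0" using c[of g] gdiag_row_sum[OF assms(1,3) _ assms(2), of g c p] assms(4)[of g] by simp
    qed
  qed
qed

text \<open>Diagonal form turns a matrix into units of the field, each of the same rank as
  \<open>1\<close>, and \<open>krank\<close> counts them. So a rank function over a field is
  determined by its value on one matrix unit.\<close>

lemma arank_field:
  fixes rho :: "('i, 'k::field) rfm \<Rightarrow> real"
  assumes ar: "arank (rmat J J UNIV) rho" and j0: "j0 \<in> J" and M: "M \<in> rmat J J UNIV"
  shows "rho M = real (krank (ent M)) * rho (un j0 j0 1)"
proof -
  interpret arank "rmat J J UNIV" rho by fact
  obtain R L where RL: "finite R" "finite L" "R \<subseteq> J" "L \<subseteq> J" "\<And>i j. i \<notin> R \<or> j \<notin> L ==> ent M i j = 0"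
    using rmat_bound[OF M] by metis
  have M': "M \<in> rmat (R \<union> L) (R \<union> L) UNIV" using RL by (intro rmatI[of R L]) auto
  obtain P P' Q Q' G p where S: "minv (R \<union> L) P P'" "minv (R \<union> L) Q Q'" "finite G" "G \<subseteq> (R \<union> L) \<times> (R \<union> L)"
    "inj_on fst G" "inj_on snd G" "\<And>g. g \<in> G ==> p g \<noteq> 0" "P * M * Q = gdiag G p"
    using field_smith[OF _ _ M'] RL by (metis finite_UnI)
  have sub: "R \<union> L \<subseteq> J" using RL by auto
  have GJ: "G \<subseteq> J \<times> J" using S(4) sub by blast
  have one: "rho (un j0 j0 (p g)) = rho (un j0 j0 1)" if "g \<in> G" for g
  proof (rule antisym)
    have "un j0 j0 (p g) = un j0 j0 1 * un j0 j0 (p g)" by (simp add: un_mult_un)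
    then show "rho (un j0 j0 (p g)) \<le> rho (un j0 j0 1)"
      using mult_le_left[of "un j0 j0 1" "un j0 j0 (p g)"] j0 by (simp add: rmat_un)
    have "un j0 j0 1 = un j0 j0 (p g) * un j0 j0 (inverse (p g))" using S(7)[OF that] by (simp add: un_mult_un)
    then show "rho (un j0 j0 1) \<le> rho (un j0 j0 (p g))"
      using mult_le_left[of "un j0 j0 (p g)" "un j0 j0 (inverse (p g))"] j0 by (simp add: rmat_un)
  qed
  have "rho M = rho (gdiag G p)" using arank_minv[OF ar S(1,2) sub M'] S(8) by simp
  also have "\<dots> = (\<Sum>g\<in>G. rho (un j0 j0 (p g)))" by (rule arank_gdiag[OF ar j0 S(3) GJ S(5,6)])
  also have "\<dots> = real (card G) * rho (un j0 j0 1)" by (simp add: one)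
  also have "card G = krank (ent M)"
    using krank_gdiag[OF S(3,5,6,7)] arank_minv[OF krank_arank S(1,2) sub M'] S(8) by simp
  finally show ?thesis .
qed

lemma krank_dg: "finite J ==> krank (ent (dg J (1::'k::field))) = card J"
proof -
  assume J: "finite J"
  have "dg J (1::'k) = gdiag ((\<lambda>i. (i, i)) ` J) (\<lambda>_. 1)"
    using J by (auto intro!: rfm_eqI simp: ent_dg ent_gdiag)
  then show ?thesis using J krank_gdiag[of "(\<lambda>i. (i, i)) ` J" "\<lambda>_. 1::'k"]
    by (simp add: inj_on_def card_image)
qed

text \<open>In diagonal form a quasi-inverse is the transpose with inverted entries; it is carried
  back by \<open>Q\<close> and \<open>P\<close>.\<close>

lemma rmat_regular:
  fixes M :: "('i, 'k::field) rfm"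
  assumes J: "finite J" and M: "M \<in> rmat J J UNIV"
  shows "\<exists>X\<in>rmat J J UNIV. M * X * M = M"
proof -
  obtain P P' Q Q' G p where S: "minv J P P'" "minv J Q Q'" "finite G" "G \<subseteq> J \<times> J"
    "inj_on fst G" "inj_on snd G" "\<And>g. g \<in> G ==> p g \<noteq> 0" "P * M * Q = gdiag G p"
    using field_smith[OF J J M] by metis
  define D where "D = gdiag G p"
  define E where "E = gdiag (prod.swap ` G) (\<lambda>g. inverse (p (prod.swap g)))"
  have E: "E \<in> rmat J J UNIV" unfolding E_def gdiag_def using S(4) by (auto intro!: rmat_sum rmat_un)
  have entE: "ent E i j = (if (j, i) \<in> G then inverse (p (j, i)) else 0)" for i j
    using S(3) by (auto simp: E_def ent_gdiag image_iff)
  have DE: "D * E = dg (fst ` G) 1"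
  proof (rule rfm_eqI)
    fix i k
    have "ent (D * E) i k = (\<Sum>j\<in>snd ` G. ent D i j * ent E j k)"
    proof (rule ent_mult)
      show "finite (snd ` G)" using S(3) by simp
      fix j assume "j \<notin> snd ` G"
      then have "(i, j) \<notin> G" by force
      then show "ent D i j * ent E j k = 0" using S(3) by (simp add: D_def ent_gdiag)
    qed
    also have "\<dots> = (\<Sum>g\<in>G. ent D i (snd g) * ent E (snd g) k)"
      using S(6) by (simp add: sum.reindex)
    also have "\<dots> = (\<Sum>g\<in>G. if fst g = i then (if i = k then 1 else 0) else 0)"
    proof (rule sum.cong[OF refl])
      fix g assume g: "g \<in> G"
      have "(i, snd g) \<in> G \<longleftrightarrow> fst g = i" using S(6) g by (metis fst_conv inj_onD prod.collapse snd_conv)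
      moreover have "(k, snd g) \<in> G \<longleftrightarrow> fst g = k" using S(6) g by (metis fst_conv inj_onD prod.collapse snd_conv)
      ultimately show "ent D i (snd g) * ent E (snd g) k = (if fst g = i then (if i = k then 1 else 0) else 0)"
        using S(3,7) g by (auto simp: D_def ent_gdiag entE)
    qed
    also have "\<dots> = (\<Sum>j\<in>fst ` G. if j = i then (if i = k then 1 else 0) else 0)"
      using S(5) by (simp add: sum.reindex)
    also have "\<dots> = ent (dg (fst ` G) 1) i k" using S(3) by (auto simp: ent_dg)
    finally show "ent (D * E) i k = ent (dg (fst ` G) 1) i k" .
  qed
  have DED: "D * E * D = D"
    unfolding DE using S(3) by (auto intro!: rfm_eqI simp: ent_dg_mult D_def ent_gdiag image_iff) force
  have m: "P \<in> rmat J J UNIV" "P' \<in> rmat J J UNIV" "Q \<in> rmat J J UNIV" "Q' \<in> rmat J J UNIV"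
    "P * P' = dg J 1" "P' * P = dg J 1" "Q * Q' = dg J 1" "Q' * Q = dg J 1"
    using S(1,2) by (auto simp: minv_def)
  have MD: "M = P' * D * Q'"
  proof -
    have "P' * D * Q' = (P' * P) * M * (Q * Q')" by (simp add: D_def S(8)[symmetric] mult.assoc)
    then show ?thesis using M m by (simp add: dg_mult_absorb mult_dg_absorb)
  qed
  have "M * (Q * E * P) * M = P' * D * (Q' * Q) * E * (P * P') * D * Q'"
    by (simp add: MD mult.assoc)
  also have "\<dots> = P' * D * (dg J 1 * E) * (dg J 1 * D) * Q'"
    by (simp add: m mult.assoc)
  also have "\<dots> = P' * (D * E * D) * Q'"
  proof -
    have "D \<in> rmat J J UNIV" unfolding D_def S(8)[symmetric] using m M by (auto intro!: rmat_mult)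
    then show ?thesis using E by (simp add: dg_mult_absorb mult.assoc)
  qed
  finally have "M * (Q * E * P) * M = M" by (simp add: DED MD)
  moreover have "Q * E * P \<in> rmat J J UNIV" using m E by (auto intro!: rmat_mult)
  ultimately show ?thesis by blast
qed

section \<open>Rank functions on matrices over a polynomial ring\<close>

text \<open>The matrix of multiplication by \<open>p\<close> on K[s]/(r) in the basis of the powers
  of \<open>s\<close>: coordinate \<open>u\<close> of \<open>p\<close> times the \<open>v\<close>-th
  power.\<close>

definition pm :: "'k::field poly \<Rightarrow> 'k poly \<Rightarrow> nat \<Rightarrow> nat \<Rightarrow> 'k" where
  "pm r p u v = (if u < degree r \<and> v < degree r then coeff ((p * monom 1 v) mod r) u else 0)"

lemma poly_mod_sum: "(\<Sum>i\<in>A. f i) mod r = (\<Sum>i\<in>A. f i mod (r :: 'k::field poly))"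
  by (induction A rule: infinite_finite_induct) (auto simp: poly_mod_add_left)

lemma poly_sum_monoms:
  assumes "degree p < n"
  shows "p = (\<Sum>i<n. monom (coeff p i) i)"
  by (rule poly_eqI) (use assms in \<open>auto simp: coeff_sum coeff_monom coeff_eq_0 if_distrib cong: if_cong\<close>)

lemma pm_mult:
  assumes r: "0 < degree r"
  shows "pm r (p * q) u v = (\<Sum>w<degree r. pm r p u w * pm r q w v)"
proof (cases "u < degree r \<and> v < degree r")
  case True
  have r0: "r \<noteq> 0" using r by auto
  let ?g = "(q * monom 1 v) mod r"
  have dg: "degree ?g < degree r" using degree_mod_less'[OF r0, of "q * monom 1 v"] r
    by (cases "?g = 0") auto
  have "(p * q * monom 1 v) mod r = (p * ?g) mod r" by (simp add: mod_mult_right_eq mult.assoc)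
  also have "p * ?g = (\<Sum>w<degree r. smult (coeff ?g w) (p * monom 1 w))"
  proof -
    have "p * ?g = (\<Sum>w<degree r. p * monom (coeff ?g w) w)"
      by (subst poly_sum_monoms[OF dg]) (simp add: sum_distrib_left)
    then show ?thesis by (simp add: smult_monom flip: mult_smult_right)
  qed
  also have "\<dots> mod r = (\<Sum>w<degree r. smult (coeff ?g w) ((p * monom 1 w) mod r))"
    by (simp add: poly_mod_sum mod_smult_left)
  finally show ?thesis using True
    by (auto simp: pm_def coeff_sum mult.commute intro!: sum.cong)
next
  case False
  then show ?thesis by (auto simp: pm_def)
qed

lemma pm_add: "pm r (p + q) u v = pm r p u v + pm r q u v"
  by (simp add: pm_def algebra_simps poly_mod_add_left)

lemma pm_0 [simp]: "pm r 0 u v = 0"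
  by (simp add: pm_def)

lemma pm_sum: "pm r (sum f A) u v = (\<Sum>a\<in>A. pm r (f a) u v)"
  by (induction A rule: infinite_finite_induct) (auto simp: pm_add)

lemma pm_1: "pm r 1 u v = (if u = v \<and> u < degree r then 1 else 0)"
  by (auto simp: pm_def mod_poly_less degree_monom_eq coeff_monom)

lemma pm_cong: "p mod r = q mod r ==> pm r p u v = pm r q u v"
  unfolding pm_def by (metis mod_mult_left_eq)

text \<open>Restriction of scalars: each entry becomes its matrix on K[s]/(r), and the second index
  component is the exponent of the basis power.\<close>

definition rep :: "'k::field poly \<Rightarrow> ('i, 'k poly) rfm \<Rightarrow> ('i \<times> nat, 'k) rfm" where
  "rep r Y = Rfm (\<lambda>(i, u) (j, v). pm r (ent Y i j) u v)"

lemma ent_rep: "ent (rep r Y) (i, u) (j, v) = pm r (ent Y i j) u v"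
proof -
  have "finite {x. (case x of (j, v) \<Rightarrow> pm r (ent Y i j) u v) \<noteq> 0}" for i u
    by (rule finite_subset[of _ "{j. ent Y i j \<noteq> 0} \<times> {..<degree r}"]) (auto simp: pm_def split: if_splits)
  then show ?thesis unfolding rep_def by (subst ent_Rfm) (auto simp: case_prod_unfold)
qed

lemma rep_add: "rep r (A + B) = rep r A + rep r B"
  by (rule rfm_eqI) (auto simp: ent_rep pm_add split: prod.split)

lemma rep_mult:
  fixes A B :: "('i, 'k::field poly) rfm"
  assumes r: "0 < degree r"
  shows "rep r (A * B) = rep r A * rep r B"
proof (rule rfm_eqI)
  fix x y :: "'i \<times> nat"
  obtain i u k v where x: "x = (i, u)" and y: "y = (k, v)" by (cases x, cases y) auto
  let ?J = "{j. ent A i j \<noteq> 0}"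
  have "ent (rep r A * rep r B) x y = (\<Sum>z\<in>?J \<times> {..<degree r}. ent (rep r A) x z * ent (rep r B) z y)"
    by (rule ent_mult) (auto simp: x ent_rep pm_def split: if_splits)
  also have "\<dots> = (\<Sum>j\<in>?J. \<Sum>w<degree r. pm r (ent A i j) u w * pm r (ent B j k) w v)"
    by (simp add: sum.cartesian_product case_prod_unfold x y ent_rep flip: ent_rep)
  also have "\<dots> = ent (rep r (A * B)) x y"
    by (simp add: x y ent_rep ent_times pm_sum pm_mult[OF r])
  finally show "ent (rep r (A * B)) x y = ent (rep r A * rep r B) x y" by simp
qed

lemma rep_rmat:
  assumes "Y \<in> rmat J L C"
  shows "rep r Y \<in> rmat UNIV UNIV UNIV"
proof -
  obtain R1 L1 where 1: "finite R1" "finite L1" "\<And>i j. i \<notin> R1 \<or> j \<notin> L1 ==> ent Y i j = 0"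
    using rmat_bound[OF assms] by metis
  show ?thesis
  proof (rule rmatI[of "R1 \<times> {..<degree r}" "L1 \<times> {..<degree r}"])
    fix x y :: "'a \<times> nat" assume "x \<notin> R1 \<times> {..<degree r} \<or> y \<notin> L1 \<times> {..<degree r}"
    then show "ent (rep r Y) x y = 0" using 1(3) by (cases x, cases y) (auto simp: ent_rep pm_def)
  qed (use 1 in auto)
qed

lemma arank_rep:
  "0 < degree r ==> arank (rmat J J UNIV) (\<lambda>Y. real (krank (ent (rep r Y))))"
  by (rule arank_pullback[OF krank_arank[of UNIV], where h="rep r"])
    (auto intro: rep_rmat simp: rep_add rep_mult)

section \<open>Values of a rank function on scalars of a commutative ring\<close>

definition cop :: "'a::comm_ring_1 \<Rightarrow> 'a \<Rightarrow> bool" where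
  "cop a b \<longleftrightarrow> (\<exists>u v. u * a + v * b = 1)"

lemma cop_sym: "cop a b ==> cop b a"
  unfolding cop_def by (metis add.commute)

lemma cop_mult: "cop a b ==> cop a c ==> cop a (b * c)"
proof -
  assume "cop a b" "cop a c"
  then obtain u v u' v' where 1: "u * a + v * b = 1" "u' * a + v' * c = 1" unfolding cop_def by blast
  have "1 = (u * a + v * b) * (u' * a + v' * c)" using 1 by simp
  also have "\<dots> = (u * a * u' + u * v' * c + v * b * u') * a + (v * v') * (b * c)" by (simp add: algebra_simps)
  finally show ?thesis unfolding cop_def by metis
qed

lemma cop_1 [simp]: "cop a 1"
  unfolding cop_def by (metis add_0 mult_1 mult_zero_left)

lemma cop_prod: "(\<And>i. i \<in> A ==> cop a (f i)) ==> cop a (prod f A)"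
  by (induction A rule: infinite_finite_induct) (auto intro: cop_mult)

lemma cop_power: "cop a b ==> cop a (b ^ n)"
  by (induction n) (auto intro: cop_mult)

lemma cop_powers: "cop a b ==> cop (a ^ m) (b ^ n)"
  by (meson cop_power cop_sym)

text \<open>Two indices give room for the 2 by 2 identities below. The rank comes with an arbitrary
  weight, so \<open>f 1\<close> stands where a normalized rank would have 1.\<close>

locale poly_arank = arank "rmat J J UNIV" rho
  for J :: "'i set" and rho :: "('i, 'a::comm_ring_1) rfm \<Rightarrow> real" +
  fixes j0 j1 :: 'i
  assumes J: "j0 \<in> J" "j1 \<in> J" "j0 \<noteq> j1"
begin

definition f :: "'a \<Rightarrow> real" where "f p = rho (un j0 j0 p)"

definition m2 where "m2 a b c d = un j0 j0 a + un j0 j1 b + un j1 j0 c + un j1 j1 d"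

lemma m2_mult: "m2 a b c d * m2 a' b' c' d' = m2 (a * a' + b * c') (a * b' + b * d') (c * a' + d * c') (c * b' + d * d')"
  using J by (simp add: m2_def algebra_simps un_mult_un un_add)

lemma m2_in [simp]: "m2 a b c d \<in> rmat J J UNIV"
  using J by (auto simp: m2_def intro!: rmat_add rmat_un)

lemma f_diag: "rho (m2 a 0 0 d) = f a + f d"
proof -
  have "gdiag {(j0, j0), (j1, j1)} (\<lambda>g. if fst g = j0 then a else d) = m2 a 0 0 d"
    using J by (simp add: gdiag_def m2_def)
  moreover have "rho (gdiag {(j0, j0), (j1, j1)} (\<lambda>g. if fst g = j0 then a else d)) = f a + f d"
    using J by (subst arank_gdiag[OF arank_axioms J(1)]) (auto simp: f_def)
  ultimately show ?thesis by simp
qed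

lemma f_tri: "f a + f d \<le> rho (m2 a b 0 d)"
proof -
  have e: "rho (un j1 j1 d) = f d"
    using f_diag[of 0 d] J by (simp add: m2_def f_def zero)
  have "rho (un j0 j0 a) + rho (un j1 j1 d) \<le> rho (un j0 j0 a + un j1 j1 d + un j0 j1 b)"
    by (rule tri[of _ _ _ "un j0 j0 1" "un j0 j0 1" "un j1 j1 1" "un j1 j1 1"])
      (use J in \<open>auto simp: un_mult_un intro: rmat_un\<close>)
  then show ?thesis unfolding e by (simp add: f_def m2_def algebra_simps)
qed

lemma f_mult_le: "f (a * b) \<le> f a" "f (a * b) \<le> f b"
  using mult_le_left[of "un j0 j0 a" "un j0 j0 b"] mult_le_right[of "un j0 j0 a" "un j0 j0 b"] J
  by (auto simp: f_def un_mult_un rmat_un)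

lemma f_nonneg: "0 \<le> f a"
  using nonneg J by (simp add: f_def rmat_un)

lemma f_0: "f 0 = 0"
  by (simp add: f_def zero)

text \<open>A Bezout relation makes \<open>diag(a, b)\<close> and \<open>diag(1, a * b)\<close>
  multiples of each other by explicit 2 by 2 matrices.\<close>

lemma f_coprime:
  assumes "cop a b"
  shows "f (a * b) = f a + f b - f 1"
proof -
  obtain u v where uv: "u * a + v * b = 1" using assms unfolding cop_def by blast
  have 1: "m2 u v (- b) a * m2 a 0 0 b * m2 1 (- v * b) 1 (u * a) = m2 1 0 0 (a * b)"
  proof -
    have "a * (a * (b * u)) + a * (b * (b * v)) = a * b * (u * a + v * b)" by (simp add: algebra_simps)
    then have "a * (a * (b * u)) + a * (b * (b * v)) = a * b" by (simp only: uv mult_1_right)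
    then show ?thesis using uv by (simp add: m2_mult algebra_simps)
  qed
  have 2: "m2 a (- v) b u * m2 1 0 0 (a * b) * m2 (u * a) (v * b) (- 1) 1 = m2 a 0 0 b"
  proof -
    have "a * (a * u) + a * (b * v) = a * (u * a + v * b)"
         "a * (b * u) + b * (b * v) = b * (u * a + v * b)" by (simp_all add: algebra_simps)
    then have "a * (a * u) + a * (b * v) = a" "a * (b * u) + b * (b * v) = b" by (simp_all only: uv mult_1_right)
    then show ?thesis using uv by (simp add: m2_mult algebra_simps)
  qed
  have "f 1 + f (a * b) \<le> f a + f b"
    using mult3_le[of "m2 u v (- b) a" "m2 a 0 0 b" "m2 1 (- v * b) 1 (u * a)"] unfolding 1 f_diag by simp
  moreover have "f a + f b \<le> f 1 + f (a * b)"
    using mult3_le[of "m2 a (- v) b u" "m2 1 0 0 (a * b)" "m2 (u * a) (v * b) (- 1) 1"] unfolding 2 f_diag by simp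
  ultimately show ?thesis by simp
qed

text \<open>Row and column operations turn \<open>diag(a, a * q * q)\<close> into a triangular
  matrix with \<open>a * q\<close> twice on the diagonal. Hence the ranks of the powers of
  \<open>q\<close> form a convex sequence.\<close>

lemma f_convex: "2 * f (a * q) \<le> f a + f (a * q * q)"
proof -
  have "m2 1 0 q (- 1) * m2 a 0 0 (a * q * q) * m2 q 1 1 0 = m2 (a * q) a 0 (a * q)"
    by (simp add: m2_mult algebra_simps)
  then have "rho (m2 (a * q) a 0 (a * q)) \<le> f a + f (a * q * q)"
    using mult3_le[of "m2 1 0 q (- 1)" "m2 a 0 0 (a * q * q)" "m2 q 1 1 0"] f_diag by simp
  then show ?thesis using f_tri[of "a * q" "a * q" a] by simp
qed

lemma f_convex_power: "2 * f (q ^ Suc k) \<le> f (q ^ k) + f (q ^ Suc (Suc k))"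
  using f_convex[of "q ^ k" q] by (simp add: mult.commute mult.left_commute)

lemma f_unit: "c * d = 1 ==> f (c * p) = f p"
proof (rule antisym)
  assume "c * d = 1"
  then have "d * (c * p) = p" by (metis mult.assoc mult.commute mult_1)
  then show "f p \<le> f (c * p)" using f_mult_le(2)[of d "c * p"] by simp
qed (rule f_mult_le)

lemma f_mono_power: "f (q ^ Suc k) \<le> f (q ^ k)"
  using f_mult_le(2)[of q "q ^ k"] by simp

text \<open>By convexity the drops get smaller along the powers, so the first one is the
  largest.\<close>

lemma f_power_diff: "f (q ^ k) - f (q ^ Suc k) \<le> f 1 - f q"
proof (induction k)
  case (Suc k)
  then show ?case using f_convex_power[of q k] by linarith
qed simp

text \<open>Without a first drop there is never one. This is applied to the variable of the
  polynomial ring.\<close>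

lemma f_power_full: "f q = f 1 ==> f (q ^ k) = f 1"
proof (induction k)
  case (Suc k)
  then show ?case using f_power_diff[of q k] f_mono_power[of q k] by simp
qed simp

text \<open>The defects \<open>f 1 - f p\<close> add up over pairwise coprime factors.\<close>

lemma f_prod:
  assumes "finite A" "\<And>q q'. q \<in> A ==> q' \<in> A ==> q \<noteq> q' ==> cop q q'"
  shows "f (\<Prod>q\<in>A. q ^ e q) = f 1 - (\<Sum>q\<in>A. f 1 - f (q ^ e q))"
  using assms
proof (induction A rule: finite_induct)
  case (insert q A)
  have "cop (q ^ e q) (\<Prod>q\<in>A. q ^ e q)"
    by (rule cop_prod, rule cop_powers) (use insert in auto)
  then have "f (q ^ e q * (\<Prod>q\<in>A. q ^ e q)) = f (q ^ e q) + f (\<Prod>q\<in>A. q ^ e q) - f 1"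
    by (rule f_coprime)
  then show ?case using insert by simp
qed simp

end

section \<open>Monic irreducible polynomials and factorization\<close>

definition mir :: "'k::field poly \<Rightarrow> bool" where
  "mir q \<longleftrightarrow> lead_coeff q = 1 \<and> 0 < degree q \<and> (\<forall>a b. q = a * b --> degree a = 0 \<or> degree b = 0)"

text \<open>A nonzero combination of \<open>q\<close> and \<open>p\<close> of least degree divides
  both. Irreducibility makes it a constant, since an associate of \<open>q\<close> would make
  \<open>q\<close> divide \<open>p\<close>.\<close>

lemma mir_cop:
  assumes q: "mir q" and nd: "\<not> q dvd p"
  shows "cop q p"
proof -
  define I where "I = {d. d \<noteq> 0 \<and> (\<exists>u v. d = u * q + v * p)}"
  have "q \<noteq> 0" using q by (auto simp: mir_def)
  then have "q \<in> I" unfolding I_def by (simp, intro exI[of _ 1] exI[of _ 0]) simp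
  then obtain d where d: "d \<in> I" "\<And>d'. d' \<in> I ==> degree d \<le> degree d'"
    using ex_has_least_nat[of "\<lambda>d. d \<in> I" q degree] by blast
  obtain u v where uv: "d \<noteq> 0" "d = u * q + v * p" using d(1) unfolding I_def by blast
  have dv: "d dvd x" if x: "x = u' * q + v' * p" for x u' v'
  proof (rule ccontr)
    assume "\<not> d dvd x"
    then have m: "x mod d \<noteq> 0" by (simp add: mod_eq_0_iff_dvd)
    have "x mod d = x - (x div d) * d" by (simp add: minus_div_mult_eq_mod)
    also have "\<dots> = (u' - (x div d) * u) * q + (v' - (x div d) * v) * p"
      by (subst (2) uv(2), subst (1) x) (simp add: algebra_simps)
    finally have "x mod d \<in> I" using m unfolding I_def by blast
    then have "degree d \<le> degree (x mod d)" by (rule d(2))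
    moreover have "degree (x mod d) < degree d" using degree_mod_less'[OF uv(1) m] .
    ultimately show False by simp
  qed
  have dq: "d dvd q" by (rule dv[of q 1 0]) simp
  have dp: "d dvd p" by (rule dv[of p 0 1]) simp
  obtain e where e: "q = d * e" using dq by (elim dvdE)
  have "degree d = 0"
  proof (rule ccontr)
    assume "degree d \<noteq> 0"
    then have "degree e = 0" using q e unfolding mir_def by metis
    then obtain c where c: "e = [:c:]" using degree_0_id by metis
    then have "c \<noteq> 0" using e \<open>q \<noteq> 0\<close> by auto
    then have "q dvd d" using e c by (intro dvdI[of _ _ "[:inverse c:]"]) (simp add: mult.assoc)
    then show False using nd dp dvd_trans by blast
  qed
  then obtain c where c: "d = [:c:]" using degree_0_id by metis
  then have "c \<noteq> 0" using uv by auto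
  then have "([:inverse c:] * u) * q + ([:inverse c:] * v) * p = 1"
  proof -
    assume c0: "c \<noteq> 0"
    have "([:inverse c:] * u) * q + ([:inverse c:] * v) * p = [:inverse c:] * d"
      by (simp only: uv(2) distrib_left mult.assoc)
    also have "\<dots> = 1" using c c0 by (simp add: one_pCons)
    finally show ?thesis .
  qed
  then show ?thesis unfolding cop_def by blast
qed

lemma mir_distinct_cop:
  assumes "mir q" "mir q'" "q \<noteq> q'"
  shows "cop q q'"
proof (rule mir_cop[OF assms(1)])
  show "\<not> q dvd q'"
  proof
    assume "q dvd q'"
    then obtain e where e: "q' = q * e" by (elim dvdE)
    then have "degree e = 0" using assms(1,2) unfolding mir_def by (metis less_numeral_extra(3))
    moreover have "lead_coeff e = 1" using e assms(1,2) lead_coeff_mult[of q e] by (simp add: mir_def)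
    ultimately have "e = 1" using degree_0_id[of e] by (simp add: one_pCons)
    then show False using e assms(3) by simp
  qed
qed

lemma mir_factorization:
  "p \<noteq> 0 ==> \<exists>c M. c \<noteq> 0 \<and> (\<forall>q\<in>#M. mir q) \<and> p = [:c:] * prod_mset M"
proof (induction "degree p" arbitrary: p rule: less_induct)
  case less
  show ?case
  proof (cases "degree p = 0")
    case True
    then obtain c where "p = [:c:]" using degree_0_id by metis
    then show ?thesis using less.prems by (intro exI[of _ c] exI[of _ "{#}"]) auto
  next
    case False
    define q where "q = smult (inverse (lead_coeff p)) p"
    have lp: "lead_coeff p \<noteq> 0" using less.prems by simp
    have pq: "p = [:lead_coeff p:] * q" using lp by (simp add: q_def)
    have dq: "degree q = degree p" "lead_coeff q = 1" using lp by (auto simp: q_def)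
    show ?thesis
    proof (cases "mir q")
      case True
      then show ?thesis using lp pq by (intro exI[of _ "lead_coeff p"] exI[of _ "{#q#}"]) auto
    next
      case F: False
      then obtain a b where ab: "q = a * b" "degree a \<noteq> 0" "degree b \<noteq> 0"
        using dq False unfolding mir_def by auto
      then have nz: "a \<noteq> 0" "b \<noteq> 0" by auto
      have "degree q = degree a + degree b" using ab nz by (simp add: degree_mult_eq)
      then have "degree a < degree p" "degree b < degree p" using ab dq by auto
      then obtain c M c' M' where "c \<noteq> 0" "\<forall>q\<in>#M. mir q" "a = [:c:] * prod_mset M"
        "c' \<noteq> 0" "\<forall>q\<in>#M'. mir q" "b = [:c':] * prod_mset M'" using less.hyps nz by metis
      then show ?thesis using ab pq lp
        by (intro exI[of _ "lead_coeff p * c * c'"] exI[of _ "M + M'"]) (auto simp: algebra_simps)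
    qed
  qed
qed

section \<open>Realizing a rank function by quotients of the polynomial ring\<close>

lemma tail_weights:
  fixes c :: "nat \<Rightarrow> real"
  defines "om n j \<equiv> (if j < n then 2 * c j - c (j - 1) - c (Suc j) else c n - c (n - 1))"
  assumes "1 \<le> m" "m \<le> n"
  shows "(\<Sum>j=m..n. om n j) = c m - c (m - 1)"
  using assms(3,2)
proof (induction rule: inc_induct)
  case base
  then show ?case by (simp add: om_def)
next
  case (step k)
  have "(\<Sum>j=k..n. om n j) = om n k + (\<Sum>j=Suc k..n. om n j)"
    using step by (simp add: sum.atLeast_Suc_atMost)
  then show ?case using step by (simp add: om_def)
qed

text \<open>A sequence with \<open>c 0 = 0\<close> is a combination of the sequences
  \<open>min j\<close>: the weight at \<open>j < n\<close> is minus the second difference, the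
  weight at \<open>n\<close> the last increment. The weights are nonnegative when \<open>c\<close>
  is concave and nondecreasing, as the defects of powers are.\<close>

lemma min_weights:
  fixes c :: "nat \<Rightarrow> real"
  defines "om n j \<equiv> (if j < n then 2 * c j - c (j - 1) - c (Suc j) else c n - c (n - 1))"
  assumes "c 0 = 0" "k \<le> n"
  shows "(\<Sum>j=1..n. om n j * real (min j k)) = c k"
  using assms(3)
proof (induction k)
  case 0
  then show ?case using assms(2) by simp
next
  case (Suc k)
  have "(\<Sum>j=1..n. om n j * real (min j (Suc k))) = (\<Sum>j=1..n. om n j * real (min j k) + (if Suc k \<le> j then om n j else 0))"
    by (rule sum.cong) (auto simp: min_def algebra_simps)
  also have "\<dots> = c k + (\<Sum>j=1..n. if Suc k \<le> j then om n j else 0)"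
    using Suc by (simp add: sum.distrib)
  also have "(\<Sum>j=1..n. if Suc k \<le> j then om n j else 0) = (\<Sum>j=Suc k..n. om n j)"
    by (rule sum.mono_neutral_cong_right) auto
  also have "\<dots> = c (Suc k) - c k" using tail_weights[of "Suc k" n c] Suc by (simp add: om_def)
  finally show ?case by simp
qed

lemma rep_un_1: "rep r (un j j 1) = dg ({j} \<times> {..<degree r}) 1"
  by (rule rfm_eqI) (auto simp: ent_rep ent_un ent_dg pm_1 split: if_splits)

lemma krank_rep_un_1: "krank (ent (rep r (un j j 1))) = degree r"
  unfolding rep_un_1 by (subst krank_dg) auto

lemma rep_un_cong: "p mod r = q mod r ==> rep r (un i j p) = rep r (un i j q)"
  by (rule rfm_eqI) (auto simp: ent_rep ent_un dest: pm_cong[of p r q])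

lemma rep_arank_locale:
  assumes "0 < degree r" "j0 \<in> J" "j1 \<in> J" "j0 \<noteq> j1"
  shows "poly_arank J (\<lambda>Y. real (krank (ent (rep r Y)))) j0 j1"
  using arank_rep[OF assms(1), of J] assms by (simp add: poly_arank_def poly_arank_axioms_def)

text \<open>Modulo \<open>r\<close>, a Bezout coefficient of \<open>p\<close> is an inverse of
  \<open>p\<close>, which therefore acts invertibly on the quotient.\<close>

lemma krank_rep_cop:
  fixes r :: "'k::field poly" and j :: 'i
  assumes r: "0 < degree r" "cop r p"
  shows "krank (ent (rep r (un j j p))) = degree r"
proof -
  obtain u v where uv: "u * r + v * p = 1" using r(2) unfolding cop_def by blast
  have "(v * p) mod r = 1 mod r" using uv by (metis add.commute mod_mult_self3)
  then have e: "rep r (un j j v) * rep r (un j j p) = rep r (un j j 1)"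
    using rep_un_cong by (simp add: un_mult_un flip: rep_mult[OF r(1)])
  have m: "rep r (un j j q) \<in> rmat UNIV UNIV UNIV" for q by (rule rep_rmat[OF rmat_un[of UNIV _ UNIV _ UNIV]]) auto
  have e': "rep r (un j j 1) * rep r (un j j p) = rep r (un j j p)"
    by (simp add: un_mult_un flip: rep_mult[OF r(1)])
  interpret arank "rmat UNIV UNIV UNIV" "\<lambda>M :: ('i \<times> nat, 'k) rfm. real (krank (ent M))" by (rule krank_arank)
  have "degree r \<le> krank (ent (rep r (un j j p)))"
    using mult_le_right[OF m m, of v p] unfolding e krank_rep_un_1 by simp
  moreover have "krank (ent (rep r (un j j p))) \<le> degree r"
    using mult_le_left[OF m m, of 1 p] unfolding e' krank_rep_un_1 by simp
  ultimately show ?thesis by simp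
qed

text \<open>The products of \<open>q\<close> with the first \<open>m\<close> powers of the variable
  have degree below \<open>degree r\<close>, so reduction leaves them alone; they are independent
  because multiplication by \<open>q\<close> is injective.\<close>

lemma krank_rep_ge:
  fixes q r :: "'k::field poly"
  assumes q: "q \<noteq> 0" and r: "degree r = degree q + m" "0 < degree r"
  shows "m \<le> krank (ent (rep r (un j j q)))"
proof -
  define B where "B = (\<lambda>v u. ent (rep r (un j j q)) (j, u) (j, v))"
  have "rep r (un j j q) \<in> rmat UNIV UNIV UNIV" by (rule rep_rmat[OF rmat_un[of UNIV _ UNIV _ UNIV]]) auto
  note factors_reindex[OF rmat_factors[OF this], of "Pair j" "Pair j"]
  then have "factors_through (krank (ent (rep r (un j j q)))) B"
    unfolding B_def by (rule factors_transpose)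
  then have "card {..<m} \<le> krank (ent (rep r (un j j q)))"
  proof (rule factors_card)
    fix c assume c: "\<And>u. (\<Sum>v\<in>{..<m}. c v * B v u) = 0"
    define h where "h = (\<Sum>v<m. monom (c v) v)"
    have Bv: "B v u = coeff (q * monom 1 v) u" if "v < m" for u v
    proof -
      have d: "degree (q * monom 1 v) = degree q + v" using q by (simp add: degree_mult_eq degree_monom_eq)
      then have "q * monom 1 v mod r = q * monom 1 v" using that r by (simp add: mod_poly_less)
      then show ?thesis using that r d by (auto simp: B_def ent_rep ent_un pm_def coeff_eq_0)
    qed
    have "q * h = (\<Sum>v<m. smult (c v) (q * monom 1 v))"
      by (simp add: h_def sum_distrib_left smult_monom flip: mult_smult_right)
    then have "coeff (q * h) u = (\<Sum>v\<in>{..<m}. c v * B v u)" for u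
      by (simp add: coeff_sum Bv)
    then have "q * h = 0" using c by (intro poly_eqI) simp
    then have "h = 0" using q by simp
    moreover have "coeff h v = c v" if "v < m" for v
      using that by (simp add: h_def coeff_sum coeff_monom)
    ultimately show "\<forall>v\<in>{..<m}. c v = 0" by auto
  qed simp
  then show ?thesis by simp
qed

text \<open>Each factor \<open>q\<close> lowers the rank by at most \<open>degree q\<close>: the
  first drop by \<open>krank_rep_ge\<close>, the later ones by convexity. Since \<open>n\<close>
  factors bring it from \<open>n * degree q\<close> down to 0, every drop is exact.\<close>

lemma krank_rep_power:
  fixes q :: "'k::field poly"
  assumes q: "0 < degree q" and n: "1 \<le> n"
  shows "real (krank (ent (rep (q ^ n) (un (j::nat \<times> nat) j (q ^ k))))) = real (degree q) * real (n - min n k)"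
proof -
  let ?r = "q ^ n"
  have q0: "q \<noteq> 0" using q by auto
  have dr: "degree ?r = n * degree q" using q0 by (simp add: degree_power_eq)
  then have r: "0 < degree ?r" using q n by simp
  \<comment> \<open>A second index, to make room for the 2 by 2 arguments of
    \<open>poly_arank\<close>.\<close>
  define j' where "j' = (Suc (fst j), snd j)"
  have jj: "j \<noteq> j'" by (cases j) (auto simp: j'_def)
  interpret poly_arank UNIV "\<lambda>Y. real (krank (ent (rep ?r Y)))" j j'
    by (rule rep_arank_locale[OF r]) (use jj in auto)
  have f1: "f 1 = n * real (degree q)" unfolding f_def krank_rep_un_1 by (simp add: dr)
  obtain n' where n': "n = Suc n'" using n by (cases n) auto
  have "n' * degree q \<le> krank (ent (rep ?r (un j j q)))"
    by (rule krank_rep_ge) (use q0 r dr n' in auto)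
  then have fq: "f q \<ge> n' * real (degree q)" unfolding f_def by (metis of_nat_le_iff of_nat_mult)
  have step: "f (q ^ k) - f (q ^ Suc k) \<le> degree q" for k
    using f_power_diff[of q k] f1 fq n' by (simp add: algebra_simps)
  have lo: "f (q ^ k) \<le> f (q ^ (k + m)) + m * real (degree q)" for k m
  proof (induction m)
    case (Suc m)
    then show ?case using step[of "k + m"] by (simp add: algebra_simps)
  qed simp
  have fn: "f (q ^ (n + m)) = 0" for m
  proof -
    have "rep ?r (un j j (q ^ (n + m))) = rep ?r (un j j 0)"
      by (rule rep_un_cong) (simp add: power_add)
    then have "f (q ^ (n + m)) = f 0" unfolding f_def by simp
    then show ?thesis by (simp add: f_0)
  qed
  show ?thesis
  proof (cases "k \<le> n")
    case True
    have "f (q ^ k) \<le> (n - k) * real (degree q)" using lo[of k "n - k"] fn[of 0] True by simp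
    moreover have "f 1 \<le> f (q ^ k) + k * real (degree q)" using lo[of 0 k] by simp
    ultimately have "f (q ^ k) = (n - k) * real (degree q)" using f1 True by (simp add: of_nat_diff algebra_simps)
    then show ?thesis using True unfolding f_def by (simp add: mult.commute)
  next
    case False
    then show ?thesis using fn[of "k - n"] unfolding f_def by simp
  qed
qed

text \<open>The diagonal form depends on \<open>Y\<close> alone, so one list of polynomials serves
  every rank function; this is why the quantifier over \<open>rho\<close> comes last. The given rank
  and the quotient ranks can then be compared entry by entry.\<close>

lemma poly_smith_values:
  fixes Y :: "('i, 'k::field poly) rfm"
  assumes Y: "Y \<in> rmat J J UNIV" and j0: "j0 \<in> J"
  shows "\<exists>(G :: ('i \<times> 'i) set) p. finite G \<and> (\<forall>g\<in>G. p g \<noteq> 0) \<and>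
    (\<forall>rho. arank (rmat J J UNIV) rho --> rho Y = (\<Sum>g\<in>G. rho (un j0 j0 (p g))))"
proof -
  obtain R L where RL: "finite R" "finite L" "R \<subseteq> J" "L \<subseteq> J" "\<And>i j. i \<notin> R \<or> j \<notin> L ==> ent Y i j = 0"
    using rmat_bound[OF Y] by metis
  have Y': "Y \<in> rmat (R \<union> L) (R \<union> L) UNIV" using RL by (intro rmatI[of R L]) auto
  have euc: "\<exists>q r. a = b * q + r \<and> (r = 0 \<or> degree r < degree b)" if "b \<noteq> 0" for a b :: "'k poly"
    using degree_mod_less[OF that, of a] by (intro exI[of _ "a div b"] exI[of _ "a mod b"]) auto
  obtain P P' Q Q' G p where S: "minv (R \<union> L) P P'" "minv (R \<union> L) Q Q'" "finite G" "G \<subseteq> (R \<union> L) \<times> (R \<union> L)"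
    "inj_on fst G" "inj_on snd G" "\<forall>g\<in>G. p g \<noteq> 0" "P * Y * Q = gdiag G p"
    using smith[of degree, OF euc _ _ Y'] RL by (metis finite_UnI)
  have sub: "R \<union> L \<subseteq> J" using RL by auto
  have GJ: "G \<subseteq> J \<times> J" using S(4) sub by blast
  have "rho Y = (\<Sum>g\<in>G. rho (un j0 j0 (p g)))" if ar: "arank (rmat J J UNIV) rho" for rho
    using arank_minv[OF ar S(1,2) sub Y'] S(8) arank_gdiag[OF ar j0 S(3) GJ S(5,6)] by simp
  then show ?thesis using S(3,7) by blast
qed

lemma (in poly_arank) f_factored:
  assumes "finite A" "\<And>q q'. q \<in> A ==> q' \<in> A ==> q \<noteq> q' ==> cop q q'" "c * d = 1"
  shows "f (c * (\<Prod>q\<in>A. q ^ e q)) = f 1 - (\<Sum>q\<in>A. f 1 - f (q ^ e q))"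
  using f_unit[OF assms(3)] f_prod[OF assms(1,2)] by simp

text \<open>The defect of \<open>p\<close> splits over its irreducible factors, and the variable
  contributes none by assumption \<open>s\<close>. For every other irreducible \<open>q\<close>,
  quotients by \<open>q ^ j\<close> with second-difference weights reproduce the defects of the
  powers of \<open>q\<close>; one more quotient, coprime to everything, supplies what is left of
  \<open>f 1\<close>.\<close>

lemma poly_rank_values:
  fixes rho :: "(nat \<times> nat, 'k::field poly) rfm \<Rightarrow> real"
  assumes pa: "poly_arank J rho j0 j1" and s: "rho (un j0 j0 [:0, 1:]) = rho (un j0 j0 1)"
    and Ps: "finite Ps" "0 \<notin> Ps"
  shows "\<exists>(I :: ('k poly \<times> nat) set) r w. finite I \<and>
    (\<forall>i\<in>I. 0 \<le> w i \<and> 0 < degree (r i) \<and> coeff (r i) 0 \<noteq> 0) \<and>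
    (\<forall>p\<in>Ps. rho (un j0 j0 p) = (\<Sum>i\<in>I. w i * real (krank (ent (rep (r i) (un j0 j0 p))))))"
proof -
  interpret P: poly_arank J rho j0 j1 by fact
  let ?s = "[:0, 1:] :: 'k poly"
  have "\<forall>p\<in>Ps. \<exists>c M. c \<noteq> 0 \<and> (\<forall>q\<in>#M. mir q) \<and> p = [:c:] * prod_mset M"
    using mir_factorization Ps(2) by metis
  then obtain cc MM where M: "\<And>p. p \<in> Ps ==> cc p \<noteq> 0 \<and> (\<forall>q\<in>#MM p. mir q) \<and> p = [:cc p:] * prod_mset (MM p)"
    by metis
  \<comment> \<open>The variable is included in any case: it makes \<open>rinf\<close> below
    nonconstant with constant coefficient 1.\<close>
  define Q where "Q = insert ?s (\<Union>p\<in>Ps. set_mset (MM p))"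
  have Qf: "finite Q" using Ps by (simp add: Q_def)
  have mirs: "mir ?s"
  proof -
    have "degree a = 0 \<or> degree b = 0" if "?s = a * b" for a b :: "'k poly"
    proof -
      have nz: "a \<noteq> 0" "b \<noteq> 0" using that by auto
      have "degree (a * b) = 1" using that by (metis degree_pCons_eq_if degree_1 one_neq_zero degree_0 One_nat_def pCons_eq_0_iff)
      then show ?thesis using degree_mult_eq[OF nz] by auto
    qed
    then show ?thesis by (auto simp: mir_def)
  qed
  have Qm: "mir q" if "q \<in> Q" for q using that M mirs by (auto simp: Q_def)
  have Qc: "cop q q'" if "q \<in> Q" "q' \<in> Q" "q \<noteq> q'" for q q' using that Qm mir_distinct_cop by blast
  obtain n where n: "1 \<le> n" "\<And>p q. p \<in> Ps ==> count (MM p) q \<le> n"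
  proof -
    define n where "n = Max (insert 1 ((\<lambda>p. size (MM p)) ` Ps))"
    have "size (MM p) \<le> n" if "p \<in> Ps" for p unfolding n_def using that Ps(1) by (intro Max_ge) auto
    then have "count (MM p) q \<le> n" if "p \<in> Ps" for p q
      using that by (meson count_le_size order_trans)
    moreover have "1 \<le> n" unfolding n_def using Ps(1) by (intro Max_ge) auto
    ultimately show ?thesis using that by blast
  qed
  have pQ: "p = [:cc p:] * (\<Prod>q\<in>Q. q ^ count (MM p) q)" if "p \<in> Ps" for p
  proof -
    have "prod_mset (MM p) = (\<Prod>q\<in>set_mset (MM p). q ^ count (MM p) q)" by (rule prod_mset_multiplicity)
    also have "\<dots> = (\<Prod>q\<in>Q. q ^ count (MM p) q)"
      by (rule prod.mono_neutral_left) (use that Qf in \<open>auto simp: Q_def not_in_iff\<close>)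
    finally show ?thesis using M[OF that] by simp
  qed
  define Q' where "Q' = Q - {?s}"
  have Q'f: "finite Q'" using Qf by (simp add: Q'_def)
  have Qs: "Q = insert ?s Q'" "?s \<notin> Q'" by (auto simp: Q'_def Q_def)
  \<comment> \<open>Coprime to every member of \<open>Q\<close> by Euclid's argument, so every
    polynomial in \<open>Ps\<close> has full rank on this quotient.\<close>
  define rinf where "rinf = (\<Prod>q\<in>Q. q) + 1"
  define c where "c = (\<lambda>q k. P.f 1 - P.f (q ^ k))"
  define om where "om = (\<lambda>q j. if j < n then 2 * c q j - c q (j - 1) - c q (Suc j) else c q n - c q (n - 1))"
  define r where "r = (\<lambda>(q, j). if j = 0 then rinf else q ^ j)"
  define w where "w = (\<lambda>(q, j). if j = 0 then (P.f 1 - (\<Sum>q\<in>Q'. c q n)) / real (degree rinf)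
                              else om q j / real (degree q))"
  \<comment> \<open>The pair \<open>(1, 0)\<close> is the label of \<open>rinf\<close>; all other
    labels \<open>(q, j)\<close> have \<open>j\<close> at least 1 and stand for the quotient by
    \<open>q ^ j\<close>.\<close>
  define I where "I = insert (1, 0) (Q' \<times> {1..n})"
  have If: "finite I" using Q'f by (simp add: I_def)
  have prodQ: "(\<Prod>q\<in>Q. q) = ?s * (\<Prod>q\<in>Q'. q)" using Qs Q'f by simp
  have rinf_deg: "0 < degree rinf"
  proof -
    have "q \<noteq> 0" if "q \<in> Q'" for q using Qm[of q] that by (auto simp: Q'_def mir_def)
    then have "(\<Prod>q\<in>Q'. q) \<noteq> 0" using Q'f by auto
    then have "degree (?s * (\<Prod>q\<in>Q'. q)) = 1 + degree (\<Prod>q\<in>Q'. q)" by (subst degree_mult_eq) auto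
    then show ?thesis unfolding rinf_def prodQ by (simp add: degree_add_eq_left)
  qed
  have rinf_0: "coeff rinf 0 \<noteq> 0" unfolding rinf_def prodQ by simp
  have rinf_cop: "cop rinf q" if "q \<in> Q" for q
  proof -
    have "(\<Prod>q\<in>Q. q) = q * (\<Prod>q\<in>Q - {q}. q)" using that Qf by (simp add: prod.remove)
    then have "1 * rinf + (- (\<Prod>q\<in>Q - {q}. q)) * q = 1" by (simp add: rinf_def algebra_simps)
    then show ?thesis unfolding cop_def by blast
  qed
  have q_0: "coeff q 0 \<noteq> 0" if "q \<in> Q'" for q
  proof
    assume "coeff q 0 = 0"
    then obtain q' where "q = pCons 0 q'" by (metis coeff_pCons_0 pCons_cases)
    then have "?s dvd q" by (intro dvdI[of _ _ q']) simp
    moreover have "cop ?s q" using Qc[of ?s q] that by (auto simp: Q'_def Q_def)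
    ultimately obtain u v where "u * ?s + v * q = 1" "?s dvd q" unfolding cop_def by blast
    then have "?s dvd 1" by (metis dvd_add dvd_mult dvd_refl)
    then obtain k where "1 = ?s * k" by (elim dvdE)
    then have "poly 1 0 = poly (?s * k) 0" by simp
    then show False by simp
  qed
  have c0: "c q 0 = 0" for q by (simp add: c_def)
  \<comment> \<open>Convexity along the powers gives the inner weights, monotonicity the last
    one.\<close>
  have om_ge: "0 \<le> om q j" if j1: "1 \<le> j" for q j
  proof (cases "j < n")
    case True
    obtain j' where "j = Suc j'" using j1 by (cases j) auto
    then show ?thesis using True P.f_convex_power[of q j'] by (simp add: om_def c_def)
  next
    case False
    obtain n' where "n = Suc n'" using n by (cases n) auto
    then show ?thesis using False P.f_mono_power[of q n'] by (simp add: om_def c_def)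
  qed
  have Q'c: "cop q q'" if "q \<in> Q'" "q' \<in> Q'" "q \<noteq> q'" for q q' using that Qc by (auto simp: Q'_def)
  \<comment> \<open>The right-hand side is the value of \<open>f\<close> on the product of all
    \<open>q ^ n\<close>.\<close>
  have winf: "0 \<le> P.f 1 - (\<Sum>q\<in>Q'. c q n)"
    using P.f_prod[OF Q'f Q'c, of "\<lambda>_. n"] P.f_nonneg unfolding c_def by metis
  have Iok: "0 \<le> w i \<and> 0 < degree (r i) \<and> coeff (r i) 0 \<noteq> 0" if "i \<in> I" for i
  proof (cases "snd i = 0")
    case True
    then show ?thesis using winf rinf_deg rinf_0 by (auto simp: w_def r_def case_prod_unfold)
  next
    case False
    obtain q j where i: "i = (q, j)" by (cases i)
    then have q: "q \<in> Q'" "1 \<le> j" using False that by (auto simp: I_def)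
    have "0 < degree q" "q \<noteq> 0" using Qm[of q] q by (auto simp: mir_def Q'_def)
    then show ?thesis using q om_ge[of j q] q_0[OF q(1)] by (simp add: i w_def r_def degree_power_eq coeff_0_power)
  qed
  define F where "F = (\<lambda>i p. real (krank (ent (rep (r i) (un j0 j0 p)))))"
  define g where "g = (\<lambda>p. \<Sum>i\<in>I. w i * F i p)"
  have Fl: "poly_arank J (\<lambda>Y. real (krank (ent (rep (r i) Y)))) j0 j1" if "i \<in> I" for i
    by (rule rep_arank_locale) (use Iok[OF that] P.J in auto)
  have Ff: "poly_arank.f (\<lambda>Y. real (krank (ent (rep (r i) Y)))) j0 = F i" if "i \<in> I" for i
    using poly_arank.f_def[OF Fl[OF that]] by (auto simp: F_def fun_eq_iff)
  have Fprod: "F i (u * (\<Prod>q\<in>Q. q ^ e q)) = F i 1 - (\<Sum>q\<in>Q. F i 1 - F i (q ^ e q))" if "i \<in> I" "u * v = 1" for i u v e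
    using poly_arank.f_factored[OF Fl[OF that(1)] Qf Qc that(2)] unfolding Ff[OF that(1)] .
  have gprod: "g (u * (\<Prod>q\<in>Q. q ^ e q)) = g 1 - (\<Sum>q\<in>Q. g 1 - g (q ^ e q))" if "u * v = 1" for u v e
  proof -
    have "g (u * (\<Prod>q\<in>Q. q ^ e q)) = (\<Sum>i\<in>I. w i * (F i 1 - (\<Sum>q\<in>Q. F i 1 - F i (q ^ e q))))"
      unfolding g_def by (rule sum.cong) (use Fprod[OF _ that] in auto)
    also have "\<dots> = g 1 - (\<Sum>i\<in>I. \<Sum>q\<in>Q. w i * F i 1 - w i * F i (q ^ e q))"
      by (simp add: g_def right_diff_distrib sum_subtractf sum_distrib_left mult.left_commute)
    also have "(\<Sum>i\<in>I. \<Sum>q\<in>Q. w i * F i 1 - w i * F i (q ^ e q)) = (\<Sum>q\<in>Q. \<Sum>i\<in>I. w i * F i 1 - w i * F i (q ^ e q))"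
      by (rule sum.swap)
    also have "\<dots> = (\<Sum>q\<in>Q. g 1 - g (q ^ e q))" by (simp add: g_def sum_subtractf)
    finally show ?thesis .
  qed
  have F1: "F i 1 = real (degree (r i))" for i unfolding F_def krank_rep_un_1 ..
  have Fcop: "F i p = F i 1" if "cop (r i) p" "i \<in> I" for i p
    unfolding F1 unfolding F_def using krank_rep_cop[of "r i" p j0] that Iok[OF that(2)] by simp
  have gsum: "g p = w (1, 0) * F (1, 0) p + (\<Sum>q\<in>Q'. \<Sum>j=1..n. w (q, j) * F (q, j) p)" for p
  proof -
    have "(1, 0) \<notin> Q' \<times> {1..n}" by simp
    then have "g p = w (1, 0) * F (1, 0) p + (\<Sum>i\<in>Q' \<times> {1..n}. w i * F i p)"
      using Q'f by (simp add: g_def I_def)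
    also have "(\<Sum>i\<in>Q' \<times> {1..n}. w i * F i p) = (\<Sum>q\<in>Q'. \<Sum>j=1..n. w (q, j) * F (q, j) p)"
      by (simp add: sum.cartesian_product case_prod_unfold)
    finally show ?thesis .
  qed
  have I10: "(1, 0) \<in> I" by (simp add: I_def)
  have degQ: "0 < degree q" "q \<noteq> 0" if "q \<in> Q" for q using Qm[OF that] by (auto simp: mir_def)
  have g1: "g 1 = P.f 1"
  proof -
    have "(\<Sum>j=1..n. w (q, j) * F (q, j) 1) = c q n" if "q \<in> Q'" for q
    proof -
      have "(\<Sum>j=1..n. w (q, j) * F (q, j) 1) = (\<Sum>j=1..n. om q j * real (min j n))"
        by (rule sum.cong) (use degQ[of q] that in \<open>auto simp: w_def F1 r_def degree_power_eq Q'_def\<close>)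
      also have "\<dots> = c q n" unfolding om_def by (rule min_weights[of "c q"]) (auto simp: c0)
      finally show ?thesis .
    qed
    then show ?thesis unfolding gsum using rinf_deg by (simp add: w_def F1 r_def)
  qed
  have gs: "g (?s ^ k) = g 1" for k
    unfolding g_def
  proof (intro sum.cong refl arg_cong2[of _ _ _ _ "(*)"] Fcop)
    fix i assume i: "i \<in> I"
    obtain q j where ij: "i = (q, j)" by (cases i)
    have "?s \<in> Q" by (simp add: Q_def)
    then have "cop (r i) ?s"
      using i rinf_cop[of ?s] cop_powers[of q ?s j 1] Qc[of q ?s] by (auto simp: I_def ij r_def Q'_def)
    then show "cop (r i) (?s ^ k)" by (rule cop_power)
  qed
  \<comment> \<open>Among the quotients, only those by powers of the same \<open>q\<close> see
    \<open>q ^ k\<close>; on all others it acts invertibly.\<close>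
  have gq: "g 1 - g (q ^ k) = c q k" if q: "q \<in> Q'" and k: "k \<le> n" for q k
  proof -
    have qQ: "q \<in> Q" using q by (simp add: Q'_def)
    have a: "F (1, 0) (q ^ k) = F (1, 0) 1"
      by (rule Fcop[OF _ I10]) (use rinf_cop[OF qQ] in \<open>simp add: r_def cop_power\<close>)
    have b: "F (q', j) (q ^ k) = F (q', j) 1" if "q' \<in> Q'" "q' \<noteq> q" "j \<in> {1..n}" for q' j
    proof (rule Fcop)
      show "(q', j) \<in> I" using that by (auto simp: I_def)
      show "cop (r (q', j)) (q ^ k)" using that Q'c[of q' q] q by (auto simp: r_def cop_powers)
    qed
    have d: "F (q, j) 1 - F (q, j) (q ^ k) = real (degree q) * real (min j k)" if "j \<in> {1..n}" for j
    proof -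
      have "F (q, j) (q ^ k) = real (degree q) * real (j - min j k)"
        unfolding F_def r_def using krank_rep_power[of q j j0 k] degQ[OF qQ] that by auto
      moreover have "F (q, j) 1 = real (degree q) * real j"
        using that degQ[OF qQ] by (simp add: F1 r_def degree_power_eq)
      ultimately show ?thesis by (simp add: of_nat_diff algebra_simps)
    qed
    have "g 1 - g (q ^ k) = (\<Sum>q'\<in>Q'. \<Sum>j=1..n. w (q', j) * (F (q', j) 1 - F (q', j) (q ^ k)))"
      unfolding gsum a by (simp add: right_diff_distrib sum_subtractf)
    also have "\<dots> = (\<Sum>q'\<in>Q'. if q' = q then (\<Sum>j=1..n. om q j * real (min j k)) else 0)"
      by (rule sum.cong[OF refl]) (use b d degQ[OF qQ] in \<open>auto simp: w_def intro!: sum.cong sum.neutral\<close>)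
    also have "\<dots> = (\<Sum>j=1..n. om q j * real (min j k))" using q Q'f by simp
    also have "\<dots> = c q k" unfolding om_def by (rule min_weights[of "c q"]) (use k in \<open>auto simp: c0\<close>)
    finally show ?thesis .
  qed
  have "rho (un j0 j0 p) = g p" if p: "p \<in> Ps" for p
  proof -
    have u: "[:cc p:] * [:inverse (cc p):] = 1" using M[OF p] by (simp add: one_pCons)
    have "P.f p = P.f 1 - (\<Sum>q\<in>Q. P.f 1 - P.f (q ^ count (MM p) q))"
      by (subst pQ[OF p]) (rule P.f_factored[OF Qf Qc u])
    also have "\<dots> = g 1 - (\<Sum>q\<in>Q. g 1 - g (q ^ count (MM p) q))"
    proof -
      have "P.f 1 - P.f (q ^ count (MM p) q) = g 1 - g (q ^ count (MM p) q)" if "q \<in> Q" for q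
      proof (cases "q = ?s")
        case True
        then show ?thesis using gs P.f_power_full[of ?s] s by (simp add: P.f_def)
      next
        case False
        then show ?thesis using gq[of q "count (MM p) q"] that n(2)[OF p] by (simp add: Q'_def c_def)
      qed
      then show ?thesis using g1 by simp
    qed
    also have "\<dots> = g p" by (subst (2) pQ[OF p]) (rule gprod[OF u, symmetric])
    finally show ?thesis by (simp add: P.f_def)
  qed
  then show ?thesis using If Iok unfolding g_def F_def by blast
qed

text \<open>Each matrix reduces to its diagonal entries simultaneously for \<open>rho\<close> and
  for all quotient ranks.\<close>

lemma poly_rank_decomposition:
  fixes rho :: "(nat \<times> nat, 'k::field poly) rfm \<Rightarrow> real"
  assumes pa: "poly_arank J rho j0 j1" and s: "rho (un j0 j0 [:0, 1:]) = rho (un j0 j0 1)"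
    and YY: "finite YY" "YY \<subseteq> rmat J J UNIV"
  shows "\<exists>(I :: ('k poly \<times> nat) set) r w. finite I \<and>
    (\<forall>i\<in>I. 0 \<le> w i \<and> 0 < degree (r i) \<and> coeff (r i) 0 \<noteq> 0) \<and>
    (\<forall>Y\<in>YY. rho Y = (\<Sum>i\<in>I. w i * real (krank (ent (rep (r i) Y)))))"
proof -
  interpret P: poly_arank J rho j0 j1 by fact
  define ok :: "(nat \<times> nat, 'k poly) rfm \<Rightarrow> ((nat \<times> nat) \<times> (nat \<times> nat)) set \<times> ((nat \<times> nat) \<times> (nat \<times> nat) \<Rightarrow> 'k poly) \<Rightarrow> bool"
    where "ok = (\<lambda>Y Gp. finite (fst Gp) \<and> (\<forall>g\<in>fst Gp. snd Gp g \<noteq> 0) \<and>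
    (\<forall>rho. arank (rmat J J UNIV) rho --> rho Y = (\<Sum>g\<in>fst Gp. rho (un j0 j0 (snd Gp g)))))"
  have "\<forall>Y\<in>YY. \<exists>Gp :: ((nat \<times> nat) \<times> (nat \<times> nat)) set \<times> _. ok Y Gp"
  proof
    fix Y assume "Y \<in> YY"
    then have "Y \<in> rmat J J UNIV" using YY(2) by blast
    from poly_smith_values[OF this P.J(1)] obtain G :: "((nat \<times> nat) \<times> (nat \<times> nat)) set" and p
      where "finite G" "\<forall>g\<in>G. p g \<noteq> 0"
        "\<forall>rho. arank (rmat J J UNIV) rho --> rho Y = (\<Sum>g\<in>G. rho (un j0 j0 (p g)))" by blast
    then have "ok Y (G, p)" by (simp add: ok_def)
    then show "\<exists>Gp :: ((nat \<times> nat) \<times> (nat \<times> nat)) set \<times> _. ok Y Gp" ..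
  qed
  from bchoice[OF this] obtain H :: "_ \<Rightarrow> ((nat \<times> nat) \<times> (nat \<times> nat)) set \<times> _" where H: "\<forall>Y\<in>YY. ok Y (H Y)" ..
  define G where "G = (\<lambda>Y. fst (H Y))"
  define p where "p = (\<lambda>Y. snd (H Y))"
  have Gp: "finite (G Y) \<and> (\<forall>g\<in>G Y. p Y g \<noteq> 0) \<and>
    (\<forall>rho. arank (rmat J J UNIV) rho --> rho Y = (\<Sum>g\<in>G Y. rho (un j0 j0 (p Y g))))" if "Y \<in> YY" for Y
    using H that unfolding ok_def G_def p_def by blast
  define Ps where "Ps = (\<Union>Y\<in>YY. p Y ` G Y)"
  have "finite Ps" "0 \<notin> Ps" using YY Gp by (auto simp: Ps_def)
  from poly_rank_values[OF pa s this] obtain I :: "('k poly \<times> nat) set" and r w where I: "finite I"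
    "\<forall>i\<in>I. 0 \<le> w i \<and> 0 < degree (r i) \<and> coeff (r i) 0 \<noteq> 0"
    "\<forall>p\<in>Ps. rho (un j0 j0 p) = (\<Sum>i\<in>I. w i * real (krank (ent (rep (r i) (un j0 j0 p)))))"
    by blast
  have "rho Y = (\<Sum>i\<in>I. w i * real (krank (ent (rep (r i) Y))))" if Y: "Y \<in> YY" for Y
  proof -
    have "rho Y = (\<Sum>g\<in>G Y. rho (un j0 j0 (p Y g)))" using Gp[OF Y] P.arank_axioms by blast
    also have "\<dots> = (\<Sum>g\<in>G Y. \<Sum>i\<in>I. w i * real (krank (ent (rep (r i) (un j0 j0 (p Y g))))))"
      by (rule sum.cong) (use I(3) Y in \<open>auto simp: Ps_def\<close>)
    also have "\<dots> = (\<Sum>i\<in>I. \<Sum>g\<in>G Y. w i * real (krank (ent (rep (r i) (un j0 j0 (p Y g))))))"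
      by (rule sum.swap)
    also have "\<dots> = (\<Sum>i\<in>I. w i * real (krank (ent (rep (r i) Y))))"
    proof (rule sum.cong[OF refl])
      fix i assume "i \<in> I"
      then have "arank (rmat J J UNIV) (\<lambda>Y. real (krank (ent (rep (r i) Y))))"
        using I(2) by (intro arank_rep) auto
      then have "real (krank (ent (rep (r i) Y))) = (\<Sum>g\<in>G Y. real (krank (ent (rep (r i) (un j0 j0 (p Y g))))))"
        using Gp[OF Y] by blast
      then show "(\<Sum>g\<in>G Y. w i * real (krank (ent (rep (r i) (un j0 j0 (p Y g)))))) = w i * real (krank (ent (rep (r i) Y)))"
        by (simp add: sum_distrib_left)
    qed
    finally show ?thesis .
  qed
  then show ?thesis using I(1,2) by blast
qed

section \<open>Sylvester rank functions\<close>

definition frm :: "('a \<Rightarrow> 'r::ring) \<Rightarrow> nat \<Rightarrow> nat \<Rightarrow> (nat \<Rightarrow> nat \<Rightarrow> 'a) \<Rightarrow> (nat, 'r) rfm" where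
  "frm f m n M = Rfm (\<lambda>i j. if i < m \<and> j < n then f (M i j) else 0)"

lemma ent_frm: "ent (frm f m n M) i j = (if i < m \<and> j < n then f (M i j) else 0)"
proof -
  have "finite {j. (if i < m \<and> j < n then f (M i j) else 0) \<noteq> 0}" for i
    by (rule finite_subset[of _ "{..<n}"]) auto
  then show ?thesis unfolding frm_def by (simp add: ent_Rfm)
qed

lemma frm_rmat:
  assumes "subring_set C" "\<And>i j. i < m ==> j < n ==> f (M i j) \<in> C"
  shows "frm f m n M \<in> rmat UNIV UNIV C"
  by (rule rmatI[of "{..<m}" "{..<n}"]) (use assms in \<open>auto simp: ent_frm subring_setD\<close>)

text \<open>A partial permutation matrix. Multiplication by it on the left moves the rows from
  \<open>b\<close> on to the rows from \<open>a\<close> on; on the right it moves the columns from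
  \<open>a\<close> on to the columns from \<open>b\<close> on.\<close>

definition sft :: "nat \<Rightarrow> nat \<Rightarrow> nat \<Rightarrow> 'r::ring \<Rightarrow> (nat, 'r) rfm" where
  "sft a b n u = Rfm (\<lambda>i j. if a \<le> i \<and> i < a + n \<and> j = i - a + b then u else 0)"

lemma ent_sft: "ent (sft a b n u) i j = (if a \<le> i \<and> i < a + n \<and> j = i - a + b then u else 0)"
proof -
  have "finite {j. (if a \<le> i \<and> i < a + n \<and> j = i - a + b then u else 0) \<noteq> 0}" for i
    by (rule finite_subset[of _ "{i - a + b}"]) auto
  then show ?thesis unfolding sft_def by (simp add: ent_Rfm)
qed

lemma ent_sft_mult: "ent (sft a b n u * M) i k = (if a \<le> i \<and> i < a + n then u * ent M (i - a + b) k else 0)"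
  by (subst ent_mult[of "{i - a + b}"]) (auto simp: ent_sft)

lemma ent_mult_sft: "ent (M * sft a b n u) i k = (if b \<le> k \<and> k < b + n then ent M i (k - b + a) * u else 0)"
  by (subst ent_mult[of "{k - b + a}"]) (auto simp: ent_sft)

lemma sft_rmat: "subring_set C ==> u \<in> C ==> sft a b n u \<in> rmat UNIV UNIV C"
  by (rule rmatI[of "{a..<a + n}" "{b..<b + n}"]) (auto simp: ent_sft subring_setD)

lemma rmat_nat_bound:
  fixes M :: "(nat, 'r::ring) rfm"
  assumes "M \<in> rmat R L C"
  obtains N where "\<And>i j. N \<le> i \<or> N \<le> j ==> ent M i j = 0"
proof -
  obtain R' L' where 1: "finite R'" "finite L'" "\<And>i j. i \<notin> R' \<or> j \<notin> L' ==> ent M i j = 0"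
    using rmat_bound[OF assms] by metis
  obtain N where "\<forall>i\<in>R' \<union> L'. i < N" using 1 finite_nat_set_iff_bounded[of "R' \<union> L'"] by auto
  then have "ent M i j = 0" if "N \<le> i \<or> N \<le> j" for i j
    using 1(3)[of i j] that by (meson UnCI leD)
  then show ?thesis by (rule that)
qed

text \<open>A ring given by a record, seen as a subring of a type-class ring. There its unit is
  merely an element acting as identity on the image, so the ambient ring may lack a unit.\<close>

locale emb_ring =
  fixes R :: "('a, 'm) ring_scheme" and emb :: "'a \<Rightarrow> 'r::ring"
  assumes zero_in: "\<zero>\<^bsub>R\<^esub> \<in> carrier R" and emb_zero: "emb \<zero>\<^bsub>R\<^esub> = 0"
    and one_in: "\<one>\<^bsub>R\<^esub> \<in> carrier R"
    and add_in: "a \<in> carrier R ==> b \<in> carrier R ==> a \<oplus>\<^bsub>R\<^esub> b \<in> carrier R"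
    and emb_add: "a \<in> carrier R ==> b \<in> carrier R ==> emb (a \<oplus>\<^bsub>R\<^esub> b) = emb a + emb b"
    and mult_in: "a \<in> carrier R ==> b \<in> carrier R ==> a \<otimes>\<^bsub>R\<^esub> b \<in> carrier R"
    and emb_mult: "a \<in> carrier R ==> b \<in> carrier R ==> emb (a \<otimes>\<^bsub>R\<^esub> b) = emb a * emb b"
    and neg: "a \<in> carrier R ==> \<exists>b\<in>carrier R. emb b = - emb a"
    and inj: "inj_on emb (carrier R)"
    and unit: "a \<in> carrier R ==> emb \<one>\<^bsub>R\<^esub> * emb a = emb a \<and> emb a * emb \<one>\<^bsub>R\<^esub> = emb a"
begin

definition C where "C = emb ` carrier R"
definition u where "u = emb \<one>\<^bsub>R\<^esub>"
definition dlt where "dlt = inv_into (carrier R) emb"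

lemma C_sub: "subring_set C"
  unfolding subring_set_def C_def using zero_in emb_zero add_in emb_add mult_in emb_mult neg
  by (auto simp: image_iff) metis+

lemma u_in: "u \<in> C" using one_in by (simp add: u_def C_def)

lemma u_unit: "a \<in> C ==> u * a = a" "a \<in> C ==> a * u = a"
  using unit by (auto simp: C_def u_def)

lemma dlt_in: "a \<in> C ==> dlt a \<in> carrier R"
  by (simp add: dlt_def C_def inv_into_into)

lemma emb_dlt: "a \<in> C ==> emb (dlt a) = a"
  by (simp add: dlt_def C_def f_inv_into_f)

lemma dlt_emb: "a \<in> carrier R ==> dlt (emb a) = a"
  using inj by (simp add: dlt_def)

lemma dlt_zero: "dlt 0 = \<zero>\<^bsub>R\<^esub>"
  using dlt_emb[OF zero_in] by (simp add: emb_zero)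

lemma emb_eqI: "a \<in> carrier R ==> b \<in> carrier R ==> emb a = emb b ==> a = b"
  using inj by (meson inj_onD)

text \<open>This opens the way to the \<open>finsum\<close> in \<open>mat_mult\<close>.\<close>

lemma abelian_monoid_R: "abelian_monoid R"
  by (rule abelian_monoidI)
    (use zero_in add_in in \<open>auto intro!: emb_eqI simp: emb_add emb_zero add_ac\<close>)

lemma finsum_emb:
  assumes "finite A" "\<And>a. a \<in> A ==> f a \<in> carrier R"
  shows "finsum R f A \<in> carrier R \<and> emb (finsum R f A) = (\<Sum>a\<in>A. emb (f a))"
  using assms
proof (induction A rule: finite_induct)
  interpret abelian_monoid R by (rule abelian_monoid_R)
  case empty
  show ?case using zero_in emb_zero by simp
next
  interpret abelian_monoid R by (rule abelian_monoid_R)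
  case (insert a A)
  then have "finsum R f (insert a A) = f a \<oplus>\<^bsub>R\<^esub> finsum R f A" by (intro finsum_insert) auto
  then show ?case using insert add_in emb_add by simp
qed

end

lemma mat_over_mono:
  assumes "M \<in> mat_over R m n" "\<zero>\<^bsub>R\<^esub> \<in> carrier R" "m \<le> m'" "n \<le> n'"
  shows "M \<in> mat_over R m' n'"
proof -
  have a: "M i j \<in> carrier R" for i j
  proof (cases "i < m \<and> j < n")
    case True then show ?thesis using assms(1) by (simp add: mat_over_def)
  next
    case False
    then have "M i j = \<zero>\<^bsub>R\<^esub>" using assms(1) by (auto simp: mat_over_def)
    then show ?thesis using assms(2) by simp
  qed
  have "M i j = \<zero>\<^bsub>R\<^esub>" if "m' \<le> i \<or> n' \<le> j" for i j
  proof -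
    have "\<forall>i j. m \<le> i \<or> n \<le> j --> M i j = \<zero>\<^bsub>R\<^esub>" using assms(1) by (simp add: mat_over_def)
    moreover have "m \<le> i \<or> n \<le> j" using that assms(3,4) by auto
    ultimately show ?thesis by blast
  qed
  then show ?thesis using a unfolding mat_over_def by blast
qed

locale syl = emb_ring R emb for R :: "('a, 'm) ring_scheme" and emb :: "'a \<Rightarrow> 'r::ring" +
  fixes rk :: "nat \<Rightarrow> nat \<Rightarrow> (nat \<Rightarrow> nat \<Rightarrow> 'a) \<Rightarrow> real"
  assumes syl: "sylvester_rank R rk"
begin

lemma rk_nonneg: "M \<in> mat_over R m n ==> 0 \<le> rk m n M"
  using syl by (simp add: sylvester_rank_def)
lemma rk_zero: "rk m n (mat_zero R) = 0"
  using syl by (simp add: sylvester_rank_def)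
lemma rk_one: "rk 1 1 (mat_one1 R) = 1"
  using syl by (simp add: sylvester_rank_def)
lemma rk_mult: "M \<in> mat_over R m n ==> N \<in> mat_over R n p ==>
  rk m p (mat_mult R m n p M N) \<le> min (rk m n M) (rk n p N)"
  using syl unfolding sylvester_rank_def by (elim conjE) fast
lemma rk_diag: "M1 \<in> mat_over R m1 n1 ==> M2 \<in> mat_over R m2 n2 ==>
  rk (m1 + m2) (n1 + n2) (mat_block R m1 n1 M1 (mat_zero R) (mat_zero R) M2) = rk m1 n1 M1 + rk m2 n2 M2"
  using syl unfolding sylvester_rank_def by (elim conjE) fast
lemma rk_tri: "M1 \<in> mat_over R m1 n1 ==> M2 \<in> mat_over R m2 n2 ==> M3 \<in> mat_over R m1 n2 ==>
  rk m1 n1 M1 + rk m2 n2 M2 \<le> rk (m1 + m2) (n1 + n2) (mat_block R m1 n1 M1 M3 (mat_zero R) M2)"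
  using syl unfolding sylvester_rank_def by (elim conjE) fast

lemma mat_zero_in: "mat_zero R \<in> mat_over R m n"
  using zero_in by (simp add: mat_over_def mat_zero_def)

lemma rk_pad:
  assumes "M \<in> mat_over R m n" "m \<le> m'" "n \<le> n'"
  shows "rk m' n' M = rk m n M"
proof -
  have "mat_block R m n M (mat_zero R) (mat_zero R) (mat_zero R) = M"
    using assms(1) by (auto simp: mat_block_def mat_zero_def mat_over_def fun_eq_iff)
  then show ?thesis
    using rk_diag[OF assms(1) mat_zero_in[of "m' - m" "n' - n"]] rk_zero assms by simp
qed

definition tm where "tm Z = (\<lambda>i j. dlt (ent Z i j))"

text \<open>The rank of any square corner that contains the support; by \<open>rk_pad\<close> all
  such corners give the same value, and the least one is a convenient choice.\<close>

definition rho where "rho Z = (let m = (LEAST m. \<forall>i j. m \<le> i \<or> m \<le> j --> ent Z i j = 0) in rk m m (tm Z))"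

abbreviation MM :: "(nat, 'r) rfm set" where "MM \<equiv> rmat UNIV UNIV C"

lemma tm_in:
  assumes "Z \<in> MM" "\<And>i j. m \<le> i \<or> n \<le> j ==> ent Z i j = 0"
  shows "tm Z \<in> mat_over R m n"
  using assms by (auto simp: mat_over_def tm_def dlt_in dlt_zero rmat_entry)

lemma rho_eq:
  assumes Z: "Z \<in> MM" and m: "\<And>i j. m \<le> i \<or> m \<le> j ==> ent Z i j = 0"
  shows "rho Z = rk m m (tm Z)"
proof -
  let ?P = "\<lambda>m. \<forall>i j. m \<le> i \<or> m \<le> j --> ent Z i j = 0"
  have P: "?P (LEAST m. ?P m)" by (rule LeastI[of ?P m]) (use m in blast)
  have le: "(LEAST m. ?P m) \<le> m" by (rule Least_le) (use m in blast)
  have "tm Z \<in> mat_over R (LEAST m. ?P m) (LEAST m. ?P m)" by (rule tm_in[OF Z]) (use P in blast)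
  from rk_pad[OF this le le] show ?thesis unfolding rho_def Let_def by simp
qed

lemma rho_frm:
  assumes "M \<in> mat_over R m n"
  shows "rho (frm emb m n M) = rk m n M"
proof -
  have c: "M i j \<in> carrier R" for i j
    using assms zero_in by (cases "i < m \<and> j < n") (auto simp: mat_over_def not_less)
  have "frm emb m n M \<in> MM" by (rule frm_rmat[OF C_sub]) (use c in \<open>auto simp: C_def\<close>)
  then have "rho (frm emb m n M) = rk (max m n) (max m n) (tm (frm emb m n M))"
    by (rule rho_eq) (auto simp: ent_frm)
  also have "tm (frm emb m n M) = M"
    using assms c by (auto simp: tm_def ent_frm fun_eq_iff dlt_emb dlt_zero mat_over_def not_less)
  finally show ?thesis using rk_pad[OF assms, of "max m n" "max m n"] by simp
qed

text \<open>The shifts place \<open>c\<close> and \<open>b\<close> so that the sum is literally a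
  block matrix with square blocks of size \<open>N\<close>, to which the Sylvester axioms
  apply.\<close>

lemma rho_block:
  assumes a: "a \<in> MM" and b: "b \<in> MM" and c: "c \<in> MM"
    and N: "\<And>i j. N \<le> i \<or> N \<le> j ==> ent a i j = 0" "\<And>i j. N \<le> i \<or> N \<le> j ==> ent b i j = 0"
      "\<And>i j. N \<le> i \<or> N \<le> j ==> ent c i j = 0"
  shows "rho a + rho b \<le> rho (a + c * sft 0 N N u + sft N 0 N u * b * sft 0 N N u)"
    and "rho (a + sft N 0 N u * b * sft 0 N N u) = rho a + rho b"
proof -
  have s: "sft x y N u \<in> MM" for x y by (rule sft_rmat[OF C_sub u_in])
  have ec: "ent (x * sft 0 N N u) i j = (if N \<le> j \<and> j < N + N then ent x i (j - N) else 0)" if "x \<in> MM" for x i j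
    using u_unit(2)[OF rmat_entry[OF that]] by (simp add: ent_mult_sft)
  have er: "ent (sft N 0 N u * x) i j = (if N \<le> i \<and> i < N + N then ent x (i - N) j else 0)" if "x \<in> MM" for x i j
    using u_unit(1)[OF rmat_entry[OF that]] by (simp add: ent_sft_mult)
  have sb: "sft N 0 N u * b \<in> MM" by (rule rmat_mult[OF C_sub s b])
  have e: "ent (a + x * sft 0 N N u + sft N 0 N u * b * sft 0 N N u) i j =
     (if i < N then (if j < N then ent a i j else ent x i (j - N)) else (if j < N then 0 else ent b (i - N) (j - N)))"
    if x: "x \<in> MM" "\<And>i j. N \<le> i \<or> N \<le> j ==> ent x i j = 0" for x i j
  proof -
    have "ent b (i - N) (j - N) = 0" if "\<not> i < N + N \<or> \<not> j < N + N" by (rule N(2)) (use that in auto)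
    moreover have "ent x i (j - N) = 0" if "\<not> i < N \<or> \<not> j < N + N" by (rule x(2)) (use that in auto)
    ultimately show ?thesis using N(1)[of i j] by (auto simp: ec[OF x(1)] ec[OF sb] er[OF b])
  qed
  have Z: "a + x * sft 0 N N u + sft N 0 N u * b * sft 0 N N u \<in> MM" if "x \<in> MM" for x
    by (intro rmat_add rmat_mult[where L'=UNIV and L=UNIV] C_sub s a b that)
  have t: "tm (a + x * sft 0 N N u + sft N 0 N u * b * sft 0 N N u)
      = mat_block R N N (tm a) (tm x) (mat_zero R) (tm b)"
    if x: "x \<in> MM" "\<And>i j. N \<le> i \<or> N \<le> j ==> ent x i j = 0" for x
    unfolding tm_def by (intro ext, subst e[OF x]) (auto simp: mat_block_def mat_zero_def dlt_zero)
  have r: "rho (a + x * sft 0 N N u + sft N 0 N u * b * sft 0 N N u)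
      = rk (N + N) (N + N) (mat_block R N N (tm a) (tm x) (mat_zero R) (tm b))"
    if x: "x \<in> MM" "\<And>i j. N \<le> i \<or> N \<le> j ==> ent x i j = 0" for x
  proof -
    have "ent (a + x * sft 0 N N u + sft N 0 N u * b * sft 0 N N u) i j = 0" if "N + N \<le> i \<or> N + N \<le> j" for i j
    proof -
      have "ent b (i - N) (j - N) = 0" by (rule N(2)) (use that in auto)
      moreover have "ent x i (j - N) = 0" if "i < N" by (rule x(2)) (use that \<open>N + N \<le> i \<or> N + N \<le> j\<close> in auto)
      ultimately show ?thesis using e[OF x, of i j] that by (auto simp del: ent_add)
    qed
    from rho_eq[OF Z[OF x(1)] this] show ?thesis by (simp only: t[OF x])
  qed
  have ra: "rho a = rk N N (tm a)" "rho b = rk N N (tm b)" using rho_eq a b N by auto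
  have ti: "tm a \<in> mat_over R N N" "tm b \<in> mat_over R N N" "tm c \<in> mat_over R N N"
    using tm_in a b c N by auto
  show "rho a + rho b \<le> rho (a + c * sft 0 N N u + sft N 0 N u * b * sft 0 N N u)"
  proof -
    have "rho (a + c * sft 0 N N u + sft N 0 N u * b * sft 0 N N u)
      = rk (N + N) (N + N) (mat_block R N N (tm a) (tm c) (mat_zero R) (tm b))"
      by (rule r[OF c]) (use N(3) in blast)
    then show ?thesis using rk_tri[OF ti] ra by simp
  qed
  have z: "(0 :: (nat, 'r) rfm) \<in> MM" by (rule rmat_zero[OF C_sub])
  have "tm 0 = mat_zero R" by (auto simp: tm_def mat_zero_def dlt_zero fun_eq_iff)
  then show "rho (a + sft N 0 N u * b * sft 0 N N u) = rho a + rho b"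
    using r[of 0] z rk_diag[OF ti(1,2)] by (simp add: ra)
qed

lemma rho_mult:
  assumes a: "a \<in> MM" and b: "b \<in> MM"
  shows "rho (a * b) \<le> min (rho a) (rho b)"
proof -
  obtain N1 where 1: "\<And>i j. N1 \<le> i \<or> N1 \<le> j ==> ent a i j = 0" using rmat_nat_bound[OF a] by metis
  obtain N2 where 2: "\<And>i j. N2 \<le> i \<or> N2 \<le> j ==> ent b i j = 0" using rmat_nat_bound[OF b] by metis
  define N where "N = max N1 N2"
  have N: "\<And>i j. N \<le> i \<or> N \<le> j ==> ent a i j = 0" "\<And>i j. N \<le> i \<or> N \<le> j ==> ent b i j = 0"
    using 1 2 by (auto simp: N_def)
  have ab: "a * b \<in> MM" by (rule rmat_mult[OF C_sub a b])
  have e: "ent (a * b) i k = (\<Sum>j<N. ent a i j * ent b j k)" for i k by (rule ent_mult) (use N in auto)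
  have "mat_mult R N N N (tm a) (tm b) = tm (a * b)"
  proof (intro ext)
    fix i k
    show "mat_mult R N N N (tm a) (tm b) i k = tm (a * b) i k"
    proof (cases "i < N \<and> k < N")
      case True
      have c: "tm a i j \<otimes>\<^bsub>R\<^esub> tm b j k \<in> carrier R" for j
        unfolding tm_def by (intro mult_in dlt_in rmat_entry[OF a] rmat_entry[OF b])
      have "emb (mat_mult R N N N (tm a) (tm b) i k) = (\<Sum>j<N. emb (tm a i j \<otimes>\<^bsub>R\<^esub> tm b j k))"
        using True finsum_emb[of "{..<N}" "\<lambda>j. tm a i j \<otimes>\<^bsub>R\<^esub> tm b j k"] c by (simp add: mat_mult_def)
      also have "\<dots> = ent (a * b) i k"
        unfolding e using rmat_entry[OF a] rmat_entry[OF b] by (simp add: tm_def emb_mult dlt_in emb_dlt)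
      finally have "dlt (emb (mat_mult R N N N (tm a) (tm b) i k)) = tm (a * b) i k" by (simp add: tm_def)
      moreover have "mat_mult R N N N (tm a) (tm b) i k \<in> carrier R"
        using True finsum_emb[of "{..<N}" "\<lambda>j. tm a i j \<otimes>\<^bsub>R\<^esub> tm b j k"] c by (simp add: mat_mult_def)
      ultimately show ?thesis by (simp add: dlt_emb)
    next
      case False
      then have "ent (a * b) i k = 0" unfolding e using N by (intro sum.neutral) auto
      then show ?thesis using False by (auto simp: mat_mult_def tm_def dlt_zero)
    qed
  qed
  moreover have "rho (a * b) = rk N N (tm (a * b))"
    by (rule rho_eq[OF ab]) (unfold e, use N in \<open>auto intro!: sum.neutral\<close>)
  ultimately show ?thesis using rk_mult[of "tm a" N N "tm b" N] rho_eq[OF a N(1)] rho_eq[OF b N(2)]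
    tm_in[OF a N(1)] tm_in[OF b N(2)] by simp
qed

text \<open>Subadditivity writes \<open>a + b\<close> as a row of two units times
  \<open>diag(a, b)\<close> times a column of two units. For \<open>tri\<close>, the local units cut
  out the blocks and shifts move them to genuine block positions.\<close>

lemma arank_rho: "arank MM rho"
proof
  show "subring_set MM" using C_sub by simp
  show "0 \<le> rho a" if a: "a \<in> MM" for a
  proof -
    obtain N1 where N1: "\<And>i j. N1 \<le> i \<or> N1 \<le> j ==> ent a i j = 0" using rmat_nat_bound[OF a] by metis
    then show ?thesis using rho_eq[OF a N1] rk_nonneg[OF tm_in[OF a N1]] by simp
  qed
  show "rho 0 = 0"
  proof -
    have "rho 0 = rk 0 0 (tm 0)" by (rule rho_eq[OF rmat_zero[OF C_sub]]) auto
    moreover have "tm 0 = mat_zero R" by (auto simp: tm_def mat_zero_def dlt_zero fun_eq_iff)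
    ultimately show ?thesis by (simp add: rk_zero)
  qed
  show "rho (a * b) \<le> rho a" "rho (a * b) \<le> rho b" if "a \<in> MM" "b \<in> MM" for a b
    using rho_mult[OF that] by auto
  show "rho (a + b) \<le> rho a + rho b" if a: "a \<in> MM" and b: "b \<in> MM" for a b
  proof -
    obtain N1 where 1: "\<And>i j. N1 \<le> i \<or> N1 \<le> j ==> ent a i j = 0" using rmat_nat_bound[OF a] by metis
    obtain N2 where 2: "\<And>i j. N2 \<le> i \<or> N2 \<le> j ==> ent b i j = 0" using rmat_nat_bound[OF b] by metis
    define N where "N = max N1 N2"
    have N: "\<And>i j. N \<le> i \<or> N \<le> j ==> ent a i j = 0" "\<And>i j. N \<le> i \<or> N \<le> j ==> ent b i j = 0"
      using 1 2 by (auto simp: N_def)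
    let ?S = "sft N 0 N u" and ?T = "sft 0 N N u" and ?U = "dg {..<N} u"
    have s: "sft x y N u \<in> MM" for x y by (rule sft_rmat[OF C_sub u_in])
    have U: "?U \<in> MM" by (rule rmat_dg[OF C_sub]) (use u_in in auto)
    have uu: "u * u = u" using u_unit u_in by blast
    have ua: "u * ent a i j = ent a i j" "ent a i j * u = ent a i j" "u * ent b i j = ent b i j" "ent b i j * u = ent b i j" for i j
      using u_unit[OF rmat_entry[OF a]] u_unit[OF rmat_entry[OF b]] by auto
    have f: "?U * a = a" "a * ?U = a" "?U * b = b" "b * ?U = b"
      using N ua by (auto intro!: rfm_eqI simp: ent_dg_mult ent_mult_dg not_less)
    have g: "?U * ?S = 0" "?T * ?U = 0" "?T * ?S = ?U"
      using uu by (auto intro!: rfm_eqI simp: ent_dg_mult ent_mult_dg ent_sft ent_sft_mult ent_dg)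
    have h: "?T * a = 0" "a * ?S = 0" using N by (auto intro!: rfm_eqI simp: ent_sft_mult ent_mult_sft)
    have "(?U + ?T) * (a + ?S * b * ?T) * (?U + ?S) =
       ?U * a * ?U + ?U * (a * ?S) + (?U * ?S) * b * ?T * (?U + ?S) + (?T * a) * (?U + ?S) +
       (?T * ?S) * b * (?T * ?U) + (?T * ?S) * b * (?T * ?S)"
      by (simp add: algebra_simps)
    also have "\<dots> = a + b" by (simp add: f g h)
    finally have eq: "(?U + ?T) * (a + ?S * b * ?T) * (?U + ?S) = a + b" .
    have m: "?U + ?T \<in> MM" "?U + ?S \<in> MM" "a + ?S * b * ?T \<in> MM"
      by (intro rmat_add rmat_mult[where L'=UNIV and L=UNIV] C_sub s a b U)+
    have m2: "(?U + ?T) * (a + ?S * b * ?T) \<in> MM" by (rule rmat_mult[OF C_sub m(1,3)])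
    have "rho (a + b) \<le> rho (a + ?S * b * ?T)"
      using rho_mult[OF m2 m(2)] rho_mult[OF m(1,3)] unfolding eq by simp
    moreover have "rho (a + ?S * b * ?T) = rho a + rho b"
      by (rule rho_block(2)[OF a b a]) (use N in blast)+
    ultimately show ?thesis by simp
  qed
  fix a b c e e' f f'
  assume m: "a \<in> MM" "b \<in> MM" "c \<in> MM" "e \<in> MM" "e' \<in> MM" "f \<in> MM" "f' \<in> MM"
    and r: "e * a = a" "a * e' = a" "f * b = b" "b * f' = b" "e * c = c" "c * f' = c"
       "e * b = 0" "f * a = 0" "f * c = 0" "a * f' = 0" "b * e' = 0" "c * e' = 0"
  obtain N1 where 1: "\<And>i j. N1 \<le> i \<or> N1 \<le> j ==> ent a i j = 0" using rmat_nat_bound[OF m(1)] by metis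
  obtain N2 where 2: "\<And>i j. N2 \<le> i \<or> N2 \<le> j ==> ent b i j = 0" using rmat_nat_bound[OF m(2)] by metis
  obtain N3 where 3: "\<And>i j. N3 \<le> i \<or> N3 \<le> j ==> ent c i j = 0" using rmat_nat_bound[OF m(3)] by metis
  define N where "N = max (max N1 N2) N3"
  have N: "\<And>i j. N \<le> i \<or> N \<le> j ==> ent a i j = 0" "\<And>i j. N \<le> i \<or> N \<le> j ==> ent b i j = 0"
    "\<And>i j. N \<le> i \<or> N \<le> j ==> ent c i j = 0"
    using 1 2 3 by (auto simp: N_def)
  let ?S = "sft N 0 N u" and ?T = "sft 0 N N u"
  have s: "sft x y N u \<in> MM" for x y by (rule sft_rmat[OF C_sub u_in])
  have "(e + ?S * f) * (a + b + c) = a + c + ?S * b"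
  proof -
    have "(e + ?S * f) * (a + b + c) = e * a + e * b + e * c + ?S * (f * a) + ?S * (f * b) + ?S * (f * c)"
      by (simp add: algebra_simps)
    then show ?thesis by (simp add: r)
  qed
  moreover have "(a + c + ?S * b) * (e' + f' * ?T) = a + c * ?T + ?S * b * ?T"
  proof -
    have "(a + c + ?S * b) * (e' + f' * ?T) = a * e' + c * e' + ?S * (b * e') + (a * f') * ?T + (c * f') * ?T + ?S * (b * f') * ?T"
      by (simp add: algebra_simps)
    then show ?thesis by (simp add: r)
  qed
  ultimately have eq: "(e + ?S * f) * (a + b + c) * (e' + f' * ?T) = a + c * ?T + ?S * b * ?T" by simp
  have mm: "e + ?S * f \<in> MM" "a + b + c \<in> MM" "e' + f' * ?T \<in> MM"
    by (intro rmat_add rmat_mult[where L'=UNIV and L=UNIV] C_sub s m)+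
  have m2: "(e + ?S * f) * (a + b + c) \<in> MM" by (rule rmat_mult[OF C_sub mm(1,2)])
  have "rho (a + c * ?T + ?S * b * ?T) \<le> rho (a + b + c)"
    using rho_mult[OF m2 mm(3)] rho_mult[OF mm(1,2)] unfolding eq by simp
  moreover have "rho a + rho b \<le> rho (a + c * ?T + ?S * b * ?T)"
    by (rule rho_block(1)[OF m(1,2,3)]) (use N in blast)+
  ultimately show "rho a + rho b \<le> rho (a + b + c)" by simp
qed

lemma rho_one: "rho (un 0 0 u) = 1"
proof -
  have "mat_one1 R \<in> mat_over R 1 1" using one_in by (auto simp: mat_one1_def mat_over_def)
  moreover have "frm emb 1 1 (mat_one1 R) = un 0 0 u"
    by (rule rfm_eqI) (auto simp: ent_frm ent_un mat_one1_def u_def)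
  ultimately show ?thesis using rho_frm rk_one by metis
qed

end

lemma arank_sum:
  assumes "finite K" "subring_set C" "\<And>i. i \<in> K ==> 0 \<le> w i \<and> arank C (rho i)"
  shows "arank C (\<lambda>Z. \<Sum>i\<in>K. w i * rho i Z)"
proof
  note ar = assms(3)[THEN conjunct2] and w = assms(3)[THEN conjunct1]
  show "subring_set C" by fact
  show "0 \<le> (\<Sum>i\<in>K. w i * rho i a)" if "a \<in> C" for a
    using arank.nonneg[OF ar that] w by (intro sum_nonneg mult_nonneg_nonneg) auto
  show "(\<Sum>i\<in>K. w i * rho i 0) = 0" using arank.zero[OF ar] by (simp add: sum.neutral)
  show "(\<Sum>i\<in>K. w i * rho i (a * b)) \<le> (\<Sum>i\<in>K. w i * rho i a)" if "a \<in> C" "b \<in> C" for a b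
    using arank.mult_le_left[OF ar that] w by (intro sum_mono mult_left_mono) auto
  show "(\<Sum>i\<in>K. w i * rho i (a * b)) \<le> (\<Sum>i\<in>K. w i * rho i b)" if "a \<in> C" "b \<in> C" for a b
    using arank.mult_le_right[OF ar that] w by (intro sum_mono mult_left_mono) auto
  show "(\<Sum>i\<in>K. w i * rho i (a + b)) \<le> (\<Sum>i\<in>K. w i * rho i a) + (\<Sum>i\<in>K. w i * rho i b)" if "a \<in> C" "b \<in> C" for a b
    using arank.add_le[OF ar that] w
    by (subst sum.distrib[symmetric], intro sum_mono) (simp add: mult_left_mono flip: distrib_left)
  fix a b c e e' f f'
  assume "a \<in> C" "b \<in> C" "c \<in> C" "e \<in> C" "e' \<in> C" "f \<in> C" "f' \<in> C"
       "e * a = a" "a * e' = a" "f * b = b" "b * f' = b" "e * c = c" "c * f' = c"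
       "e * b = 0" "f * a = 0" "f * c = 0" "a * f' = 0" "b * e' = 0" "c * e' = 0"
  then have "rho i a + rho i b \<le> rho i (a + b + c)" if "i \<in> K" for i
    using arank.tri[OF ar[OF that]] by blast
  then show "(\<Sum>i\<in>K. w i * rho i a) + (\<Sum>i\<in>K. w i * rho i b) \<le> (\<Sum>i\<in>K. w i * rho i (a + b + c))"
    using w by (subst sum.distrib[symmetric], intro sum_mono) (simp add: mult_left_mono flip: distrib_left)
qed

text \<open>All axioms are weak inequalities or equations between values, hence closed under
  limits.\<close>

lemma arank_lim:
  assumes F: "F \<noteq> bot" and ev: "\<forall>\<^sub>F d in F. arank C (rho d)"
    and lim: "\<And>Z. Z \<in> C ==> ((\<lambda>d. rho d Z) \<longlongrightarrow> rho' Z) F" and C: "subring_set C"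
  shows "arank C rho'"
proof
  note cl = subring_setD[OF C]
  show "subring_set C" by fact
  show "0 \<le> rho' a" if "a \<in> C" for a
    by (rule tendsto_lowerbound[OF lim[OF that] _ F]) (use ev in eventually_elim, use that arank.nonneg in blast)
  show "rho' 0 = 0"
    by (rule tendsto_unique[OF F lim[OF cl(1)]], rule tendsto_eventually) (use ev in eventually_elim, use arank.zero in blast)
  show "rho' (a * b) \<le> rho' a" if "a \<in> C" "b \<in> C" for a b
    by (rule tendsto_le[OF F lim[OF that(1)] lim[OF cl(3)[OF that]]])
      (use ev in eventually_elim, use that arank.mult_le_left in blast)
  show "rho' (a * b) \<le> rho' b" if "a \<in> C" "b \<in> C" for a b
    by (rule tendsto_le[OF F lim[OF that(2)] lim[OF cl(3)[OF that]]])
      (use ev in eventually_elim, use that arank.mult_le_right in blast)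
  show "rho' (a + b) \<le> rho' a + rho' b" if "a \<in> C" "b \<in> C" for a b
    by (rule tendsto_le[OF F tendsto_add[OF lim[OF that(1)] lim[OF that(2)]] lim[OF cl(2)[OF that]]])
      (use ev in eventually_elim, use that arank.add_le in blast)
  fix a b c e e' f f'
  assume m: "a \<in> C" "b \<in> C" "c \<in> C" "e \<in> C" "e' \<in> C" "f \<in> C" "f' \<in> C"
    and r: "e * a = a" "a * e' = a" "f * b = b" "b * f' = b" "e * c = c" "c * f' = c"
       "e * b = 0" "f * a = 0" "f * c = 0" "a * f' = 0" "b * e' = 0" "c * e' = 0"
  have abc: "a + b + c \<in> C" using m cl by simp
  show "rho' a + rho' b \<le> rho' (a + b + c)"
    by (rule tendsto_le[OF F lim[OF abc] tendsto_add[OF lim[OF m(1)] lim[OF m(2)]]])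
      (use ev in eventually_elim, use arank.tri[OF _ m r] in blast)
qed

section \<open>A criterion for regularity\<close>

text \<open>\<open>D\<close> is regular but lives in a large type \<open>'s\<close>, while the ring
  wanted has carrier type \<open>'v\<close>. The closure of the image of \<open>psi\<close> under
  the ring operations and \<open>qi\<close> consists of values of finite terms, and an injective
  pairing together with tags lets \<open>'v\<close> hold these terms. The map \<open>psi\<close>
  respects the operations only up to rank zero.\<close>

locale coded_regular =
  fixes R :: "'v ring" and D :: "'s::ring set" and rho :: "(nat, 's) rfm \<Rightarrow> real"
    and un1 :: 's and psi :: "'v \<Rightarrow> 's" and qi :: "'s \<Rightarrow> 's"
    and pr :: "'v \<Rightarrow> 'v \<Rightarrow> 'v" and tag :: "nat \<Rightarrow> 'v"
  assumes ar: "arank (rmat UNIV UNIV D) rho"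
    and D_sub: "subring_set D"
    and un1_in: "un1 \<in> D" and un1_unit: "d \<in> D ==> un1 * d = d \<and> d * un1 = d"
    and rho_un1: "rho (un 0 0 un1) = 1"
    and qi_in: "d \<in> D ==> qi d \<in> D" and qi_reg: "d \<in> D ==> d * qi d * d = d"
    and psi_in: "a \<in> carrier R ==> psi a \<in> D"
    and psi_add: "a \<in> carrier R ==> b \<in> carrier R ==> rho (un 0 0 (psi (a \<oplus>\<^bsub>R\<^esub> b) - (psi a + psi b))) = 0"
    and psi_mult: "a \<in> carrier R ==> b \<in> carrier R ==> rho (un 0 0 (psi (a \<otimes>\<^bsub>R\<^esub> b) - psi a * psi b)) = 0"
    and psi_one: "psi \<one>\<^bsub>R\<^esub> = un1"
    and R_closed: "a \<in> carrier R ==> b \<in> carrier R ==> a \<oplus>\<^bsub>R\<^esub> b \<in> carrier R \<and> a \<otimes>\<^bsub>R\<^esub> b \<in> carrier R"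
      "\<one>\<^bsub>R\<^esub> \<in> carrier R"
    and pr_inj: "pr a b = pr a' b' \<longleftrightarrow> a = a' \<and> b = b'" and tag_inj: "tag m = tag n \<longleftrightarrow> m = n"
begin

interpretation arank "rmat UNIV UNIV D" rho by (rule ar)

text \<open>A term language inside \<open>'v\<close>: tags separate the constructors and
  \<open>pr\<close> stores the arguments. It is a relation because not every element of
  \<open>'v\<close> is a term.\<close>

inductive code :: "'v \<Rightarrow> 's \<Rightarrow> bool" where
  code_gen: "a \<in> carrier R ==> code (pr (tag 0) a) (psi a)"
| code_add: "code v d ==> code w e ==> code (pr (tag 1) (pr v w)) (d + e)"
| code_mult: "code v d ==> code w e ==> code (pr (tag 2) (pr v w)) (d * e)"
| code_neg: "code v d ==> code (pr (tag 3) v) (- d)"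
| code_inv: "code v d ==> code (pr (tag 4) v) (qi d)"
| code_zero: "code (pr (tag 5) (tag 5)) 0"

lemma code_fun: "code v d ==> code v d' ==> d = d'"
proof (induction arbitrary: d' rule: code.induct)
  case (code_gen a)
  from code_gen.prems show ?case by (cases rule: code.cases) (auto simp: pr_inj tag_inj)
next
  case (code_add v d w e)
  from code_add.prems show ?case
    by (cases rule: code.cases) (use code_add.IH in \<open>auto simp: pr_inj tag_inj\<close>)
next
  case (code_mult v d w e)
  from code_mult.prems show ?case
    by (cases rule: code.cases) (use code_mult.IH in \<open>auto simp: pr_inj tag_inj\<close>)
next
  case (code_neg v d)
  from code_neg.prems show ?case
    by (cases rule: code.cases) (use code_neg.IH in \<open>auto simp: pr_inj tag_inj\<close>)
next
  case (code_inv v d)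
  from code_inv.prems show ?case
    by (cases rule: code.cases) (use code_inv.IH in \<open>auto simp: pr_inj tag_inj\<close>)
next
  case code_zero
  from code_zero.prems show ?case by (cases rule: code.cases) (auto simp: pr_inj tag_inj)
qed

definition D0 where "D0 = {d. \<exists>v. code v d}"

lemma D0_sub: "subring_set D0"
  unfolding subring_set_def D0_def using code.intros by blast

lemma D0_D: "d \<in> D0 ==> d \<in> D"
proof -
  assume "d \<in> D0"
  then obtain v where "code v d" by (auto simp: D0_def)
  then show ?thesis
    by (induction rule: code.induct) (auto intro: psi_in qi_in subring_setD[OF D_sub])
qed

lemma D0I: "code v d ==> d \<in> D0"
  by (auto simp: D0_def)

lemma D0_psi: "a \<in> carrier R ==> psi a \<in> D0"
  by (rule D0I[OF code_gen])

lemma D0_qi: "d \<in> D0 ==> qi d \<in> D0"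
  unfolding D0_def by (auto intro: code_inv)

lemma D0_un1: "un1 \<in> D0" using D0_psi[OF R_closed(2)] psi_one by simp

lemmas Dc = subring_setD[OF D_sub]

lemmas D0_closed = subring_setD[OF D0_sub]

text \<open>Congruence modulo the ideal of elements of rank zero.\<close>

definition eqv where "eqv x y \<longleftrightarrow> rho (un 0 0 (x - y)) = 0"

lemma un_in: "d \<in> D ==> un i j d \<in> rmat UNIV UNIV D"
  by (rule rmat_un[OF D_sub]) auto

lemma rho_un_move: "d \<in> D ==> rho (un i j d) \<le> rho (un 0 0 d)"
proof -
  assume d: "d \<in> D"
  have "un i j d = un i 0 un1 * un 0 0 d * un 0 j un1" using un1_unit[OF d] by (simp add: un_mult_un)
  then show ?thesis using mult3_le[OF un_in[OF un1_in] un_in[OF d] un_in[OF un1_in]] by simp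
qed

lemma eqv_refl: "eqv x x" by (simp add: eqv_def zero)

lemma eqv_neg0: "x \<in> D ==> y \<in> D ==> eqv x y ==> eqv y x"
proof -
  assume xy: "x \<in> D" "y \<in> D" "eqv x y"
  have d: "x - y \<in> D" using xy by (simp add: Dc)
  have "un (0::nat) 0 (y - x) = un 0 0 (- un1) * un 0 0 (x - y)" using un1_unit[OF d] by (simp add: un_mult_un)
  then have "rho (un 0 0 (y - x)) \<le> rho (un 0 0 (x - y))"
    using mult_le_right[OF un_in un_in[OF d], of "- un1" 0 0 0 0] subring_setD(4)[OF D_sub un1_in] by simp
  moreover have "0 \<le> rho (un 0 0 (y - x))" using xy by (intro nonneg un_in) (simp add: Dc)
  ultimately show ?thesis using xy(3) by (simp add: eqv_def)
qed

lemma eqv_add: "[|x \<in> D; y \<in> D; x' \<in> D; y' \<in> D; eqv x x'; eqv y y'|] ==> eqv (x + y) (x' + y')"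
proof -
  assume a: "x \<in> D" "y \<in> D" "x' \<in> D" "y' \<in> D" "eqv x x'" "eqv y y'"
  have d: "x - x' \<in> D" "y - y' \<in> D" using a by (simp_all add: Dc)
  have "un (0::nat) 0 (x + y - (x' + y')) = un 0 0 (x - x') + un 0 0 (y - y')"
    by (simp add: algebra_simps flip: un_add)
  then have "rho (un 0 0 (x + y - (x' + y'))) \<le> 0"
    using add_le[OF un_in[OF d(1)] un_in[OF d(2)], of 0 0 0 0] a(5,6) by (simp add: eqv_def)
  moreover have "0 \<le> rho (un 0 0 (x + y - (x' + y')))"
    by (rule nonneg, rule un_in) (use a in \<open>simp add: Dc\<close>)
  ultimately show ?thesis by (simp add: eqv_def)
qed

lemma eqv_mult: "[|x \<in> D; y \<in> D; x' \<in> D; y' \<in> D; eqv x x'; eqv y y'|] ==> eqv (x * y) (x' * y')"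
proof -
  assume a: "x \<in> D" "y \<in> D" "x' \<in> D" "y' \<in> D" "eqv x x'" "eqv y y'"
  have d: "x - x' \<in> D" "y - y' \<in> D" "x * y - x' * y' \<in> D" "(x - x') * y \<in> D" "x' * (y - y') \<in> D"
    using a by (simp_all add: Dc)
  have e: "un (0::nat) 0 (x * y - x' * y') = un 0 0 ((x - x') * y) + un 0 0 (x' * (y - y'))"
    by (simp add: algebra_simps flip: un_add)
  have "rho (un 0 0 ((x - x') * y)) \<le> rho (un 0 0 (x - x'))"
    using mult_le_left[OF un_in[OF d(1)] un_in[OF a(2)], of 0 0 0 0] by (simp add: un_mult_un)
  moreover have "rho (un 0 0 (x' * (y - y'))) \<le> rho (un 0 0 (y - y'))"
    using mult_le_right[OF un_in[OF a(3)] un_in[OF d(2)], of 0 0 0 0] by (simp add: un_mult_un)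
  ultimately have "rho (un 0 0 (x * y - x' * y')) \<le> 0"
    using add_le[OF un_in[OF d(4)] un_in[OF d(5)], of 0 0 0 0] a(5,6) unfolding e by (simp add: eqv_def)
  moreover have "0 \<le> rho (un 0 0 (x * y - x' * y'))" by (rule nonneg, rule un_in, rule d)
  ultimately show ?thesis by (simp add: eqv_def)
qed

lemma eqv_trans: "[|x \<in> D; y \<in> D; z \<in> D; eqv x y; eqv y z|] ==> eqv x z"
proof -
  assume a: "x \<in> D" "y \<in> D" "z \<in> D" "eqv x y" "eqv y z"
  have d: "- y \<in> D" using a by (simp add: Dc)
  have "eqv (x + y + - y) (y + z + - y)"
    by (intro eqv_add eqv_refl) (use a d in \<open>simp_all add: Dc\<close>)
  then show ?thesis by simp
qed

text \<open>A finitely supported matrix is a finite sum of its entries placed by matrix units, and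
  each summand has rank zero.\<close>

lemma rho_null:
  assumes "Z \<in> rmat UNIV UNIV D" "\<And>i j. eqv (ent Z i j) 0"
  shows "rho Z = 0"
proof -
  obtain R' L' where 1: "finite R'" "finite L'" "\<And>i j. i \<notin> R' \<or> j \<notin> L' ==> ent Z i j = 0"
    using rmat_bound[OF assms(1)] by metis
  have Z: "Z = (\<Sum>x\<in>R' \<times> L'. un (fst x) (snd x) (ent Z (fst x) (snd x)))"
  proof (rule rfm_eqI)
    fix i j
    have "(\<Sum>x\<in>R' \<times> L'. ent (un (fst x) (snd x) (ent Z (fst x) (snd x))) i j)
        = (\<Sum>x\<in>R' \<times> L'. if x = (i, j) then ent Z i j else 0)"
      by (rule sum.cong) (auto simp: ent_un)
    also have "\<dots> = ent Z i j" using 1 by auto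
    finally show "ent Z i j = ent (\<Sum>x\<in>R' \<times> L'. un (fst x) (snd x) (ent Z (fst x) (snd x))) i j" by simp
  qed
  have "rho (\<Sum>x\<in>S. un (fst x) (snd x) (ent Z (fst x) (snd x))) \<le> 0" if "finite S" for S
    using that
  proof (induction S rule: finite_induct)
    case (insert x S)
    let ?f = "\<lambda>x. un (fst x) (snd x) (ent Z (fst x) (snd x))"
    have e: "ent Z i j \<in> D" for i j by (rule rmat_entry[OF assms(1)])
    have "rho (?f x) \<le> 0" using rho_un_move[OF e, of "fst x" "snd x" "fst x" "snd x"] assms(2)[of "fst x" "snd x"]
      by (simp add: eqv_def)
    moreover have "rho (?f x + sum ?f S) \<le> rho (?f x) + rho (sum ?f S)"
      by (rule add_le) (auto intro!: un_in e rmat_sum D_sub)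
    ultimately show ?case using insert by simp
  qed (simp add: zero)
  from this[of "R' \<times> L'"] have "rho Z \<le> 0" using 1 Z by simp
  then show ?thesis using nonneg[OF assms(1)] by simp
qed

lemma rho_eqv:
  assumes A: "A \<in> rmat UNIV UNIV D" and B: "B \<in> rmat UNIV UNIV D"
    and e: "\<And>i j. eqv (ent A i j) (ent B i j)"
  shows "rho A = rho B"
proof -
  have le: "rho A \<le> rho B" if A: "A \<in> rmat UNIV UNIV D" and B: "B \<in> rmat UNIV UNIV D"
    and e: "\<And>i j. eqv (ent A i j) (ent B i j)" for A B
  proof -
    have AB: "A - B \<in> rmat UNIV UNIV D" by (rule closed(5)[OF A B])
    have "rho (A - B) = 0" by (rule rho_null[OF AB]) (use e in \<open>simp add: eqv_def\<close>)
    then show ?thesis using add_le[OF B AB] by simp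
  qed
  show ?thesis
    by (rule antisym; rule le) (use A B e eqv_neg0 rmat_entry[OF A] rmat_entry[OF B] in auto)
qed

text \<open>A class modulo rank zero is named by the code of one chosen representative, so that
  equality of classes becomes equality in \<open>'v\<close>.\<close>

definition rp where "rp d = (SOME d'. d' \<in> D0 \<and> eqv d' d)"
definition cd where "cd d = (SOME v. code v d)"
definition dec where "dec v = (THE d. code v d)"
definition q where "q d = cd (rp d)"

lemma rp: "d \<in> D0 ==> rp d \<in> D0 \<and> eqv (rp d) d"
  unfolding rp_def by (rule someI[of _ d]) (simp add: eqv_refl)

lemma dec_cd: "d \<in> D0 ==> dec (cd d) = d"
proof -
  assume "d \<in> D0"
  then have "code (cd d) d" unfolding cd_def D0_def by (auto intro: someI)
  then show ?thesis unfolding dec_def using code_fun by (intro the_equality) auto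
qed

lemma rp_cong: "d \<in> D0 ==> e \<in> D0 ==> eqv d e ==> rp d = rp e"
proof -
  assume a: "d \<in> D0" "e \<in> D0" "eqv d e"
  \<comment> \<open>Equivalent elements give the same predicate, hence the same choice by
    \<open>SOME\<close>.\<close>
  have "(d' \<in> D0 \<and> eqv d' d) = (d' \<in> D0 \<and> eqv d' e)" for d'
    using a D0_D eqv_trans[of d' d e] eqv_trans[of d' e d] eqv_neg0[of d e] by blast
  then show ?thesis unfolding rp_def by presburger
qed

lemma q_cong: "d \<in> D0 ==> e \<in> D0 ==> eqv d e ==> q d = q e"
  by (simp add: q_def rp_cong)

lemma dec_q: "d \<in> D0 ==> dec (q d) \<in> D0 \<and> eqv (dec (q d)) d"
  using rp dec_cd by (simp add: q_def)

text \<open>The quotient of \<open>D0\<close> by its elements of rank zero, carried by codes: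
  decode, operate in \<open>D\<close>, and name the class of the result.\<close>

definition S :: "'v ring" where
  "S = \<lparr>carrier = q ` D0, mult = (\<lambda>v w. q (dec v * dec w)), one = q un1, zero = q 0, add = (\<lambda>v w. q (dec v + dec w))\<rparr>"

lemma S_simps: "carrier S = q ` D0" "v \<otimes>\<^bsub>S\<^esub> w = q (dec v * dec w)" "v \<oplus>\<^bsub>S\<^esub> w = q (dec v + dec w)"
  "\<one>\<^bsub>S\<^esub> = q un1" "\<zero>\<^bsub>S\<^esub> = q 0"
  by (simp_all add: S_def)

lemma qadd: "d \<in> D0 ==> e \<in> D0 ==> q (dec (q d) + dec (q e)) = q (d + e)"
  by (rule q_cong) (use dec_q D0_closed D0_D eqv_add in \<open>auto\<close>)

lemma qmult: "d \<in> D0 ==> e \<in> D0 ==> q (dec (q d) * dec (q e)) = q (d * e)"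
  by (rule q_cong) (use dec_q D0_closed D0_D eqv_mult in \<open>auto\<close>)

lemma S_add: "d \<in> D0 ==> e \<in> D0 ==> q d \<oplus>\<^bsub>S\<^esub> q e = q (d + e)"
  and S_mult: "d \<in> D0 ==> e \<in> D0 ==> q d \<otimes>\<^bsub>S\<^esub> q e = q (d * e)"
  by (simp_all add: S_simps qadd qmult)

lemma un1_D0: "d \<in> D0 ==> un1 * d = d" "d \<in> D0 ==> d * un1 = d"
  using un1_unit D0_D by auto

lemma abelian_group_S: "abelian_group S"
proof (rule abelian_groupI)
  show "x \<oplus>\<^bsub>S\<^esub> y \<in> carrier S" if "x \<in> carrier S" "y \<in> carrier S" for x y
    using that D0_closed by (auto simp: S_simps(1) S_add)
  show "\<zero>\<^bsub>S\<^esub> \<in> carrier S" using D0_closed by (auto simp: S_simps)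
  show "x \<oplus>\<^bsub>S\<^esub> y \<oplus>\<^bsub>S\<^esub> z = x \<oplus>\<^bsub>S\<^esub> (y \<oplus>\<^bsub>S\<^esub> z)" if "x \<in> carrier S" "y \<in> carrier S" "z \<in> carrier S" for x y z
    using that D0_closed by (auto simp: S_simps(1) S_add add.assoc)
  show "x \<oplus>\<^bsub>S\<^esub> y = y \<oplus>\<^bsub>S\<^esub> x" if "x \<in> carrier S" "y \<in> carrier S" for x y
    using that D0_closed by (auto simp: S_simps(1) S_add add.commute)
  show "\<zero>\<^bsub>S\<^esub> \<oplus>\<^bsub>S\<^esub> x = x" if "x \<in> carrier S" for x
    using that D0_closed unfolding S_simps(5) by (auto simp: S_simps(1) S_add)
  show "\<exists>y\<in>carrier S. y \<oplus>\<^bsub>S\<^esub> x = \<zero>\<^bsub>S\<^esub>" if xS: "x \<in> carrier S" for x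
  proof -
    obtain d where d: "d \<in> D0" "x = q d" using xS by (auto simp: S_simps(1))
    then have "q (- d) \<oplus>\<^bsub>S\<^esub> x = \<zero>\<^bsub>S\<^esub>" "q (- d) \<in> carrier S" using D0_closed by (auto simp: S_add S_simps(5) S_simps(1))
    then show ?thesis by blast
  qed
qed

lemma ring_S: "ring S"
proof (rule ringI[OF abelian_group_S])
  show "monoid S"
  proof (rule monoidI)
    show "x \<otimes>\<^bsub>S\<^esub> y \<in> carrier S" if "x \<in> carrier S" "y \<in> carrier S" for x y
      using that D0_closed by (auto simp: S_simps(1) S_mult)
    show "\<one>\<^bsub>S\<^esub> \<in> carrier S" using D0_un1 by (auto simp: S_simps)
    show "x \<otimes>\<^bsub>S\<^esub> y \<otimes>\<^bsub>S\<^esub> z = x \<otimes>\<^bsub>S\<^esub> (y \<otimes>\<^bsub>S\<^esub> z)" if "x \<in> carrier S" "y \<in> carrier S" "z \<in> carrier S" for x y z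
      using that D0_closed by (auto simp: S_simps(1) S_mult mult.assoc)
    show "\<one>\<^bsub>S\<^esub> \<otimes>\<^bsub>S\<^esub> x = x" "x \<otimes>\<^bsub>S\<^esub> \<one>\<^bsub>S\<^esub> = x" if "x \<in> carrier S" for x
      using that D0_un1 unfolding S_simps(4) by (auto simp: S_simps(1) S_mult un1_D0)
  qed
  show "(x \<oplus>\<^bsub>S\<^esub> y) \<otimes>\<^bsub>S\<^esub> z = x \<otimes>\<^bsub>S\<^esub> z \<oplus>\<^bsub>S\<^esub> y \<otimes>\<^bsub>S\<^esub> z"
    "z \<otimes>\<^bsub>S\<^esub> (x \<oplus>\<^bsub>S\<^esub> y) = z \<otimes>\<^bsub>S\<^esub> x \<oplus>\<^bsub>S\<^esub> z \<otimes>\<^bsub>S\<^esub> y"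
    if "x \<in> carrier S" "y \<in> carrier S" "z \<in> carrier S" for x y z
    using that D0_closed by (auto simp: S_simps(1) S_mult S_add distrib_left distrib_right)
qed

lemma regular_S: "vn_regular S"
  unfolding vn_regular_def
proof (intro conjI ballI ring_S)
  fix a assume "a \<in> carrier S"
  then obtain d where d: "d \<in> D0" "a = q d" by (auto simp: S_simps(1))
  then have "a \<otimes>\<^bsub>S\<^esub> q (qi d) \<otimes>\<^bsub>S\<^esub> a = a" using D0_qi D0_closed qi_reg D0_D by (simp add: S_mult)
  then show "\<exists>x\<in>carrier S. a \<otimes>\<^bsub>S\<^esub> x \<otimes>\<^bsub>S\<^esub> a = a" using D0_qi[OF d(1)] by (auto simp: S_simps(1))
qed

lemma dec_in: "v \<in> carrier S ==> dec v \<in> D0"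
  using dec_q by (auto simp: S_simps(1))

lemma dec_D: "v \<in> carrier S ==> dec v \<in> D"
  using dec_in D0_D by blast

lemma dec_finsum:
  assumes "finite A" "\<And>a. a \<in> A ==> f a \<in> carrier S"
  shows "finsum S f A \<in> carrier S \<and> eqv (dec (finsum S f A)) (\<Sum>a\<in>A. dec (f a))"
  using assms
proof (induction A rule: finite_induct)
  interpret S: abelian_group S by (rule abelian_group_S)
  case empty
  show ?case using dec_q[OF D0_closed(1)] by (simp add: S_simps(5)) (auto simp: S_simps(1) D0_closed)
next
  interpret S: abelian_group S by (rule abelian_group_S)
  case (insert a A)
  have e: "finsum S f (insert a A) = f a \<oplus>\<^bsub>S\<^esub> finsum S f A"
    by (rule S.finsum_insert) (use insert in auto)
  have sA: "(\<Sum>a\<in>A. dec (f a)) \<in> D0" by (rule subring_set_sum[OF D0_sub]) (use insert dec_in in auto)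
  have fa: "dec (f a) \<in> D0" "dec (finsum S f A) \<in> D0" using insert dec_in by auto
  have "eqv (dec (f a \<oplus>\<^bsub>S\<^esub> finsum S f A)) (dec (f a) + dec (finsum S f A))"
    using dec_q[OF D0_closed(2)[OF fa]] by (simp add: S_simps(3))
  moreover have "eqv (dec (f a) + dec (finsum S f A)) (dec (f a) + (\<Sum>a\<in>A. dec (f a)))"
    by (rule eqv_add) (use fa sA D0_D insert eqv_refl in auto)
  ultimately have "eqv (dec (f a \<oplus>\<^bsub>S\<^esub> finsum S f A)) (dec (f a) + (\<Sum>a\<in>A. dec (f a)))"
    by (rule eqv_trans[rotated 3]) (use fa sA D0_D D0_closed dec_in S.add.m_closed insert in auto)
  then show ?case using e insert by simp
qed

definition rkS where "rkS m n M = rho (frm dec m n M)"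

lemma frm_dec_in: "M \<in> mat_over S m n ==> frm dec m n M \<in> rmat UNIV UNIV D"
  by (rule frm_rmat[OF D_sub]) (auto simp: mat_over_def dec_D)

lemma dec_zero: "eqv (dec \<zero>\<^bsub>S\<^esub>) 0" "dec \<zero>\<^bsub>S\<^esub> \<in> D"
  using dec_q[OF D0_closed(1)] D0_D by (auto simp: S_simps(5))

text \<open>Up to entries of rank zero, the decoded block matrix is \<open>a\<close> plus shifted
  copies of \<open>b\<close> and \<open>c\<close>. With \<open>Cc\<close> zero the two bounds
  together give additivity on block diagonal matrices.\<close>

lemma rkS_block:
  assumes A: "A \<in> mat_over S m1 n1" and B: "B \<in> mat_over S m2 n2" and Cc: "Cc \<in> mat_over S m1 n2"
  shows "rkS m1 n1 A + rkS m2 n2 B \<le> rkS (m1 + m2) (n1 + n2) (mat_block S m1 n1 A Cc (mat_zero S) B)"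
    and "rkS (m1 + m2) (n1 + n2) (mat_block S m1 n1 A Cc (mat_zero S) B) \<le> rkS m1 n1 A + rkS m2 n2 B + rkS m1 n2 Cc"
proof -
  define a where "a = frm dec m1 n1 A"
  define b where "b = frm dec m2 n2 B"
  define c where "c = frm dec m1 n2 Cc"
  have m: "a \<in> rmat UNIV UNIV D" "b \<in> rmat UNIV UNIV D" "c \<in> rmat UNIV UNIV D"
    using frm_dec_in A B Cc by (auto simp: a_def b_def c_def)
  let ?S = "sft m1 0 m2 un1" and ?T = "sft 0 n1 n2 un1" and ?S' = "sft 0 m1 m2 un1" and ?T' = "sft n1 0 n2 un1"
  have s: "sft x y z un1 \<in> rmat UNIV UNIV D" for x y z by (rule sft_rmat[OF D_sub un1_in])
  have uu: "un1 * un1 = un1" using un1_unit un1_in by blast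
  have ux: "un1 * ent x i j = ent x i j" "ent x i j * un1 = ent x i j" if "x \<in> rmat UNIV UNIV D" for x :: "(nat, 's) rfm" and i j
    using un1_unit rmat_entry[OF that] by auto
  have outa: "ent a i j = 0" if "m1 \<le> i \<or> n1 \<le> j" for i j using that by (auto simp: a_def ent_frm)
  have outb: "ent b i j = 0" if "m2 \<le> i \<or> n2 \<le> j" for i j using that by (auto simp: b_def ent_frm)
  have outc: "ent c i j = 0" if "m1 \<le> i \<or> n2 \<le> j" for i j using that by (auto simp: c_def ent_frm)
  have outb': "ent b (i - m1) (j - n1) = 0" if "\<not> i < m1 + m2 \<or> \<not> j < n1 + n2" for i j
    by (rule outb) (use that in auto)
  have outc': "ent c i (j - n1) = 0" if "\<not> i < m1 \<or> \<not> j < n1 + n2" for i j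
    by (rule outc) (use that in auto)
  define b' where "b' = ?S * b * ?T"
  define c' where "c' = c * ?T"
  have m': "b' \<in> rmat UNIV UNIV D" "c' \<in> rmat UNIV UNIV D"
    unfolding b'_def c'_def using m s closed by auto
  have Sb: "?S * b \<in> rmat UNIV UNIV D" using m s closed by auto
  have eb: "ent b' i j = (if m1 \<le> i \<and> n1 \<le> j then ent b (i - m1) (j - n1) else 0)" for i j
    unfolding b'_def using outb'[of i j] ux[OF m(2)] by (auto simp: ent_mult_sft ent_sft_mult mult.assoc)
  have ec: "ent c' i j = (if n1 \<le> j then ent c i (j - n1) else 0)" for i j
    unfolding c'_def using outc'[of i j] ux[OF m(3)] by (auto simp: ent_mult_sft)
  have rb: "rho b' = rho b"
  proof (rule antisym)
    show "rho b' \<le> rho b" unfolding b'_def by (rule mult3_le) (use m s in auto)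
    have "?S' * b' * ?T' = b"
      by (rule rfm_eqI) (auto simp: ent_mult_sft ent_sft_mult eb ux[OF m(2)] mult.assoc outb)
    then show "rho b \<le> rho b'" using mult3_le[of ?S' b' ?T'] m' s by metis
  qed
  have rc: "rho c' \<le> rho c" unfolding c'_def by (rule mult_le_left) (use m s in auto)
  let ?M = "mat_block S m1 n1 A Cc (mat_zero S) B"
  have Min: "?M \<in> mat_over S (m1 + m2) (n1 + n2)"
    using A B Cc dec_zero D0_closed by (auto simp: mat_over_def mat_block_def mat_zero_def S_simps)
  have "rho (frm dec (m1 + m2) (n1 + n2) ?M) = rho (a + b' + c')"
  proof (rule rho_eqv)
    show "frm dec (m1 + m2) (n1 + n2) ?M \<in> rmat UNIV UNIV D" by (rule frm_dec_in[OF Min])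
    show "a + b' + c' \<in> rmat UNIV UNIV D" using m m' closed by auto
    fix i j
    show "eqv (ent (frm dec (m1 + m2) (n1 + n2) ?M) i j) (ent (a + b' + c') i j)"
      using dec_zero(1) by (auto simp: eb ec ent_frm a_def b_def c_def mat_block_def mat_zero_def eqv_refl)
  qed
  then have r: "rkS (m1 + m2) (n1 + n2) ?M = rho (a + b' + c')" by (simp add: rkS_def)
  have "rho a + rho b' \<le> rho (a + b' + c')"
  proof (rule tri[of _ _ _ "dg {..<m1} un1" "dg {..<n1} un1" "dg {m1..<m1 + m2} un1" "dg {n1..<n1 + n2} un1"])
    show "dg {..<m1} un1 \<in> rmat UNIV UNIV D" "dg {..<n1} un1 \<in> rmat UNIV UNIV D"
      "dg {m1..<m1 + m2} un1 \<in> rmat UNIV UNIV D" "dg {n1..<n1 + n2} un1 \<in> rmat UNIV UNIV D"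
      using un1_in by (auto intro!: rmat_dg D_sub)
    show "dg {..<m1} un1 * a = a" "a * dg {..<n1} un1 = a"
      using outa by (auto intro!: rfm_eqI simp: ent_dg_mult ent_mult_dg ux[OF m(1)])
    show "dg {m1..<m1 + m2} un1 * b' = b'" "b' * dg {n1..<n1 + n2} un1 = b'"
      using outb' by (auto intro!: rfm_eqI simp: ent_dg_mult ent_mult_dg eb ux[OF m(2)])
    show "dg {..<m1} un1 * c' = c'" "c' * dg {n1..<n1 + n2} un1 = c'"
      using outc' by (auto intro!: rfm_eqI simp: ent_dg_mult ent_mult_dg ec ux[OF m(3)])
    show "dg {..<m1} un1 * b' = 0" "b' * dg {..<n1} un1 = 0"
      by (auto intro!: rfm_eqI simp: ent_dg_mult ent_mult_dg eb)
    show "dg {m1..<m1 + m2} un1 * a = 0" "a * dg {n1..<n1 + n2} un1 = 0"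
      using outa by (auto intro!: rfm_eqI simp: ent_dg_mult ent_mult_dg)
    show "dg {m1..<m1 + m2} un1 * c' = 0" "c' * dg {..<n1} un1 = 0"
      using outc' by (auto intro!: rfm_eqI simp: ent_dg_mult ent_mult_dg ec)
  qed (use m m' in auto)
  then show "rkS m1 n1 A + rkS m2 n2 B \<le> rkS (m1 + m2) (n1 + n2) ?M"
    unfolding r rb by (simp add: rkS_def a_def b_def)
  have ab: "a + b' \<in> rmat UNIV UNIV D" using m m' closed by auto
  have "rho (a + b' + c') \<le> rho a + rho b' + rho c'"
    using add_le[OF ab m'(2)] add_le[OF m(1) m'(1)] by simp
  then show "rkS (m1 + m2) (n1 + n2) ?M \<le> rkS m1 n1 A + rkS m2 n2 B + rkS m1 n2 Cc"
    using rc unfolding r rb by (simp add: rkS_def a_def b_def c_def)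
qed

lemma rkS_zero: "rkS m n (mat_zero S) = 0"
proof -
  have "mat_zero S \<in> mat_over S m n" using D0_closed by (auto simp: mat_over_def mat_zero_def S_simps)
  then show ?thesis unfolding rkS_def
    by (intro rho_null frm_dec_in) (use dec_zero in \<open>auto simp: ent_frm mat_zero_def eqv_refl\<close>)
qed

lemma sylvester_S: "sylvester_rank S rkS"
  unfolding sylvester_rank_def
proof (intro conjI allI ballI)
  show "0 \<le> rkS m n M" if "M \<in> mat_over S m n" for m n M
    unfolding rkS_def by (rule nonneg[OF frm_dec_in[OF that]])
  show "rkS m n (mat_zero S) = 0" for m n by (rule rkS_zero)
  show "rkS 1 1 (mat_one1 S) = 1"
  proof -
    have 1: "mat_one1 S \<in> mat_over S 1 1" using D0_un1 by (auto simp: mat_over_def mat_one1_def S_simps)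
    have "rho (frm dec 1 1 (mat_one1 S)) = rho (un 0 0 un1)"
      by (rule rho_eqv[OF frm_dec_in[OF 1] un_in[OF un1_in]])
        (use dec_q[OF D0_un1] in \<open>auto simp: ent_frm ent_un mat_one1_def S_simps(4) eqv_refl\<close>)
    then show ?thesis by (simp add: rkS_def rho_un1)
  qed
  show "rkS m p (mat_mult S m n p M N) \<le> min (rkS m n M) (rkS n p N)"
    if M: "M \<in> mat_over S m n" and N: "N \<in> mat_over S n p" for m n p M N
  proof -
    have c: "M i j \<otimes>\<^bsub>S\<^esub> N j k \<in> carrier S" if "i < m" "j < n" "k < p" for i j k
      using M N that ring.ring_simprules(5)[OF ring_S] by (auto simp: mat_over_def)
    have fs: "finsum S (\<lambda>j. M i j \<otimes>\<^bsub>S\<^esub> N j k) {..<n} \<in> carrier S \<and>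
        eqv (dec (finsum S (\<lambda>j. M i j \<otimes>\<^bsub>S\<^esub> N j k) {..<n})) (\<Sum>j<n. dec (M i j \<otimes>\<^bsub>S\<^esub> N j k))"
      if "i < m" "k < p" for i k by (rule dec_finsum) (use c that in auto)
    have MN: "mat_mult S m n p M N \<in> mat_over S m p" using fs by (auto simp: mat_over_def mat_mult_def)
    have i: "frm dec m n M \<in> rmat UNIV UNIV D" "frm dec n p N \<in> rmat UNIV UNIV D" using frm_dec_in M N by auto
    have "rho (frm dec m p (mat_mult S m n p M N)) = rho (frm dec m n M * frm dec n p N)"
    proof (rule rho_eqv[OF frm_dec_in[OF MN]])
      show "frm dec m n M * frm dec n p N \<in> rmat UNIV UNIV D" by (rule closed(3)[OF i])
      fix i k
      have e: "ent (frm dec m n M * frm dec n p N) i k = (\<Sum>j<n. ent (frm dec m n M) i j * ent (frm dec n p N) j k)"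
        by (rule ent_mult) (auto simp: ent_frm)
      show "eqv (ent (frm dec m p (mat_mult S m n p M N)) i k) (ent (frm dec m n M * frm dec n p N) i k)"
      proof (cases "i < m \<and> k < p")
        case True
        have D1: "dec (M i j) \<in> D0" "dec (N j k) \<in> D0" if "j < n" for j
          using M N True that dec_in by (auto simp: mat_over_def)
        have "eqv (\<Sum>j\<in>A. dec (M i j \<otimes>\<^bsub>S\<^esub> N j k)) (\<Sum>j\<in>A. dec (M i j) * dec (N j k))
            \<and> (\<Sum>j\<in>A. dec (M i j \<otimes>\<^bsub>S\<^esub> N j k)) \<in> D \<and> (\<Sum>j\<in>A. dec (M i j) * dec (N j k)) \<in> D" if "A \<subseteq> {..<n}" "finite A" for A
          using that(2,1)
        proof (induction A rule: finite_induct)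
          case empty
          then show ?case using eqv_refl subring_setD(1)[OF D_sub] by simp
        next
          case (insert j A)
          have j: "j < n" using insert by auto
          have "eqv (dec (M i j \<otimes>\<^bsub>S\<^esub> N j k)) (dec (M i j) * dec (N j k))" "dec (M i j \<otimes>\<^bsub>S\<^esub> N j k) \<in> D"
            "dec (M i j) * dec (N j k) \<in> D"
            using dec_q[OF D0_closed(3)[OF D1[OF j]]] D0_D D0_closed(3)[OF D1[OF j]] by (auto simp: S_simps(2))
          then show ?case using insert eqv_add subring_setD(2)[OF D_sub] by simp
        qed
        from this[of "{..<n}"] have 1: "eqv (\<Sum>j<n. dec (M i j \<otimes>\<^bsub>S\<^esub> N j k)) (\<Sum>j<n. dec (M i j) * dec (N j k))"
          "(\<Sum>j<n. dec (M i j \<otimes>\<^bsub>S\<^esub> N j k)) \<in> D" "(\<Sum>j<n. dec (M i j) * dec (N j k)) \<in> D" by auto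
        have "eqv (dec (finsum S (\<lambda>j. M i j \<otimes>\<^bsub>S\<^esub> N j k) {..<n})) (\<Sum>j<n. dec (M i j) * dec (N j k))"
          using eqv_trans[OF _ 1(2,3) _ 1(1)] fs True dec_D by blast
        then show ?thesis using True unfolding e by (simp add: ent_frm mat_mult_def)
      next
        case False
        then show ?thesis unfolding e by (auto simp: ent_frm eqv_refl intro!: sum.neutral)
      qed
    qed
    then show ?thesis using mult_le_left[OF i] mult_le_right[OF i] by (simp add: rkS_def)
  qed
  show "rkS (m1 + m2) (n1 + n2) (mat_block S m1 n1 M1 (mat_zero S) (mat_zero S) M2) = rkS m1 n1 M1 + rkS m2 n2 M2"
    if "M1 \<in> mat_over S m1 n1" "M2 \<in> mat_over S m2 n2" for m1 n1 m2 n2 M1 M2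
  proof -
    have "mat_zero S \<in> mat_over S m1 n2" using D0_closed by (auto simp: mat_over_def mat_zero_def S_simps)
    then show ?thesis using rkS_block[OF that] rkS_zero by fastforce
  qed
  show "rkS m1 n1 M1 + rkS m2 n2 M2 \<le> rkS (m1 + m2) (n1 + n2) (mat_block S m1 n1 M1 M3 (mat_zero S) M2)"
    if "M1 \<in> mat_over S m1 n1" "M2 \<in> mat_over S m2 n2" "M3 \<in> mat_over S m1 n2" for m1 n1 m2 n2 M1 M2 M3
    by (rule rkS_block(1)[OF that])
qed

lemma phi_hom: "(\<lambda>a. q (psi a)) \<in> ring_hom R S"
proof (rule ring_hom_memI)
  show "q (psi a) \<in> carrier S" if "a \<in> carrier R" for a using that D0_psi by (simp add: S_simps)
  show "q (psi (a \<otimes>\<^bsub>R\<^esub> b)) = q (psi a) \<otimes>\<^bsub>S\<^esub> q (psi b)" if "a \<in> carrier R" "b \<in> carrier R" for a b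
    using that D0_psi D0_closed R_closed psi_mult by (simp add: S_mult) (auto intro!: q_cong simp: eqv_def)
  show "q (psi (a \<oplus>\<^bsub>R\<^esub> b)) = q (psi a) \<oplus>\<^bsub>S\<^esub> q (psi b)" if "a \<in> carrier R" "b \<in> carrier R" for a b
    using that D0_psi D0_closed R_closed psi_add by (simp add: S_add) (auto intro!: q_cong simp: eqv_def)
  show "q (psi \<one>\<^bsub>R\<^esub>) = \<one>\<^bsub>S\<^esub>" by (simp add: psi_one S_simps)
qed

lemma regular:
  assumes "\<And>m n M. M \<in> mat_over R m n ==> rk m n M = rho (frm psi m n M)"
  shows "regular_rank TYPE('v) R rk"
  unfolding regular_rank_def
proof (intro exI[of _ S] exI[of _ rkS] exI[of _ "\<lambda>a. q (psi a)"] conjI allI ballI regular_S sylvester_S phi_hom)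
  fix m n M assume M: "M \<in> mat_over R m n"
  have "rho (frm dec m n (\<lambda>i j. q (psi (M i j)))) = rho (frm psi m n M)"
  proof (rule rho_eqv)
    show "frm dec m n (\<lambda>i j. q (psi (M i j))) \<in> rmat UNIV UNIV D"
      by (rule frm_rmat[OF D_sub]) (use M dec_q D0_psi D0_D in \<open>auto simp: mat_over_def\<close>)
    show "frm psi m n M \<in> rmat UNIV UNIV D"
      by (rule frm_rmat[OF D_sub]) (use M psi_in in \<open>auto simp: mat_over_def\<close>)
    show "eqv (ent (frm dec m n (\<lambda>i j. q (psi (M i j)))) i j) (ent (frm psi m n M) i j)" for i j
      using M dec_q D0_psi by (auto simp: ent_frm eqv_refl mat_over_def)
  qed
  then show "rk m n M = rkS m n (\<lambda>i j. q (psi (M i j)))" using assms[OF M] by (simp add: rkS_def)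
qed

end

text \<open>Tychonoff: the values lie in a product of compact intervals, so the image filter has a
  cluster point. Pulling its neighbourhoods back refines \<open>F\<close> to a filter along which
  all coordinates converge at once.\<close>

lemma bounded_family_cluster:
  fixes x :: "'d \<Rightarrow> 'z \<Rightarrow> real"
  assumes F: "F \<noteq> bot" and ev: "\<forall>\<^sub>F d in F. \<forall>z. x d z \<in> {0..B z}"
  obtains F' l where "F' \<le> F" "F' \<noteq> bot" "\<And>z. ((\<lambda>d. x d z) \<longlongrightarrow> l z) F'"
proof -
  define K where "K = PiE UNIV (\<lambda>z. {0..B z})"
  have "compactin (product_topology (\<lambda>z. euclideanreal) UNIV) K"
    unfolding K_def compactin_PiE by auto
  then have K: "compact K" by (simp add: euclidean_product_topology)
  have "filtermap x F \<noteq> bot" using F by (simp add: filtermap_bot_iff)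
  moreover have "eventually (\<lambda>y. y \<in> K) (filtermap x F)"
    unfolding eventually_filtermap using ev by eventually_elim (auto simp: K_def)
  ultimately obtain l where l: "inf (nhds l) (filtermap x F) \<noteq> bot"
    using K unfolding compact_filter by blast
  define F' where "F' = inf F (filtercomap x (nhds l))"
  have "F' \<noteq> bot"
  proof
    assume "F' = bot"
    then have "eventually (\<lambda>_. False) F'" by simp
    then obtain Q R where QR: "eventually Q F" "eventually R (filtercomap x (nhds l))" "\<forall>d. \<not> (Q d \<and> R d)"
      unfolding F'_def eventually_inf by blast
    obtain P where P: "eventually P (nhds l)" "\<And>d. P (x d) ==> R d"
      using QR(2) unfolding eventually_filtercomap by blast
    have "eventually (\<lambda>y. \<not> P y) (filtermap x F)"
      unfolding eventually_filtermap using QR(1) by eventually_elim (use QR(3) P(2) in blast)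
    then have "eventually (\<lambda>_. False) (inf (nhds l) (filtermap x F))"
      unfolding eventually_inf using P(1) by blast
    then show False using l by (simp add: trivial_limit_def)
  qed
  moreover have "((\<lambda>d. x d z) \<longlongrightarrow> l z) F'" for z
  proof -
    have "filterlim x (nhds l) (filtercomap x (nhds l))" by (rule filterlim_filtercomap)
    then have "(x \<longlongrightarrow> l) F'" by (rule filterlim_mono) (auto simp: F'_def)
    then show ?thesis
      by (rule continuous_on_tendsto_compose[OF continuous_on_product_coordinates[of z]]) auto
  qed
  ultimately show ?thesis using that[of F' l] by (auto simp: F'_def)
qed

definition flat :: "('a \<Rightarrow> ('j, 'k::field) rfm) \<Rightarrow> (nat \<Rightarrow> nat \<Rightarrow> 'a) \<Rightarrow> nat \<times> 'j \<Rightarrow> nat \<times> 'j \<Rightarrow> 'k" where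
  "flat phi M = (\<lambda>(a, u) (b, v). ent (phi (M a b)) u v)"

type_synonym ('v, 'k) approximant = "(nat \<times> nat) set \<times> ('v \<Rightarrow> (nat \<times> nat, 'k) rfm)"

text \<open>Each approximant carries its own finite index set, so algebras of all sizes are members
  of one type and \<open>dg J 1\<close> is the unit of its algebra. Zero has to go to zero because
  matrices are padded by it.\<close>

definition apx :: "('v, 'm) ring_scheme \<Rightarrow> ('v, 'k::field) approximant set" where
  "apx R = {(J, phi). finite J \<and> (\<forall>a\<in>carrier R. phi a \<in> rmat J J UNIV) \<and> phi \<one>\<^bsub>R\<^esub> = dg J 1 \<and>
     phi \<zero>\<^bsub>R\<^esub> = 0 \<and> (\<forall>a\<in>carrier R. \<forall>b\<in>carrier R. phi (a \<oplus>\<^bsub>R\<^esub> b) = phi a + phi b)}"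

text \<open>The product of the matrix algebras over all approximants. Values off \<open>apx\<close>
  are normalized to zero, so that \<open>unit_p\<close> is a unit.\<close>

definition prod_alg :: "('v, 'm) ring_scheme \<Rightarrow> (('v, 'k::field) approximant \<Rightarrow> (nat \<times> nat, 'k) rfm) set" where
  "prod_alg R = {g. \<forall>i. (i \<in> apx R --> g i \<in> rmat (fst i) (fst i) UNIV) \<and> (i \<notin> apx R --> g i = 0)}"

lemma prod_algD: "g \<in> prod_alg R ==> i \<in> apx R ==> g i \<in> rmat (fst i) (fst i) UNIV"
  "g \<in> prod_alg R ==> i \<notin> apx R ==> g i = 0"
  unfolding prod_alg_def by blast+

lemma prod_algI: "(\<And>i. i \<in> apx R ==> g i \<in> rmat (fst i) (fst i) UNIV) ==> (\<And>i. i \<notin> apx R ==> g i = 0)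
   ==> g \<in> prod_alg R"
  unfolding prod_alg_def by blast

lemma prod_alg_sub: "subring_set (prod_alg R)"
  unfolding subring_set_def
proof (intro conjI ballI)
  show "0 \<in> prod_alg R" by (rule prod_algI) (auto intro: rmat_zero)
  show "a + b \<in> prod_alg R" "a * b \<in> prod_alg R" "- a \<in> prod_alg R"
    if "a \<in> prod_alg R" "b \<in> prod_alg R" for a b
    using prod_algD[OF that(1)] prod_algD[OF that(2)]
    by (auto intro!: prod_algI rmat_add rmat_uminus simp del: split_paired_All) (blast intro: rmat_mult subring_set_UNIV)
qed

text \<open>Projection to coordinate \<open>i\<close>, a matrix of matrices being flattened into one
  matrix over the field.\<close>

definition evm :: "'b \<Rightarrow> (nat, 'b \<Rightarrow> ('j, 'k::field) rfm) rfm \<Rightarrow> (nat \<times> 'j, 'k) rfm" where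
  "evm i Z = Rfm (\<lambda>(a, u) (b, v). ent (ent Z a b i) u v)"

lemma ent_evm: "ent (evm i Z) (a, u) (b, v) = ent (ent Z a b i) u v"
proof -
  have "finite {y. (case y of (b, v) \<Rightarrow> ent (ent Z a b i) u v) \<noteq> 0}" for a u
  proof (rule finite_subset)
    show "{y. (case y of (b, v) \<Rightarrow> ent (ent Z a b i) u v) \<noteq> 0}
      \<subseteq> (SIGMA b:{b. ent Z a b \<noteq> 0}. {v. ent (ent Z a b i) u v \<noteq> 0})" by auto
  qed auto
  then show ?thesis unfolding evm_def by (subst ent_Rfm) (auto simp: case_prod_unfold)
qed

lemma evm_add: "evm i (A + B) = evm i A + evm i B"
  by (rule rfm_eqI) (auto simp: ent_evm)

lemma sum_fun_apply: "(\<Sum>s\<in>S. f s) i = (\<Sum>s\<in>S. f s i)"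
  by (induction S rule: infinite_finite_induct) auto

lemma evm_mult:
  fixes A B :: "(nat, 'b \<Rightarrow> ('j, 'k::field) rfm) rfm"
  shows "evm i (A * B) = evm i A * evm i B"
proof (rule rfm_eqI)
  fix x y :: "nat \<times> 'j"
  obtain a u c v where x: "x = (a, u)" and y: "y = (c, v)" by (cases x, cases y) auto
  let ?S = "{b. ent A a b \<noteq> 0}"
  let ?W = "\<lambda>b. {w. ent (ent A a b i) u w \<noteq> 0}"
  have "ent (evm i A * evm i B) x y = (\<Sum>z\<in>Sigma ?S ?W. ent (evm i A) x z * ent (evm i B) z y)"
    by (rule ent_mult) (auto simp: x ent_evm)
  also have "\<dots> = (\<Sum>b\<in>?S. \<Sum>w\<in>?W b. ent (ent A a b i) u w * ent (ent B b c i) w v)"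
    by (subst sum.Sigma) (auto simp: x y ent_evm case_prod_unfold intro!: sum.cong)
  also have "\<dots> = (\<Sum>b\<in>?S. ent (ent A a b i * ent B b c i) u v)" by (simp add: ent_times)
  also have "\<dots> = ent (evm i (A * B)) x y"
    by (simp add: x y ent_evm ent_times[of A] sum_fun_apply)
  finally show "ent (evm i (A * B)) x y = ent (evm i A * evm i B) x y" by simp
qed

lemma evm_rows:
  assumes Z: "Z \<in> rmat UNIV UNIV (prod_alg R)" and b: "\<forall>a b. n \<le> a \<or> n \<le> b --> ent Z a b = 0" and i: "i \<in> apx R"
  shows "ent (evm i Z) x y \<noteq> 0 ==> x \<in> {..<n} \<times> fst i \<and> y \<in> {..<n} \<times> fst i"
proof -
  assume nz: "ent (evm i Z) x y \<noteq> 0"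
  obtain a u c v where x: "x = (a, u)" and y: "y = (c, v)" by (cases x, cases y) auto
  have e: "ent (ent Z a c i) u v \<noteq> 0" using nz by (simp add: x y ent_evm)
  then have "ent Z a c \<noteq> 0" by auto
  then have "a < n" "c < n" using b by (auto simp: not_le[symmetric])
  moreover have "ent Z a c i \<in> rmat (fst i) (fst i) UNIV"
    by (rule prod_algD(1)[OF rmat_entry[OF Z] i])
  then have "u \<in> fst i" "v \<in> fst i" using e rmat_outside[of "ent Z a c i" "fst i" "fst i" UNIV u v] by auto
  ultimately show ?thesis by (simp add: x y)
qed

lemma apx_finite: "i \<in> apx R ==> finite (fst i)"
  by (auto simp: apx_def)

lemma evm_rmat:
  fixes i :: "('v, 'k::field) approximant" and R :: "('v, 'm) ring_scheme"
  assumes Z: "Z \<in> rmat UNIV UNIV (prod_alg R)" and i: "i \<in> apx R"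
  shows "evm i Z \<in> rmat UNIV UNIV UNIV"
proof -
  obtain n where n: "\<forall>a b. n \<le> a \<or> n \<le> b --> ent Z a b = 0" using rmat_nat_bound[OF Z] by metis
  have "ent (evm i Z) x y = 0" if "x \<notin> {..<n} \<times> fst i \<or> y \<notin> {..<n} \<times> fst i" for x y :: "nat \<times> nat \<times> nat"
    using evm_rows[OF Z n i, where x=x and y=y] that by blast
  then show ?thesis
    by (intro rmatI[of "{..<n} \<times> fst i" "{..<n} \<times> fst i"]) (use apx_finite[OF i] in auto)
qed

lemma arank_evm:
  assumes "i \<in> apx R"
  shows "arank (rmat UNIV UNIV (prod_alg R)) (\<lambda>Z. real (krank (ent (evm i Z))))"
  by (rule arank_pullback[OF krank_arank[of UNIV], where h="evm i"])
    (use evm_rmat[OF _ assms] subring_set_rmat[OF prod_alg_sub] in \<open>simp_all add: evm_add evm_mult\<close>)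

lemma krank_evm_le:
  assumes Z: "Z \<in> rmat UNIV UNIV (prod_alg R)" and n: "\<forall>a b. n \<le> a \<or> n \<le> b --> ent Z a b = 0" and i: "i \<in> apx R"
  shows "krank (ent (evm i Z)) \<le> n * card (fst i)"
proof -
  have "krank (ent (evm i Z)) \<le> card ({..<n} \<times> fst i)"
  proof (rule krank_rows)
    show "finite ({..<n} \<times> fst i)" using apx_finite[OF i] by simp
    show "ent (evm i Z) x y = 0" if "x \<notin> {..<n} \<times> fst i" for x y
      using evm_rows[OF Z n i, where x=x and y=y] that by blast
  qed
  then show ?thesis by (simp add: card_cartesian_product)
qed

definition unit_p :: "('v, 'm) ring_scheme \<Rightarrow> ('v, 'k::field) approximant \<Rightarrow> (nat \<times> nat, 'k) rfm" where
  "unit_p R = (\<lambda>i. if i \<in> apx R then dg (fst i) 1 else 0)"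

definition psi_p :: "('v, 'm) ring_scheme \<Rightarrow> 'v \<Rightarrow> ('v, 'k::field) approximant \<Rightarrow> (nat \<times> nat, 'k) rfm" where
  "psi_p R a = (\<lambda>i. if i \<in> apx R then snd i a else 0)"

lemma psi_p_in: "a \<in> carrier R ==> psi_p R a \<in> prod_alg R"
  by (rule prod_algI) (auto simp: psi_p_def apx_def)

lemma psi_p_one: "psi_p R \<one>\<^bsub>R\<^esub> = unit_p R"
  by (auto simp: psi_p_def unit_p_def apx_def fun_eq_iff)

lemma psi_p_zero: "psi_p R \<zero>\<^bsub>R\<^esub> = 0"
  by (auto simp: psi_p_def apx_def fun_eq_iff)

lemma psi_p_add: "a \<in> carrier R ==> b \<in> carrier R ==> psi_p R (a \<oplus>\<^bsub>R\<^esub> b) = psi_p R a + psi_p R b"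
  by (auto simp: psi_p_def apx_def fun_eq_iff)

lemma unit_p_in: "unit_p R \<in> prod_alg R"
  by (rule prod_algI) (use apx_finite in \<open>auto simp: unit_p_def intro!: rmat_dg\<close>)

lemma unit_p_unit: "d \<in> prod_alg R ==> unit_p R * d = d \<and> d * unit_p R = d"
proof -
  assume d: "d \<in> prod_alg R"
  have "unit_p R i * d i = d i \<and> d i * unit_p R i = d i" for i
    using prod_algD[OF d, of i] dg_mult_absorb[of "d i" "fst i" "fst i" UNIV] mult_dg_absorb[of "d i" "fst i" "fst i" UNIV]
    by (cases "i \<in> apx R") (simp_all add: unit_p_def)
  then show ?thesis by (simp add: fun_eq_iff del: split_paired_All)
qed

lemma prod_alg_regular: "d \<in> prod_alg R ==> \<exists>x\<in>prod_alg R. d * x * d = d"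
proof -
  assume d: "d \<in> prod_alg R"
  have "\<exists>y. (i \<in> apx R --> y \<in> rmat (fst i) (fst i) UNIV) \<and> (i \<notin> apx R --> y = 0) \<and> d i * y * d i = d i" for i
  proof (cases "i \<in> apx R")
    case True
    then have "d i \<in> rmat (fst i) (fst i) UNIV" using d by (rule prod_algD(1)[rotated])
    from rmat_regular[OF apx_finite[OF True] this] show ?thesis using True by blast
  next
    case False
    then have "d i = 0" using d by (rule prod_algD(2)[rotated])
    then show ?thesis using False by auto
  qed
  then have "\<exists>x. \<forall>i. (i \<in> apx R --> x i \<in> rmat (fst i) (fst i) UNIV) \<and> (i \<notin> apx R --> x i = 0) \<and> d i * x i * d i = d i"
    by (rule choice[OF allI])
  then obtain x where "\<forall>i. (i \<in> apx R --> x i \<in> rmat (fst i) (fst i) UNIV) \<and> (i \<notin> apx R --> x i = 0) \<and> d i * x i * d i = d i" ..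
  then have "x \<in> prod_alg R" "\<And>i. d i * x i * d i = d i" by (blast intro: prod_algI)+
  then show ?thesis by (intro bexI[of _ x]) (simp_all add: fun_eq_iff del: split_paired_All)
qed

lemma mat_over_entry: "M \<in> mat_over R m n ==> \<zero>\<^bsub>R\<^esub> \<in> carrier R ==> M i j \<in> carrier R"
  by (cases "i < m \<and> j < n") (auto simp: mat_over_def not_less)

lemma evm_frm:
  assumes "M \<in> mat_over R n n" "i \<in> apx R"
  shows "ent (evm i (frm (psi_p R) n n M)) = flat (snd i) M"
proof (intro ext)
  fix x y :: "nat \<times> nat \<times> nat"
  obtain a u c v where x: "x = (a, u)" and y: "y = (c, v)" by (cases x, cases y) auto
  have z: "snd i \<zero>\<^bsub>R\<^esub> = 0" using assms(2) by (auto simp: apx_def)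
  show "ent (evm i (frm (psi_p R) n n M)) x y = flat (snd i) M x y"
    using assms z by (auto simp: x y ent_evm ent_frm psi_p_def flat_def mat_over_def not_less)
qed

text \<open>Approximations are chosen for every finite set of matrices, and a limit is taken along
  the directed family of finite sets, for all matrices over the product algebra at once. The limit
  is a rank function there that pulls back to exactly \<open>rk\<close>, and failures of
  multiplicativity have rank zero in it.\<close>

theorem regular_criterion:
  fixes R :: "'v ring" and emb :: "'v \<Rightarrow> 'r::ring" and pr :: "'v \<Rightarrow> 'v \<Rightarrow> 'v" and tag :: "nat \<Rightarrow> 'v"
  assumes sy: "syl R emb rk"
    and pr_inj: "\<And>a b a' b'. pr a b = pr a' b' \<longleftrightarrow> a = a' \<and> b = b'"
    and tag_inj: "\<And>m n. tag m = tag n \<longleftrightarrow> m = n"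
    and approx: "\<And>n FM e. finite FM ==> FM \<subseteq> mat_over R n n ==> 0 < e ==>
      \<exists>(K :: ('v, 'k::field) approximant set) w. finite K \<and> K \<subseteq> apx R \<and> (\<forall>i\<in>K. 0 \<le> w i) \<and>
        (\<forall>M\<in>FM. \<bar>rk n n M - (\<Sum>i\<in>K. w i * real (krank (flat (snd i) M)))\<bar> \<le> e)"
  shows "regular_rank TYPE('v) R rk"
proof -
  interpret syl R emb rk by fact
  define A where "A = {(n, M). M \<in> mat_over R n n}"
  \<comment> \<open>\<open>top Y\<close> is both a common size for the matrices in \<open>Y\<close>
    and the measure of precision: the error allowed for \<open>Y\<close> is
    \<open>1 / (1 + top Y)\<close>.\<close>
  define top where "top = (\<lambda>Y :: (nat \<times> (nat \<Rightarrow> nat \<Rightarrow> 'v)) set. Max (insert 0 (fst ` Y)))"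
  define ok where "ok = (\<lambda>Y (K :: ('v, 'k) approximant set, w). finite K \<and> K \<subseteq> apx R \<and> (\<forall>i\<in>K. 0 \<le> w i) \<and>
        (\<forall>M\<in>snd ` Y. \<bar>rk (top Y) (top Y) M - (\<Sum>i\<in>K. w i * real (krank (flat (snd i) M)))\<bar> \<le> 1 / (1 + real (top Y))))"
  have le_top: "n \<le> top Y" if "(n, M) \<in> Y" "finite Y" for n M Y
    unfolding top_def using that by (intro Max_ge) (auto intro: rev_image_eqI)
  have ex: "\<exists>Kw. ok Y Kw" if Y: "finite Y" "Y \<subseteq> A" for Y
  proof -
    have "snd ` Y \<subseteq> mat_over R (top Y) (top Y)"
    proof
      fix M assume "M \<in> snd ` Y"
      then obtain n where n: "(n, M) \<in> Y" by auto
      then have "M \<in> mat_over R n n" using Y by (auto simp: A_def)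
      then show "M \<in> mat_over R (top Y) (top Y)"
        by (rule mat_over_mono[OF _ zero_in]) (use le_top n Y in auto)
    qed
    from approx[OF _ this, of "1 / (1 + real (top Y))"] Y
    obtain K :: "('v, 'k) approximant set" and w where "finite K" "K \<subseteq> apx R" "\<forall>i\<in>K. 0 \<le> w i"
      "\<forall>M\<in>snd ` Y. \<bar>rk (top Y) (top Y) M - (\<Sum>i\<in>K. w i * real (krank (flat (snd i) M)))\<bar> \<le> 1 / (1 + real (top Y))"
      by auto
    then have "ok Y (K, w)" by (simp add: ok_def)
    then show ?thesis ..
  qed
  define Kw where "Kw = (\<lambda>Y. SOME Kw. ok Y Kw)"
  have Kw: "ok Y (Kw Y)" if "finite Y" "Y \<subseteq> A" for Y
    unfolding Kw_def by (rule someI_ex[OF ex[OF that]])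
  define P :: "(nat, ('v, 'k) approximant \<Rightarrow> (nat \<times> nat, 'k) rfm) rfm set" where "P = rmat UNIV UNIV (prod_alg R)"
  \<comment> \<open>The value 0 off \<open>P\<close> serves the compactness argument, which wants a
    bound for every element of the type.\<close>
  define x where "x = (\<lambda>Y Z. if Z \<in> P then \<Sum>i\<in>fst (Kw Y). snd (Kw Y) i * real (krank (ent (evm i Z))) else 0)"
  define F0 where "F0 = finite_subsets_at_top A"
  have F0: "F0 \<noteq> bot" by (simp add: F0_def)
  define psi :: "'v \<Rightarrow> ('v, 'k) approximant \<Rightarrow> (nat \<times> nat, 'k) rfm" where "psi = psi_p R"
  have frmP: "frm psi m n M \<in> P" if "M \<in> mat_over R m n" for m n M
    unfolding P_def psi_def by (rule frm_rmat[OF prod_alg_sub]) (rule psi_p_in, rule mat_over_entry[OF that zero_in])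
  have frm_pad: "frm psi m n M = frm psi m' n' M" if M: "M \<in> mat_over R m n" "m \<le> m'" "n \<le> n'" for m n m' n' M
    by (rule rfm_eqI) (use M psi_p_zero in \<open>auto simp: ent_frm mat_over_def psi_def not_less\<close>)
  have xrk: "\<bar>rk n n M - x Y (frm psi n n M)\<bar> \<le> 1 / (1 + real (top Y))"
    if Y: "finite Y" "Y \<subseteq> A" "(n, M) \<in> Y" for Y n M
  proof -
    have M: "M \<in> mat_over R n n" using Y by (auto simp: A_def)
    have n: "n \<le> top Y" using le_top Y by auto
    have M': "M \<in> mat_over R (top Y) (top Y)" by (rule mat_over_mono[OF M zero_in n n])
    have sub: "fst (Kw Y) \<subseteq> apx R" using Kw[OF Y(1,2)] by (auto simp: ok_def case_prod_unfold)
    have "x Y (frm psi n n M) = (\<Sum>i\<in>fst (Kw Y). snd (Kw Y) i * real (krank (ent (evm i (frm psi n n M)))))"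
      using frmP[OF M] by (simp add: x_def)
    also have "\<dots> = (\<Sum>i\<in>fst (Kw Y). snd (Kw Y) i * real (krank (flat (snd i) M)))"
    proof (rule sum.cong[OF refl])
      fix i assume "i \<in> fst (Kw Y)"
      then have "i \<in> apx R" using sub by blast
      then show "snd (Kw Y) i * real (krank (ent (evm i (frm psi n n M)))) = snd (Kw Y) i * real (krank (flat (snd i) M))"
        unfolding psi_def using evm_frm[OF M \<open>i \<in> apx R\<close>] by (simp del: split_paired_All)
    qed
    finally have e: "x Y (frm psi n n M) = (\<Sum>i\<in>fst (Kw Y). snd (Kw Y) i * real (krank (flat (snd i) M)))" .
    have "M \<in> snd ` Y" using Y(3) by force
    then have "\<bar>rk (top Y) (top Y) M - (\<Sum>i\<in>fst (Kw Y). snd (Kw Y) i * real (krank (flat (snd i) M)))\<bar> \<le> 1 / (1 + real (top Y))"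
      using Kw[OF Y(1,2)] by (auto simp: ok_def case_prod_unfold)
    then show ?thesis using rk_pad[OF M n n] e by simp
  qed
  have one: "mat_one1 R \<in> mat_over R 1 1" using one_in by (auto simp: mat_one1_def mat_over_def)
  have frm_one: "frm psi 1 1 (mat_one1 R) = un 0 0 (unit_p R)"
    by (rule rfm_eqI) (auto simp: ent_frm ent_un mat_one1_def psi_def psi_p_one)
  have arx: "arank P (x Y)" if Y: "finite Y" "Y \<subseteq> A" for Y
  proof -
    have K: "finite (fst (Kw Y))" "fst (Kw Y) \<subseteq> apx R" "\<forall>i\<in>fst (Kw Y). 0 \<le> snd (Kw Y) i"
      using Kw[OF Y] by (auto simp: ok_def case_prod_unfold)
    have a: "arank P (\<lambda>Z. \<Sum>i\<in>fst (Kw Y). snd (Kw Y) i * real (krank (ent (evm i Z))))"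
      unfolding P_def
    proof (rule arank_sum[OF K(1) subring_set_rmat[OF prod_alg_sub]])
      fix i assume i: "i \<in> fst (Kw Y)"
      have "arank (rmat UNIV UNIV (prod_alg R)) (\<lambda>Z. real (krank (ent (evm i Z))))"
        by (rule arank_evm) (use i K(2) in blast)
      then show "0 \<le> snd (Kw Y) i \<and> arank (rmat UNIV UNIV (prod_alg R)) (\<lambda>Z. real (krank (ent (evm i Z))))"
        using i K(3) by blast
    qed
    interpret a: arank P "\<lambda>Z. \<Sum>i\<in>fst (Kw Y). snd (Kw Y) i * real (krank (ent (evm i Z)))" by fact
    have e: "x Y Z = (\<Sum>i\<in>fst (Kw Y). snd (Kw Y) i * real (krank (ent (evm i Z))))" if "Z \<in> P" for Z
      using that by (simp add: x_def)
    show ?thesis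
    proof
      fix b c d g g' f f'
      assume m: "b \<in> P" "c \<in> P" "d \<in> P" "g \<in> P" "g' \<in> P" "f \<in> P" "f' \<in> P"
        and r: "g * b = b" "b * g' = b" "f * c = c" "c * f' = c" "g * d = d" "d * f' = d"
       "g * c = 0" "f * b = 0" "f * d = 0" "b * f' = 0" "c * g' = 0" "d * g' = 0"
      show "x Y b + x Y c \<le> x Y (b + c + d)" using a.tri[OF m r] m a.closed by (simp add: e)
    qed (use a.sub a.nonneg a.zero a.mult_le_left a.mult_le_right a.add_le a.closed in \<open>auto simp: e\<close>)
  qed
  define nb where "nb = (\<lambda>Z :: (nat, ('v, 'k) approximant \<Rightarrow> (nat \<times> nat, 'k) rfm) rfm. SOME n. \<forall>a b. n \<le> a \<or> n \<le> b --> ent Z a b = 0)"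
  have nb: "ent Z a b = 0" if Z: "Z \<in> P" and ab: "nb Z \<le> a \<or> nb Z \<le> b" for Z a b
  proof -
    have "\<exists>n. \<forall>a b. n \<le> a \<or> n \<le> b --> ent Z a b = 0" using rmat_nat_bound[of Z] Z unfolding P_def by metis
    then have "\<forall>a b. nb Z \<le> a \<or> nb Z \<le> b --> ent Z a b = 0" unfolding nb_def by (rule someI_ex)
    then show ?thesis using ab by blast
  qed
  \<comment> \<open>The approximate rank of the unit is within 1 of the true value 1, so the total
    weight counted with \<open>card (fst i)\<close> is at most 2. A matrix supported in size
    \<open>nb Z\<close> then has rank at most \<open>2 * nb Z\<close>.\<close>
  have bound: "x Y Z \<in> {0..2 * real (nb Z)}" if Y: "finite Y" "Y \<subseteq> A" "(1, mat_one1 R) \<in> Y" for Y Z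
  proof (cases "Z \<in> P")
    case True
    interpret a: arank P "x Y" by (rule arx[OF Y(1,2)])
    have K: "finite (fst (Kw Y))" "fst (Kw Y) \<subseteq> apx R" "\<forall>i\<in>fst (Kw Y). 0 \<le> snd (Kw Y) i"
      using Kw[OF Y(1,2)] by (auto simp: ok_def case_prod_unfold)
    have "x Y (un 0 0 (unit_p R)) = (\<Sum>i\<in>fst (Kw Y). snd (Kw Y) i * real (card (fst i)))"
    proof -
      have i: "un 0 0 (unit_p R) \<in> P" using frmP[OF one] unfolding frm_one .
      have "krank (ent (evm i (un 0 0 (unit_p R)))) = card (fst i)" if "i \<in> apx R" for i :: "('v, 'k) approximant"
      proof -
        have "evm i (un 0 0 (unit_p R)) = dg ({0} \<times> fst i) 1"
          using that by (intro rfm_eqI) (auto simp: ent_evm ent_un ent_dg unit_p_def split: if_splits)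
        then show ?thesis using apx_finite[OF that] by (simp add: krank_dg card_cartesian_product)
      qed
      then show ?thesis using K(2) i by (auto simp: x_def intro!: sum.cong)
    qed
    moreover have "x Y (un 0 0 (unit_p R)) \<le> 2"
    proof -
      have "1 / (1 + real (top Y)) \<le> 1" by simp
      then show ?thesis using xrk[OF Y] rk_one unfolding frm_one by linarith
    qed
    ultimately have w: "(\<Sum>i\<in>fst (Kw Y). snd (Kw Y) i * real (card (fst i))) \<le> 2" by simp
    have "x Y Z \<le> (\<Sum>i\<in>fst (Kw Y). snd (Kw Y) i * (real (nb Z) * real (card (fst i))))"
    proof -
      have "real (krank (ent (evm i Z))) \<le> real (nb Z) * real (card (fst i))" if "i \<in> fst (Kw Y)" for i
      proof -
        have "krank (ent (evm i Z)) \<le> nb Z * card (fst i)"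
        proof (rule krank_evm_le)
          show "Z \<in> rmat UNIV UNIV (prod_alg R)" using True unfolding P_def .
          show "\<forall>a b. nb Z \<le> a \<or> nb Z \<le> b --> ent Z a b = 0" using nb[OF True] by blast
          show "i \<in> apx R" using K(2) that by blast
        qed
        from of_nat_mono[OF this, where ?'a = real] show ?thesis by simp
      qed
      then show ?thesis using K(3) True by (auto simp: x_def intro!: sum_mono mult_left_mono)
    qed
    also have "\<dots> = real (nb Z) * (\<Sum>i\<in>fst (Kw Y). snd (Kw Y) i * real (card (fst i)))"
      by (simp add: sum_distrib_left mult.left_commute)
    also have "\<dots> \<le> real (nb Z) * 2" by (rule mult_left_mono[OF w]) simp
    finally show ?thesis using a.nonneg[OF True] by (simp add: mult.commute)
  qed (simp add: x_def)
  have "\<forall>\<^sub>F Y in F0. \<forall>Z. x Y Z \<in> {0..2 * real (nb Z)}"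
    unfolding F0_def eventually_finite_subsets_at_top
    by (rule exI[of _ "{(1, mat_one1 R)}"]) (use bound one in \<open>auto simp: A_def\<close>)
  from bounded_family_cluster[OF F0 this]
  obtain F l where F: "F \<le> F0" "F \<noteq> bot" and l: "\<And>Z. ((\<lambda>Y. x Y Z) \<longlongrightarrow> l Z) F" by metis
  have evA: "\<forall>\<^sub>F Y in F. finite Y \<and> Y \<subseteq> A"
    by (rule filter_leD[OF F(1)]) (auto simp: F0_def)
  have arl: "arank P l"
  proof (rule arank_lim[OF F(2) _ l])
    show "\<forall>\<^sub>F Y in F. arank P (x Y)" using evA by eventually_elim (use arx in blast)
    show "subring_set P" unfolding P_def by (rule subring_set_rmat[OF prod_alg_sub])
  qed
  interpret L: arank P l by (rule arl)
  have lrk: "l (frm psi n n M) = rk n n M" if M: "M \<in> mat_over R n n" for n M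
  proof -
    have "\<bar>rk n n M - l (frm psi n n M)\<bar> \<le> 1 / (1 + real N)" for N
    proof (rule tendsto_upperbound[OF _ _ F(2)])
      show "((\<lambda>Y. \<bar>rk n n M - x Y (frm psi n n M)\<bar>) \<longlongrightarrow> \<bar>rk n n M - l (frm psi n n M)\<bar>) F"
        by (intro tendsto_intros l)
      \<comment> \<open>Adjoining a zero matrix of size \<open>N\<close> forces \<open>top Y\<close>
        to be at least \<open>N\<close>, and so fixes the precision.\<close>
      have "\<forall>\<^sub>F Y in F0. finite Y \<and> Y \<subseteq> A \<and> (n, M) \<in> Y \<and> (N, mat_zero R) \<in> Y"
        unfolding F0_def eventually_finite_subsets_at_top
        by (rule exI[of _ "{(n, M), (N, mat_zero R)}"]) (use M mat_zero_in in \<open>auto simp: A_def\<close>)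
      from filter_leD[OF F(1) this]
      show "\<forall>\<^sub>F Y in F. \<bar>rk n n M - x Y (frm psi n n M)\<bar> \<le> 1 / (1 + real N)"
      proof eventually_elim
        case (elim Y)
        then have "\<bar>rk n n M - x Y (frm psi n n M)\<bar> \<le> 1 / (1 + real (top Y))" using xrk by blast
        also have "\<dots> \<le> 1 / (1 + real N)" using le_top[of N "mat_zero R" Y] elim by (intro divide_left_mono) auto
        finally show ?case .
      qed
    qed
    note le = this
    show ?thesis
    proof (rule ccontr)
      assume "l (frm psi n n M) \<noteq> rk n n M"
      then have "0 < \<bar>rk n n M - l (frm psi n n M)\<bar>" by simp
      then obtain N where "inverse (real (Suc N)) < \<bar>rk n n M - l (frm psi n n M)\<bar>"
        using reals_Archimedean by blast
      then show False using le[of N] by (simp add: inverse_eq_divide)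
    qed
  qed
  have lrk': "rk m n M = l (frm psi m n M)" if M: "M \<in> mat_over R m n" for m n M
    using lrk[OF mat_over_mono[OF M zero_in, of "max m n" "max m n"]] rk_pad[OF M, of "max m n" "max m n"]
      frm_pad[OF M, of "max m n" "max m n"] by simp
  let ?u = "unit_p R :: ('v, 'k) approximant \<Rightarrow> (nat \<times> nat, 'k) rfm"
  have uu: "?u * d = d" "d * ?u = d" if "d \<in> prod_alg R" for d using unit_p_unit[OF that] by auto
  have inP: "un i j d \<in> P" if "d \<in> prod_alg R" for i j d
    unfolding P_def by (rule rmat_un[OF prod_alg_sub]) (use that in auto)
  have lone: "l (un 0 0 ?u) = 1" using lrk[OF one] rk_one unfolding frm_one by simp
  have lmult: "l (un 0 0 (psi (a \<otimes>\<^bsub>R\<^esub> b) - psi a * psi b)) = 0" if ab: "a \<in> carrier R" "b \<in> carrier R" for a b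
  proof -
    \<comment> \<open>Over the algebra this matrix is a column times a row, so its rank is at most
      1. Over the product algebra, eliminating with the images of \<open>a\<close> and
      \<open>b\<close> leaves \<open>diag(1, df)\<close>, where the unit alone already has rank
      1.\<close>
    define Mx where "Mx = (\<lambda>(i :: nat) (j :: nat). if i = 0 \<and> j = 0 then \<one>\<^bsub>R\<^esub> else if i = 0 \<and> j = 1 then b
      else if i = 1 \<and> j = 0 then a else if i = 1 \<and> j = 1 then a \<otimes>\<^bsub>R\<^esub> b else \<zero>\<^bsub>R\<^esub>)"
    have Mx: "Mx \<in> mat_over R 2 2"
      using ab one_in zero_in mult_in by (auto simp: Mx_def mat_over_def)
    have two: "i < 2 \<longleftrightarrow> i = 0 \<or> i = 1" for i :: nat by auto
    interpret r: arank MM rho by (rule arank_rho)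
    have eC: "emb a \<in> C" "emb b \<in> C" using ab by (auto simp: C_def)
    have iM: "un i j d \<in> MM" if "d \<in> C" for i j d by (rule rmat_un[OF C_sub]) (use that in auto)
    have "frm emb 2 2 Mx = (un 0 0 u + un 1 0 (emb a)) * un 0 0 u * (un 0 0 u + un 0 1 (emb b))"
    proof -
      have "frm emb 2 2 Mx = un 0 0 u + un 0 1 (emb b) + un 1 0 (emb a) + un 1 1 (emb a * emb b)"
        by (rule rfm_eqI) (auto simp: ent_frm ent_un Mx_def two emb_mult ab emb_zero u_def)
      moreover have "u * u = u" "u * emb b = emb b" "emb a * u = emb a" using u_unit eC u_in by auto
      ultimately show ?thesis by (simp add: algebra_simps un_mult_un)
    qed
    then have "rk 2 2 Mx \<le> rho (un 0 0 u)"
      using r.mult3_le[of "un 0 0 u + un 1 0 (emb a)" "un 0 0 u" "un 0 0 u + un 0 1 (emb b)"] rho_frm[OF Mx]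
        iM eC u_in r.closed(2) by simp
    then have 1: "l (frm psi 2 2 Mx) \<le> 1" using rho_one lrk[OF Mx] by simp
    let ?A = "psi a" and ?B = "psi b" and ?Q = "psi (a \<otimes>\<^bsub>R\<^esub> b)"
    have pin: "?A \<in> prod_alg R" "?B \<in> prod_alg R" "?Q \<in> prod_alg R" "?u \<in> prod_alg R"
      unfolding psi_def by (intro psi_p_in ab mult_in unit_p_in)+
    define df where "df = ?Q - ?A * ?B"
    have dfin: "df \<in> prod_alg R" unfolding df_def using pin subring_setD(3,5)[OF prod_alg_sub] by blast
    have f: "frm psi 2 2 Mx = un 0 0 ?u + un 0 1 ?B + un 1 0 ?A + un 1 1 ?Q"
      using psi_p_one[of R] psi_p_zero[of R]
      by (intro rfm_eqI) (auto simp: ent_frm ent_un Mx_def two psi_def)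
    define X where "X = un 0 0 ?u + un 1 1 ?u + un (1::nat) 0 (- ?A)"
    define V where "V = un 0 0 ?u + un 1 1 ?u + un 0 (1::nat) (- ?B)"
    have XV: "X * frm psi 2 2 Mx * V = un 0 0 ?u + un 1 1 df"
    proof -
      have "X * frm psi 2 2 Mx = un 0 0 ?u + un 0 1 ?B + un 1 1 df"
        unfolding f X_def by (intro rfm_eqI) (simp add: distrib_right ent_un_mult ent_un uu pin df_def)
      moreover have "(un 0 0 ?u + un 0 1 ?B + un 1 1 df) * V = un 0 0 ?u + un 1 1 df"
        unfolding V_def by (intro rfm_eqI) (simp add: distrib_right ent_un_mult ent_un uu pin dfin)
      ultimately show ?thesis by simp
    qed
    have "- ?A \<in> prod_alg R" "- ?B \<in> prod_alg R" using pin subring_setD(4)[OF prod_alg_sub] by blast+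
    then have XP: "X \<in> P" "V \<in> P" unfolding X_def V_def by (simp_all add: L.closed(2) inP pin)
    have "l (X * frm psi 2 2 Mx * V) \<le> l (frm psi 2 2 Mx)" by (rule L.mult3_le[OF XP(1) frmP[OF Mx] XP(2)])
    then have 2: "l (un 0 0 ?u + un 1 1 df) \<le> 1" using 1 unfolding XV by simp
    have "l (un 0 0 ?u + un 1 1 df) = l (un 0 0 ?u) + l (un 1 1 df)"
      by (rule L.orth_add[of _ _ "un 0 0 ?u" "un 0 0 ?u" "un 1 1 ?u" "un 1 1 ?u"])
        (use inP pin dfin uu in \<open>auto simp: un_mult_un\<close>)
    then have 3: "l (un 1 1 df) \<le> 0" using 2 lone by simp
    have "un (0::nat) 0 df = un 0 1 ?u * un 1 1 df * un 1 0 ?u" using uu dfin by (simp add: un_mult_un)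
    then have "l (un 0 0 df) \<le> l (un 1 1 df)"
      using L.mult3_le[OF inP[OF pin(4)] inP[OF dfin] inP[OF pin(4)], of 0 1 1 1 1 0] by simp
    then have "l (un 0 0 df) = 0" using 3 L.nonneg[OF inP[OF dfin], of 0 0] by simp
    then show ?thesis unfolding df_def .
  qed
  define qi where "qi = (\<lambda>d :: ('v, 'k) approximant \<Rightarrow> (nat \<times> nat, 'k) rfm. SOME y. y \<in> prod_alg R \<and> d * y * d = d)"
  have qi: "qi d \<in> prod_alg R \<and> d * qi d * d = d" if "d \<in> prod_alg R" for d
    using someI_ex[of "\<lambda>y. y \<in> prod_alg R \<and> d * y * d = d"] prod_alg_regular[OF that] unfolding qi_def by blast
  interpret cr: coded_regular R "prod_alg R" l ?u psi qi pr tag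
  proof (rule coded_regular.intro)
    show "arank (rmat UNIV UNIV (prod_alg R)) l" using arl unfolding P_def .
    show "l (un 0 0 (psi (a \<oplus>\<^bsub>R\<^esub> b) - (psi a + psi b))) = 0" if "a \<in> carrier R" "b \<in> carrier R" for a b
      unfolding psi_def psi_p_add[OF that] by (simp add: L.zero)
    show "psi \<one>\<^bsub>R\<^esub> = ?u" unfolding psi_def by (rule psi_p_one)
    show "psi a \<in> prod_alg R" if "a \<in> carrier R" for a unfolding psi_def by (rule psi_p_in[OF that])
    show "subring_set (prod_alg R)" by (rule prod_alg_sub)
    show "unit_p R \<in> prod_alg R" by (rule unit_p_in)
    show "unit_p R * d = d \<and> d * unit_p R = d" if "d \<in> prod_alg R" for d by (rule unit_p_unit[OF that])
  qed (use lone qi lmult add_in mult_in one_in pr_inj tag_inj in auto)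
  show ?thesis by (rule cr.regular) (rule lrk')
qed

section \<open>The crossed product\<close>

locale dyn =
  fixes X :: "'x topology" and T :: "'x \<Rightarrow> 'x"
    and rk :: "nat \<Rightarrow> nat \<Rightarrow> (nat \<Rightarrow> nat \<Rightarrow> (int \<Rightarrow> 'x \<Rightarrow> 'k::field)) \<Rightarrow> real"
  assumes td: "totally_disconnected_space X" and cpt: "compact_space X" and met: "metrizable_space X"
    and homeo: "homeomorphic_map X X T"
    and sylv: "sylvester_rank (crossed_product X T) rk"
begin

abbreviation "TX \<equiv> topspace X"
abbreviation "tp \<equiv> Tpow X T"
abbreviation "Tinv \<equiv> inv_into TX T"

lemma haus: "Hausdorff_space X" using met by (rule metrizable_imp_Hausdorff_space)

lemma T_cont: "continuous_map X X T" using homeo by (rule homeomorphic_imp_continuous_map)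

lemma T_in: "x \<in> TX ==> T x \<in> TX"
  using T_cont by (meson continuous_map_image_subset_topspace image_subset_iff)

lemma T_bij: "T ` TX = TX" "inj_on T TX"
  using homeo by (auto simp: homeomorphic_eq_everything_map)

lemma Tinv_T: "x \<in> TX ==> Tinv (T x) = x" using T_bij by simp

lemma T_Tinv: "x \<in> TX ==> T (Tinv x) = x" using T_bij by (simp add: f_inv_into_f)

lemma Tinv_in: "x \<in> TX ==> Tinv x \<in> TX" using T_bij by (metis inv_into_into)

lemma Tinv_cont: "continuous_map X X Tinv"
proof -
  obtain g where g: "homeomorphic_maps X X T g" using homeo by (auto simp: homeomorphic_map_maps)
  then have "g y = Tinv y" if "y \<in> TX" for y
    using that Tinv_T unfolding homeomorphic_maps_def
    by (metis continuous_map_image_subset_topspace image_subset_iff)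
  then show ?thesis using g continuous_map_eq unfolding homeomorphic_maps_def by metis
qed

lemma funpow_in: "(\<And>x. x \<in> TX ==> f x \<in> TX) ==> x \<in> TX ==> (f ^^ n) x \<in> TX"
  by (induction n) auto

lemma tp_in: "x \<in> TX ==> tp i x \<in> TX"
  using funpow_in[of T] funpow_in[of Tinv] T_in Tinv_in by (simp add: Tpow_def)

lemma tp_0 [simp]: "tp 0 x = x" by (simp add: Tpow_def)

lemma tp_Suc: "x \<in> TX ==> tp (i + 1) x = T (tp i x)"
proof (cases "0 \<le> i")
  case True
  then have "nat (i + 1) = Suc (nat i)" by simp
  then show ?thesis using True by (simp add: Tpow_def)
next
  case False
  assume x: "x \<in> TX"
  define n where "n = nat (- i - 1)"
  have n: "nat (- i) = Suc n" using False by (simp add: n_def)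
  have "T (tp i x) = T (Tinv ((Tinv ^^ n) x))" using False n by (simp add: Tpow_def)
  also have "\<dots> = (Tinv ^^ n) x" by (rule T_Tinv) (use funpow_in[of Tinv] Tinv_in x in auto)
  also have "\<dots> = tp (i + 1) x" using False by (auto simp: Tpow_def n_def)
  finally show ?thesis by simp
qed

lemma tp_pred: "x \<in> TX ==> tp (i - 1) x = Tinv (tp i x)"
  using tp_Suc[of x "i - 1"] Tinv_T[OF tp_in[of x "i - 1"]] by simp

lemma tp_add: "x \<in> TX ==> tp (i + j) x = tp i (tp j x)"
proof (induction i rule: int_induct[where k=0])
  case (step1 i)
  then show ?case using tp_Suc[of x "i + j"] tp_Suc[OF tp_in, of x i j] by (simp add: algebra_simps)
next
  case (step2 i)
  then show ?case using tp_pred[of x "i + j"] tp_pred[OF tp_in, of x i j] by (simp add: algebra_simps)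
qed simp

lemma tp_cancel [simp]: "x \<in> TX ==> tp i (tp (- i) x) = x" "x \<in> TX ==> tp (- i) (tp i x) = x"
  by (simp_all flip: tp_add)

lemma funpow_cont: "continuous_map X X f ==> continuous_map X X (f ^^ n)"
  by (induction n) (auto intro: continuous_map_compose simp: continuous_map_id)

lemma tp_cont: "continuous_map X X (tp i)"
  using funpow_cont[OF T_cont] funpow_cont[OF Tinv_cont] by (simp add: Tpow_def)

section \<open>Clopen sets and locally constant functions\<close>

definition clop :: "'x set \<Rightarrow> bool" where "clop U \<longleftrightarrow> openin X U \<and> closedin X U"

lemma clop_sub: "clop U ==> U \<subseteq> TX"
  by (simp add: clop_def openin_subset)

lemma clop_TX [simp]: "clop TX" and clop_empty [simp]: "clop {}"
  by (auto simp: clop_def)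

lemma clop_Int: "clop U ==> clop V ==> clop (U \<inter> V)"
  and clop_Un: "clop U ==> clop V ==> clop (U \<union> V)"
  and clop_Diff: "clop U ==> clop V ==> clop (U - V)"
  by (auto simp: clop_def openin_diff closedin_diff)

lemma clop_UN: "finite I ==> (\<And>i. i \<in> I ==> clop (U i)) ==> clop (\<Union>i\<in>I. U i)"
  by (induction I rule: finite_induct) (auto intro: clop_Un)

lemma clop_INT: "finite I ==> (\<And>i. i \<in> I ==> clop (U i)) ==> clop (TX \<inter> (\<Inter>i\<in>I. U i))"
proof (induction I rule: finite_induct)
  case (insert i I)
  have "TX \<inter> (\<Inter>i\<in>insert i I. U i) = U i \<inter> (TX \<inter> (\<Inter>i\<in>I. U i))" by auto
  then show ?case using insert by (metis clop_Int insertCI)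
qed simp

text \<open>The image of \<open>U\<close> under the \<open>i\<close>-th power of \<open>T\<close>,
  written as a preimage so that clopenness follows from continuity.\<close>

definition sh :: "int \<Rightarrow> 'x set \<Rightarrow> 'x set" where "sh i U = {x \<in> TX. tp (- i) x \<in> U}"

lemma clop_sh: "clop U ==> clop (sh i U)"
  unfolding clop_def sh_def
  using openin_continuous_map_preimage[OF tp_cont] closedin_continuous_map_preimage[OF tp_cont] by blast

lemma sh_sh: "sh i (sh j U) = sh (i + j) U"
  unfolding sh_def using tp_in by (auto simp: tp_add[symmetric] add.commute)

lemma sh_0: "U \<subseteq> TX ==> sh 0 U = U"
  by (auto simp: sh_def)

lemma sh_TX [simp]: "sh i TX = TX"
  using tp_in by (auto simp: sh_def)

lemma mem_sh: "x \<in> TX ==> tp i x \<in> sh j U \<longleftrightarrow> tp (i - j) x \<in> U"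
  using tp_in tp_add[of x "- j" i] by (simp add: sh_def)

text \<open>In a compact Hausdorff space a component and a closed set disjoint from it are separated
  by a clopen set, and here components are points.\<close>

lemma clop_base:
  assumes x: "x \<in> W" and W: "openin X W"
  obtains U where "clop U" "x \<in> U" "U \<subseteq> W"
proof -
  have xX: "x \<in> TX" using x W openin_subset by blast
  let ?C = "connected_component_of_set X x"
  have "?C \<subseteq> TX" "connectedin X ?C"
    by (auto simp: connected_component_of_subset_topspace connectedin_connected_component_of)
  then obtain a where "?C \<subseteq> {a}" using td unfolding totally_disconnected_space_def by blast
  moreover have "x \<in> ?C" using xX by (simp add: connected_component_of_refl)
  ultimately have C: "?C = {x}" by blast
  have "{x} \<in> connected_components_of X" using C xX by (auto simp: connected_components_of_def)
  then have "separated_between X {x} (TX - W)"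
    using separated_between_compact_connected_component[of X "{x}" "TX - W"] cpt haus x W xX
    by (auto simp: compact_imp_locally_compact_space disjnt_def)
  then obtain U where "closedin X U" "openin X U" "x \<in> U" "TX - W \<subseteq> TX - U"
    unfolding separated_between by auto
  then show ?thesis using that[of U] openin_subset[of X U] by (auto simp: clop_def)
qed

lemma clop_cover:
  assumes S: "closedin X S" and U: "\<And>x. x \<in> S ==> clop (U x) \<and> x \<in> U x"
  obtains P where "finite P" "P \<subseteq> S" "S \<subseteq> (\<Union>x\<in>P. U x)"
proof -
  have "compactin X S" using closedin_compact_space[OF cpt S] .
  moreover have "\<forall>V\<in>U ` S. openin X V" "S \<subseteq> \<Union>(U ` S)" using U by (auto simp: clop_def)
  ultimately obtain \<F> where F: "finite \<F>" "\<F> \<subseteq> U ` S" "S \<subseteq> \<Union>\<F>"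
    unfolding compactin_def by meson
  obtain P where "P \<subseteq> S" "finite P" "\<F> = U ` P" using finite_subset_image[OF F(1,2)] by auto
  then show ?thesis using that[of P] F(3) by auto
qed

abbreviation lc :: "('x \<Rightarrow> 'k) set" where "lc \<equiv> loc_const_fun X"

lemma lcD: "f \<in> lc ==> x \<in> TX ==> \<exists>U. clop U \<and> x \<in> U \<and> (\<forall>y\<in>U. f y = f x)"
proof -
  assume f: "f \<in> lc" "x \<in> TX"
  then obtain U where U: "openin X U" "x \<in> U" "\<forall>y\<in>U. f y = f x" unfolding loc_const_fun_def by blast
  then show ?thesis using clop_base[of x U] by (metis subsetD)
qed

lemma lc_out: "f \<in> lc ==> x \<notin> TX ==> f x = 0"
  by (simp add: loc_const_fun_def)

lemma lcI:
  assumes "\<And>x. x \<in> TX ==> \<exists>U. clop U \<and> x \<in> U \<and> (\<forall>y\<in>U. f y = f x)" "\<And>x. x \<notin> TX ==> f x = 0"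
  shows "f \<in> lc"
  using assms unfolding loc_const_fun_def clop_def by blast

lemma lc_0: "(\<lambda>x. 0) \<in> lc" by (rule lcI) (auto intro!: exI[of _ TX])

lemma lc_add: "f \<in> lc ==> g \<in> lc ==> (\<lambda>x. f x + g x) \<in> lc"
proof (rule lcI)
  fix x assume a: "f \<in> lc" "g \<in> lc" "x \<in> TX"
  obtain U where U: "clop U" "x \<in> U" "\<forall>y\<in>U. f y = f x" using lcD[OF a(1,3)] by blast
  obtain V where V: "clop V" "x \<in> V" "\<forall>y\<in>V. g y = g x" using lcD[OF a(2,3)] by blast
  show "\<exists>U. clop U \<and> x \<in> U \<and> (\<forall>y\<in>U. f y + g y = f x + g x)"
    by (intro exI[of _ "U \<inter> V"] conjI clop_Int ballI) (use U V in \<open>blast | metis IntD1 IntD2\<close>)+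
qed (simp add: lc_out)

lemma lc_uminus: "f \<in> lc ==> (\<lambda>x. - f x) \<in> lc"
proof (rule lcI)
  fix x assume f: "f \<in> lc" "x \<in> TX"
  obtain U where "clop U" "x \<in> U" "\<forall>y\<in>U. f y = f x" using lcD[OF f] by blast
  then show "\<exists>U. clop U \<and> x \<in> U \<and> (\<forall>y\<in>U. - f y = - f x)" by metis
qed (simp add: lc_out)

lemma lc_ind: "clop U ==> (\<lambda>x. if x \<in> U then c else 0) \<in> lc"
proof (rule lcI)
  fix x assume U: "clop U" and x: "x \<in> TX"
  show "\<exists>V. clop V \<and> x \<in> V \<and> (\<forall>y\<in>V. (if y \<in> U then c else 0) = (if x \<in> U then c else 0))"
  proof (cases "x \<in> U")
    case True
    then show ?thesis using U by (intro exI[of _ U]) auto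
  next
    case False
    then show ?thesis using U x clop_Diff[OF clop_TX U] by (intro exI[of _ "TX - U"]) auto
  qed
qed (auto dest: clop_sub)

lemma lc_mult_tp:
  assumes f: "f \<in> lc" and g: "g \<in> lc"
  shows "(\<lambda>x. f x * g (tp i x)) \<in> lc"
proof (rule lcI)
  fix x assume x: "x \<in> TX"
  obtain U where U: "clop U" "x \<in> U" "\<forall>y\<in>U. f y = f x" using lcD[OF f x] by blast
  obtain V where V: "clop V" "tp i x \<in> V" "\<forall>y\<in>V. g y = g (tp i x)" using lcD[OF g tp_in[OF x]] by blast
  have "tp i y \<in> V" if "y \<in> sh (- i) V" for y using that by (simp add: sh_def)
  moreover have "x \<in> sh (- i) V" using V x by (simp add: sh_def)
  ultimately show "\<exists>W. clop W \<and> x \<in> W \<and> (\<forall>y\<in>W. f y * g (tp i y) = f x * g (tp i x))"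
    by (intro exI[of _ "U \<inter> sh (- i) V"] conjI clop_Int clop_sh ballI) (use U V in \<open>blast | metis IntD1 IntD2\<close>)+
qed (simp add: lc_out[OF f])

lemma lc_sum: "finite I ==> (\<And>i. i \<in> I ==> f i \<in> lc) ==> (\<lambda>x. \<Sum>i\<in>I. f i x) \<in> lc"
  by (induction I rule: finite_induct) (auto intro: lc_add lc_0)

section \<open>The crossed product as matrices along orbits\<close>

abbreviation CP :: "(int \<Rightarrow> 'x \<Rightarrow> 'k) ring" where "CP \<equiv> crossed_product X T"

definition supp :: "(int \<Rightarrow> 'x \<Rightarrow> 'k) \<Rightarrow> int set" where "supp F = {i. F i \<noteq> (\<lambda>x. 0)}"

lemma carrier_CP: "F \<in> carrier CP \<longleftrightarrow> finite (supp F) \<and> (\<forall>i. F i \<in> lc)"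
  by (simp add: crossed_product_def supp_def)

lemma CP_simps: "\<zero>\<^bsub>CP\<^esub> = (\<lambda>i x. 0)" "\<one>\<^bsub>CP\<^esub> = (\<lambda>i x. if i = 0 \<and> x \<in> TX then 1 else 0)"
  "F \<oplus>\<^bsub>CP\<^esub> G = (\<lambda>i x. F i x + G i x)"
  "F \<otimes>\<^bsub>CP\<^esub> G = (\<lambda>n x. \<Sum>i\<in>supp F. F i x * G (n - i) (tp (- i) x))"
  by (simp_all add: crossed_product_def supp_def)

lemma supp_out: "i \<notin> supp F ==> F i x = 0"
  by (simp add: supp_def)

text \<open>The regular representation. Position \<open>(x, a)\<close> stands for the point
  \<open>tp a x\<close>, and \<open>f t^i\<close> has the entry \<open>f (tp a x)\<close> in row
  \<open>a\<close> and column \<open>a - i\<close>. The matrix is block diagonal in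
  \<open>x\<close>, and its rows are finite because supports are.\<close>

definition emb :: "(int \<Rightarrow> 'x \<Rightarrow> 'k) \<Rightarrow> ('x \<times> int, 'k) rfm" where
  "emb F = Rfm (\<lambda>(x, a) (y, b). if x = y \<and> x \<in> TX then F (a - b) (tp a x) else 0)"

lemma ent_emb:
  assumes "finite (supp F)"
  shows "ent (emb F) (x, a) (y, b) = (if x = y \<and> x \<in> TX then F (a - b) (tp a x) else 0)"
proof -
  have "finite {z. (case z of (y, b) \<Rightarrow> if x = y \<and> x \<in> TX then F (a - b) (tp a x) else 0) \<noteq> 0}" for x a
  proof (rule finite_subset)
    show "{z. (case z of (y, b) \<Rightarrow> if x = y \<and> x \<in> TX then F (a - b) (tp a x) else 0) \<noteq> 0}
       \<subseteq> {x} \<times> (\<lambda>i. a - i) ` supp F"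
    proof
      fix z assume z: "z \<in> {z. (case z of (y, b) \<Rightarrow> if x = y \<and> x \<in> TX then F (a - b) (tp a x) else 0) \<noteq> 0}"
      obtain y b where yb: "z = (y, b)" by (cases z)
      with z have "y = x" "F (a - b) (tp a x) \<noteq> 0" by (auto split: if_splits)
      then have "a - b \<in> supp F" using supp_out by metis
      then have "b \<in> (\<lambda>i. a - i) ` supp F" by (intro image_eqI[of _ _ "a - b"]) auto
      then show "z \<in> {x} \<times> (\<lambda>i. a - i) ` supp F" using yb \<open>y = x\<close> by simp
    qed
  qed (use assms in auto)
  then show ?thesis unfolding emb_def by (subst ent_Rfm) (auto simp: case_prod_unfold)
qed

lemma supp_add: "supp (\<lambda>i x. F i x + G i x) \<subseteq> supp F \<union> supp G"
  by (auto simp: supp_def)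

lemma CP_add: "F \<in> carrier CP ==> G \<in> carrier CP ==> F \<oplus>\<^bsub>CP\<^esub> G \<in> carrier CP"
  unfolding CP_simps carrier_CP using finite_subset[OF supp_add] by (auto intro: lc_add)

lemma CP_mult:
  assumes F: "F \<in> carrier CP" and G: "G \<in> carrier CP"
  shows "F \<otimes>\<^bsub>CP\<^esub> G \<in> carrier CP"
  unfolding CP_simps carrier_CP
proof
  have f: "finite (supp F)" "finite (supp G)" using F G by (auto simp: carrier_CP)
  show "finite (supp (\<lambda>n x. \<Sum>i\<in>supp F. F i x * G (n - i) (tp (- i) x)))"
  proof (rule finite_subset)
    show "supp (\<lambda>n x. \<Sum>i\<in>supp F. F i x * G (n - i) (tp (- i) x)) \<subseteq> (\<lambda>(i, j). i + j) ` (supp F \<times> supp G)"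
    proof
      fix n assume "n \<in> supp (\<lambda>n x. \<Sum>i\<in>supp F. F i x * G (n - i) (tp (- i) x))"
      then obtain x where "(\<Sum>i\<in>supp F. F i x * G (n - i) (tp (- i) x)) \<noteq> 0" by (auto simp: supp_def)
      then obtain i where i: "i \<in> supp F" "F i x * G (n - i) (tp (- i) x) \<noteq> 0"
        by (meson sum.not_neutral_contains_not_neutral)
      then have "n - i \<in> supp G" using supp_out[of "n - i" G] by auto
      then show "n \<in> (\<lambda>(i, j). i + j) ` (supp F \<times> supp G)"
        using i by (intro image_eqI[of _ _ "(i, n - i)"]) auto
    qed
  qed (use f in auto)
  show "\<forall>n. (\<lambda>x. \<Sum>i\<in>supp F. F i x * G (n - i) (tp (- i) x)) \<in> lc"
    using f F G by (intro allI lc_sum lc_mult_tp) (auto simp: carrier_CP)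
qed

lemma emb_ring_CP: "emb_ring CP emb"
proof
  show "\<zero>\<^bsub>CP\<^esub> \<in> carrier CP" by (simp add: CP_simps carrier_CP supp_def lc_0)
  have fz: "finite (supp (\<lambda>i x. 0))" by (simp add: supp_def)
  show "emb \<zero>\<^bsub>CP\<^esub> = 0" by (rule rfm_eqI) (auto simp: CP_simps ent_emb[OF fz])
  have "supp (\<lambda>i x. if i = 0 \<and> x \<in> TX then 1 else 0) \<subseteq> {0}" by (auto simp: supp_def)
  then have f1: "finite (supp \<one>\<^bsub>CP\<^esub>)" unfolding CP_simps by (rule finite_subset) simp
  have "(\<lambda>x. if i = 0 \<and> x \<in> TX then 1 else 0) \<in> lc" for i :: int
    using lc_ind[OF clop_TX, of 1] lc_0 by (cases "i = 0") auto
  then show one: "\<one>\<^bsub>CP\<^esub> \<in> carrier CP" using f1 unfolding carrier_CP by (simp add: CP_simps)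
  show "F \<oplus>\<^bsub>CP\<^esub> G \<in> carrier CP" if "F \<in> carrier CP" "G \<in> carrier CP" for F G by (rule CP_add[OF that])
  show "F \<otimes>\<^bsub>CP\<^esub> G \<in> carrier CP" if "F \<in> carrier CP" "G \<in> carrier CP" for F G by (rule CP_mult[OF that])
  show "emb (F \<oplus>\<^bsub>CP\<^esub> G) = emb F + emb G" if F: "F \<in> carrier CP" and G: "G \<in> carrier CP" for F G
  proof -
    have "finite (supp (F \<oplus>\<^bsub>CP\<^esub> G))" "finite (supp F)" "finite (supp G)"
      using CP_add[OF F G] F G by (auto simp: carrier_CP)
    note e = this[THEN ent_emb]
    show ?thesis
    proof (rule rfm_eqI)
      fix z w :: "'x \<times> int"
      obtain x a y b where z: "z = (x, a)" "w = (y, b)" by (cases z, cases w) auto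
      show "ent (emb (F \<oplus>\<^bsub>CP\<^esub> G)) z w = ent (emb F + emb G) z w"
        unfolding z ent_add e by (auto simp: CP_simps)
    qed
  qed
  show mult: "emb (F \<otimes>\<^bsub>CP\<^esub> G) = emb F * emb G" if F: "F \<in> carrier CP" and G: "G \<in> carrier CP" for F G
  proof (rule rfm_eqI)
    fix z w :: "'x \<times> int"
    obtain x a y c where z: "z = (x, a)" "w = (y, c)" by (cases z, cases w) auto
    have f: "finite (supp (F \<otimes>\<^bsub>CP\<^esub> G))" "finite (supp F)" "finite (supp G)"
      using CP_mult[OF F G] F G by (auto simp: carrier_CP)
    note e = f[THEN ent_emb]
    let ?J = "(\<lambda>i. (x, a - i)) ` supp F"
    have "ent (emb F * emb G) z w = (\<Sum>j\<in>?J. ent (emb F) z j * ent (emb G) j w)"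
    proof (rule ent_mult)
      show "finite ?J" using f by simp
      fix j assume j: "j \<notin> ?J"
      obtain y' b where jb: "j = (y', b)" by (cases j)
      have "a - b \<notin> supp F" if "y' = x" using j jb that by (auto simp: image_iff)
      then have "ent (emb F) z j = 0" using supp_out[of "a - b" F] by (auto simp: e z jb)
      then show "ent (emb F) z j * ent (emb G) j w = 0" by simp
    qed
    also have "\<dots> = (\<Sum>i\<in>supp F. ent (emb F) z (x, a - i) * ent (emb G) (x, a - i) w)"
      by (subst sum.reindex) (auto simp: inj_on_def)
    also have "\<dots> = ent (emb (F \<otimes>\<^bsub>CP\<^esub> G)) z w"
    proof (cases "x = y \<and> x \<in> TX")
      case True
      have "tp (a - i) x = tp (- i) (tp a x)" for i using tp_add[of x "- i" a] conjunct2[OF True] by simp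
      then show ?thesis using True unfolding z e by (simp add: CP_simps algebra_simps)
    next
      case False
      then show ?thesis unfolding z e by (auto intro!: sum.neutral)
    qed
    finally show "ent (emb (F \<otimes>\<^bsub>CP\<^esub> G)) z w = ent (emb F * emb G) z w" by simp
  qed
  show "\<exists>G\<in>carrier CP. emb G = - emb F" if F: "F \<in> carrier CP" for F
  proof
    have s: "supp (\<lambda>i x. - F i x) = supp F" by (auto simp: supp_def fun_eq_iff)
    show "(\<lambda>i x. - F i x) \<in> carrier CP" using F by (auto simp: carrier_CP s lc_uminus)
    have "finite (supp F)" "finite (supp (\<lambda>i x. - F i x))" using F by (auto simp: carrier_CP s)
    note e = this[THEN ent_emb]
    show "emb (\<lambda>i x. - F i x) = - emb F" by (rule rfm_eqI) (auto simp: e)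
  qed
  show "inj_on emb (carrier CP)"
  proof (rule inj_onI)
    fix F G assume F: "F \<in> carrier CP" and G: "G \<in> carrier CP" and eq: "emb F = emb G"
    have "finite (supp F)" "finite (supp G)" using F G by (auto simp: carrier_CP)
    note e = this[THEN ent_emb]
    have "F n x = G n x" for n x
    proof (cases "x \<in> TX")
      case True
      have "ent (emb F) (x, 0) (x, - n) = ent (emb G) (x, 0) (x, - n)" using eq by simp
      then show ?thesis using True by (simp add: e)
    next
      case False
      have "F n \<in> lc" "G n \<in> lc" using F G by (auto simp: carrier_CP)
      then show ?thesis using lc_out[OF _ False] by metis
    qed
    then show "F = G" by blast
  qed
  show "emb \<one>\<^bsub>CP\<^esub> * emb F = emb F \<and> emb F * emb \<one>\<^bsub>CP\<^esub> = emb F" if F: "F \<in> carrier CP" for F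
  proof -
    have s1: "supp \<one>\<^bsub>CP\<^esub> \<subseteq> {0}" by (auto simp: supp_def CP_simps)
    have o: "F i x = 0" if "x \<notin> TX" for i x using lc_out that F by (auto simp: carrier_CP)
    have "\<one>\<^bsub>CP\<^esub> \<otimes>\<^bsub>CP\<^esub> F = F"
    proof (intro ext)
      fix n x
      have "(\<one>\<^bsub>CP\<^esub> \<otimes>\<^bsub>CP\<^esub> F) n x = (\<Sum>i\<in>{0}. \<one>\<^bsub>CP\<^esub> i x * F (n - i) (tp (- i) x))"
        unfolding CP_simps(4) by (rule sum.mono_neutral_left) (use s1 supp_out[of _ "\<one>\<^bsub>CP\<^esub>"] in auto)
      also have "\<dots> = F n x" using o by (auto simp: CP_simps)
      finally show "(\<one>\<^bsub>CP\<^esub> \<otimes>\<^bsub>CP\<^esub> F) n x = F n x" .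
    qed
    moreover have "F \<otimes>\<^bsub>CP\<^esub> \<one>\<^bsub>CP\<^esub> = F"
    proof (intro ext)
      fix n x
      have "(\<Sum>i\<in>supp F. F i x * \<one>\<^bsub>CP\<^esub> (n - i) (tp (- i) x)) = (\<Sum>i\<in>supp F. if i = n then F n x else 0)"
        by (rule sum.cong) (use o tp_in in \<open>auto simp: CP_simps\<close>)
      also have "\<dots> = F n x" using F supp_out by (auto simp: carrier_CP)
      finally show "(F \<otimes>\<^bsub>CP\<^esub> \<one>\<^bsub>CP\<^esub>) n x = F n x" by (simp add: CP_simps(4))
    qed
    ultimately show ?thesis using mult[OF one F] mult[OF F one] by simp
  qed
qed

sublocale syl CP emb rk
  using emb_ring_CP sylv by (simp add: syl_def syl_axioms_def)

text \<open>The monomials \<open>c 1_U t^n\<close>, which for clopen \<open>U\<close> span the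
  algebra additively.\<close>

definition gF :: "'x set \<Rightarrow> int \<Rightarrow> 'k \<Rightarrow> int \<Rightarrow> 'x \<Rightarrow> 'k" where
  "gF U n c = (\<lambda>i x. if i = n \<and> x \<in> U then c else 0)"

definition gn :: "'x set \<Rightarrow> int \<Rightarrow> 'k \<Rightarrow> ('x \<times> int, 'k) rfm" where "gn U n c = emb (gF U n c)"

lemma gF_supp: "finite (supp (gF U n c))"
  by (rule finite_subset[of _ "{n}"]) (auto simp: supp_def gF_def)

lemma gn_in: "clop U ==> gn U n c \<in> C"
proof -
  assume U: "clop U"
  have "gF U n c i \<in> lc" for i using lc_ind[OF U, of c] lc_0 by (cases "i = n") (auto simp: gF_def)
  then have "gF U n c \<in> carrier CP" using gF_supp by (simp add: carrier_CP)
  then show ?thesis by (simp add: gn_def C_def)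
qed

lemma ent_gn: "ent (gn U n c) (x, a) (y, b) = (if x = y \<and> x \<in> TX \<and> a - b = n \<and> tp a x \<in> U then c else 0)"
  unfolding gn_def ent_emb[OF gF_supp] by (auto simp: gF_def)

lemma ent_gn_mult: "ent (gn U n c * M) (x, a) z = (if x \<in> TX \<and> tp a x \<in> U then c * ent M (x, a - n) z else 0)"
  by (subst ent_mult[of "{(x, a - n)}"]) (auto simp: ent_gn split: if_splits)

lemma gn_mult: "gn U n c * gn V m d = gn (U \<inter> sh n V) (n + m) (c * d)"
proof (rule rfm_eqI)
  fix z w :: "'x \<times> int"
  obtain x a y b where z: "z = (x, a)" "w = (y, b)" by (cases z, cases w) auto
  show "ent (gn U n c * gn V m d) z w = ent (gn (U \<inter> sh n V) (n + m) (c * d)) z w"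
    using mem_sh[of x a n V] by (auto simp: z ent_gn_mult ent_gn)
qed

lemma gn_add: "gn U n (c + d) = gn U n c + gn U n d"
  by (rule rfm_eqI) (auto simp: ent_gn)

lemma gn_0 [simp]: "gn U n 0 = 0" "gn {} n c = 0"
  by (auto intro!: rfm_eqI simp: ent_gn)

lemma gn_Un: "U \<inter> V = {} ==> gn (U \<union> V) n c = gn U n c + gn V n c"
  by (rule rfm_eqI) (auto simp: ent_gn)

lemma u_gn: "u = gn TX 0 1"
proof -
  have "finite (supp \<one>\<^bsub>CP\<^esub>)" using one_in by (simp add: carrier_CP)
  note e = this[THEN ent_emb]
  show ?thesis unfolding u_def
  proof (rule rfm_eqI)
    fix z w :: "'x \<times> int"
    obtain x a y b where z: "z = (x, a)" "w = (y, b)" by (cases z, cases w) auto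
    show "ent (emb \<one>\<^bsub>CP\<^esub>) z w = ent (gn TX 0 1) z w"
      unfolding z e ent_gn by (auto simp: CP_simps tp_in)
  qed
qed

end

section \<open>The rank concentrated at an invariant closed set\<close>

text \<open>The common setting of \<open>rho\<close> and of its localization at an invariant set:
  entries from a ring with unit \<open>u\<close>, but a rank known through the axioms of
  \<open>arank\<close> only.\<close>

locale mrank = arank "rmat UNIV UNIV C" r for C :: "'r::ring set" and r :: "(nat, 'r) rfm \<Rightarrow> real" +
  fixes u :: 'r
  assumes C_sub: "subring_set C" and u_in: "u \<in> C" and u_unit: "a \<in> C ==> u * a = a" "a \<in> C ==> a * u = a"
begin

abbreviation MM :: "(nat, 'r) rfm set" where "MM \<equiv> rmat UNIV UNIV C"

lemma dg_unit:
  assumes "x \<in> MM" "\<forall>i j. N \<le> i \<or> N \<le> j --> ent x i j = 0"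
  shows "dg {..<N} u * x = x" "x * dg {..<N} u = x"
  using assms(2) u_unit[OF rmat_entry[OF assms(1)]]
  by (auto intro!: rfm_eqI simp: ent_dg_mult ent_mult_dg not_less)

lemma dg_u_in: "finite J ==> dg J u \<in> MM"
  by (rule rmat_dg[OF C_sub]) (use u_in in auto)

lemma nat_bound: "x \<in> MM ==> \<exists>N. \<forall>i j. N \<le> i \<or> N \<le> j --> ent x i j = 0"
  using rmat_nat_bound by metis

lemma r_uminus: "x \<in> MM ==> r (- x) = r x"
proof -
  assume x: "x \<in> MM"
  then obtain N where "\<forall>i j. N \<le> i \<or> N \<le> j --> ent x i j = 0" using nat_bound by blast
  from dg_unit(1)[OF x this] show ?thesis using rho_minus[OF x dg_u_in] by blast
qed

definition eq0 where "eq0 x y \<longleftrightarrow> x \<in> MM \<and> y \<in> MM \<and> r (x - y) = 0"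

lemma eq0_refl: "x \<in> MM ==> eq0 x x" by (simp add: eq0_def zero)

lemma eq0_sym: "eq0 x y ==> eq0 y x"
  using r_uminus[of "x - y"] closed(5)[of x y] by (simp add: eq0_def)

lemma eq0_add: "eq0 x x' ==> eq0 y y' ==> eq0 (x + y) (x' + y')"
proof -
  assume a: "eq0 x x'" "eq0 y y'"
  have e: "x + y - (x' + y') = (x - x') + (y - y')" by simp
  have "r (x + y - (x' + y')) \<le> 0"
    unfolding e using a add_le[of "x - x'" "y - y'"] closed(5) by (simp add: eq0_def)
  then show ?thesis using a nonneg[of "x + y - (x' + y')"] closed(2,5) by (simp add: eq0_def)
qed

lemma eq0_mult: "eq0 x x' ==> eq0 y y' ==> eq0 (x * y) (x' * y')"
proof -
  assume a: "eq0 x x'" "eq0 y y'"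
  have m: "x \<in> MM" "x' \<in> MM" "y \<in> MM" "y' \<in> MM" using a by (auto simp: eq0_def)
  have "x * y - x' * y' = (x - x') * y + x' * (y - y')" by (simp add: algebra_simps)
  moreover have "r ((x - x') * y) \<le> 0" using mult_le_left[of "x - x'" y] a m closed(5) by (simp add: eq0_def)
  moreover have "r (x' * (y - y')) \<le> 0" using mult_le_right[of x' "y - y'"] a m closed(5) by (simp add: eq0_def)
  moreover have "(x - x') * y \<in> MM" "x' * (y - y') \<in> MM" "x * y - x' * y' \<in> MM" using m closed(3,5) by simp_all
  ultimately show ?thesis using add_le[of "(x - x') * y" "x' * (y - y')"] nonneg[of "x * y - x' * y'"] m closed(3)
    by (simp add: eq0_def)
qed

lemma eq0_trans: "eq0 x y ==> eq0 y z ==> eq0 x z"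
proof -
  assume a: "eq0 x y" "eq0 y z"
  have m: "x \<in> MM" "y \<in> MM" "z \<in> MM" using a by (auto simp: eq0_def)
  have e: "x - z = (x - y) + (y - z)" by simp
  have "r (x - z) \<le> 0" unfolding e using a add_le[of "x - y" "y - z"] m closed(5) by (simp add: eq0_def)
  then show ?thesis using m nonneg[of "x - z"] closed(5) by (simp add: eq0_def)
qed

lemma eq0_r: "eq0 x y ==> r x = r y"
proof -
  have le: "r x \<le> r y" if "eq0 x y" for x y
    using that add_le[of y "x - y"] closed(5)[of x y] by (simp add: eq0_def)
  show "eq0 x y ==> r x = r y" using le[of x y] le[of y x] eq0_sym[of x y] by simp
qed

text \<open>The counterpart of \<open>rho_block\<close>, derived from \<open>tri\<close> with the
  local units \<open>?U\<close> and \<open>?S * ?T\<close> for the two blocks.\<close>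

lemma block:
  assumes m: "a \<in> MM" "b \<in> MM" "c \<in> MM"
    and N: "\<forall>i j. N \<le> i \<or> N \<le> j --> ent a i j = 0" "\<forall>i j. N \<le> i \<or> N \<le> j --> ent b i j = 0"
      "\<forall>i j. N \<le> i \<or> N \<le> j --> ent c i j = 0"
  shows "r a + r b \<le> r (a + c * sft 0 N N u + sft N 0 N u * b * sft 0 N N u)"
proof -
  let ?S = "sft N 0 N u" and ?T = "sft 0 N N u" and ?U = "dg {..<N} u"
  have s: "sft x y N u \<in> MM" for x y by (rule sft_rmat[OF C_sub u_in])
  have uu: "u * u = u" using u_unit u_in by blast
  define b' where "b' = ?S * b * ?T"
  define c' where "c' = c * ?T"
  have m': "b' \<in> MM" "c' \<in> MM" unfolding b'_def c'_def using m s closed(3) by simp_all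
  have TS: "?T * ?S = ?U" using uu by (auto intro!: rfm_eqI simp: ent_sft_mult ent_sft ent_dg)
  have UT: "?U * ?T = ?T" "?S * ?U = ?S" using uu
    by (auto intro!: rfm_eqI simp: ent_dg_mult ent_mult_dg ent_sft)
  have z: "?T * ?U = 0" "?U * ?S = 0" by (auto intro!: rfm_eqI simp: ent_dg_mult ent_mult_dg ent_sft)
  have U: "?U * a = a" "a * ?U = a" "?U * b = b" "b * ?U = b" "?U * c = c" "c * ?U = c"
    using dg_unit m N by auto
  have Ta: "?T * a = 0" "?T * c = 0" using N by (auto intro!: rfm_eqI simp: ent_sft_mult)
  have aS: "a * ?S = 0" using N by (auto intro!: rfm_eqI simp: ent_mult_sft)
  have "?T * b' * ?S = ?U * b * ?U" unfolding b'_def using TS by (simp add: mult.assoc) (simp add: mult.assoc[symmetric])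
  then have Tb: "?T * b' * ?S = b" by (simp add: U)
  have rb: "r b \<le> r b'" using mult3_le[of ?T b' ?S] s m' by (simp add: Tb)
  have "r a + r b' \<le> r (a + b' + c')"
  proof (rule tri[of _ _ _ ?U ?U "?S * ?T" "?S * ?T"])
    show "?U * b' = 0" "b' * ?U = 0" "c' * ?U = 0"
      unfolding b'_def c'_def by (simp_all add: mult.assoc z) (simp add: mult.assoc[symmetric] z)
    show "?U * c' = c'" unfolding c'_def by (simp add: mult.assoc[symmetric] U)
    have "?S * ?T * b' = ?S * (?T * ?S) * b * ?T" unfolding b'_def by (simp add: mult.assoc)
    also have "\<dots> = b'" unfolding TS b'_def by (simp add: UT)
    finally show "?S * ?T * b' = b'" .
    have "b' * (?S * ?T) = ?S * b * (?T * ?S) * ?T" unfolding b'_def by (simp add: mult.assoc)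
    also have "\<dots> = ?S * (b * ?U) * ?T" unfolding TS by (simp add: mult.assoc)
    finally show "b' * (?S * ?T) = b'" by (simp add: U b'_def)
    have "c' * (?S * ?T) = c * (?T * ?S) * ?T" unfolding c'_def by (simp add: mult.assoc)
    then show "c' * (?S * ?T) = c'" unfolding TS by (simp add: U c'_def)
    show "?S * ?T * a = 0" by (simp add: mult.assoc Ta)
    show "?S * ?T * c' = 0" unfolding c'_def by (simp add: mult.assoc) (simp add: mult.assoc[symmetric] Ta mult.assoc)
    show "a * (?S * ?T) = 0" by (simp add: mult.assoc[symmetric] aS)
    show "?U * a = a" "a * ?U = a" by (fact U)+
    show "?S * ?T \<in> MM" "?S * ?T \<in> MM" using s closed(3) by simp_all
  qed (use m m' dg_u_in in auto)
  then show ?thesis using rb by (simp add: b'_def c'_def algebra_simps)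
qed

text \<open>Since \<open>h\<close> respects products only up to rank zero, images of local units are
  no longer exact local units and \<open>tri\<close> does not apply to them. They are used instead
  to multiply the image into exact block positions, with an error of rank zero; then
  \<open>block\<close> applies.\<close>

lemma pullback_null:
  assumes D: "subring_set D" and h: "\<And>a. a \<in> D ==> h a \<in> MM"
    and hadd: "\<And>a b. a \<in> D ==> b \<in> D ==> eq0 (h (a + b)) (h a + h b)"
    and hmult: "\<And>a b. a \<in> D ==> b \<in> D ==> eq0 (h (a * b)) (h a * h b)"
  shows "arank D (\<lambda>a. r (h a))"
proof
  note D' = subring_setD[OF D]
  have h0: "eq0 (h 0) 0"
  proof -
    have "eq0 (h 0 + - h 0) (h 0 + h 0 + - h 0)"
      by (rule eq0_add) (use hadd[of 0 0] D'(1) h closed(4) in \<open>auto intro: eq0_refl\<close>)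
    then show ?thesis using eq0_sym by simp
  qed
  show "subring_set D" by fact
  show "0 \<le> r (h a)" if "a \<in> D" for a using that h nonneg by blast
  show "r (h 0) = 0" using eq0_r[OF h0] zero by simp
  show "r (h (a * b)) \<le> r (h a)" "r (h (a * b)) \<le> r (h b)" if "a \<in> D" "b \<in> D" for a b
    using eq0_r[OF hmult[OF that]] mult_le_left mult_le_right h that by auto
  show "r (h (a + b)) \<le> r (h a) + r (h b)" if "a \<in> D" "b \<in> D" for a b
    using eq0_r[OF hadd[OF that]] add_le h that by auto
  fix a b c e e' f f'
  assume m: "a \<in> D" "b \<in> D" "c \<in> D" "e \<in> D" "e' \<in> D" "f \<in> D" "f' \<in> D"
    and R: "e * a = a" "a * e' = a" "f * b = b" "b * f' = b" "e * c = c" "c * f' = c"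
       "e * b = 0" "f * a = 0" "f * c = 0" "a * f' = 0" "b * e' = 0" "c * e' = 0"
  have hm: "h a \<in> MM" "h b \<in> MM" "h c \<in> MM" "h e \<in> MM" "h e' \<in> MM" "h f \<in> MM" "h f' \<in> MM" using m h by auto
  have P: "eq0 (h e * h a) (h a)" "eq0 (h a * h e') (h a)" "eq0 (h f * h b) (h b)" "eq0 (h b * h f') (h b)"
    "eq0 (h e * h c) (h c)" "eq0 (h c * h f') (h c)"
    using hmult[THEN eq0_sym] m R by metis+
  have Z: "eq0 (h e * h b) 0" "eq0 (h f * h a) 0" "eq0 (h f * h c) 0" "eq0 (h a * h f') 0" "eq0 (h b * h e') 0" "eq0 (h c * h e') 0"
    using hmult[THEN eq0_sym, THEN eq0_trans] h0 m R by metis+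
  obtain N1 where N1: "\<forall>i j. N1 \<le> i \<or> N1 \<le> j --> ent (h a) i j = 0" using nat_bound[OF hm(1)] by blast
  obtain N2 where N2: "\<forall>i j. N2 \<le> i \<or> N2 \<le> j --> ent (h b) i j = 0" using nat_bound[OF hm(2)] by blast
  obtain N3 where N3: "\<forall>i j. N3 \<le> i \<or> N3 \<le> j --> ent (h c) i j = 0" using nat_bound[OF hm(3)] by blast
  define N where "N = max N1 (max N2 N3)"
  have N: "\<forall>i j. N \<le> i \<or> N \<le> j --> ent (h a) i j = 0" "\<forall>i j. N \<le> i \<or> N \<le> j --> ent (h b) i j = 0"
      "\<forall>i j. N \<le> i \<or> N \<le> j --> ent (h c) i j = 0" using N1 N2 N3 by (auto simp: N_def)
  let ?S = "sft N 0 N u" and ?T = "sft 0 N N u"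
  have s: "?S \<in> MM" "?T \<in> MM" by (rule sft_rmat[OF C_sub u_in])+
  define Y where "Y = h a + h b + h c"
  have YM: "Y \<in> MM" unfolding Y_def using hm closed(2) by simp
  have ab: "a + b \<in> D" using m D'(2) by blast
  have YZ: "eq0 (h (a + b + c)) Y"
    unfolding Y_def by (rule eq0_trans[OF hadd[OF ab m(3)]], rule eq0_add[OF hadd[OF m(1,2)] eq0_refl[OF hm(3)]])
  have 1: "eq0 (h e * Y) (h a + 0 + h c)"
    unfolding Y_def distrib_left by (intro eq0_add P Z)
  have 2: "eq0 (h f * Y) (0 + h b + 0)"
    unfolding Y_def distrib_left by (intro eq0_add P Z)
  \<comment> \<open>The left factor stacks the rows of \<open>a + c\<close> above those of
    \<open>b\<close>, the latter moved down by \<open>N\<close>.\<close>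
  have 3: "eq0 ((h e + ?S * h f) * Y) ((h a + 0 + h c) + ?S * (0 + h b + 0))"
    unfolding distrib_right[of "h e"] mult.assoc by (intro eq0_add eq0_mult 1 2 eq0_refl s)
  have 4: "eq0 ((h a + h c + ?S * h b) * h e') (h a + 0 + ?S * 0)"
    unfolding distrib_right mult.assoc by (intro eq0_add eq0_mult P Z eq0_refl s)
  have 5: "eq0 ((h a + h c + ?S * h b) * h f') (0 + h c + ?S * h b)"
    unfolding distrib_right mult.assoc by (intro eq0_add eq0_mult P Z eq0_refl s)
  have 6: "eq0 ((h a + h c + ?S * h b) * (h e' + h f' * ?T)) (h a + 0 + ?S * 0 + (0 + h c + ?S * h b) * ?T)"
    unfolding distrib_left[of _ "h e'"] mult.assoc[symmetric] by (intro eq0_add eq0_mult 4 5 eq0_refl s)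
  have em: "h e' + h f' * ?T \<in> MM" using hm s closed(2,3) by simp
  have "eq0 ((h e + ?S * h f) * Y * (h e' + h f' * ?T)) ((h a + h c + ?S * h b) * (h e' + h f' * ?T))"
    by (rule eq0_mult[OF _ eq0_refl[OF em]]) (use 3 in simp)
  from eq0_r[OF eq0_trans[OF this 6]]
  have "r (h a + h c * ?T + ?S * h b * ?T) = r ((h e + ?S * h f) * Y * (h e' + h f' * ?T))"
    by (simp add: algebra_simps)
  also have "\<dots> \<le> r Y"
    by (rule mult3_le) (use hm s YM em closed(2,3) in auto)
  also have "\<dots> = r (h (a + b + c))" using eq0_r[OF YZ] by simp
  finally show "r (h a) + r (h b) \<le> r (h (a + b + c))" using block[OF hm(1-3) N] by simp
qed

end

context dyn
begin

lemma mrank_rho: "mrank C rho u"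
  unfolding mrank_def mrank_axioms_def using arank_rho C_sub u_in u_unit by blast

text \<open>The cut to \<open>V\<close> as an infinite diagonal: it multiplies matrices of every
  size, and for clopen \<open>V\<close> its products with members of \<open>MM\<close> are again in
  \<open>MM\<close>.\<close>

definition chi :: "'x set \<Rightarrow> (nat, ('x \<times> int, 'k) rfm) rfm" where "chi V = dg UNIV (gn V 0 1)"

lemma ent_chi_mult: "ent (chi V * M) i j = gn V 0 1 * ent M i j"
  by (simp add: chi_def ent_dg_mult)

lemma ent_mult_chi: "ent (M * chi V) i j = ent M i j * gn V 0 1"
  by (simp add: chi_def ent_mult_dg)

lemma C_block: "a \<in> C ==> ent a (x, p) (y, q) \<noteq> 0 ==> x = y \<and> x \<in> TX"
proof -
  assume a: "a \<in> C" "ent a (x, p) (y, q) \<noteq> 0"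
  then obtain F where F: "F \<in> carrier CP" "a = emb F" by (auto simp: C_def)
  then have "finite (supp F)" by (simp add: carrier_CP)
  then show ?thesis using a(2) unfolding F(2) by (auto simp: ent_emb split: if_splits)
qed

text \<open>Only finitely many powers of \<open>t\<close> occur, so each row reaches columns at
  bounded distance along the orbit. This bound controls all boundary effects below.\<close>

lemma C_deg: "a \<in> C ==> \<exists>D::nat. \<forall>x p y q. ent a (x, p) (y, q) \<noteq> 0 --> \<bar>p - q\<bar> \<le> int D"
proof -
  assume a: "a \<in> C"
  then obtain F where F: "F \<in> carrier CP" "a = emb F" by (auto simp: C_def)
  then have f: "finite (supp F)" by (simp add: carrier_CP)
  then obtain D where D: "\<forall>i\<in>supp F. nat \<bar>i\<bar> \<le> D"
    using finite_nat_set_iff_bounded_le[of "(\<lambda>i. nat \<bar>i\<bar>) ` supp F"] by auto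
  have "\<bar>p - q\<bar> \<le> int D" if "ent a (x, p) (y, q) \<noteq> 0" for x p y q
  proof -
    have "F (p - q) (tp p x) \<noteq> 0" using that f unfolding F(2) by (auto simp: ent_emb split: if_splits)
    then have "p - q \<in> supp F" using supp_out by metis
    then show ?thesis using D by fastforce
  qed
  then show ?thesis by blast
qed

lemma MM_deg:
  assumes M: "M \<in> MM"
  shows "\<exists>D::nat. \<forall>i j x p y q. ent (ent M i j) (x, p) (y, q) \<noteq> 0 --> \<bar>p - q\<bar> \<le> int D"
proof -
  obtain N where N: "\<And>i j. N \<le> i \<or> N \<le> j ==> ent M i j = 0" using rmat_nat_bound[OF M] by metis
  have "\<forall>z. \<exists>D::nat. \<forall>x p y q. ent (ent M (fst z) (snd z)) (x, p) (y, q) \<noteq> 0 --> \<bar>p - q\<bar> \<le> int D"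
    using C_deg[OF rmat_entry[OF M]] by blast
  then obtain Df where Df: "\<forall>z. \<forall>x p y q. ent (ent M (fst z) (snd z)) (x, p) (y, q) \<noteq> 0 --> \<bar>p - q\<bar> \<le> int (Df z)"
    unfolding choice_iff by blast
  define D where "D = Max (insert 0 (Df ` ({..<N} \<times> {..<N})))"
  have "\<bar>p - q\<bar> \<le> int D" if nz: "ent (ent M i j) (x, p) (y, q) \<noteq> 0" for i j x p y q
  proof -
    have "ent M i j \<noteq> 0" using nz by auto
    then have "(i, j) \<in> {..<N} \<times> {..<N}" using N[of i j] by (auto simp: not_le[symmetric])
    then have "Df (i, j) \<le> D" unfolding D_def by (intro Max_ge) auto
    moreover have "\<bar>p - q\<bar> \<le> int (Df (i, j))" using Df[rule_format, of "(i, j)" x p y q] nz by simp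
    ultimately show ?thesis by linarith
  qed
  then show ?thesis by blast
qed

lemma chi_fin: "M \<in> MM ==> \<exists>n. chi V * M = dg {..<n} (gn V 0 1) * M"
proof -
  assume M: "M \<in> MM"
  obtain N where N: "\<And>i j. N \<le> i \<or> N \<le> j ==> ent M i j = 0" using rmat_nat_bound[OF M] by metis
  have "chi V * M = dg {..<N} (gn V 0 1) * M"
    by (rule rfm_eqI) (use N in \<open>auto simp: ent_chi_mult ent_dg_mult not_less\<close>)
  then show ?thesis ..
qed

lemma chi_fin_right: "M \<in> MM ==> \<exists>n. M * chi V = M * dg {..<n} (gn V 0 1)"
proof -
  assume M: "M \<in> MM"
  obtain N where N: "\<And>i j. N \<le> i \<or> N \<le> j ==> ent M i j = 0" using rmat_nat_bound[OF M] by metis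
  have "M * chi V = M * dg {..<N} (gn V 0 1)"
    by (rule rfm_eqI) (use N in \<open>auto simp: ent_mult_chi ent_mult_dg not_less\<close>)
  then show ?thesis ..
qed

lemma dg_gn_in: "clop V ==> finite J ==> dg J (gn V n c) \<in> MM"
  by (rule rmat_dg[OF C_sub]) (auto intro: gn_in)

lemma chi_in: "M \<in> MM ==> clop V ==> chi V * M \<in> MM"
  using chi_fin[of M V] dg_gn_in[of V] rmat_mult[OF C_sub, of _ UNIV UNIV M UNIV UNIV] by (metis finite_lessThan)

lemma in_chi: "M \<in> MM ==> clop V ==> M * chi V \<in> MM"
  using chi_fin_right[of M V] dg_gn_in[of V] rmat_mult[OF C_sub, of M UNIV UNIV _ UNIV UNIV] by (metis finite_lessThan)

lemma chi_chi: "V \<subseteq> TX ==> W \<subseteq> TX ==> chi V * chi W = chi (V \<inter> W)"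
  by (simp add: chi_def dg_mult_dg gn_mult sh_0)

lemma chi_TX: "M \<in> MM ==> chi TX * M = M" "M \<in> MM ==> M * chi TX = M"
proof -
  assume M: "M \<in> MM"
  note e = u_unit[OF rmat_entry[OF M]]
  show "chi TX * M = M" by (rule rfm_eqI) (simp add: ent_chi_mult u_gn[symmetric] e)
  show "M * chi TX = M" by (rule rfm_eqI) (simp add: ent_mult_chi u_gn[symmetric] e)
qed

lemma chi_le:
  assumes ar: "arank MM r" and M: "M \<in> MM" and V: "clop V"
  shows "r (chi V * M) \<le> r M"
proof -
  obtain n where n: "chi V * M = dg {..<n} (gn V 0 1) * M" using chi_fin[OF M] by blast
  show ?thesis unfolding n by (rule arank.mult_le_right[OF ar dg_gn_in[OF V] M]) simp
qed

lemma chi_mono: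
  assumes ar: "arank MM r" and M: "M \<in> MM" and V: "clop V" "clop W" "V \<subseteq> W"
  shows "r (chi V * M) \<le> r (chi W * M)"
proof -
  have "chi V * (chi W * M) = chi V * M"
    using chi_chi[of V W] V clop_sub by (simp add: mult.assoc[symmetric] Int_absorb2)
  then show ?thesis using chi_le[OF ar chi_in[OF M V(2)] V(1)] by simp
qed

lemma lc_zero_clop: "f \<in> lc ==> clop {x \<in> TX. f x = 0}"
proof -
  assume f: "f \<in> lc"
  have op: "openin X {x \<in> TX. P (f x)}" for P
  proof (subst openin_subopen, intro ballI)
    fix x assume x: "x \<in> {x \<in> TX. P (f x)}"
    then obtain U where U: "clop U" "x \<in> U" "\<forall>y\<in>U. f y = f x" using lcD[OF f, of x] by auto
    have "U \<subseteq> {x \<in> TX. P (f x)}" using U x clop_sub[OF U(1)] by fastforce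
    then show "\<exists>T. openin X T \<and> x \<in> T \<and> T \<subseteq> {x \<in> TX. P (f x)}" using U by (auto simp: clop_def)
  qed
  have "TX - {x \<in> TX. f x = 0} = {x \<in> TX. f x \<noteq> 0}" by auto
  then have "closedin X {x \<in> TX. f x = 0}" using op[of "\<lambda>v. v \<noteq> 0"] by (auto simp: closedin_def)
  then show ?thesis using op[of "\<lambda>v. v = 0"] by (simp add: clop_def)
qed

end

locale dynF = dyn X T rk for X :: "'x topology" and T and rk :: "nat \<Rightarrow> nat \<Rightarrow> (nat \<Rightarrow> nat \<Rightarrow> (int \<Rightarrow> 'x \<Rightarrow> 'k::field)) \<Rightarrow> real" +
  fixes Fx :: "'x set"
  assumes Fx_sub: "Fx \<subseteq> TX" and Fx_inv: "x \<in> Fx ==> tp i x \<in> Fx"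
begin

definition nbs where "nbs = {V. clop V \<and> Fx \<subseteq> V}"

text \<open>Only the rows are cut; \<open>shrink\<close> shows that for a smaller neighbourhood the
  columns are then cut as well.\<close>

definition rp where "rp M = Inf ((\<lambda>V. rho (chi V * M)) ` nbs)"

lemma TX_nbs: "TX \<in> nbs" using Fx_sub by (simp add: nbs_def)

lemma nbs_Int: "V \<in> nbs ==> W \<in> nbs ==> V \<inter> W \<in> nbs" by (auto simp: nbs_def clop_Int)

lemma rp_le: "M \<in> MM ==> V \<in> nbs ==> rp M \<le> rho (chi V * M)"
  unfolding rp_def using arank.nonneg[OF arank_rho chi_in]
  by (intro cINF_lower bdd_belowI[of _ 0]) (auto simp: nbs_def)

lemma rp_greatest: "(\<And>V. V \<in> nbs ==> c \<le> rho (chi V * M)) ==> c \<le> rp M"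
  unfolding rp_def using TX_nbs by (intro cINF_greatest) auto

lemma rp_approx: "M \<in> MM ==> 0 < d ==> \<exists>V\<in>nbs. rho (chi V * M) < rp M + d"
  using rp_greatest[of "rp M + d" M] by force

definition margin where "margin D V = TX \<inter> (\<Inter>n\<in>{- int D..int D}. sh n V)"

lemma margin_nbs: "V \<in> nbs ==> margin D V \<in> nbs"
proof -
  assume V: "V \<in> nbs"
  have "clop (margin D V)" unfolding margin_def by (rule clop_INT) (use V in \<open>auto simp: nbs_def clop_sh\<close>)
  moreover have "Fx \<subseteq> margin D V" using V Fx_sub Fx_inv by (auto simp: nbs_def margin_def sh_def)
  ultimately show ?thesis by (simp add: nbs_def)
qed

lemma margin_sub: "V \<in> nbs ==> margin D V \<subseteq> V"
  unfolding margin_def nbs_def using sh_0[OF clop_sub] by force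

text \<open>An element of degree at most \<open>D\<close> leads from a row over the margin to a
  column at most \<open>D\<close> steps away, hence over \<open>V\<close>.\<close>

lemma margin_mult:
  assumes M: "M \<in> MM" and D: "\<forall>i j x p y q. ent (ent M i j) (x, p) (y, q) \<noteq> 0 --> \<bar>p - q\<bar> \<le> int D"
  shows "chi (margin D V) * M * chi V = chi (margin D V) * M"
proof (intro rfm_eqI)
  fix i j and z w :: "'x \<times> int"
  obtain x p y q where zw: "z = (x, p)" "w = (y, q)" by (cases z, cases w) auto
  let ?e = "ent M i j"
  have eC: "?e \<in> C" by (rule rmat_entry[OF M])
  have r: "ent (a * gn V 0 1) (x, p) (y, q) = (if y \<in> TX \<and> tp q y \<in> V then ent a (x, p) (y, q) else 0)" for a :: "('x \<times> int, 'k) rfm"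
    by (subst ent_mult[of "{(y, q)}"]) (auto simp: ent_gn split: if_splits)
  have "ent (gn (margin D V) 0 1 * ?e * gn V 0 1) (x, p) (y, q) = ent (gn (margin D V) 0 1 * ?e) (x, p) (y, q)"
  proof (cases "ent (gn (margin D V) 0 1 * ?e) (x, p) (y, q) = 0")
    case False
    then have nz: "ent ?e (x, p) (y, q) \<noteq> 0" "x \<in> TX" "tp p x \<in> margin D V"
      by (auto simp: ent_gn_mult split: if_splits)
    then have xy: "x = y" using C_block[OF eC] by blast
    have "\<bar>p - q\<bar> \<le> int D" using D nz by blast
    then have "p - q \<in> {- int D..int D}" by auto
    then have "tp p x \<in> sh (p - q) V" using nz(3) unfolding margin_def by blast
    then have "tp q x \<in> V" using mem_sh[of x p "p - q" V] nz(2) by simp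
    then show ?thesis unfolding r using xy nz(2) by simp
  qed (simp add: r)
  then show "ent (ent (chi (margin D V) * M * chi V) i j) z w = ent (ent (chi (margin D V) * M) i j) z w"
    by (simp add: ent_mult_chi ent_chi_mult zw)
qed

text \<open>This lets a cut pass through a factor at the price of a smaller neighbourhood; it stands
  in for commutation of \<open>chi\<close> with the algebra.\<close>

lemma shrink:
  assumes "V \<in> nbs" "M \<in> MM"
  shows "\<exists>V'\<in>nbs. V' \<subseteq> V \<and> (\<forall>W\<in>nbs. W \<subseteq> V' --> chi W * M * chi V = chi W * M)"
proof -
  obtain D where D: "\<forall>i j x p y q. ent (ent M i j) (x, p) (y, q) \<noteq> 0 --> \<bar>p - q\<bar> \<le> int D"
    using MM_deg[OF assms(2)] by blast
  have "chi W * M * chi V = chi W * M" if W: "W \<in> nbs" "W \<subseteq> margin D V" for W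
  proof -
    have "chi W * chi (margin D V) = chi W"
      using chi_chi[of W "margin D V"] W clop_sub by (simp add: nbs_def margin_def Int_absorb2)
    note c = this
    have "chi W * M * chi V = chi W * chi (margin D V) * M * chi V" by (simp only: c)
    also have "\<dots> = chi W * (chi (margin D V) * M * chi V)" by (simp only: mult.assoc)
    also have "\<dots> = chi W * chi (margin D V) * M" unfolding margin_mult[OF assms(2) D] by (simp only: mult.assoc)
    finally show ?thesis by (simp only: c)
  qed
  then show ?thesis using margin_nbs[OF assms(1)] margin_sub[OF assms(1)] by blast
qed

lemma nbs_clop: "V \<in> nbs ==> clop V" by (simp add: nbs_def)

text \<open>The bound by the left factor passes to the infimum directly. The bound by the right
  factor and the triangular axiom use \<open>shrink\<close> to move the cut past what stands to the
  left; two neighbourhoods are merged by intersection.\<close>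

lemma arank_rp: "arank MM rp"
proof
  interpret a: arank MM rho by (rule arank_rho)
  show "subring_set MM" using C_sub by simp
  show "0 \<le> rp a" if "a \<in> MM" for a by (rule rp_greatest) (use that a.nonneg chi_in nbs_clop in auto)
  show "rp 0 = 0"
    using rp_le[OF a.closed(1) TX_nbs] rp_greatest[of 0 0] a.zero by simp
  show "rp (a * b) \<le> rp a" if m: "a \<in> MM" "b \<in> MM" for a b
  proof (rule rp_greatest)
    fix V assume V: "V \<in> nbs"
    have "rp (a * b) \<le> rho (chi V * (a * b))" by (rule rp_le[OF a.closed(3)[OF m] V])
    also have "\<dots> = rho (chi V * a * b)" by (simp add: mult.assoc)
    also have "\<dots> \<le> rho (chi V * a)" by (rule a.mult_le_left) (use m chi_in nbs_clop V in auto)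
    finally show "rp (a * b) \<le> rho (chi V * a)" .
  qed
  show "rp (a * b) \<le> rp b" if m: "a \<in> MM" "b \<in> MM" for a b
  proof (rule rp_greatest)
    fix V assume V: "V \<in> nbs"
    obtain V' where V': "V' \<in> nbs" "chi V' * a * chi V = chi V' * a" using shrink[OF V m(1)] by blast
    have "rp (a * b) \<le> rho (chi V' * (a * b))" by (rule rp_le[OF a.closed(3)[OF m] V'(1)])
    also have "chi V' * (a * b) = (chi V' * a) * (chi V * b)" 
    proof -
      have "(chi V' * a) * (chi V * b) = (chi V' * a * chi V) * b" by (simp only: mult.assoc)
      then show ?thesis unfolding V'(2) by (simp only: mult.assoc)
    qed
    also have "rho \<dots> \<le> rho (chi V * b)" by (rule a.mult_le_right) (use m chi_in nbs_clop V V' in auto)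
    finally show "rp (a * b) \<le> rho (chi V * b)" .
  qed
  show "rp (a + b) \<le> rp a + rp b" if m: "a \<in> MM" "b \<in> MM" for a b
  proof -
    have 1: "rp (a + b) \<le> rho (chi V * a) + rho (chi W * b)" if V: "V \<in> nbs" and W: "W \<in> nbs" for V W
    proof -
      have VW: "V \<inter> W \<in> nbs" using nbs_Int V W by blast
      have "rp (a + b) \<le> rho (chi (V \<inter> W) * (a + b))" by (rule rp_le[OF a.closed(2)[OF m] VW])
      also have "\<dots> \<le> rho (chi (V \<inter> W) * a) + rho (chi (V \<inter> W) * b)"
        unfolding distrib_left by (rule a.add_le) (use m chi_in nbs_clop VW in auto)
      also have "\<dots> \<le> rho (chi V * a) + rho (chi W * b)"
        by (intro add_mono chi_mono[OF arank_rho]) (use m nbs_clop V W VW in auto)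
      finally show ?thesis .
    qed
    have "rp (a + b) - rho (chi V * a) \<le> rp b" if "V \<in> nbs" for V
      by (rule rp_greatest) (use 1[OF that] in force)
    then have "rp (a + b) - rp b \<le> rp a" by (intro rp_greatest) force
    then show ?thesis by simp
  qed
  fix a b c e e' f f'
  assume m: "a \<in> MM" "b \<in> MM" "c \<in> MM" "e \<in> MM" "e' \<in> MM" "f \<in> MM" "f' \<in> MM"
    and R: "e * a = a" "a * e' = a" "f * b = b" "b * f' = b" "e * c = c" "c * f' = c"
       "e * b = 0" "f * a = 0" "f * c = 0" "a * f' = 0" "b * e' = 0" "c * e' = 0"
  interpret mr: mrank C rho u by (rule mrank_rho)
  show "rp a + rp b \<le> rp (a + b + c)"
  proof (rule rp_greatest)
    fix V assume V: "V \<in> nbs"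
    \<comment> \<open>The neighbourhood \<open>W\<close> defined below works for both local units,
      so the cut of \<open>a + b + c\<close> to \<open>V\<close> controls the blocks cut to
      \<open>W\<close>.\<close>
    obtain V1 where V1: "V1 \<in> nbs" "\<forall>W\<in>nbs. W \<subseteq> V1 --> chi W * e * chi V = chi W * e" using shrink[OF V m(4)] by blast
    obtain V2 where V2: "V2 \<in> nbs" "\<forall>W\<in>nbs. W \<subseteq> V2 --> chi W * f * chi V = chi W * f" using shrink[OF V m(6)] by blast
    define W where "W = V1 \<inter> V2"
    have W: "W \<in> nbs" "chi W * e * chi V = chi W * e" "chi W * f * chi V = chi W * f"
      using V1 V2 nbs_Int by (auto simp: W_def)
    have wm: "chi W * x \<in> MM" if "x \<in> MM" for x using chi_in[OF that nbs_clop[OF W(1)]] .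
    obtain N1 where N1: "\<forall>i j. N1 \<le> i \<or> N1 \<le> j --> ent (chi W * a) i j = 0" using mr.nat_bound[OF wm[OF m(1)]] by blast
    obtain N2 where N2: "\<forall>i j. N2 \<le> i \<or> N2 \<le> j --> ent (chi W * b) i j = 0" using mr.nat_bound[OF wm[OF m(2)]] by blast
    obtain N3 where N3: "\<forall>i j. N3 \<le> i \<or> N3 \<le> j --> ent (chi W * c) i j = 0" using mr.nat_bound[OF wm[OF m(3)]] by blast
    define N where "N = max N1 (max N2 N3)"
    have N: "\<forall>i j. N \<le> i \<or> N \<le> j --> ent (chi W * a) i j = 0" "\<forall>i j. N \<le> i \<or> N \<le> j --> ent (chi W * b) i j = 0"
      "\<forall>i j. N \<le> i \<or> N \<le> j --> ent (chi W * c) i j = 0" using N1 N2 N3 by (auto simp: N_def)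
    let ?S = "sft N 0 N u" and ?T = "sft 0 N N u"
    have s: "?S \<in> MM" "?T \<in> MM" by (rule sft_rmat[OF C_sub u_in])+
    define Y where "Y = a + b + c"
    have YM: "Y \<in> MM" unfolding Y_def using m a.closed(2) by simp
    have eY: "e * Y = a + c" "f * Y = b" using R by (simp_all add: Y_def distrib_left)
    have "(chi W * e + ?S * (chi W * f)) * (chi V * Y) = chi W * e * chi V * Y + ?S * (chi W * f * chi V * Y)"
      by (simp add: distrib_right mult.assoc)
    also have "\<dots> = chi W * (e * Y) + ?S * (chi W * (f * Y))" unfolding W(2,3) by (simp only: mult.assoc)
    also have "\<dots> = chi W * a + chi W * c + ?S * (chi W * b)" unfolding eY by (simp add: distrib_left)
    finally have "(chi W * e + ?S * (chi W * f)) * (chi V * Y) * (e' + f' * ?T)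
        = chi W * (a * e') + chi W * (c * e') + ?S * (chi W * (b * e')) + chi W * (a * f') * ?T + chi W * (c * f') * ?T + ?S * (chi W * (b * f')) * ?T"
      by (simp add: algebra_simps)
    then have eq: "(chi W * e + ?S * (chi W * f)) * (chi V * Y) * (e' + f' * ?T) = chi W * a + chi W * c * ?T + ?S * (chi W * b) * ?T"
      by (simp add: R)
    have "rp a + rp b \<le> rho (chi W * a) + rho (chi W * b)" by (intro add_mono rp_le m W)
    also have "\<dots> \<le> rho (chi W * a + chi W * c * ?T + ?S * (chi W * b) * ?T)"
      by (rule mr.block[OF wm wm wm N]) (use m in auto)
    also have "\<dots> \<le> rho (chi V * Y)"
      unfolding eq[symmetric] by (rule a.mult3_le) (use m s wm chi_in[OF YM nbs_clop[OF V]] a.closed(2,3) in simp_all)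
    finally show "rp a + rp b \<le> rho (chi V * (a + b + c))" by (simp add: Y_def)
  qed
qed

lemma mrank_rp: "mrank C rp u"
  unfolding mrank_def mrank_axioms_def using arank_rp C_sub u_in u_unit by blast

text \<open>Finitely many locally constant coefficients vanish on \<open>Fx\<close>, hence on a
  clopen neighbourhood of it, and the cut to that neighbourhood kills \<open>Z\<close>. So
  \<open>rp\<close> depends only on what happens over \<open>Fx\<close>.\<close>

lemma rp_null:
  assumes Z: "Z \<in> MM" and z: "\<And>i j x p w. x \<in> Fx ==> ent (ent Z i j) (x, p) w = 0"
  shows "rp Z = 0"
proof -
  obtain N where N: "\<And>i j. N \<le> i \<or> N \<le> j ==> ent Z i j = 0" using rmat_nat_bound[OF Z] by metis
  obtain D where D: "\<forall>i j x p y q. ent (ent Z i j) (x, p) (y, q) \<noteq> 0 --> \<bar>p - q\<bar> \<le> int D"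
    using MM_deg[OF Z] by blast
  define F where "F = (\<lambda>i j. dlt (ent Z i j))"
  have F: "F i j \<in> carrier CP" "emb (F i j) = ent Z i j" for i j
    using dlt_in emb_dlt rmat_entry[OF Z] by (auto simp: F_def)
  have Ff: "finite (supp (F i j))" "F i j n \<in> lc" for i j n using F(1)[of i j] by (auto simp: carrier_CP)
  have e: "ent (ent Z i j) (x, p) (y, q) = (if x = y \<and> x \<in> TX then F i j (p - q) (tp p x) else 0)" for i j x p y q
    using ent_emb[OF Ff(1), of i j x p y q] by (simp add: F(2))
  \<comment> \<open>The common zero set of all coefficients; \<open>N\<close> and \<open>D\<close>
    make them finitely many.\<close>
  define V where "V = TX \<inter> (\<Inter>t\<in>{..<N} \<times> {..<N} \<times> {- int D..int D}. {x \<in> TX. F (fst t) (fst (snd t)) (snd (snd t)) x = 0})"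
  have Vc: "clop V" unfolding V_def by (rule clop_INT) (auto intro: lc_zero_clop Ff)
  have FV: "Fx \<subseteq> V"
  proof
    fix x assume x: "x \<in> Fx"
    then have xX: "x \<in> TX" using Fx_sub by blast
    have "F i j n x = 0" for i j n using z[OF x, of i j 0 "(x, - n)"] xX by (simp add: e)
    then show "x \<in> V" using xX by (simp add: V_def)
  qed
  have V0: "F i j n x = 0" if "x \<in> V" for i j n x
  proof (rule ccontr)
    assume nz: "F i j n x \<noteq> 0"
    have xX: "x \<in> TX" using that by (simp add: V_def)
    have n1: "ent (ent Z i j) (x, 0) (x, - n) \<noteq> 0" using nz xX by (simp add: e)
    then have "\<bar>0 - (- n)\<bar> \<le> int D" using D by blast
    moreover have "ent Z i j \<noteq> 0" using n1 by auto
    then have "i < N" "j < N" using N[of i j] by (auto simp: not_le[symmetric])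
    ultimately have "(i, j, n) \<in> {..<N} \<times> {..<N} \<times> {- int D..int D}" by auto
    then show False using that nz unfolding V_def by fastforce
  qed
  have "chi V * Z = 0"
  proof (intro rfm_eqI)
    fix i j and t w :: "'x \<times> int"
    obtain x p y q where zw: "t = (x, p)" "w = (y, q)" by (cases t, cases w) auto
    show "ent (ent (chi V * Z) i j) t w = ent (ent 0 i j) t w"
      using V0 by (auto simp: zw ent_chi_mult ent_gn_mult e)
  qed
  then have "rp Z \<le> 0" using rp_le[OF Z, of V] Vc FV arank.zero[OF arank_rho] by (simp add: nbs_def)
  then show ?thesis using arank.nonneg[OF arank_rp Z] by simp
qed

end

section \<open>Towers\<close>

text \<open>Equalities between levels are only required on the invariant set \<open>S\<close> that carries the rank:
  \<open>S = topspace X\<close> for Rokhlin towers, and the periodic points for cyclic ones.\<close>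
locale tower = dyn X T rk for X :: "'x topology" and T and rk :: "nat \<Rightarrow> nat \<Rightarrow> (nat \<Rightarrow> nat \<Rightarrow> (int \<Rightarrow> 'x \<Rightarrow> 'k::field)) \<Rightarrow> real" +
  fixes r :: "(nat, ('x \<times> int, 'k) rfm) rfm \<Rightarrow> real" and S :: "'x set" and E :: "'x set" and h :: nat and PC :: "'k poly set"
  assumes mr: "mrank C r u" and S_sub: "S \<subseteq> TX" and S_inv: "x \<in> S ==> tp i x \<in> S"
    and null: "[|Z \<in> MM; \<And>i j x p w. x \<in> S ==> ent (ent Z i j) (x, p) w = 0|] ==> r Z = 0"
    and E: "clop E" and h: "0 < h"
    and T1: "0 < d ==> d < int h ==> E \<inter> sh d E = {}"
    and PC: "subring_set PC"
    and T2: "p \<in> PC ==> coeff p q \<noteq> 0 ==> x \<in> S ==> x \<in> sh (int q * int h) E \<longleftrightarrow> x \<in> E"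
begin

definition L :: "nat \<Rightarrow> 'x set" where "L k = sh (int k) E"

lemma L_clop: "clop (L k)" unfolding L_def by (rule clop_sh[OF E])

lemma T1': "z \<in> E ==> z \<in> sh d E ==> \<bar>d\<bar> < int h ==> d = 0"
proof (rule ccontr)
  assume z: "z \<in> E" "z \<in> sh d E" "\<bar>d\<bar> < int h" "d \<noteq> 0"
  have zX: "z \<in> TX" using z(1) E clop_sub by blast
  show False
  proof (cases "0 < d")
    case True
    then show False using T1[of d] z by auto
  next
    case False
    have "tp (- d) z \<in> E" using z(2) by (simp add: sh_def)
    moreover have "tp (- d) z \<in> sh (- d) E" using zX z(1) mem_sh[OF zX, of "- d" "- d" E] by simp
    ultimately show False using T1[of "- d"] z False by auto
  qed
qed

lemma L_disj: "y \<in> L k ==> y \<in> L k' ==> k < h ==> k' < h ==> k = k'"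
proof -
  assume a: "y \<in> L k" "y \<in> L k'" "k < h" "k' < h"
  have y: "y \<in> TX" using a by (simp add: L_def sh_def)
  have "tp (- int k) y \<in> E" using a(1) by (simp add: L_def sh_def)
  moreover have "tp (- int k) y \<in> sh (int k' - int k) E"
    using mem_sh[OF y, of "- int k" "int k' - int k" E] a(2) by (simp add: L_def sh_def)
  ultimately have "int k' - int k = 0" using T1' a(3,4) by fastforce
  then show ?thesis by simp
qed

text \<open>The image of the matrix unit between levels \<open>k\<close> and \<open>l\<close> with
  coefficient \<open>p\<close>: the monomial of degree \<open>q\<close> stands for \<open>q\<close>
  additional turns of \<open>h\<close> steps, and the rows are cut to level
  \<open>k\<close>.\<close>

definition gp :: "nat \<Rightarrow> nat \<Rightarrow> 'k poly \<Rightarrow> ('x \<times> int, 'k) rfm" where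
  "gp k l p = (\<Sum>q\<le>degree p. gn (L k) (int k - int l + int q * int h) (coeff p q))"

lemma gp_bound: "degree p \<le> N ==> gp k l p = (\<Sum>q\<le>N. gn (L k) (int k - int l + int q * int h) (coeff p q))"
  unfolding gp_def by (rule sum.mono_neutral_left) (auto simp: coeff_eq_0 not_le)

lemma gp_add: "gp k l (p + p') = gp k l p + gp k l p'"
proof -
  define N where "N = max (degree p) (degree p')"
  have "degree (p + p') \<le> N" "degree p \<le> N" "degree p' \<le> N" by (auto simp: N_def degree_add_le)
  then show ?thesis by (simp add: gp_bound[of _ N] gn_add sum.distrib)
qed

lemma gp_0 [simp]: "gp k l 0 = 0" by (simp add: gp_def)

lemma gp_sum: "gp k l (\<Sum>i\<in>A. f i) = (\<Sum>i\<in>A. gp k l (f i))"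
  by (induction A rule: infinite_finite_induct) (auto simp: gp_add)

lemma gp_monom: "gp k l (monom c n) = gn (L k) (int k - int l + int n * int h) c"
proof -
  have "gp k l (monom c n) = (\<Sum>q\<le>n. gn (L k) (int k - int l + int q * int h) (coeff (monom c n) q))"
    by (rule gp_bound) (rule degree_monom_le)
  also have "\<dots> = (\<Sum>q\<le>n. if q = n then gn (L k) (int k - int l + int n * int h) c else 0)"
    by (rule sum.cong) auto
  finally show ?thesis by simp
qed

lemma gp_in: "gp k l p \<in> C"
  unfolding gp_def by (intro subring_set_sum[OF C_sub] gn_in L_clop)

definition agr :: "('x \<times> int, 'k) rfm \<Rightarrow> ('x \<times> int, 'k) rfm \<Rightarrow> bool" where
  "agr a b \<longleftrightarrow> (\<forall>x p w. x \<in> S --> ent a (x, p) w = ent b (x, p) w)"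

lemma agr_sum: "(\<And>i. i \<in> A ==> agr (f i) (g i)) ==> agr (sum f A) (sum g A)"
  unfolding agr_def by (auto intro!: sum.cong)

lemma agr_refl [simp]: "agr a a" by (simp add: agr_def)

text \<open>The product is supported on the points of level \<open>k\<close> whose translate lies on
  level \<open>l'\<close>. By \<open>T2\<close> full turns may be dropped, and by \<open>T1\<close>
  two levels of one tower meet only if they are equal.\<close>

lemma gn_agr:
  assumes lt: "k < h" "l < h" "l' < h" and p: "p \<in> PC"
  shows "agr (gn (L k) (int k - int l + int q * int h) (coeff p q) * gn (L l') (int l' - int m + int q' * int h) c)
     (if l = l' then gn (L k) (int k - int m + int (q + q') * int h) (coeff p q * c) else 0)"
proof (cases "coeff p q = 0")
  case True
  then show ?thesis by (simp add: gn_mult)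
next
  case nz: False
  let ?N = "int k - int l + int q * int h"
  have key: "y \<in> L k \<inter> sh ?N (L l') \<longleftrightarrow> y \<in> L k \<and> l = l'" if y: "y \<in> S" for y
  proof -
    have yX: "y \<in> TX" using y S_sub by blast
    define z where "z = tp (- int k) y"
    have z: "z \<in> S" "z \<in> TX" unfolding z_def using S_inv[OF y] S_sub by auto
    have L1: "y \<in> L k \<longleftrightarrow> z \<in> E" using yX by (simp add: L_def sh_def z_def)
    have "y \<in> sh ?N (L l') \<longleftrightarrow> tp (- (?N + int l')) y \<in> E" unfolding L_def sh_sh using yX by (simp add: sh_def)
    also have "tp (- (?N + int l')) y = tp (- (int q * int h)) (tp (int l - int l') z)"
      unfolding z_def using yX by (simp add: tp_in tp_add[symmetric] algebra_simps)
    also have "\<dots> \<in> E \<longleftrightarrow> tp (int l - int l') z \<in> sh (int q * int h) E"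
      using z tp_in by (simp add: sh_def)
    also have "\<dots> \<longleftrightarrow> tp (int l - int l') z \<in> E" by (rule T2[OF p nz S_inv[OF z(1)]])
    also have "\<dots> \<longleftrightarrow> z \<in> sh (int l' - int l) E" using z by (simp add: sh_def)
    finally have L2: "y \<in> sh ?N (L l') \<longleftrightarrow> z \<in> sh (int l' - int l) E" .
    have lt': "\<bar>int l' - int l\<bar> < int h" using lt by linarith
    have "z \<in> E ==> z \<in> sh (int l' - int l) E \<longleftrightarrow> l = l'"
      using T1'[OF _ _ lt', of z] sh_0[OF clop_sub[OF E]] by auto
    then show ?thesis using L1 L2 by blast
  qed
  have e: "?N + (int l' - int m + int q' * int h) = int k - int m + int (q + q') * int h" if "l = l'"
    using that by (simp add: algebra_simps)
  show ?thesis
    unfolding agr_def gn_mult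
  proof (intro allI impI)
    fix x p' and w :: "'x \<times> int" assume x: "x \<in> S"
    obtain y b where w: "w = (y, b)" by (cases w)
    show "ent (gn (L k \<inter> sh ?N (L l')) (?N + (int l' - int m + int q' * int h)) (coeff p q * c)) (x, p') w =
       ent (if l = l' then gn (L k) (int k - int m + int (q + q') * int h) (coeff p q * c) else 0) (x, p') w"
      using key[OF S_inv[OF x, of p']] e by (auto simp: w ent_gn)
  qed
qed

lemma poly_mult_monoms: "p * p' = (\<Sum>q\<le>degree p. \<Sum>q'\<le>degree p'. monom (coeff p q * coeff p' q') (q + q'))"
  for p p' :: "'k poly"
proof -
  have "p * p' = (\<Sum>q\<le>degree p. monom (coeff p q) q) * (\<Sum>q'\<le>degree p'. monom (coeff p' q') q')"
    by (simp add: poly_as_sum_of_monoms)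
  then show ?thesis by (simp add: sum_product mult_monom)
qed

lemma gp_mult:
  assumes lt: "k < h" "l < h" "l' < h" and p: "p \<in> PC"
  shows "agr (gp k l p * gp l' m p') (if l = l' then gp k m (p * p') else 0)"
proof -
  have 1: "gp k l p * gp l' m p' = (\<Sum>q\<le>degree p. \<Sum>q'\<le>degree p'.
     gn (L k) (int k - int l + int q * int h) (coeff p q) * gn (L l') (int l' - int m + int q' * int h) (coeff p' q'))"
    unfolding gp_def by (simp add: sum_product)
  have 2: "gp k m (p * p') = (\<Sum>q\<le>degree p. \<Sum>q'\<le>degree p'. gn (L k) (int k - int m + int (q + q') * int h) (coeff p q * coeff p' q'))"
    by (subst poly_mult_monoms) (simp only: gp_sum gp_monom)
  have 3: "(if l = l' then gp k m (p * p') else 0) = (\<Sum>q\<le>degree p. \<Sum>q'\<le>degree p'.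
     if l = l' then gn (L k) (int k - int m + int (q + q') * int h) (coeff p q * coeff p' q') else 0)"
    using 2 by simp
  show ?thesis unfolding 1 3 by (intro agr_sum gn_agr[OF lt p])
qed

text \<open>An index \<open>(k, i)\<close> combines a level of the tower with a row of the matrix,
  so matrices of all sizes over the tower are treated at once. Entries will be taken from
  \<open>PC\<close>: constants for a Rokhlin tower, all polynomials for a tower that closes up
  cyclically.\<close>

definition psi :: "(nat \<times> nat, 'k poly) rfm \<Rightarrow> (nat, ('x \<times> int, 'k) rfm) rfm" where
  "psi W = Rfm (\<lambda>i j. \<Sum>k<h. \<Sum>l<h. gp k l (ent W (k, i) (l, j)))"

lemma ent_psi: "ent (psi W) i j = (\<Sum>k<h. \<Sum>l<h. gp k l (ent W (k, i) (l, j)))"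
proof -
  have "finite {j. (\<Sum>k<h. \<Sum>l<h. gp k l (ent W (k, i) (l, j))) \<noteq> 0}" for i
  proof (rule finite_subset)
    show "{j. (\<Sum>k<h. \<Sum>l<h. gp k l (ent W (k, i) (l, j))) \<noteq> 0} \<subseteq> (\<Union>k<h. snd ` {z. ent W (k, i) z \<noteq> 0})"
    proof
      fix j assume "j \<in> {j. (\<Sum>k<h. \<Sum>l<h. gp k l (ent W (k, i) (l, j))) \<noteq> 0}"
      then have "(\<Sum>k<h. \<Sum>l<h. gp k l (ent W (k, i) (l, j))) \<noteq> 0" by blast
      then obtain k where k: "k \<in> {..<h}" "(\<Sum>l<h. gp k l (ent W (k, i) (l, j))) \<noteq> 0"
        by (rule sum.not_neutral_contains_not_neutral)
      from k(2) obtain l where "l \<in> {..<h}" "gp k l (ent W (k, i) (l, j)) \<noteq> 0"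
        by (rule sum.not_neutral_contains_not_neutral)
      then have "ent W (k, i) (l, j) \<noteq> 0" by auto
      then show "j \<in> (\<Union>k<h. snd ` {z. ent W (k, i) z \<noteq> 0})" using k(1) by force
    qed
  qed auto
  then show ?thesis unfolding psi_def by (simp add: ent_Rfm)
qed

abbreviation "J \<equiv> {..<h} \<times> (UNIV :: nat set)"

lemma psi_in:
  assumes W: "W \<in> rmat J J PC"
  shows "psi W \<in> MM"
proof -
  obtain R1 L1 where 1: "finite R1" "finite L1" "\<And>i j. i \<notin> R1 \<or> j \<notin> L1 ==> ent W i j = 0"
    using rmat_bound[OF W] by metis
  show ?thesis
  proof (rule rmatI[of "snd ` R1" "snd ` L1"])
    fix i j assume "i \<notin> snd ` R1 \<or> j \<notin> snd ` L1"
    then have "ent W (k, i) (l, j) = 0" for k l by (intro 1(3)) force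
    then show "ent (psi W) i j = 0" by (simp add: ent_psi)
  next
    show "ent (psi W) i j \<in> C" for i j unfolding ent_psi by (intro subring_set_sum[OF C_sub] gp_in)
  qed (use 1 in auto)
qed

lemma psi_add: "psi (W + W') = psi W + psi W'"
  by (rule rfm_eqI) (simp only: ent_psi ent_add gp_add sum.distrib)

lemma psi_mult:
  assumes W: "W \<in> rmat J J PC" and W': "W' \<in> rmat J J PC"
  shows "agr (ent (psi (W * W')) i j') (ent (psi W * psi W') i j')"
proof -
  obtain R1 L1 where 1: "finite R1" "finite L1" "\<And>i j. i \<notin> R1 \<or> j \<notin> L1 ==> ent W i j = 0"
    using rmat_bound[OF W] by metis
  define Q where "Q = snd ` L1"
  have Q: "finite Q" "\<And>k i l j. j \<notin> Q ==> ent W (k, i) (l, j) = 0"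
  proof -
    show "finite Q" using 1 by (simp add: Q_def)
    show "ent W (k, i) (l, j) = 0" if "j \<notin> Q" for k i l j by (rule 1(3)) (use that in \<open>force simp: Q_def\<close>)
  qed
  have out: "ent W (k, i) (l, j) = 0" if "\<not> l < h" for k i l j using rmat_outside[OF W] that by auto
  have zz: "ent W (k, i) z = 0" if "z \<notin> {..<h} \<times> Q" for k i z
    using that Q(2)[of "snd z" k i "fst z"] out[of "fst z" k i "snd z"] by (cases z) auto
  \<comment> \<open>A Kronecker delta is inserted so that both sides become sums over the same
    indices \<open>k\<close>, \<open>l\<close>, \<open>l'\<close>, \<open>m\<close>.\<close>
  have dlt: "(\<Sum>m<h. G m) = (\<Sum>l'<h. \<Sum>m<h. if l = l' then G m else 0)" if "l < h" for G :: "nat \<Rightarrow> ('x \<times> int, 'k) rfm" and l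
    by (subst sum.swap) (simp add: that)
  have WW: "ent (W * W') (k, i) (m, j') = (\<Sum>j\<in>Q. \<Sum>l<h. ent W (k, i) (l, j) * ent W' (l, j) (m, j'))" for k m
  proof -
    have "ent (W * W') (k, i) (m, j') = (\<Sum>z\<in>{..<h} \<times> Q. ent W (k, i) z * ent W' z (m, j'))"
      by (rule ent_mult) (use Q(1) zz in auto)
    also have "\<dots> = (\<Sum>l<h. \<Sum>j\<in>Q. ent W (k, i) (l, j) * ent W' (l, j) (m, j'))"
      by (simp add: sum.cartesian_product case_prod_unfold)
    also have "\<dots> = (\<Sum>j\<in>Q. \<Sum>l<h. ent W (k, i) (l, j) * ent W' (l, j) (m, j'))" by (rule sum.swap)
    finally show ?thesis .
  qed
  let ?g = "\<lambda>j k l m. gp k m (ent W (k, i) (l, j) * ent W' (l, j) (m, j'))"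
  have "ent (psi (W * W')) i j' = (\<Sum>k<h. \<Sum>m<h. \<Sum>j\<in>Q. \<Sum>l<h. ?g j k l m)"
    by (simp only: ent_psi WW gp_sum)
  also have "\<dots> = (\<Sum>k<h. \<Sum>j\<in>Q. \<Sum>m<h. \<Sum>l<h. ?g j k l m)"
    by (intro sum.cong refl sum.swap)
  also have "\<dots> = (\<Sum>j\<in>Q. \<Sum>k<h. \<Sum>m<h. \<Sum>l<h. ?g j k l m)" by (rule sum.swap)
  also have "\<dots> = (\<Sum>j\<in>Q. \<Sum>k<h. \<Sum>l<h. \<Sum>m<h. ?g j k l m)"
    by (intro sum.cong refl sum.swap)
  also have "\<dots> = (\<Sum>j\<in>Q. \<Sum>k<h. \<Sum>l<h. \<Sum>l'<h. \<Sum>m<h. if l = l' then ?g j k l m else 0)"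
    by (intro sum.cong refl dlt) simp
  finally have A: "ent (psi (W * W')) i j' = (\<Sum>j\<in>Q. \<Sum>k<h. \<Sum>l<h. \<Sum>l'<h. \<Sum>m<h. if l = l' then ?g j k l m else 0)" .
  have "ent (psi W * psi W') i j' = (\<Sum>j\<in>Q. ent (psi W) i j * ent (psi W') j j')"
    by (rule ent_mult[OF Q(1)]) (simp add: ent_psi Q(2))
  also have "\<dots> = (\<Sum>j\<in>Q. \<Sum>k<h. \<Sum>l<h. \<Sum>l'<h. \<Sum>m<h. gp k l (ent W (k, i) (l, j)) * gp l' m (ent W' (l', j) (m, j')))"
    unfolding ent_psi by (simp only: sum_distrib_right) (simp only: sum_distrib_left)
  finally have B: "ent (psi W * psi W') i j' = (\<Sum>j\<in>Q. \<Sum>k<h. \<Sum>l<h. \<Sum>l'<h. \<Sum>m<h. gp k l (ent W (k, i) (l, j)) * gp l' m (ent W' (l', j) (m, j')))" .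
  have "agr (ent (psi W * psi W') i j') (ent (psi (W * W')) i j')"
    unfolding A B
  proof (intro agr_sum)
    fix j k l l' m assume "k \<in> {..<h}" "l \<in> {..<h}" "l' \<in> {..<h}" "m \<in> {..<h}"
    then have "agr (gp k l (ent W (k, i) (l, j)) * gp l' m (ent W' (l', j) (m, j')))
      (if l = l' then gp k m (ent W (k, i) (l, j) * ent W' (l', j) (m, j')) else 0)"
      by (intro gp_mult rmat_entry[OF W]) auto
    then show "agr (gp k l (ent W (k, i) (l, j)) * gp l' m (ent W' (l', j) (m, j'))) (if l = l' then ?g j k l m else 0)"
      by (cases "l = l'") auto
  qed
  then show ?thesis by (simp add: agr_def)
qed

lemma agr_eq0:
  assumes "Z \<in> MM" "Z' \<in> MM" "\<And>i j. agr (ent Z i j) (ent Z' i j)"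
  shows "mrank.eq0 C r Z Z'"
proof -
  interpret m: mrank C r u by (rule mr)
  have "r (Z - Z') = 0"
    by (rule null) (use assms m.closed(5) in \<open>auto simp: agr_def\<close>)
  then show ?thesis using assms by (simp add: m.eq0_def)
qed

lemma arank_psi: "arank (rmat J J PC) (\<lambda>W. r (psi W))"
proof -
  interpret m: mrank C r u by (rule mr)
  show ?thesis
  proof (rule m.pullback_null)
    show "subring_set (rmat J J PC)" using PC by simp
    show "psi W \<in> MM" if "W \<in> rmat J J PC" for W by (rule psi_in[OF that])
    show "m.eq0 (psi (W + W')) (psi W + psi W')" if "W \<in> rmat J J PC" "W' \<in> rmat J J PC" for W W'
      unfolding psi_add by (rule m.eq0_refl) (use that psi_in m.closed(2) in auto)
    show "m.eq0 (psi (W * W')) (psi W * psi W')" if "W \<in> rmat J J PC" "W' \<in> rmat J J PC" for W W'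
      by (rule agr_eq0) (use that psi_in psi_mult rmat_mult[OF PC that] m.closed(3) in auto)
  qed
qed

text \<open>So the variable acts on the base of the tower as one full turn, \<open>t\<close> to the
  power \<open>h\<close>.\<close>

lemma psi_unit: "psi (un (0, 0) (0, 0) (monom c n)) = un 0 0 (gn E (int n * int h) c)"
proof (rule rfm_eqI)
  fix i j
  have "ent (psi (un (0, 0) (0, 0) (monom c n))) i j = (\<Sum>k<h. \<Sum>l<h. if k = 0 \<and> l = 0 then (if i = 0 \<and> j = 0 then gn E (int n * int h) c else 0) else 0)"
    unfolding ent_psi
  proof (intro sum.cong refl)
    fix k l
    show "gp k l (ent (un (0, 0) (0, 0) (monom c n)) (k, i) (l, j)) = (if k = 0 \<and> l = 0 then (if i = 0 \<and> j = 0 then gn E (int n * int h) c else 0) else 0)"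
      using sh_0[OF clop_sub[OF E]] by (auto simp: ent_un gp_monom L_def)
  qed
  also have "\<dots> = (\<Sum>k<h. if k = 0 then (if i = 0 \<and> j = 0 then gn E (int n * int h) c else 0) else 0)"
  proof (intro sum.cong refl)
    fix k
    show "(\<Sum>l<h. if k = 0 \<and> l = 0 then (if i = 0 \<and> j = 0 then gn E (int n * int h) c else 0) else 0) = (if k = 0 then (if i = 0 \<and> j = 0 then gn E (int n * int h) c else 0) else 0)"
      using h by (cases "k = 0") auto
  qed
  also have "\<dots> = ent (un 0 0 (gn E (int n * int h) c)) i j" using h by (auto simp: ent_un)
  finally show "ent (psi (un (0, 0) (0, 0) (monom c n))) i j = ent (un 0 0 (gn E (int n * int h) c)) i j" .
qed

text \<open>Division by \<open>h\<close> reads off the number of turns.\<close>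

lemma ent_gp:
  "ent (gp k l p) (x, a) (y, b) = (if x = y \<and> x \<in> TX \<and> tp a x \<in> L k \<and> int h dvd (a - b - int k + int l) \<and> 0 \<le> a - b - int k + int l
     then coeff p (nat ((a - b - int k + int l) div int h)) else 0)"
proof -
  let ?N = "a - b - int k + int l"
  have "ent (gp k l p) (x, a) (y, b) = (\<Sum>q\<le>degree p. if ?N = int q * int h then (if x = y \<and> x \<in> TX \<and> tp a x \<in> L k then coeff p q else 0) else 0)"
    unfolding gp_def ent_sum by (intro sum.cong refl) (auto simp: ent_gn)
  also have "\<dots> = (\<Sum>q\<le>degree p. if q = nat (?N div int h) then (if x = y \<and> x \<in> TX \<and> tp a x \<in> L k \<and> int h dvd ?N \<and> 0 \<le> ?N then coeff p q else 0) else 0)"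
  proof (intro sum.cong refl)
    fix q
    have nn: "N = int q * int h \<longleftrightarrow> q = nat (N div int h) \<and> int h dvd N \<and> 0 \<le> N" for N
    proof
      assume "N = int q * int h"
      then show "q = nat (N div int h) \<and> int h dvd N \<and> 0 \<le> N" using h by simp
    next
      assume N: "q = nat (N div int h) \<and> int h dvd N \<and> 0 \<le> N"
      then have "0 \<le> N div int h" using h pos_imp_zdiv_nonneg_iff[of "int h" N] by linarith
      then have q: "int q = N div int h" using N by linarith
      have "N = (N div int h) * int h" using N dvd_div_mult_self[of "int h" N] by linarith
      then show "N = int q * int h" by (simp only: q[symmetric])
    qed
    have "?N = int q * int h \<longleftrightarrow> q = nat (?N div int h) \<and> int h dvd ?N \<and> 0 \<le> ?N" by (rule nn)
    then show "(if ?N = int q * int h then (if x = y \<and> x \<in> TX \<and> tp a x \<in> L k then coeff p q else 0) else 0)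
      = (if q = nat (?N div int h) then (if x = y \<and> x \<in> TX \<and> tp a x \<in> L k \<and> int h dvd ?N \<and> 0 \<le> ?N then coeff p q else 0) else 0)"
      by auto
  qed
  also have "\<dots> = (if nat (?N div int h) \<le> degree p then (if x = y \<and> x \<in> TX \<and> tp a x \<in> L k \<and> int h dvd ?N \<and> 0 \<le> ?N then coeff p (nat (?N div int h)) else 0) else 0)"
    by simp
  finally show ?thesis by (auto simp: coeff_eq_0)
qed

end

section \<open>Approximants from quotients of the polynomial ring\<close>

context dyn
begin

text \<open>The coefficient between levels \<open>k\<close> and \<open>l\<close> with
  \<open>q - m\<close> turns, read at the reference point \<open>x\<close>. The offset
  \<open>m\<close> moves negative turns to nonnegative exponents.\<close>

definition ypc :: "'x \<Rightarrow> nat \<Rightarrow> nat \<Rightarrow> (int \<Rightarrow> 'x \<Rightarrow> 'k) \<Rightarrow> nat \<Rightarrow> nat \<Rightarrow> nat \<Rightarrow> 'k" where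
  "ypc x h m F k l q = F (int k - int l + (int q - int m) * int h) (tp (int k) x)"

definition yp :: "'x \<Rightarrow> nat \<Rightarrow> nat \<Rightarrow> (int \<Rightarrow> 'x \<Rightarrow> 'k) \<Rightarrow> nat \<Rightarrow> nat \<Rightarrow> 'k poly" where
  "yp x h m F k l = (\<Sum>q | ypc x h m F k l q \<noteq> 0. monom (ypc x h m F k l q) q)"

lemma coeff_yp:
  assumes "finite (supp F)" "0 < h"
  shows "coeff (yp x h m F k l) q = ypc x h m F k l q"
proof -
  have "finite {q. ypc x h m F k l q \<noteq> 0}"
  proof (rule finite_subset)
    show "{q. ypc x h m F k l q \<noteq> 0} \<subseteq> (\<lambda>q. int k - int l + (int q - int m) * int h) -` supp F"
      unfolding ypc_def supp_def by auto
    show "finite ((\<lambda>q. int k - int l + (int q - int m) * int h) -` supp F)"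
      by (rule finite_vimageI[OF assms(1)]) (rule injI, use assms(2) in simp)
  qed
  then show ?thesis unfolding yp_def by (simp add: coeff_sum coeff_monom)
qed

definition ym where
  "ym x h m F = Rfm (\<lambda>k l. if k < h \<and> l < h then yp x h m F k l else 0)"

lemma ent_ym: "ent (ym x h m F) k l = (if k < h \<and> l < h then yp x h m F k l else 0)"
proof -
  have "finite {l. (if k < h \<and> l < h then yp x h m F k l else 0) \<noteq> 0}" for k
    by (rule finite_subset[of _ "{..<h}"]) auto
  then show ?thesis unfolding ym_def by (simp add: ent_Rfm)
qed

definition YM :: "'x \<Rightarrow> nat \<Rightarrow> nat \<Rightarrow> nat \<Rightarrow> (nat \<Rightarrow> nat \<Rightarrow> int \<Rightarrow> 'x \<Rightarrow> 'k) \<Rightarrow> (nat \<times> nat, 'k poly) rfm" where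
  "YM x h m n M = Rfm (\<lambda>(k, i) (l, j). if k < h \<and> l < h \<and> i < n \<and> j < n then yp x h m (M i j) k l else 0)"

lemma ent_YM: "ent (YM x h m n M) (k, i) (l, j) = (if k < h \<and> l < h \<and> i < n \<and> j < n then yp x h m (M i j) k l else 0)"
proof -
  have "finite {z. (case z of (l, j) \<Rightarrow> if k < h \<and> l < h \<and> i < n \<and> j < n then yp x h m (M i j) k l else 0) \<noteq> 0}" for k i
    by (rule finite_subset[of _ "{..<h} \<times> {..<n}"]) (auto split: if_splits)
  then show ?thesis unfolding YM_def by (subst ent_Rfm) (auto simp: case_prod_unfold)
qed

lemma YM_in: "YM x h m n M \<in> rmat ({..<h} \<times> UNIV) ({..<h} \<times> UNIV) UNIV"
proof (rule rmatI[of "{..<h} \<times> {..<n}" "{..<h} \<times> {..<n}"])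
  fix z w :: "nat \<times> nat" assume "z \<notin> {..<h} \<times> {..<n} \<or> w \<notin> {..<h} \<times> {..<n}"
  then show "ent (YM x h m n M) z w = 0" by (cases z, cases w) (auto simp: ent_YM)
qed auto

text \<open>In the quotient, \<open>s'\<close> is meant to be an inverse of the variable; the factor
  \<open>s' ^ m\<close> undoes the offset and makes the map unital.\<close>

definition phi :: "'x \<Rightarrow> nat \<Rightarrow> nat \<Rightarrow> 'k poly \<Rightarrow> 'k poly \<Rightarrow> (int \<Rightarrow> 'x \<Rightarrow> 'k) \<Rightarrow> (nat \<times> nat, 'k) rfm" where
  "phi x h m r s' F = rep r (dg UNIV (s' ^ m) * ym x h m F)"

lemma ent_phi: "ent (phi x h m r s' F) (k, a) (l, b) = (if k < h \<and> l < h then pm r (s' ^ m * yp x h m F k l) a b else 0)"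
  by (simp add: phi_def ent_rep ent_dg_mult ent_ym)

lemma phi_apx:
  assumes x: "x \<in> TX" and h: "0 < h" and r: "0 < degree r" and s': "([:0, 1:] * s') mod r = 1 mod r"
  shows "({..<h} \<times> {..<degree r}, phi x h m r s') \<in> apx CP"
proof -
  let ?J = "{..<h} \<times> {..<degree r}"
  have pw: "(s' ^ m * monom 1 m) mod r = 1 mod r"
  proof -
    have "s' ^ m * monom 1 m = ([:0, 1:] * s') ^ m"
      by (simp only: power_mult_distrib monom_altdef smult_1_left mult.commute)
    also have "\<dots> mod r = (([:0, 1:] * s') mod r) ^ m mod r" by (rule power_mod[symmetric])
    also have "\<dots> = 1 mod r" by (simp only: s' power_mod power_one)
    finally show ?thesis .
  qed
  have in1: "phi x h m r s' F \<in> rmat ?J ?J UNIV" for F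
  proof (rule rmatI[of ?J ?J])
    fix z w :: "nat \<times> nat" assume "z \<notin> ?J \<or> w \<notin> ?J"
    then show "ent (phi x h m r s' F) z w = 0" unfolding phi_def by (cases z, cases w) (auto simp: ent_rep ent_dg_mult ent_ym pm_def)
  qed auto
  have y1: "yp x h m \<one>\<^bsub>CP\<^esub> k l = (if k = l then monom 1 m else 0)" if "k < h" "l < h" for k l
  proof (rule poly_eqI)
    fix q
    have f: "finite (supp \<one>\<^bsub>CP\<^esub>)" using one_in by (simp add: carrier_CP)
    have "int k - int l + (int q - int m) * int h = 0 \<longleftrightarrow> k = l \<and> q = m"
    proof
      assume a: "int k - int l + (int q - int m) * int h = 0"
      have "\<bar>(int q - int m) * int h\<bar> < 1 * int h" using a that by linarith
      then have "\<bar>int q - int m\<bar> * int h < 1 * int h" by (simp add: abs_mult)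
      then have "\<bar>int q - int m\<bar> < 1" by (rule mult_right_less_imp_less) simp
      then have "q = m" by simp
      then show "k = l \<and> q = m" using a by simp
    qed simp
    then show "coeff (yp x h m \<one>\<^bsub>CP\<^esub> k l) q = coeff (if k = l then monom 1 m else 0) q"
      unfolding coeff_yp[OF f h] using tp_in[OF x] by (auto simp: ypc_def CP_simps)
  qed
  have one: "phi x h m r s' \<one>\<^bsub>CP\<^esub> = dg ?J 1"
  proof (rule rfm_eqI)
    fix z w :: "nat \<times> nat"
    obtain k a l b where zw: "z = (k, a)" "w = (l, b)" by (cases z, cases w) auto
    show "ent (phi x h m r s' \<one>\<^bsub>CP\<^esub>) z w = ent (dg ?J 1) z w"
      using pm_cong[OF pw, of a b] by (auto simp: zw ent_phi y1 ent_dg pm_1)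
  qed
  have zero: "phi x h m r s' \<zero>\<^bsub>CP\<^esub> = 0"
  proof (rule rfm_eqI)
    fix z w :: "nat \<times> nat"
    obtain k a l b where zw: "z = (k, a)" "w = (l, b)" by (cases z, cases w) auto
    have "yp x h m \<zero>\<^bsub>CP\<^esub> k l = 0" by (simp add: yp_def ypc_def CP_simps)
    then show "ent (phi x h m r s' \<zero>\<^bsub>CP\<^esub>) z w = ent 0 z w" by (simp add: zw ent_phi)
  qed
  have add: "phi x h m r s' (F \<oplus>\<^bsub>CP\<^esub> G) = phi x h m r s' F + phi x h m r s' G" if F: "F \<in> carrier CP" and G: "G \<in> carrier CP" for F G
  proof (rule rfm_eqI)
    fix z w :: "nat \<times> nat"
    obtain k a l b where zw: "z = (k, a)" "w = (l, b)" by (cases z, cases w) auto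
    have f: "finite (supp F)" "finite (supp G)" "finite (supp (F \<oplus>\<^bsub>CP\<^esub> G))"
      using F G CP_add[OF F G] by (auto simp: carrier_CP)
    have "yp x h m (F \<oplus>\<^bsub>CP\<^esub> G) k l = yp x h m F k l + yp x h m G k l"
      by (rule poly_eqI) (simp only: coeff_add coeff_yp[OF f(1) h] coeff_yp[OF f(2) h] coeff_yp[OF f(3) h], simp add: ypc_def CP_simps)
    then show "ent (phi x h m r s' (F \<oplus>\<^bsub>CP\<^esub> G)) z w = ent (phi x h m r s' F + phi x h m r s' G) z w"
      by (simp add: zw ent_phi distrib_left pm_add)
  qed
  show ?thesis unfolding apx_def using in1 one zero add by auto
qed

text \<open>Undoing the offset multiplies by an invertible element of the quotient and leaves the
  rank unchanged; the rest is a reordering of the index components.\<close>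

lemma krank_phi:
  assumes M: "M \<in> mat_over CP n n" and r: "0 < degree r" and s': "([:0, 1:] * s') mod r = 1 mod r"
  shows "krank (flat (phi x h m r s') M) = krank (ent (rep r (YM x h m n M)))"
proof -
  let ?Y = "YM x h m n M" and ?d = "dg ({..<h} \<times> {..<n})"
  have pw: "(monom 1 m * s' ^ m) mod r = 1 mod r"
  proof -
    have "monom 1 m * s' ^ m = ([:0, 1:] * s') ^ m"
      by (simp only: power_mult_distrib monom_altdef smult_1_left)
    also have "\<dots> mod r = (([:0, 1:] * s') mod r) ^ m mod r" by (rule power_mod[symmetric])
    also have "\<dots> = 1 mod r" by (simp only: s' power_mod power_one)
    finally show ?thesis .
  qed
  have Yin: "?Y \<in> rmat UNIV UNIV UNIV" using YM_in by (rule rmat_mono) auto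
  have din: "?d p \<in> rmat UNIV UNIV UNIV" for p :: "'k poly" by (rule rmat_dg) auto
  have dY: "?d p * ?Y \<in> rmat UNIV UNIV UNIV" for p by (rule rmat_mult[OF _ din Yin]) simp
  interpret k: arank "rmat UNIV UNIV UNIV" "\<lambda>M :: ((nat \<times> nat) \<times> nat, 'k) rfm. real (krank (ent M))" by (rule krank_arank)
  have e: "ent (rep r (?d (s' ^ m) * ?Y)) ((k, i), a) ((l, j), b) = flat (phi x h m r s') M (i, (k, a)) (j, (l, b))" for k i a l j b
  proof -
    have "M i j = \<zero>\<^bsub>CP\<^esub>" if "\<not> (i < n \<and> j < n)" using M that by (auto simp: mat_over_def not_less)
    moreover have "yp x h m \<zero>\<^bsub>CP\<^esub> k l = 0" by (simp add: yp_def ypc_def CP_simps)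
    ultimately show ?thesis by (auto simp: flat_def ent_phi ent_rep ent_dg_mult ent_YM)
  qed
  have eq1: "flat (phi x h m r s') M = (\<lambda>z w. ent (rep r (?d (s' ^ m) * ?Y)) ((fst (snd z), fst z), snd (snd z)) ((fst (snd w), fst w), snd (snd w)))"
    by (auto simp: fun_eq_iff e)
  have eq2: "ent (rep r (?d (s' ^ m) * ?Y)) = (\<lambda>z w. flat (phi x h m r s') M (snd (fst z), (fst (fst z), snd z)) (snd (fst w), (fst (fst w), snd w)))"
    by (auto simp: fun_eq_iff e)
  note fac = rmat_factors[OF rep_rmat[OF dY]]
  have "krank (flat (phi x h m r s') M) \<le> krank (ent (rep r (?d (s' ^ m) * ?Y)))"
    unfolding eq1 by (rule krank_reindex[OF fac])
  moreover have "factors_through (krank (ent (rep r (?d (s' ^ m) * ?Y)))) (flat (phi x h m r s') M)"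
    unfolding eq1 by (rule factors_reindex[OF fac])
  then have "krank (ent (rep r (?d (s' ^ m) * ?Y))) \<le> krank (flat (phi x h m r s') M)"
    by (subst (1) eq2) (rule krank_reindex)
  ultimately have 1: "krank (flat (phi x h m r s') M) = krank (ent (rep r (?d (s' ^ m) * ?Y)))" by simp
  have 2: "krank (ent (rep r (?d (s' ^ m) * ?Y))) \<le> krank (ent (rep r ?Y))"
    using k.mult_le_right[OF rep_rmat[OF din] rep_rmat[OF Yin]] by (simp add: rep_mult[OF r])
  have "rep r (?d (monom 1 m) * (?d (s' ^ m) * ?Y)) = rep r ?Y"
  proof (rule rfm_eqI)
    fix z w :: "(nat \<times> nat) \<times> nat"
    obtain k i a l j b where zw: "z = ((k, i), a)" "w = ((l, j), b)" by (metis prod.collapse)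
    have "(monom 1 m * (s' ^ m * p)) mod r = p mod r" for p
    proof -
      have "(monom 1 m * (s' ^ m * p)) mod r = ((monom 1 m * s' ^ m) mod r * p) mod r"
        by (simp only: mod_mult_left_eq mult.assoc)
      then show ?thesis by (simp only: pw mod_mult_left_eq mult_1)
    qed
    then show "ent (rep r (?d (monom 1 m) * (?d (s' ^ m) * ?Y))) z w = ent (rep r ?Y) z w"
      using pm_cong[of "monom 1 m * (s' ^ m * yp x h m (M i j) k l)" r "yp x h m (M i j) k l" a b]
      by (auto simp: zw ent_rep ent_dg_mult ent_YM)
  qed
  then have "krank (ent (rep r ?Y)) \<le> krank (ent (rep r (?d (s' ^ m) * ?Y)))"
    using k.mult_le_right[OF rep_rmat[OF din] rep_rmat[OF dY], of r "monom 1 m" r "s' ^ m"] by (simp add: rep_mult[OF r])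
  then show ?thesis using 1 2 by simp
qed

text \<open>If \<open>r = c + s * t\<close> with \<open>c\<close> nonzero, then \<open>s\<close>
  times \<open>- t / c\<close> is 1 modulo \<open>r\<close>.\<close>

lemma inverse_s:
  assumes "coeff r 0 \<noteq> 0"
  shows "\<exists>s'. ([:0, 1:] * s') mod r = 1 mod (r :: 'k poly)"
proof -
  obtain c t where r: "r = pCons c t" by (cases r)
  have c: "c \<noteq> 0" using assms r by simp
  have "[:0, 1:] * smult (- inverse c) t = 1 + r * [:- inverse c:]"
    using c by (simp add: r one_pCons)
  then have "([:0, 1:] * smult (- inverse c) t) mod r = 1 mod r"
    by (simp only: mod_mult_self2)
  then show ?thesis ..
qed

end

context dyn
begin

lemma ent_mult_gn: "ent (A * gn TX N 1) z (y, b) = (if y \<in> TX then ent A z (y, b + N) else 0)"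
  by (subst ent_mult[of "{(y, b + N)}"]) (auto simp: ent_gn tp_in split: if_splits)

end

text \<open>Exactly one \<open>l\<close> below \<open>h\<close> has the required residue.\<close>

lemma sum_dvd_unique:
  fixes v :: "'a::comm_monoid_add"
  assumes "0 < h"
  shows "(\<Sum>l<h. if int h dvd c + int l then v else 0) = v"
proof -
  define l0 where "l0 = nat ((- c) mod int h)"
  have l0: "int l0 = (- c) mod int h" "l0 < h" using assms by (simp_all add: l0_def nat_less_iff)
  have "int h dvd c + int l \<longleftrightarrow> l = l0" if "l < h" for l
  proof -
    have "int h dvd c + int l \<longleftrightarrow> int l mod int h = (- c) mod int h"
      by (simp add: mod_eq_dvd_iff add.commute)
    then show ?thesis using l0 that by auto
  qed
  then have "(\<Sum>l<h. if int h dvd c + int l then v else 0) = (\<Sum>l<h. if l = l0 then v else 0)"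
    by (intro sum.cong) auto
  then show ?thesis using l0(2) by simp
qed

context tower
begin

text \<open>Over the levels in \<open>I\<close> the coefficients equal those at the reference point,
  so the matrix over the algebra is the image of its polynomial matrix. The right factor shifts by
  \<open>m\<close> turns, after which, by \<open>neg\<close>, no negative turn is left.\<close>

lemma psi_expand:
  assumes M: "M \<in> mat_over CP n n" and I: "I \<subseteq> {..<h}"
    and const: "\<forall>i j d k y. k \<in> I --> y \<in> L k --> M i j d y = M i j d (tp (int k) x0)"
    and neg: "\<forall>i j k l q. k \<in> I --> l < h --> q < 0 --> M i j (int k - int l + (q - int m) * int h) (tp (int k) x0) = 0"
  shows "chi (\<Union>k\<in>I. L k) * frm emb n n M * dg UNIV (gn TX (int m * int h) 1) = psi (dg (I \<times> UNIV) 1 * YM x0 h m n M)"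
    (is "?A = ?B")
proof (intro rfm_eqI)
  fix i j and z w :: "'x \<times> int"
  obtain x a y b where zw: "z = (x, a)" "w = (y, b)" by (cases z, cases w) auto
  let ?F = "M i j" and ?W = "\<Union>k\<in>I. L k"
  show "ent (ent ?A i j) z w = ent (ent ?B i j) z w"
  proof (cases "i < n \<and> j < n")
    case False
    then have z: "ent (dg (I \<times> UNIV) 1 * YM x0 h m n M) (k, i) (l, j) = 0" for k l by (auto simp: ent_dg_mult ent_YM)
    show ?thesis using False by (auto simp: ent_mult_dg ent_chi_mult ent_frm ent_psi z)
  next
    case True
    have f: "finite (supp ?F)" using M True by (auto simp: mat_over_def carrier_CP)
    define v where "v = (if x = y \<and> x \<in> TX then ?F (a - (b + int m * int h)) (tp a x) else 0)"
    have lhs: "ent (ent ?A i j) z w = (if tp a x \<in> ?W then v else 0)"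
      using True by (auto simp: zw v_def ent_mult_dg ent_chi_mult ent_frm ent_mult_gn ent_gn_mult ent_emb[OF f])
    have t: "ent (gp k l (ent (dg (I \<times> UNIV) 1 * YM x0 h m n M) (k, i) (l, j))) z w
        = (if k \<in> I \<and> tp a x \<in> L k then (if int h dvd (a - b - int k) + int l then v else 0) else 0)"
      if kl: "k < h" "l < h" for k l
    proof (cases "k \<in> I \<and> tp a x \<in> L k \<and> int h dvd (a - b - int k) + int l \<and> x = y \<and> x \<in> TX")
      case False
      then show ?thesis unfolding zw ent_gp v_def using True kl by (auto simp: ent_dg_mult)
    next
      case c: True
      then obtain q where q: "(a - b - int k) + int l = int h * q" by (auto elim: dvdE)
      have e: "int k - int l + (q - int m) * int h = a - (b + int m * int h)" using q by (simp add: algebra_simps)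
      have dq: "((a - b - int k) + int l) div int h = q" unfolding q using h by simp
      have s: "0 \<le> (a - b - int k) + int l \<longleftrightarrow> 0 \<le> q" unfolding q using h by (simp add: zero_le_mult_iff)
      have vv: "v = ?F (a - (b + int m * int h)) (tp (int k) x0)" using c const unfolding v_def by metis
      have p: "ent (dg (I \<times> UNIV) 1 * YM x0 h m n M) (k, i) (l, j) = yp x0 h m ?F k l"
        using c True kl by (simp add: ent_dg_mult ent_YM)
      show ?thesis
      proof (cases "0 \<le> q")
        case True
        then have "ypc x0 h m ?F k l (nat q) = v" unfolding ypc_def vv e[symmetric] by simp
        then show ?thesis unfolding p zw ent_gp dq s coeff_yp[OF f h] using c True by auto
      next
        case False
        then have "v = 0" unfolding vv e[symmetric] using neg c kl by (meson not_le)
        then show ?thesis unfolding p zw ent_gp dq s using False by simp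
      qed
    qed
    have "ent (ent ?B i j) z w = (\<Sum>k<h. \<Sum>l<h. ent (gp k l (ent (dg (I \<times> UNIV) 1 * YM x0 h m n M) (k, i) (l, j))) z w)"
      by (simp only: ent_psi ent_sum)
    also have "\<dots> = (\<Sum>k<h. \<Sum>l<h. (if k \<in> I \<and> tp a x \<in> L k then (if int h dvd (a - b - int k) + int l then v else 0) else 0))"
      by (intro sum.cong refl t) auto
    also have "\<dots> = (\<Sum>k<h. if k \<in> I \<and> tp a x \<in> L k then v else 0)"
    proof (intro sum.cong refl)
      fix k
      show "(\<Sum>l<h. (if k \<in> I \<and> tp a x \<in> L k then (if int h dvd (a - b - int k) + int l then v else 0) else 0)) = (if k \<in> I \<and> tp a x \<in> L k then v else 0)"
        using sum_dvd_unique[OF h, of "a - b - int k" v] by (cases "k \<in> I \<and> tp a x \<in> L k") (simp, auto intro!: sum.neutral)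
    qed
    also have "\<dots> = (if tp a x \<in> ?W then v else 0)"
    proof (cases "tp a x \<in> ?W")
      case True
      then obtain k0 where k0: "k0 \<in> I" "tp a x \<in> L k0" by auto
      have "(\<Sum>k<h. if k \<in> I \<and> tp a x \<in> L k then v else 0) = (\<Sum>k<h. if k = k0 then v else 0)"
        using k0 I L_disj by (intro sum.cong refl) (auto simp: subset_eq)
      then show ?thesis using True k0 I by auto
    qed (auto intro!: sum.neutral)
    finally show ?thesis using lhs by simp
  qed
qed

end

section \<open>The invariant measure of a rank function, and the rank on a Rokhlin tower\<close>

context dyn
begin

lemma gn00: "U \<subseteq> TX ==> V \<subseteq> TX ==> gn U 0 1 * gn V 0 1 = gn (U \<inter> V) 0 1"
  by (simp add: gn_mult sh_0)

lemma un_gn_in: "clop U ==> un i j (gn U n c) \<in> MM"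
  by (rule rmat_un[OF C_sub]) (auto intro: gn_in)

text \<open>The power of \<open>t\<close> is a unit of the algebra and can be cancelled.\<close>

lemma un_shift:
  assumes r: "arank MM r" and U: "clop U"
  shows "r (un 0 0 (gn U d 1)) = r (un 0 0 (gn U 0 1))"
proof -
  interpret arank MM r by fact
  have "un 0 0 (gn U d 1) = un 0 0 (gn U 0 1) * un 0 0 (gn TX d 1)"
    "un 0 0 (gn U 0 1) = un 0 0 (gn U d 1) * un 0 0 (gn TX (- d) 1)"
    using clop_sub[OF U] by (simp_all add: un_mult_un gn_mult Int_absorb2)
  then show ?thesis using mult_le_left[OF un_gn_in[OF U] un_gn_in[OF clop_TX]] by (metis order_antisym)
qed

text \<open>A finitely additive \<open>T\<close>-invariant probability measure on the clopen sets;
  it measures all error terms.\<close>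

definition mu :: "'x set \<Rightarrow> real" where "mu U = rho (un 0 0 (gn U 0 1))"

lemma mu_TX: "mu TX = 1" using rho_one by (simp add: mu_def u_gn)

lemma mu_nonneg: "clop U ==> 0 \<le> mu U"
  unfolding mu_def by (rule arank.nonneg[OF arank_rho un_gn_in])

lemma mu_empty [simp]: "mu {} = 0" by (simp add: mu_def arank.zero[OF arank_rho])

lemma mu_mono: "clop U ==> clop V ==> U \<subseteq> V ==> mu U \<le> mu V"
proof -
  assume a: "clop U" "clop V" "U \<subseteq> V"
  have "un 0 0 (gn U 0 1) = un 0 0 (gn U 0 1) * un 0 0 (gn V 0 1)"
    using a clop_sub by (simp add: un_mult_un gn00 Int_absorb2)
  then show ?thesis unfolding mu_def using arank.mult_le_right[OF arank_rho un_gn_in[OF a(1)] un_gn_in[OF a(2)]] by metis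
qed

lemma mu_Un: "clop U ==> clop V ==> U \<inter> V = {} ==> mu (U \<union> V) = mu U + mu V"
proof -
  assume a: "clop U" "clop V" "U \<inter> V = {}"
  interpret arank MM rho by (rule arank_rho)
  have s: "U \<subseteq> TX" "V \<subseteq> TX" "V \<inter> U = {}" using a clop_sub by auto
  show ?thesis unfolding mu_def gn_Un[OF a(3)] un_add
    by (rule orth_add[of _ _ "un 0 0 (gn U 0 1)" "un 0 0 (gn U 0 1)" "un 0 0 (gn V 0 1)" "un 0 0 (gn V 0 1)"])
       (use a s un_gn_in in \<open>simp_all add: un_mult_un gn00\<close>)
qed

lemma mu_Un_le: "clop U ==> clop V ==> mu (U \<union> V) \<le> mu U + mu V"
  using mu_Un[of U "V - U"] clop_Diff[of V U] mu_mono[of "V - U" V] by (simp add: Un_Diff_cancel)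

lemma mu_UN_le: "finite I ==> (\<And>i. i \<in> I ==> clop (U i)) ==> mu (\<Union>i\<in>I. U i) \<le> (\<Sum>i\<in>I. mu (U i))"
proof (induction I rule: finite_induct)
  case (insert i I)
  have "mu (U i \<union> (\<Union>i\<in>I. U i)) \<le> mu (U i) + mu (\<Union>i\<in>I. U i)"
    by (rule mu_Un_le) (use insert clop_UN[of I U] in auto)
  then show ?case using insert by fastforce
qed simp

lemma mu_UN: "finite I ==> (\<And>i. i \<in> I ==> clop (U i)) ==> (\<And>i j. i \<in> I ==> j \<in> I ==> i \<noteq> j ==> U i \<inter> U j = {})
   ==> mu (\<Union>i\<in>I. U i) = (\<Sum>i\<in>I. mu (U i))"
proof (induction I rule: finite_induct)
  case (insert i I)
  have "U i \<inter> U j = {}" if "j \<in> I" for j using insert.prems(2)[of i j] insert.hyps that by auto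
  then have "mu (U i \<union> (\<Union>i\<in>I. U i)) = mu (U i) + mu (\<Union>i\<in>I. U i)"
    by (intro mu_Un) (use insert clop_UN[of I U] in auto)
  then show ?case using insert by fastforce
qed simp

lemma mu_sh: "clop U ==> mu (sh i U) = mu U"
proof -
  have le: "mu (sh i U) \<le> mu U" if U: "clop U" for i U
  proof -
    have "sh i U \<subseteq> TX" by (auto simp: sh_def)
    then have "un 0 0 (gn (sh i U) 0 1) = un 0 0 (gn TX i 1) * un 0 0 (gn U 0 1) * un 0 0 (gn TX (- i) 1)"
      by (simp add: un_mult_un gn_mult Int_absorb1 Int_absorb2)
    then show ?thesis unfolding mu_def
      using arank.mult3_le[OF arank_rho un_gn_in[OF clop_TX] un_gn_in[OF U] un_gn_in[OF clop_TX]] by metis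
  qed
  assume U: "clop U"
  have "mu U \<le> mu (sh i U)" using le[OF clop_sh[OF U, of i], of "- i"] sh_0[OF clop_sub[OF U]] by (simp add: sh_sh)
  then show ?thesis using le[OF U] by (simp add: order_antisym)
qed

text \<open>An error supported over \<open>U\<close> costs at most the measure of \<open>U\<close>
  for each row.\<close>

lemma chi_mu:
  assumes M: "M \<in> MM" and n: "\<forall>i j. n \<le> i --> ent M i j = 0" and U: "clop U"
  shows "rho (chi U * M) \<le> real n * mu U"
proof -
  interpret arank MM rho by (rule arank_rho)
  have 1: "chi U * M = dg {..<n} (gn U 0 1) * M"
    by (rule rfm_eqI) (use n in \<open>auto simp: ent_chi_mult ent_dg_mult not_less\<close>)
  have 2: "rho (un i i (gn U 0 1)) \<le> mu U" for i
  proof -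
    have "un i i (gn U 0 1) = un i 0 (gn TX 0 1) * un 0 0 (gn U 0 1) * un 0 i (gn TX 0 1)"
      using clop_sub[OF U] by (simp add: un_mult_un gn00 Int_absorb1 Int_absorb2)
    then show ?thesis unfolding mu_def
      using mult3_le[OF un_gn_in[OF clop_TX] un_gn_in[OF U] un_gn_in[OF clop_TX]] by metis
  qed
  have "rho (dg {..<n} (gn U 0 1)) \<le> real n * mu U"
  proof (induction n)
    case 0
    then show ?case by (simp add: zero)
  next
    case (Suc n)
    have "dg {..<Suc n} (gn U 0 1) = un n n (gn U 0 1) + dg {..<n} (gn U 0 1)"
      by (simp add: lessThan_Suc dg_insert)
    then have "rho (dg {..<Suc n} (gn U 0 1)) \<le> rho (un n n (gn U 0 1)) + rho (dg {..<n} (gn U 0 1))"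
      using add_le[OF un_gn_in[OF U] dg_gn_in[OF U]] by simp
    then show ?case using Suc 2[of n] by (simp add: algebra_simps)
  qed
  moreover have "rho (chi U * M) \<le> rho (dg {..<n} (gn U 0 1))"
    unfolding 1 by (rule mult_le_left[OF dg_gn_in[OF U] M]) simp
  ultimately show ?thesis by simp
qed

lemma chi_Un: "U \<inter> V = {} ==> chi (U \<union> V) * M = chi U * M + chi V * M"
  by (simp add: chi_def gn_Un dg_add distrib_right)

text \<open>Disjoint row cuts alone do not give additivity; the column cuts have to be disjoint as
  well, and then the cuts serve as local units.\<close>

lemma chi_orth:
  assumes r: "arank MM r" and M: "M \<in> MM" "M' \<in> MM" and c: "clop P" "clop P'" "clop Q" "clop Q'"
    and d: "P \<inter> P' = {}" "Q \<inter> Q' = {}"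
  shows "r (chi P * M * chi Q + chi P' * M' * chi Q') = r (chi P * M * chi Q) + r (chi P' * M' * chi Q')"
proof -
  interpret arank MM r by fact
  obtain N1 where N1: "\<And>i j. N1 \<le> i \<or> N1 \<le> j ==> ent M i j = 0" using rmat_nat_bound[OF M(1)] by metis
  obtain N2 where N2: "\<And>i j. N2 \<le> i \<or> N2 \<le> j ==> ent M' i j = 0" using rmat_nat_bound[OF M(2)] by metis
  define N where "N = max N1 N2"
  have N: "\<not> i < N ==> ent M i j = 0" "\<not> i < N ==> ent M' i j = 0"
    "\<not> j < N ==> ent M i j = 0" "\<not> j < N ==> ent M' i j = 0" for i j using N1[of i j] N2[of i j] by (auto simp: N_def not_less)
  note s = c[THEN clop_sub]
  have d': "P' \<inter> P = {}" "Q' \<inter> Q = {}" using d by auto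
  have l: "gn A 0 1 * (gn B 0 1 * y) = gn (A \<inter> B) 0 1 * y" if "A \<subseteq> TX" "B \<subseteq> TX" for A B y
    using gn00[OF that] by (simp add: mult.assoc[symmetric])
  let ?d = "\<lambda>A. dg {..<N} (gn A 0 1)"
  define a where "a = chi P * M * chi Q"
  define b where "b = chi P' * M' * chi Q'"
  have e: "ent a i j = gn P 0 1 * (ent M i j * gn Q 0 1)" "ent b i j = gn P' 0 1 * (ent M' i j * gn Q' 0 1)" for i j
    by (simp_all add: a_def b_def ent_mult_chi ent_chi_mult mult.assoc)
  have m: "a \<in> MM" "b \<in> MM" unfolding a_def b_def using M c by (auto intro: chi_in in_chi)
  have u1: "?d P * a = a" "a * ?d Q = a" "?d P' * b = b" "b * ?d Q' = b"
    by (rule rfm_eqI, simp add: ent_dg_mult ent_mult_dg e l gn00 s N mult.assoc)+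
  have u2: "?d P * b = 0" "?d P' * a = 0" "a * ?d Q' = 0" "b * ?d Q = 0"
    by (rule rfm_eqI, simp add: ent_dg_mult ent_mult_dg e l gn00 s d d' mult.assoc)+
  have "r (a + b) = r a + r b"
    by (rule orth_add[OF m _ _ _ _ u1 u2]) (use c in \<open>auto intro: dg_gn_in\<close>)
  then show ?thesis by (simp only: a_def b_def)
qed

text \<open>Compression to one orbit segment of length \<open>h\<close>: what leaves the segment is
  dropped, so the map is additive and unital but in general not multiplicative. The second index
  component is a dummy that fits the index type of approximants.\<close>

definition phi0 :: "'x \<Rightarrow> nat \<Rightarrow> (int \<Rightarrow> 'x \<Rightarrow> 'k) \<Rightarrow> (nat \<times> nat, 'k) rfm" where
  "phi0 x h F = Rfm (\<lambda>(k, a) (l, b). if k < h \<and> l < h \<and> a = 0 \<and> b = 0 then F (int k - int l) (tp (int k) x) else 0)"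

lemma ent_phi0: "ent (phi0 x h F) (k, a) (l, b) = (if k < h \<and> l < h \<and> a = 0 \<and> b = 0 then F (int k - int l) (tp (int k) x) else 0)"
proof -
  define g where "g = (\<lambda>(k, a :: nat) (l, b :: nat). if k < h \<and> l < h \<and> a = 0 \<and> b = 0 then F (int k - int l) (tp (int k) x) else 0)"
  have "finite {w. g z w \<noteq> 0}" for z
    by (rule finite_subset[of _ "{..<h} \<times> {0::nat}"]) (auto simp: g_def split: prod.splits if_splits)
  from ent_Rfm[OF this] show ?thesis unfolding phi0_def g_def[symmetric] by (simp add: g_def)
qed

lemma phi0_apx:
  assumes x: "x \<in> TX"
  shows "({..<h} \<times> {0}, phi0 x h) \<in> apx CP"
proof -
  let ?J = "{..<h} \<times> {0::nat}"
  have in1: "phi0 x h F \<in> rmat ?J ?J UNIV" for F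
  proof (rule rmatI[of ?J ?J])
    fix z w :: "nat \<times> nat" assume "z \<notin> ?J \<or> w \<notin> ?J"
    then show "ent (phi0 x h F) z w = 0" by (cases z, cases w) (auto simp: ent_phi0)
  qed auto
  have "ent (phi0 x h \<one>\<^bsub>CP\<^esub>) (k, a) (l, b) = ent (dg ?J 1) (k, a) (l, b)" for k a l b
    using tp_in[OF x] by (auto simp: ent_phi0 ent_dg CP_simps)
  then have one: "phi0 x h \<one>\<^bsub>CP\<^esub> = dg ?J 1" by (intro rfm_eqI) (metis prod.collapse)
  have "ent (phi0 x h \<zero>\<^bsub>CP\<^esub>) (k, a) (l, b) = ent 0 (k, a) (l, b)" for k a l b
    by (auto simp: ent_phi0 CP_simps)
  then have zero: "phi0 x h \<zero>\<^bsub>CP\<^esub> = 0" by (intro rfm_eqI) (metis prod.collapse)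
  have "ent (phi0 x h (F \<oplus>\<^bsub>CP\<^esub> G)) (k, a) (l, b) = ent (phi0 x h F + phi0 x h G) (k, a) (l, b)" for F G k a l b
    by (auto simp: ent_phi0 CP_simps)
  then have add: "phi0 x h (F \<oplus>\<^bsub>CP\<^esub> G) = phi0 x h F + phi0 x h G" for F G by (intro rfm_eqI) (metis prod.collapse)
  show ?thesis unfolding apx_def using in1 one zero add by auto
qed

text \<open>Rows outside \<open>I\<close> are dropped. If \<open>I\<close> keeps distance
  \<open>D\<close> from both ends, the remaining rows lose nothing by the truncation for elements of
  degree at most \<open>D\<close>.\<close>

definition WK :: "nat set \<Rightarrow> 'x \<Rightarrow> nat \<Rightarrow> nat \<Rightarrow> (nat \<Rightarrow> nat \<Rightarrow> int \<Rightarrow> 'x \<Rightarrow> 'k) \<Rightarrow> (nat \<times> nat, 'k) rfm" where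
  "WK I x h n M = Rfm (\<lambda>(k, i) (l, j). if k \<in> I \<and> k < h \<and> l < h \<and> i < n \<and> j < n then M i j (int k - int l) (tp (int k) x) else 0)"

lemma ent_WK: "ent (WK I x h n M) (k, i) (l, j) = (if k \<in> I \<and> k < h \<and> l < h \<and> i < n \<and> j < n then M i j (int k - int l) (tp (int k) x) else 0)"
proof -
  have "finite {z. (case z of (l, j) \<Rightarrow> if k \<in> I \<and> k < h \<and> l < h \<and> i < n \<and> j < n then M i j (int k - int l) (tp (int k) x) else 0) \<noteq> 0}" for k i
    by (rule finite_subset[of _ "{..<h} \<times> {..<n}"]) (auto split: if_splits)
  then show ?thesis unfolding WK_def by (subst ent_Rfm) (auto simp: case_prod_unfold)
qed

lemma WK_in: "WK I x h n M \<in> rmat ({..<h} \<times> UNIV) ({..<h} \<times> UNIV) UNIV"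
proof (rule rmatI[of "{..<h} \<times> {..<n}" "{..<h} \<times> {..<n}"])
  fix z w :: "nat \<times> nat" assume "z \<notin> {..<h} \<times> {..<n} \<or> w \<notin> {..<h} \<times> {..<n}"
  then show "ent (WK I x h n M) z w = 0" by (cases z, cases w) (auto simp: ent_WK)
qed auto

lemma krank_phi0:
  assumes M: "M \<in> mat_over CP n n"
  shows "krank (flat (phi0 x h) M) = krank (ent (WK UNIV x h n M))"
proof -
  \<comment> \<open>Indices with nonzero dummy component are sent to level \<open>h\<close>, where
    \<open>WK\<close> is zero.\<close>
  let ?W = "WK UNIV x h n M" and ?f = "\<lambda>z :: nat \<times> nat \<times> nat. (if snd (snd z) = 0 then fst (snd z) else h, fst z)"
  have z0: "M i j d y = 0" if "\<not> (i < n \<and> j < n)" for i j d y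
    using M that by (auto simp: mat_over_def not_less CP_simps)
  have e: "flat (phi0 x h) M (i, (k, a)) (j, (l, b)) = ent ?W (?f (i, (k, a))) (?f (j, (l, b)))" for k i a l j b
    using z0[of i j] by (auto simp: flat_def ent_phi0 ent_WK)
  have eq1: "flat (phi0 x h) M = (\<lambda>z w. ent ?W (?f z) (?f w))"
    by (intro ext) (metis e prod.collapse)
  have e2: "ent ?W (k, i) (l, j) = flat (phi0 x h) M (i, (k, 0)) (j, (l, 0))" for k i l j by (simp add: e)
  have eq2: "ent ?W = (\<lambda>z w. flat (phi0 x h) M (snd z, (fst z, 0)) (snd w, (fst w, 0)))"
    by (intro ext) (metis e2 prod.collapse)
  note fac = rmat_factors[OF WK_in[of UNIV x h n M]]
  have "krank (flat (phi0 x h) M) \<le> krank (ent ?W)" unfolding eq1 by (rule krank_reindex[OF fac])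
  moreover have "factors_through (krank (ent ?W)) (flat (phi0 x h) M)" unfolding eq1 by (rule factors_reindex[OF fac])
  then have "krank (ent ?W) \<le> krank (flat (phi0 x h) M)" by (subst (1) eq2) (rule krank_reindex)
  ultimately show ?thesis by simp
qed

lemma krank_WK:
  assumes M: "M \<in> mat_over CP n n"
  shows "\<bar>real (krank (flat (phi0 x h) M)) - real (krank (ent (WK I x h n M)))\<bar> \<le> real (card ({..<h} - I) * n)"
proof -
  let ?R = "({..<h} - I) \<times> {..<n}"
  interpret k: arank "rmat UNIV UNIV UNIV" "\<lambda>M :: (nat \<times> nat, 'k) rfm. real (krank (ent M))" by (rule krank_arank)
  have W: "WK A x h n M \<in> rmat UNIV UNIV UNIV" for A by (rule rmat_mono[OF WK_in]) auto
  have "ent (WK UNIV x h n M) (k, i) (l, j) = ent (WK I x h n M + WK (- I) x h n M) (k, i) (l, j)" for k i l j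
    by (auto simp: ent_WK)
  then have s: "WK UNIV x h n M = WK I x h n M + WK (- I) x h n M" by (intro rfm_eqI) (metis prod.collapse)
  have "krank (ent (WK (- I) x h n M)) \<le> card ?R"
    by (rule krank_rows) (auto simp: ent_WK split: if_splits)
  then have c: "krank (ent (WK (- I) x h n M)) \<le> card ({..<h} - I) * n" by (simp add: card_cartesian_product)
  have 1: "real (krank (ent (WK UNIV x h n M))) \<le> real (krank (ent (WK I x h n M))) + real (card ({..<h} - I) * n)"
    unfolding s using k.add_le[OF W[of I] W[of "- I"]] of_nat_mono[OF c, where 'a = real] by linarith
  have d: "dg ((I \<inter> {..<h}) \<times> {..<n}) 1 \<in> rmat UNIV UNIV (UNIV :: 'k set)" by (rule rmat_dg) auto
  have "ent (WK I x h n M) (k, i) (l, j) = ent (dg ((I \<inter> {..<h}) \<times> {..<n}) 1 * WK UNIV x h n M) (k, i) (l, j)" for k i l j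
    by (auto simp: ent_WK ent_dg_mult)
  then have "WK I x h n M = dg ((I \<inter> {..<h}) \<times> {..<n}) 1 * WK UNIV x h n M" by (intro rfm_eqI) (metis prod.collapse)
  then have "real (krank (ent (WK I x h n M))) \<le> real (krank (ent (WK UNIV x h n M)))"
    using k.mult_le_right[OF d W[of UNIV]] by simp
  then show ?thesis using 1 unfolding krank_phi0[OF M] by linarith
qed

text \<open>Constant polynomials, so that the tower construction is available without turns.\<close>

definition cm :: "(nat \<times> nat, 'k) rfm \<Rightarrow> (nat \<times> nat, 'k poly) rfm" where
  "cm W = Rfm (\<lambda>z w. [:ent W z w:])"

lemma ent_cm: "ent (cm W) z w = [:ent W z w:]"
  unfolding cm_def by (subst ent_Rfm) auto

lemma cm_add: "cm (W + W') = cm W + cm W'" by (rule rfm_eqI) (simp add: ent_cm)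

lemma cm_mult: "cm (W * W') = cm W * cm W'"
proof (rule rfm_eqI)
  fix z w
  have s: "[:sum f A:] = (\<Sum>a\<in>A. [:f a:])" for f :: "nat \<times> nat \<Rightarrow> 'k" and A
    by (rule poly_eqI) (auto simp: coeff_sum coeff_pCons split: nat.splits)
  show "ent (cm (W * W')) z w = ent (cm W * cm W') z w" by (simp add: ent_cm ent_times s mult.commute)
qed

lemma cm_in: "W \<in> rmat A B UNIV ==> cm W \<in> rmat A B (range (\<lambda>c. [:c:]))"
  unfolding rmat_def by (auto simp: ent_cm)

text \<open>From an interior level an element of degree at most \<open>D\<close> stays inside the
  tower, so it acts by a matrix of constants. The rank pulled back to matrices over the field is
  \<open>krank\<close> times its value on one level, which is \<open>mu E\<close>.\<close>

lemma Rokhlin_tower_rank: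
  assumes E: "clop E" and h: "0 < h" "2 * D \<le> h" and T1: "\<forall>d. 0 < d --> d < int h --> E \<inter> sh d E = {}"
    and x0: "x0 \<in> TX" and M: "M \<in> mat_over CP n n" and D: "\<forall>i j d x. int D < \<bar>d\<bar> --> M i j d x = 0"
    and const: "\<forall>i j d k y. k < h --> y \<in> sh (int k) E --> M i j d y = M i j d (tp (int k) x0)"
  shows "rho (chi (\<Union>k\<in>{D..<h - D}. sh (int k) E) * frm emb n n M) = real (krank (ent (WK {D..<h - D} x0 h n M))) * mu E"
proof -
  \<comment> \<open>With only constants in \<open>PC\<close>, condition \<open>T2\<close> concerns
    \<open>q = 0\<close> and holds without any periodicity.\<close>
  let ?I = "{D..<h - D}" and ?PC = "range (\<lambda>c :: 'k. [:c:])"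
  interpret t: tower X T rk rho TX E h ?PC
  proof (rule tower.intro[OF dyn_axioms tower_axioms.intro])
    show "mrank C rho u" by (rule mrank_rho)
    show "TX \<subseteq> TX" by simp
    show "tp i x \<in> TX" if "x \<in> TX" for i x using that by (rule tp_in)
    show "rho Z = 0" if Z: "Z \<in> MM" and z: "\<And>i j x p w. x \<in> TX ==> ent (ent Z i j) (x, p) w = 0" for Z
    proof -
      have "ent (ent Z i j) (x, p) (y, q) = 0" for i j x p y q
        using z C_block[OF rmat_entry[OF Z], of i j x p y q] by blast
      then have "Z = 0" by (intro rfm_eqI) (metis ent_0 prod.collapse)
      then show ?thesis by (simp add: arank.zero[OF arank_rho])
    qed
    show "clop E" "0 < h" by fact+
    show "E \<inter> sh d E = {}" if "0 < d" "d < int h" for d using T1 that by blast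
    show "subring_set ?PC" unfolding subring_set_def
    proof (intro conjI ballI)
      fix a b assume ab: "a \<in> ?PC" "b \<in> ?PC"
      then obtain c d where "a = [:c:]" "b = [:d:]" by auto
      then show "a + b \<in> ?PC" "a * b \<in> ?PC" by auto
    next
      fix a assume "a \<in> ?PC" then obtain c where "a = [:c:]" by auto
      then show "- a \<in> ?PC" by auto
    next
      have "0 = [:0 :: 'k:]" by simp
      then show "0 \<in> ?PC" by (rule range_eqI)
    qed
    show "x \<in> sh (int q * int h) E \<longleftrightarrow> x \<in> E" if "p \<in> ?PC" "coeff p q \<noteq> 0" for p q x
    proof -
      have "q = 0" using that by (auto simp: coeff_pCons split: nat.splits)
      then show ?thesis using sh_0[OF clop_sub[OF E]] by simp
    qed
  qed
  have Mx: "frm emb n n M \<in> MM" by (rule frm_rmat[OF C_sub]) (use M in \<open>auto simp: C_def mat_over_def\<close>)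
  have cl: "clop (\<Union>k\<in>?I. sh (int k) E)" by (rule clop_UN) (auto intro: clop_sh E)
  let ?A = "chi (\<Union>k\<in>?I. sh (int k) E) * frm emb n n M"
  have AM: "?A \<in> MM" by (rule chi_in[OF Mx cl])
  have "?A = ?A * dg UNIV (gn TX (int 0 * int h) 1)" using chi_TX(2)[OF AM] by (simp add: chi_def)
  also have "\<dots> = t.psi (dg (?I \<times> UNIV) 1 * YM x0 h 0 n M)"
    unfolding t.L_def[symmetric]
  proof (rule t.psi_expand[OF M])
    show "?I \<subseteq> {..<h}" by auto
    show "\<forall>i j d k y. k \<in> ?I --> y \<in> t.L k --> M i j d y = M i j d (tp (int k) x0)"
      using const by (auto simp: t.L_def)
    show "\<forall>i j k l q. k \<in> ?I --> l < h --> q < 0 --> M i j (int k - int l + (q - int 0) * int h) (tp (int k) x0) = 0"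
    proof (intro allI impI)
      fix i j k l and q :: int assume a: "k \<in> ?I" "l < h" "q < 0"
      have "q * int h \<le> (- 1) * int h" by (rule mult_right_mono) (use a in auto)
      moreover have "int k < int h - int D" using a by auto
      ultimately have "int D < \<bar>int k - int l + (q - int 0) * int h\<bar>" by simp
      then show "M i j (int k - int l + (q - int 0) * int h) (tp (int k) x0) = 0" using D by blast
    qed
  qed
  also have "dg (?I \<times> UNIV) 1 * YM x0 h 0 n M = cm (WK ?I x0 h n M)"
  proof -
    have "ent (dg (?I \<times> UNIV) 1 * YM x0 h 0 n M) (k, i) (l, j) = ent (cm (WK ?I x0 h n M)) (k, i) (l, j)" for k i l j
    proof (cases "k \<in> ?I \<and> l < h \<and> i < n \<and> j < n")
      case True
      have f: "finite (supp (M i j))" using M True by (auto simp: mat_over_def carrier_CP)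
      have "yp x0 h 0 (M i j) k l = [:M i j (int k - int l) (tp (int k) x0):]"
      proof (rule poly_eqI)
        fix q
        show "coeff (yp x0 h 0 (M i j) k l) q = coeff [:M i j (int k - int l) (tp (int k) x0):] q"
        proof (cases q)
          case (Suc q')
          have "1 * int h \<le> int q * int h" by (rule mult_right_mono) (use Suc in auto)
          moreover have "int D \<le> int k" "int l < int h" using True by auto
          moreover have e: "(int q - int 0) * int h = int q * int h" by simp
          ultimately have "int D < \<bar>int k - int l + (int q - int 0) * int h\<bar>" unfolding e by linarith
          then have "M i j (int k - int l + (int q - int 0) * int h) (tp (int k) x0) = 0" using D by blast
          then show ?thesis unfolding coeff_yp[OF f h(1)] ypc_def using Suc by simp
        qed (simp add: coeff_yp[OF f h(1)] ypc_def)
      qed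
      then show ?thesis using True by (simp add: ent_dg_mult ent_YM ent_cm ent_WK)
    qed (auto simp: ent_dg_mult ent_YM ent_cm ent_WK)
    then show ?thesis by (intro rfm_eqI) (metis prod.collapse)
  qed
  finally have 1: "?A = t.psi (cm (WK ?I x0 h n M))" .
  have ar: "arank (rmat t.J t.J UNIV) (\<lambda>W. rho (t.psi (cm W)))"
    by (rule arank_pullback[OF t.arank_psi, of "rmat t.J t.J UNIV" cm]) (auto simp: cm_add cm_mult intro: cm_in)
  have j0: "((0::nat), (0::nat)) \<in> t.J" using h by simp
  have "cm (un (0, 0) (0, 0) 1) = un (0, 0) (0, 0) (monom 1 0)"
    by (rule rfm_eqI) (auto simp: ent_cm ent_un monom_0)
  then have "rho (t.psi (cm (un (0, 0) (0, 0) 1))) = mu E" by (simp only: t.psi_unit) (simp add: mu_def)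
  then show ?thesis unfolding 1 using arank_field[OF ar j0 WK_in] by simp
qed

text \<open>Functions that approximants represent exactly on \<open>FM\<close>. Errors are kept
  apart, so the contributions of different towers can simply be added.\<close>

definition cone :: "(nat \<Rightarrow> nat \<Rightarrow> int \<Rightarrow> 'x \<Rightarrow> 'k) set \<Rightarrow> ((nat \<Rightarrow> nat \<Rightarrow> int \<Rightarrow> 'x \<Rightarrow> 'k) \<Rightarrow> real) \<Rightarrow> bool" where
  "cone FM f \<longleftrightarrow> (\<exists>(K :: (int \<Rightarrow> 'x \<Rightarrow> 'k, 'k) approximant set) w. finite K \<and> K \<subseteq> apx CP \<and> (\<forall>i\<in>K. 0 \<le> w i) \<and>
     (\<forall>M\<in>FM. f M = (\<Sum>i\<in>K. w i * real (krank (flat (snd i) M)))))"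

lemma cone_cong: "cone FM f ==> (\<And>M. M \<in> FM ==> g M = f M) ==> cone FM g"
  unfolding cone_def by simp

lemma cone_zero: "cone FM (\<lambda>M. 0)"
  unfolding cone_def by (intro exI[of _ "{}"]) simp

lemma cone_single:
  fixes i :: "(int \<Rightarrow> 'x \<Rightarrow> 'k, 'k) approximant"
  shows "i \<in> apx CP ==> 0 \<le> c ==> cone FM (\<lambda>M. c * real (krank (flat (snd i) M)))"
  unfolding cone_def by (intro exI[of _ "{i}"] exI[of _ "\<lambda>_. c"]) simp

lemma cone_add: "cone FM f ==> cone FM g ==> cone FM (\<lambda>M. f M + g M)"
proof -
  assume "cone FM f" "cone FM g"
  then obtain K K' :: "(int \<Rightarrow> 'x \<Rightarrow> 'k, 'k) approximant set" and w w' where 1: "finite K" "K \<subseteq> apx CP" "\<forall>i\<in>K. 0 \<le> w i" "\<forall>M\<in>FM. f M = (\<Sum>i\<in>K. w i * real (krank (flat (snd i) M)))"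
    and 2: "finite K'" "K' \<subseteq> apx CP" "\<forall>i\<in>K'. 0 \<le> w' i" "\<forall>M\<in>FM. g M = (\<Sum>i\<in>K'. w' i * real (krank (flat (snd i) M)))"
    unfolding cone_def by blast
  define v where "v i = (if i \<in> K then w i else 0) + (if i \<in> K' then w' i else 0)" for i
  have "f M + g M = (\<Sum>i\<in>K \<union> K'. v i * real (krank (flat (snd i) M)))" if "M \<in> FM" for M
  proof -
    let ?g = "\<lambda>i. real (krank (flat (snd i) M))"
    have "(\<Sum>i\<in>K. w i * ?g i) = (\<Sum>i\<in>K \<union> K'. (if i \<in> K then w i else 0) * ?g i)"
      by (rule sum.mono_neutral_cong_left) (use 1 2 in auto)
    moreover have "(\<Sum>i\<in>K'. w' i * ?g i) = (\<Sum>i\<in>K \<union> K'. (if i \<in> K' then w' i else 0) * ?g i)"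
      by (rule sum.mono_neutral_cong_left) (use 1 2 in auto)
    ultimately show ?thesis using 1(4) 2(4) that by (simp add: v_def distrib_right sum.distrib)
  qed
  then show ?thesis unfolding cone_def using 1 2
    by (intro exI[of _ "K \<union> K'"] exI[of _ v]) (auto simp: v_def)
qed

lemma cone_sum: "finite A ==> (\<And>a. a \<in> A ==> cone FM (f a)) ==> cone FM (\<lambda>M. \<Sum>a\<in>A. f a M)"
  by (induction A rule: finite_induct) (auto intro: cone_zero cone_add)

end

section \<open>Neighbourhoods with constant coefficients or without short returns\<close>

context dyn
begin

lemma frm_in: "M \<in> mat_over CP n n ==> frm emb n n M \<in> MM"
  by (rule frm_rmat[OF C_sub]) (auto simp: C_def mat_over_def)

lemma dg_gn_cancel:
  assumes A: "A \<in> MM" and out: "\<And>i j. \<not> j < n ==> ent A i j = 0"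
  shows "A = A * dg {..<n} (gn TX N 1) * dg {..<n} (gn TX (- N) 1)"
proof -
  have g: "gn TX N 1 * gn TX (- N) 1 = u" by (simp add: gn_mult u_gn)
  show ?thesis unfolding mult.assoc dg_mult_dg g
    by (rule rfm_eqI) (simp add: ent_mult_dg out u_unit(2)[OF rmat_entry[OF A]])
qed

lemma finite_const_nbhd:
  assumes FF: "finite FF" "FF \<subseteq> lc" and x: "x \<in> TX"
  shows "\<exists>U. clop U \<and> x \<in> U \<and> (\<forall>k<H. \<forall>y\<in>sh (int k) U. \<forall>f\<in>FF. f y = f (tp (int k) x))"
proof -
  have ex: "\<exists>V. clop V \<and> tp (int k) x \<in> V \<and> (\<forall>y\<in>V. f y = f (tp (int k) x))" if f: "f \<in> FF" for k f
    by (rule lcD[OF subsetD[OF FF(2) f] tp_in[OF x]])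
  define V where "V k f = (SOME V. clop V \<and> tp (int k) x \<in> V \<and> (\<forall>y\<in>V. f y = f (tp (int k) x)))" for k and f :: "'x \<Rightarrow> 'k"
  have V: "clop (V k f) \<and> tp (int k) x \<in> V k f \<and> (\<forall>y\<in>V k f. f y = f (tp (int k) x))" if "f \<in> FF" for k f
    unfolding V_def by (rule someI_ex[OF ex[OF that]])
  note V1 = V[THEN conjunct1] and V2 = V[THEN conjunct2, THEN conjunct1] and V3 = V[THEN conjunct2, THEN conjunct2, THEN bspec]
  define U where "U = TX \<inter> (\<Inter>z\<in>{..<H} \<times> FF. sh (- int (fst z)) (V (fst z) (snd z)))"
  have "clop U" unfolding U_def by (rule clop_INT) (use FF(1) V1 in \<open>auto intro!: clop_sh\<close>)
  moreover have "x \<in> U" using x V2 by (auto simp: U_def sh_def)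
  moreover have "f y = f (tp (int k) x)" if k: "k < H" and y: "y \<in> sh (int k) U" and f: "f \<in> FF" for k y f
  proof -
    have yX: "y \<in> TX" and z: "tp (- int k) y \<in> U" using y by (auto simp: sh_def)
    have "(k, f) \<in> {..<H} \<times> FF" using k f by simp
    then have "tp (- int k) y \<in> sh (- int k) (V k f)" using z unfolding U_def by fastforce
    then have "tp (int k) (tp (- int k) y) \<in> V k f" by (simp add: sh_def)
    then have "y \<in> V k f" using yX by simp
    then show ?thesis by (rule V3[OF f])
  qed
  ultimately show ?thesis by (intro exI[of _ U] conjI allI impI ballI)
qed

text \<open>By the degree bound only finitely many coefficient functions are involved.\<close>

lemma coeff_nbhd:
  assumes FM: "finite FM" "FM \<subseteq> mat_over CP n n" and D: "\<forall>M\<in>FM. \<forall>i j d x. int D < \<bar>d\<bar> --> M i j d x = 0" and x: "x \<in> TX"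
  shows "\<exists>U. clop U \<and> x \<in> U \<and> (\<forall>M\<in>FM. \<forall>i j d k y. k < H --> y \<in> sh (int k) U --> M i j d y = M i j d (tp (int k) x))"
proof -
  define FF where "FF = (\<lambda>(M, i, j, d). M i j d) ` (FM \<times> {..<n} \<times> {..<n} \<times> {- int D..int D})"
  have FF1: "finite FF" unfolding FF_def using FM by simp
  have FF2: "FF \<subseteq> lc"
  proof
    fix f assume "f \<in> FF"
    then obtain M i j d where f: "f = M i j d" "M \<in> FM" "i < n" "j < n" by (auto simp: FF_def)
    then have "M i j \<in> carrier CP" using FM by (auto simp: mat_over_def)
    then show "f \<in> lc" using f by (simp add: carrier_CP)
  qed
  from finite_const_nbhd[OF FF1 FF2 x, of H]
  obtain U where U: "clop U" "x \<in> U" "\<forall>k<H. \<forall>y\<in>sh (int k) U. \<forall>f\<in>FF. f y = f (tp (int k) x)"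
    by (elim exE conjE)
  have main: "M i j d y = M i j d (tp (int k) x)" if "M \<in> FM" "k < H" "y \<in> sh (int k) U" for M i j d k y
  proof (cases "i < n \<and> j < n \<and> \<bar>d\<bar> \<le> int D")
    case True
    then have "(M, i, j, d) \<in> FM \<times> {..<n} \<times> {..<n} \<times> {- int D..int D}" using that by auto
    then have "M i j d \<in> FF" unfolding FF_def by (rule rev_image_eqI) simp
    then show ?thesis by (rule U(3)[rule_format, OF that(2,3)])
  next
    case False
    then consider "\<not> (i < n \<and> j < n)" | "int D < \<bar>d\<bar>" by linarith
    then show ?thesis
    proof cases
      case 1
      then have "M i j = \<zero>\<^bsub>CP\<^esub>" using FM that by (auto simp: mat_over_def not_less)
      then show ?thesis by (simp add: CP_simps)
    next
      case 2
      then show ?thesis using D[rule_format, OF that(1)] by simp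
    qed
  qed
  show ?thesis by (intro exI[of _ U] conjI ballI allI impI U(1,2)) (rule main)
qed

text \<open>Hausdorff separation of \<open>x\<close> from finitely many translates, none of which is
  \<open>x\<close> itself.\<close>

lemma free_nbhd:
  assumes x: "x \<in> TX" and nf: "\<forall>k. 0 < k --> k < H --> tp (int k) x \<noteq> x"
  shows "\<exists>U. clop U \<and> x \<in> U \<and> (\<forall>k. 0 < k --> k < int H --> U \<inter> sh k U = {})"
proof -
  have "\<exists>U. clop U \<and> x \<in> U \<and> U \<inter> sh (int k) U = {}" if k: "0 < k" "k < H" for k
  proof -
    have ne: "x \<noteq> tp (- int k) x"
    proof
      assume a: "x = tp (- int k) x"
      have "tp (int k) (tp (- int k) x) = x" using x by simp
      then have "tp (int k) x = x" using a by simp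
      then show False using nf k by blast
    qed
    have tx: "tp (- int k) x \<in> TX" by (rule tp_in[OF x])
    obtain A B where AB: "openin X A" "openin X B" "x \<in> A" "tp (- int k) x \<in> B" "disjnt A B"
      using haus x tx ne unfolding Hausdorff_space_def by metis
    have o: "openin X (A \<inter> {z \<in> TX. tp (- int k) z \<in> B})"
      using openin_continuous_map_preimage[OF tp_cont AB(2)] AB(1) by blast
    obtain U where U: "clop U" "x \<in> U" "U \<subseteq> A \<inter> {z \<in> TX. tp (- int k) z \<in> B}"
      using clop_base[OF _ o, of x] AB x by blast
    have "U \<inter> sh (int k) U = {}" using U(3) AB(5) by (auto simp: sh_def disjnt_def)
    then show ?thesis using U by blast
  qed
  then have "\<forall>k\<in>{0<..<H}. \<exists>U. clop U \<and> x \<in> U \<and> U \<inter> sh (int k) U = {}" by auto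
  then obtain V where V: "\<forall>k\<in>{0<..<H}. clop (V k) \<and> x \<in> V k \<and> V k \<inter> sh (int k) (V k) = {}" by metis
  define U where "U = TX \<inter> (\<Inter>k\<in>{0<..<H}. V k)"
  have "clop U" unfolding U_def by (rule clop_INT) (use V in auto)
  moreover have "x \<in> U" using V x by (auto simp: U_def)
  moreover have "U \<inter> sh k U = {}" if k: "0 < k" "k < int H" for k
  proof -
    have "nat k \<in> {0<..<H}" using k by auto
    then have "V (nat k) \<inter> sh (int (nat k)) (V (nat k)) = {}" "U \<subseteq> V (nat k)" using V by (blast, auto simp: U_def)
    then have "V (nat k) \<inter> sh k (V (nat k)) = {}" "U \<subseteq> V (nat k)" using k by simp_all
    then show ?thesis by (auto simp: sh_def)
  qed
  ultimately show ?thesis by blast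
qed

end

section \<open>The rank at the periodic points\<close>

context dynF
begin

lemma rp_cong:
  assumes Z: "Z \<in> MM" "Z' \<in> MM" and e: "\<And>i j x p y q. x \<in> Fx ==> ent (ent Z i j) (x, p) (y, q) = ent (ent Z' i j) (x, p) (y, q)"
  shows "rp Z = rp Z'"
proof -
  interpret m: mrank C rp u by (rule mrank_rp)
  have "rp (Z - Z') = 0"
    by (rule rp_null[OF m.closed(5)[OF Z]]) (use e in \<open>auto simp: split_paired_all\<close>)
  then have "m.eq0 Z Z'" using Z by (simp add: m.eq0_def)
  then show ?thesis by (rule m.eq0_r)
qed

lemma ent_chi: "ent (ent (chi V * M) i j) (x, p) w = (if x \<in> TX \<and> tp p x \<in> V then ent (ent M i j) (x, p) w else 0)"
  by (simp add: ent_chi_mult ent_gn_mult)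

lemma ent_chi_right: "ent (ent (M * chi V) i j) z (y, q) = (if y \<in> TX \<and> tp q y \<in> V then ent (ent M i j) z (y, q) else 0)"
  unfolding ent_mult_chi by (subst ent_mult[of "{(y, q)}"]) (auto simp: ent_gn split: if_splits)

lemma rp_chi_cong:
  assumes M: "M \<in> MM" and V: "clop V" "clop W" and e: "\<And>x. x \<in> Fx ==> x \<in> V \<longleftrightarrow> x \<in> W"
  shows "rp (chi V * M) = rp (chi W * M)"
  by (rule rp_cong) (use M V e Fx_inv in \<open>auto simp: chi_in ent_chi\<close>)

text \<open>Over \<open>Fx\<close> both sets are invariant, so cutting rows is the same as cutting
  columns there, and \<open>rp\<close> does not see what happens elsewhere. This makes the sum
  orthogonal.\<close>

lemma rp_split:
  assumes M: "M \<in> MM" and B: "clop B" "clop B'" "B \<inter> B' = {}"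
    and inv: "\<And>x i. x \<in> Fx ==> tp i x \<in> B \<longleftrightarrow> x \<in> B" "\<And>x i. x \<in> Fx ==> tp i x \<in> B' \<longleftrightarrow> x \<in> B'"
  shows "rp (chi (B \<union> B') * M) = rp (chi B * M) + rp (chi B' * M)"
proof -
  have blk: "ent (ent M i j) (x, p) (y, q) = 0" if "x \<noteq> y" for i j x p y q
    using C_block[OF rmat_entry[OF M], of i j x p y q] that by blast
  have ii: "tp p x \<in> V \<longleftrightarrow> tp q x \<in> V" if "\<And>x i. x \<in> Fx ==> tp i x \<in> V \<longleftrightarrow> x \<in> V" "x \<in> Fx" for V p q x
    using that by blast
  have one: "rp (chi V * M) = rp (chi V * M * chi V)" if V: "clop V" and iv: "\<And>x i. x \<in> Fx ==> tp i x \<in> V \<longleftrightarrow> x \<in> V" for V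
  proof (rule rp_cong)
    fix i j x p y q assume x: "x \<in> Fx"
    show "ent (ent (chi V * M) i j) (x, p) (y, q) = ent (ent (chi V * M * chi V) i j) (x, p) (y, q)"
      using ii[OF iv x, of p q] blk[of x y i j p q] x Fx_sub by (cases "x = y") (auto simp: ent_chi ent_chi_right)
  qed (use M V in \<open>auto intro: chi_in in_chi\<close>)
  have "rp (chi (B \<union> B') * M) = rp (chi B * M * chi B + chi B' * M * chi B')"
  proof (rule rp_cong)
    fix i j x p y q assume x: "x \<in> Fx"
    show "ent (ent (chi (B \<union> B') * M) i j) (x, p) (y, q) = ent (ent (chi B * M * chi B + chi B' * M * chi B') i j) (x, p) (y, q)"
      using ii[OF inv(1) x, of p q] ii[OF inv(2) x, of p q] blk[of x y i j p q] x Fx_sub B(3)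
      by (cases "x = y") (auto simp: ent_chi ent_chi_right)
  qed (use M B in \<open>auto intro!: chi_in in_chi clop_Un arank.closed(2)[OF arank_rp]\<close>)
  also have "\<dots> = rp (chi B * M * chi B) + rp (chi B' * M * chi B')"
    by (rule chi_orth[OF arank_rp M M B(1,2) B(1,2) B(3) B(3)])
  finally show ?thesis using one[OF B(1) inv(1)] one[OF B(2) inv(2)] by simp
qed

text \<open>On \<open>Fx\<close> the base is invariant under \<open>h\<close> steps, so the tower
  closes up and all polynomials are allowed as entries. In the pulled back rank the variable has
  full rank, because it acts on the base as a power of the unit \<open>t\<close>; the decomposition
  over quotients then provides the approximants.\<close>

lemma cyclic_tower_cone:
  assumes FM: "finite FM" "FM \<subseteq> mat_over CP n n" and D: "\<forall>M\<in>FM. \<forall>i j d x. int D < \<bar>d\<bar> --> M i j d x = 0"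
    and E: "clop E" and h: "0 < h" and T1: "\<forall>d. 0 < d --> d < int h --> E \<inter> sh d E = {}"
    and inv: "\<forall>y\<in>Fx. y \<in> sh (int h) E \<longleftrightarrow> y \<in> E" and x0: "x0 \<in> TX"
    and const: "\<forall>M\<in>FM. \<forall>i j d k y. k < h --> y \<in> sh (int k) E --> M i j d y = M i j d (tp (int k) x0)"
  shows "cone FM (\<lambda>M. rp (chi (\<Union>k<h. sh (int k) E) * frm emb n n M))"
proof -
  have inv': "y \<in> sh (int q * int h) E \<longleftrightarrow> y \<in> E" if "y \<in> Fx" for y q
    using that
  proof (induction q arbitrary: y)
    case 0
    then show ?case using sh_0[OF clop_sub[OF E]] by simp
  next
    case (Suc q)
    have yX: "y \<in> TX" using Suc Fx_sub by blast
    have "y \<in> sh (int (Suc q) * int h) E \<longleftrightarrow> y \<in> sh (int h) (sh (int q * int h) E)"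
      by (simp add: sh_sh algebra_simps)
    also have "\<dots> \<longleftrightarrow> tp (- int h) y \<in> sh (int q * int h) E" using yX by (simp add: sh_def[of "int h"])
    also have "\<dots> \<longleftrightarrow> tp (- int h) y \<in> E" by (rule Suc.IH[OF Fx_inv[OF Suc.prems]])
    also have "\<dots> \<longleftrightarrow> y \<in> sh (int h) E" using yX by (simp add: sh_def)
    finally show ?case using inv Suc.prems by blast
  qed
  interpret t: tower X T rk rp Fx E h "UNIV :: 'k poly set"
  proof (rule tower.intro[OF dyn_axioms tower_axioms.intro])
    show "mrank C rp u" by (rule mrank_rp)
    show "Fx \<subseteq> TX" by (rule Fx_sub)
    show "tp i x \<in> Fx" if "x \<in> Fx" for i x using that by (rule Fx_inv)
    show "rp Z = 0" if "Z \<in> MM" "\<And>i j x p w. x \<in> Fx ==> ent (ent Z i j) (x, p) w = 0" for Z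
      using that by (rule rp_null)
    show "clop E" "0 < h" by fact+
    show "E \<inter> sh d E = {}" if "0 < d" "d < int h" for d using T1 that by blast
    show "subring_set (UNIV :: 'k poly set)" by simp
    show "x \<in> sh (int q * int h) E \<longleftrightarrow> x \<in> E" if "x \<in> Fx" for q x by (rule inv'[OF that])
  qed
  \<comment> \<open>With this offset a negative exponent \<open>q\<close> belongs to a degree below
    \<open>- D\<close>, where all coefficients vanish.\<close>
  define m where "m = D + 1"
  have cl: "clop (\<Union>k<h. sh (int k) E)" by (rule clop_UN) (auto intro: clop_sh E)
  have main: "rp (chi (\<Union>k<h. sh (int k) E) * frm emb n n M) = rp (t.psi (YM x0 h m n M))" if M: "M \<in> FM" for M
  proof -
    let ?A = "chi (\<Union>k<h. sh (int k) E) * frm emb n n M" and ?N = "int m * int h"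
    have Mm: "M \<in> mat_over CP n n" using FM M by blast
    have AM: "?A \<in> MM" by (rule chi_in[OF frm_in[OF Mm] cl])
    have out: "\<not> j < n ==> ent ?A i j = 0" for i j by (simp add: ent_chi_mult ent_frm)
    have e1: "?A * dg UNIV (gn TX ?N 1) = ?A * dg {..<n} (gn TX ?N 1)"
      by (rule rfm_eqI) (simp add: ent_mult_dg out)
    have e2: "?A = ?A * dg {..<n} (gn TX ?N 1) * dg {..<n} (gn TX (- ?N) 1)"
      by (rule dg_gn_cancel[OF AM]) (rule out)
    \<comment> \<open>The offset is a power of the unit \<open>t\<close>, so it does not change the
      rank.\<close>
    have "rp (?A * dg {..<n} (gn TX ?N 1)) \<le> rp ?A"
      by (rule arank.mult_le_left[OF arank_rp AM dg_gn_in]) auto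
    moreover have "rp ?A \<le> rp (?A * dg {..<n} (gn TX ?N 1))"
      by (subst e2, rule arank.mult_le_left[OF arank_rp arank.closed(3)[OF arank_rp AM dg_gn_in] dg_gn_in]) auto
    ultimately have "rp ?A = rp (?A * dg UNIV (gn TX ?N 1))" unfolding e1 by simp
    also have "?A * dg UNIV (gn TX ?N 1) = t.psi (dg ({..<h} \<times> UNIV) 1 * YM x0 h m n M)"
      unfolding t.L_def[symmetric]
    proof (rule t.psi_expand[OF Mm])
      show "\<forall>i j d k y. k \<in> {..<h} --> y \<in> t.L k --> M i j d y = M i j d (tp (int k) x0)"
        by (intro allI impI, rule const[rule_format, OF M]) (simp_all add: t.L_def)
      show "\<forall>i j k l q. k \<in> {..<h} --> l < h --> q < 0 --> M i j (int k - int l + (q - int m) * int h) (tp (int k) x0) = 0"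
      proof (intro allI impI)
        fix i j k l and q :: int assume a: "k \<in> {..<h}" "l < h" "q < 0"
        have "(q - int m) * int h \<le> (- 1 - int m) * int h" by (rule mult_right_mono) (use a in auto)
        also have "\<dots> = - int h + (- int m) * int h" by (simp add: algebra_simps)
        also have "\<dots> \<le> - int h + (- int m) * 1"
          by (intro add_left_mono mult_left_mono_neg) (use h in auto)
        finally have "int D < \<bar>int k - int l + (q - int m) * int h\<bar>" using a by (auto simp: m_def)
        then show "M i j (int k - int l + (q - int m) * int h) (tp (int k) x0) = 0" using D M by blast
      qed
    qed auto
    also have "dg ({..<h} \<times> UNIV) 1 * YM x0 h m n M = YM x0 h m n M" by (rule dg_mult_absorb[OF YM_in])
    finally show ?thesis .
  qed
  have pa: "poly_arank t.J (\<lambda>W. rp (t.psi W)) (0, 0) (0, 1)"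
    unfolding poly_arank_def poly_arank_axioms_def using t.arank_psi h by auto
  have s: "rp (t.psi (un (0, 0) (0, 0) [:0, 1:])) = rp (t.psi (un (0, 0) (0, 0) 1))"
  proof -
    have m01: "[:0, 1:] = monom (1::'k) 1" "1 = monom (1::'k) 0" by (simp_all add: monom_altdef)
    show ?thesis unfolding m01 t.psi_unit using un_shift[OF arank_rp E, of "int 1 * int h"] by simp
  qed
  let ?Y = "\<lambda>M. YM x0 h m n M"
  have YY: "finite (?Y ` FM)" "?Y ` FM \<subseteq> rmat t.J t.J UNIV" using FM YM_in by auto
  obtain I and r :: "'k poly \<times> nat \<Rightarrow> 'k poly" and w where I: "finite I"
    "\<forall>i\<in>I. 0 \<le> w i \<and> 0 < degree (r i) \<and> coeff (r i) 0 \<noteq> 0"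
    "\<forall>Y\<in>?Y ` FM. rp (t.psi Y) = (\<Sum>i\<in>I. w i * real (krank (ent (rep (r i) Y))))"
    using poly_rank_decomposition[OF pa s YY] by blast
  have "\<forall>i\<in>I. \<exists>s'. ([:0, 1:] * s') mod r i = 1 mod r i" using I(2) inverse_s by blast
  then obtain s' where s': "\<forall>i\<in>I. ([:0, 1:] * s' i) mod r i = 1 mod r i" by metis
  have "cone FM (\<lambda>M. \<Sum>i\<in>I. w i * real (krank (flat (snd ({..<h} \<times> {..<degree (r i)}, phi x0 h m (r i) (s' i))) M)))"
    by (intro cone_sum cone_single phi_apx) (use I s' x0 h in auto)
  then show ?thesis
  proof (rule cone_cong)
    fix M assume M: "M \<in> FM"
    have "rp (t.psi (?Y M)) = (\<Sum>i\<in>I. w i * real (krank (ent (rep (r i) (?Y M)))))" using I(3) M by blast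
    also have "\<dots> = (\<Sum>i\<in>I. w i * real (krank (flat (snd ({..<h} \<times> {..<degree (r i)}, phi x0 h m (r i) (s' i))) M)))"
    proof (intro sum.cong refl)
      fix i assume i: "i \<in> I"
      have "krank (flat (phi x0 h m (r i) (s' i)) M) = krank (ent (rep (r i) (?Y M)))"
        by (rule krank_phi) (use FM M I s' i in auto)
      then show "w i * real (krank (ent (rep (r i) (?Y M)))) = w i * real (krank (flat (snd ({..<h} \<times> {..<degree (r i)}, phi x0 h m (r i) (s' i))) M))"
        by simp
    qed
    finally show "rp (chi (\<Union>k<h. sh (int k) E) * frm emb n n M)
      = (\<Sum>i\<in>I. w i * real (krank (flat (snd ({..<h} \<times> {..<degree (r i)}, phi x0 h m (r i) (s' i))) M)))"
      using main[OF M] by simp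
  qed
qed

text \<open>\<open>d\<close> is the least period of \<open>x\<close>. Intersecting \<open>P\<close>
  translates of \<open>U\<close> by multiples of \<open>d\<close> makes the base invariant under
  \<open>d\<close> steps on \<open>Fx\<close>, since there the translates repeat after
  \<open>P\<close> of them.\<close>

lemma cyclic_cover_point:
  assumes FM: "finite FM" "FM \<subseteq> mat_over CP n n" and D: "\<forall>M\<in>FM. \<forall>i j d x. int D < \<bar>d\<bar> --> M i j d x = 0"
    and P: "0 < P" "\<forall>x\<in>Fx. tp (int P) x = x" and x: "x \<in> Fx"
  shows "\<exists>d E. 0 < d \<and> clop E \<and> x \<in> E \<and> (\<forall>k. 0 < k --> k < int d --> E \<inter> sh k E = {}) \<and>
    (\<forall>y\<in>Fx. y \<in> sh (int d) E \<longleftrightarrow> y \<in> E) \<and>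
    (\<forall>M\<in>FM. \<forall>i j c k y. k < d --> y \<in> sh (int k) E --> M i j c y = M i j c (tp (int k) x))"
proof -
  have xX: "x \<in> TX" using x Fx_sub by blast
  define d where "d = (LEAST d. 0 < d \<and> tp (int d) x = x)"
  have d: "0 < d \<and> tp (int d) x = x" unfolding d_def by (rule LeastI[of _ P]) (use P x in auto)
  have dm: "\<forall>k. 0 < k --> k < d --> tp (int k) x \<noteq> x" using not_less_Least unfolding d_def by blast
  obtain U1 where U1: "clop U1" "x \<in> U1" "\<forall>k. 0 < k --> k < int d --> U1 \<inter> sh k U1 = {}"
    using free_nbhd[OF xX dm] by blast
  obtain U2 where U2: "clop U2" "x \<in> U2"
    "\<forall>M\<in>FM. \<forall>i j c k y. k < d --> y \<in> sh (int k) U2 --> M i j c y = M i j c (tp (int k) x)"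
    using coeff_nbhd[OF FM D xX, of d] by (elim exE conjE)
  define U where "U = U1 \<inter> U2"
  define E where "E = TX \<inter> (\<Inter>i<P. sh (int i * int d) U)"
  have Uc: "clop U" unfolding U_def by (rule clop_Int) fact+
  have Ec: "clop E" unfolding E_def by (rule clop_INT) (auto intro: clop_sh Uc)
  have mE: "y \<in> E \<longleftrightarrow> (\<forall>i<P. tp (- (int i * int d)) y \<in> U)" if "y \<in> TX" for y
    using that by (auto simp: E_def sh_def)
  have pw: "tp (int i * int d) x = x" for i
  proof (induction i)
    case (Suc i)
    have "tp (int (Suc i) * int d) x = tp (int i * int d) (tp (int d) x)"
      using tp_add[OF xX, of "int i * int d" "int d"] by (simp add: algebra_simps)
    then show ?case by (simp only: Suc.IH d[THEN conjunct2])
  qed simp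
  have "tp (- (int i * int d)) x = x" for i using tp_cancel(2)[OF xX, of "int i * int d"] pw by simp
  then have xE: "x \<in> E" using mE[OF xX] U1(2) U2(2) by (simp add: U_def)
  have EU: "E \<subseteq> U"
  proof
    fix y assume y: "y \<in> E"
    then have "y \<in> TX" by (simp add: E_def)
    then have "tp (- (int 0 * int d)) y \<in> U" using mE y P by blast
    then show "y \<in> U" by simp
  qed
  have PF: "tp (- (int P * j)) y = y" if y: "y \<in> Fx" for y j
  proof -
    have yX: "y \<in> TX" using y Fx_sub by blast
    have n: "tp (int P * int k) y = y" for k
    proof (induction k)
      case (Suc k)
      have "tp (int P * int (Suc k)) y = tp (int P * int k) (tp (int P) y)"
        using tp_add[OF yX, of "int P * int k" "int P"] by (simp add: algebra_simps)
      then show ?case by (simp only: Suc.IH P(2)[rule_format, OF y])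
    qed simp
    show ?thesis
    proof (cases "0 \<le> j")
      case True
      then show ?thesis using n[of "nat j"] tp_cancel(2)[OF yX, of "int P * j"] by simp
    next
      case False
      then show ?thesis using n[of "nat (- j)"] by simp
    qed
  qed
  have iE: "y \<in> sh (int d) E \<longleftrightarrow> y \<in> E" if y: "y \<in> Fx" for y
  proof -
    have yX: "y \<in> TX" using y Fx_sub by blast
    have "y \<in> sh (int d) E \<longleftrightarrow> tp (- int d) y \<in> E" using yX by (simp add: sh_def)
    also have "\<dots> \<longleftrightarrow> (\<forall>i<P. tp (- (int i * int d)) (tp (- int d) y) \<in> U)" by (rule mE[OF tp_in[OF yX]])
    also have "\<dots> \<longleftrightarrow> (\<forall>i<P. tp (- (int (Suc i) * int d)) y \<in> U)"
    proof -
      have "tp (- (int i * int d)) (tp (- int d) y) = tp (- (int (Suc i) * int d)) y" for i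
        using tp_add[OF yX, of "- (int i * int d)" "- int d"] by (simp add: algebra_simps)
      then show ?thesis by (simp only:)
    qed
    also have "\<dots> \<longleftrightarrow> (\<forall>i<P. tp (- (int i * int d)) y \<in> U)"
    proof -
      have w: "tp (- (int P * int d)) y = tp (- (int 0 * int d)) y" using PF[OF y, of "int d"] by simp
      \<comment> \<open>Shifting the index by one permutes the conditions cyclically, the last one
        being the first again.\<close>
      have "(\<forall>i<P. Q (Suc i)) \<longleftrightarrow> (\<forall>i<P. Q i)" if q: "Q P \<longleftrightarrow> Q 0" for Q :: "nat \<Rightarrow> bool"
      proof
        assume a: "\<forall>i<P. Q (Suc i)"
        have "Q i" if "i < P" for i
        proof (cases i)
          case 0
          have "Q (Suc (P - 1))" by (rule a[rule_format]) (use P(1) in simp)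
          moreover have "Suc (P - 1) = P" using P(1) by simp
          ultimately have "Q P" by (simp only:)
          then show ?thesis unfolding 0 by (simp only: q)
        next
          case (Suc i')
          show ?thesis unfolding Suc by (rule a[rule_format]) (use that Suc in simp)
        qed
        then show "\<forall>i<P. Q i" by blast
      next
        assume a: "\<forall>i<P. Q i"
        show "\<forall>i<P. Q (Suc i)"
        proof (intro allI impI)
          fix i assume i: "i < P"
          show "Q (Suc i)"
          proof (cases "Suc i < P")
            case True
            then show ?thesis by (rule a[rule_format])
          next
            case False
            have "Q 0" by (rule a[rule_format]) (rule P(1))
            moreover have "Suc i = P" using i False by simp
            ultimately show ?thesis by (simp only: q)
          qed
        qed
      qed
      from this[of "\<lambda>i. tp (- (int i * int d)) y \<in> U"] show ?thesis using w by simp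
    qed
    finally show ?thesis using mE[OF yX] by simp
  qed
  have shm: "sh k E \<subseteq> sh k U1" "sh k E \<subseteq> sh k U2" for k using EU by (auto simp: sh_def U_def)
  have "E \<inter> sh k E = {}" if "0 < k" "k < int d" for k
    using U1(3) that EU shm(1)[of k] by (auto simp: U_def)
  moreover have "\<forall>M\<in>FM. \<forall>i j c k y. k < d --> y \<in> sh (int k) E --> M i j c y = M i j c (tp (int k) x)"
    by (intro ballI allI impI, rule U2(3)[rule_format], assumption, assumption) (use shm(2) in blast)
  ultimately show ?thesis using d Ec xE iE
    by (intro exI[of _ d] exI[of _ E] conjI) (simp_all only: simp_thms, blast+)
qed

text \<open>Finitely many cyclic towers cover \<open>Fx\<close>. They are made disjoint one at a
  time by removing from the next base the union \<open>B\<close> of the towers already used;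
  \<open>B\<close> is invariant on \<open>Fx\<close>, so the smaller base still closes up.\<close>

lemma cyclic_cone:
  assumes FM: "finite FM" "FM \<subseteq> mat_over CP n n" and D: "\<forall>M\<in>FM. \<forall>i j d x. int D < \<bar>d\<bar> --> M i j d x = 0"
    and P: "0 < P" "\<forall>x\<in>Fx. tp (int P) x = x" and cl: "closedin X Fx"
  shows "cone FM (\<lambda>M. rp (frm emb n n M))"
proof -
  have "\<forall>x\<in>Fx. \<exists>d E. 0 < d \<and> clop E \<and> x \<in> E \<and> (\<forall>k. 0 < k --> k < int d --> E \<inter> sh k E = {}) \<and>
    (\<forall>y\<in>Fx. y \<in> sh (int d) E \<longleftrightarrow> y \<in> E) \<and>
    (\<forall>M\<in>FM. \<forall>i j c k y. k < d --> y \<in> sh (int k) E --> M i j c y = M i j c (tp (int k) x))"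
    by (intro ballI cyclic_cover_point[OF FM D P])
  then obtain d E where dE: "\<forall>x\<in>Fx. 0 < d x \<and> clop (E x) \<and> x \<in> E x \<and> (\<forall>k. 0 < k --> k < int (d x) --> E x \<inter> sh k (E x) = {}) \<and>
    (\<forall>y\<in>Fx. y \<in> sh (int (d x)) (E x) \<longleftrightarrow> y \<in> E x) \<and>
    (\<forall>M\<in>FM. \<forall>i j c k y. k < d x --> y \<in> sh (int k) (E x) --> M i j c y = M i j c (tp (int k) x))"
    unfolding bchoice_iff by (elim exE)
  note dE1 = dE[THEN bspec, THEN conjunct1]
  note dE2 = dE[THEN bspec, THEN conjunct2, THEN conjunct1]
  note dE3 = dE[THEN bspec, THEN conjunct2, THEN conjunct2, THEN conjunct1]
  note dE4 = dE[THEN bspec, THEN conjunct2, THEN conjunct2, THEN conjunct2, THEN conjunct1]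
  note dE5 = dE[THEN bspec, THEN conjunct2, THEN conjunct2, THEN conjunct2, THEN conjunct2, THEN conjunct1]
  note dE6 = dE[THEN bspec, THEN conjunct2, THEN conjunct2, THEN conjunct2, THEN conjunct2, THEN conjunct2]
  \<comment> \<open>On \<open>Fx\<close> this is the union of all translates of the base, as
    \<open>mCC\<close> shows, and hence invariant there.\<close>
  define CC where "CC x = (\<Union>k<d x. sh (int k) (E x))" for x
  have CCc: "clop (CC x)" if "x \<in> Fx" for x unfolding CC_def by (rule clop_UN) (use dE2 that in \<open>auto intro: clop_sh\<close>)
  have per: "tp (i + int (d x) * q) y \<in> E x \<longleftrightarrow> tp i y \<in> E x" if x: "x \<in> Fx" and y: "y \<in> Fx" for x y i q
  proof -
    have yX: "y \<in> TX" using y Fx_sub by blast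
    have st: "tp (i + int (d x)) y \<in> E x \<longleftrightarrow> tp i y \<in> E x" for i
    proof -
      have "tp (i + int (d x)) y \<in> sh (int (d x)) (E x) \<longleftrightarrow> tp i y \<in> E x" using mem_sh[OF yX] by simp
      then show ?thesis using dE5[OF x] Fx_inv[OF y] by blast
    qed
    show ?thesis
    proof (induction q rule: int_induct[where k = 0])
      case (step1 q)
      then show ?case using st[of "i + int (d x) * q"] by (simp add: algebra_simps)
    next
      case (step2 q)
      then show ?case using st[of "i + int (d x) * (q - 1)"] by (simp add: algebra_simps)
    qed simp
  qed
  have mCC: "y \<in> CC x \<longleftrightarrow> (\<exists>i. tp i y \<in> E x)" if x: "x \<in> Fx" and y: "y \<in> Fx" for x y
  proof
    have yX: "y \<in> TX" using y Fx_sub by blast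
    assume "\<exists>i. tp i y \<in> E x"
    then obtain i where i: "tp i y \<in> E x" by blast
    have dp: "0 < int (d x)" using dE1[OF x] by simp
    define k where "k = nat ((- i) mod int (d x))"
    have k: "int k = (- i) mod int (d x)" "k < d x" using dp by (simp_all add: k_def nat_less_iff)
    have "- i = int (d x) * ((- i) div int (d x)) + int k" using k(1) by simp
    then have "i = - int k + int (d x) * (- ((- i) div int (d x)))" by linarith
    then have "tp (- int k) y \<in> E x" using per[OF x y, of "- int k" "- ((- i) div int (d x))"] i by metis
    then show "y \<in> CC x" using k(2) yX by (auto simp: CC_def sh_def)
  qed (auto simp: CC_def sh_def)
  have iCC: "tp i y \<in> CC x \<longleftrightarrow> y \<in> CC x" if x: "x \<in> Fx" and y: "y \<in> Fx" for x y i
  proof -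
    have yX: "y \<in> TX" using y Fx_sub by blast
    have "(\<exists>j. tp j (tp i y) \<in> E x) \<longleftrightarrow> (\<exists>j. tp j y \<in> E x)"
    proof
      assume "\<exists>j. tp j (tp i y) \<in> E x" then show "\<exists>j. tp j y \<in> E x" using tp_add[OF yX] by metis
    next
      assume "\<exists>j. tp j y \<in> E x"
      then obtain j where "tp j y \<in> E x" by blast
      then have "tp (j - i) (tp i y) \<in> E x" using tp_add[OF yX, of "j - i" i] by simp
      then show "\<exists>j. tp j (tp i y) \<in> E x" by blast
    qed
    then show ?thesis using mCC[OF x y] mCC[OF x Fx_inv[OF y]] by simp
  qed
  have step: "finite Q ==> Q \<subseteq> Fx ==> cone FM (\<lambda>M. rp (chi (\<Union>x\<in>Q. CC x) * frm emb n n M))" for Q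
  proof (induction Q rule: finite_induct)
    case empty
    have "chi {} * M = 0" for M by (simp add: chi_def)
    then have "rp (chi {} * M) = 0" for M by (simp add: arank.zero[OF arank_rp])
    then show ?case using cone_zero by simp
  next
    case (insert x Q)
    define B where "B = (\<Union>x\<in>Q. CC x)"
    have x: "x \<in> Fx" using insert by simp
    have Bc: "clop B" unfolding B_def by (rule clop_UN) (use insert CCc in auto)
    have Bi: "tp i y \<in> B \<longleftrightarrow> y \<in> B" if "y \<in> Fx" for y i using iCC insert.prems that unfolding B_def by blast
    define E' where "E' = E x - B"
    have E'c: "clop E'" unfolding E'_def by (rule clop_Diff) (use dE2[OF x] Bc in auto)
    have sub: "sh k E' \<subseteq> sh k (E x)" for k by (auto simp: E'_def sh_def)
    have "cone FM (\<lambda>M. rp (chi (\<Union>k<d x. sh (int k) E') * frm emb n n M))"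
    proof (rule cyclic_tower_cone[OF FM D E'c])
      show "0 < d x" "x \<in> TX" using dE1[OF x] x Fx_sub by auto
      show "\<forall>k. 0 < k --> k < int (d x) --> E' \<inter> sh k E' = {}"
      proof (intro allI impI)
        fix k assume "0 < k" "k < int (d x)"
        then have "E x \<inter> sh k (E x) = {}" using dE4[OF x] by blast
        then show "E' \<inter> sh k E' = {}" using sub[of k] by (auto simp: E'_def)
      qed
      show "\<forall>y\<in>Fx. y \<in> sh (int (d x)) E' \<longleftrightarrow> y \<in> E'"
      proof
        fix y assume y: "y \<in> Fx"
        have yX: "y \<in> TX" using y Fx_sub by blast
        have "y \<in> sh (int (d x)) (E x) \<longleftrightarrow> y \<in> E x" using dE5[OF x] y by blast
        then show "y \<in> sh (int (d x)) E' \<longleftrightarrow> y \<in> E'" using Bi[OF y] yX by (auto simp: E'_def sh_def)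
      qed
      show "\<forall>M\<in>FM. \<forall>i j c k y. k < d x --> y \<in> sh (int k) E' --> M i j c y = M i j c (tp (int k) x)"
        by (intro ballI allI impI, rule dE6[OF x, rule_format], assumption, assumption) (use sub in blast)
    qed
    with insert.IH have c: "cone FM (\<lambda>M. rp (chi B * frm emb n n M) + rp (chi (\<Union>k<d x. sh (int k) E') * frm emb n n M))"
      using insert.prems by (intro cone_add) (auto simp: B_def)
    show ?case
    proof (rule cone_cong[OF c])
      fix M assume "M \<in> FM"
      then have Mx: "frm emb n n M \<in> MM" using FM frm_in by blast
      have cd: "clop (CC x - B)" by (rule clop_Diff[OF CCc[OF x] Bc])
      have "(\<Union>y\<in>insert x Q. CC y) = B \<union> (CC x - B)" by (auto simp: B_def)
      then have "rp (chi (\<Union>y\<in>insert x Q. CC y) * frm emb n n M) = rp (chi B * frm emb n n M) + rp (chi (CC x - B) * frm emb n n M)"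
        using rp_split[OF Mx Bc cd] Bi iCC[OF x] by auto
      also have "rp (chi (CC x - B) * frm emb n n M) = rp (chi (\<Union>k<d x. sh (int k) E') * frm emb n n M)"
      proof (rule rp_chi_cong[OF Mx cd])
        show "clop (\<Union>k<d x. sh (int k) E')" by (rule clop_UN) (auto intro: clop_sh E'c)
        fix y assume y: "y \<in> Fx"
        show "y \<in> CC x - B \<longleftrightarrow> y \<in> (\<Union>k<d x. sh (int k) E')"
          using Bi[OF y] by (auto simp: CC_def E'_def sh_def)
      qed
      finally show "rp (chi (\<Union>y\<in>insert x Q. CC y) * frm emb n n M)
        = rp (chi B * frm emb n n M) + rp (chi (\<Union>k<d x. sh (int k) E') * frm emb n n M)" .
    qed
  qed
  have "clop (E x) \<and> x \<in> E x" if "x \<in> Fx" for x using dE2 dE3 that by blast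
  then obtain Q where Q: "finite Q" "Q \<subseteq> Fx" "Fx \<subseteq> (\<Union>x\<in>Q. E x)" by (rule clop_cover[OF cl])
  show ?thesis
  proof (rule cone_cong[OF step[OF Q(1,2)]])
    fix M assume "M \<in> FM"
    then have Mx: "frm emb n n M \<in> MM" using FM frm_in by blast
    have cu: "clop (\<Union>x\<in>Q. CC x)" by (rule clop_UN) (use Q CCc in auto)
    have "y \<in> (\<Union>x\<in>Q. CC x)" if y: "y \<in> Fx" for y
    proof -
      obtain x where x: "x \<in> Q" "y \<in> E x" using Q(3) y by blast
      then have "tp 0 y \<in> E x" by simp
      then show ?thesis using mCC[of x y] x Q y by blast
    qed
    then have "rp (chi TX * frm emb n n M) = rp (chi (\<Union>x\<in>Q. CC x) * frm emb n n M)"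
      by (intro rp_chi_cong[OF Mx clop_TX cu]) (use Fx_sub in blast)
    then show "rp (frm emb n n M) = rp (chi (\<Union>x\<in>Q. CC x) * frm emb n n M)" using chi_TX(1)[OF Mx] by simp
  qed
qed

end

section \<open>Marker sets and return times\<close>

context dyn
begin

lemma finite_disjointify:
  assumes "finite P" "\<And>x. x \<in> P ==> clop (U x)"
  shows "\<exists>U'. (\<forall>x\<in>P. clop (U' x) \<and> U' x \<subseteq> U x) \<and> (\<forall>x\<in>P. \<forall>y\<in>P. x \<noteq> y --> U' x \<inter> U' y = {}) \<and> (\<Union>x\<in>P. U x) \<subseteq> (\<Union>x\<in>P. U' x)"
  using assms
proof (induction P rule: finite_induct)
  case (insert x P)
  then obtain U' where U': "\<forall>x\<in>P. clop (U' x) \<and> U' x \<subseteq> U x" "\<forall>x\<in>P. \<forall>y\<in>P. x \<noteq> y --> U' x \<inter> U' y = {}" "(\<Union>x\<in>P. U x) \<subseteq> (\<Union>x\<in>P. U' x)"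
    by auto
  define U2 where "U2 = U'(x := U x - (\<Union>y\<in>P. U y))"
  have e: "U2 x = U x - (\<Union>y\<in>P. U y)" "\<And>y. y \<in> P ==> U2 y = U' y" using insert.hyps by (auto simp: U2_def)
  have "clop (U2 x)" unfolding e by (intro clop_Diff clop_UN) (use insert in auto)
  moreover have "U2 x \<inter> U' y = {}" if "y \<in> P" for y using U'(1) that unfolding e by blast
  moreover have "(\<Union>y\<in>insert x P. U y) \<subseteq> (\<Union>y\<in>insert x P. U2 y)"
    using U'(3) e by auto
  ultimately show ?case using U' e by (intro exI[of _ U2]) (auto simp: Int_commute)
qed auto

text \<open>Visits to a marker set of this kind are at least \<open>N\<close> steps apart, which
  bounds tower heights from below.\<close>

definition free_set :: "nat \<Rightarrow> 'x set \<Rightarrow> bool" where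
  "free_set N U \<longleftrightarrow> (\<forall>x\<in>U. \<forall>k. 0 < \<bar>k\<bar> --> \<bar>k\<bar> < int N --> tp k x \<notin> U)"

lemma free_setI:
  assumes "clop U" "\<forall>k. 0 < k --> k < int N --> U \<inter> sh k U = {}"
  shows "free_set N U"
  unfolding free_set_def
proof (intro ballI allI impI notI)
  fix x k assume a: "x \<in> U" "0 < \<bar>k\<bar>" "\<bar>k\<bar> < int N" "tp k x \<in> U"
  have xX: "x \<in> TX" using a clop_sub[OF assms(1)] by blast
  show False
  proof (cases "0 < k")
    case True
    have "tp k x \<in> sh k U" using mem_sh[OF xX, of k k U] a by simp
    then show False using assms(2) a True by auto
  next
    case False
    have "x \<in> sh (- k) U" using xX a by (simp add: sh_def)
    moreover have "0 < - k" "- k < int N" using a False by auto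
    ultimately show False using assms(2) a by blast
  qed
qed

text \<open>The sets are processed one after another; from each, only points at distance at least
  \<open>N\<close> from the markers chosen so far are added. Rejected points are close to a marker,
  which gives the covering property.\<close>

lemma greedy_marker:
  assumes "finite A" "0 < N" "\<forall>U\<in>A. clop U \<and> free_set N U"
  shows "\<exists>E. clop E \<and> E \<subseteq> \<Union>A \<and> free_set N E \<and> (\<forall>x\<in>\<Union>A. \<exists>k. \<bar>k\<bar> < int N \<and> tp k x \<in> E)"
  using assms
proof (induction A rule: finite_induct)
  case empty
  then show ?case by (intro exI[of _ "{}"]) (auto simp: free_set_def)
next
  case (insert U A)
  then obtain E where E: "clop E" "E \<subseteq> \<Union>A" "free_set N E" "\<forall>x\<in>\<Union>A. \<exists>k. \<bar>k\<bar> < int N \<and> tp k x \<in> E" by auto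
  have U: "clop U" "free_set N U" using insert.prems by auto
  define Z where "Z = (\<Union>k\<in>{- int N<..<int N}. sh k E)"
  have Zc: "clop Z" unfolding Z_def by (rule clop_UN) (auto intro: clop_sh E)
  have ZI: "x \<in> Z" if "x \<in> TX" "\<bar>k\<bar> < int N" "tp (- k) x \<in> E" for x k
  proof -
    have "k \<in> {- int N<..<int N}" using that(2) by auto
    then show ?thesis using that unfolding Z_def sh_def by blast
  qed
  define E' where "E' = E \<union> (U - Z)"
  have "clop E'" unfolding E'_def by (intro clop_Un clop_Diff E U Zc)
  moreover have "free_set N E'" unfolding free_set_def
  proof (intro ballI allI impI notI)
    fix x k assume a: "x \<in> E'" "0 < \<bar>k\<bar>" "\<bar>k\<bar> < int N" "tp k x \<in> E'"
    have xX: "x \<in> TX" using a(1) clop_sub[OF E(1)] clop_sub[OF U(1)] by (auto simp: E'_def)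
    consider "x \<in> E" "tp k x \<in> E" | "x \<in> U" "tp k x \<in> U" | "x \<in> U - Z" "tp k x \<in> E" | "x \<in> E" "tp k x \<in> U - Z"
      using a by (auto simp: E'_def)
    then show False
    proof cases
      case 1 then show False using E(3) a unfolding free_set_def by blast
    next
      case 2 then show False using U(2) a unfolding free_set_def by blast
    next
      case 3 then show False using ZI[OF xX, of "- k"] a by simp
    next
      case 4 then show False using ZI[OF tp_in[OF xX], of k k] a xX by simp
    qed
  qed
  moreover have "\<exists>k. \<bar>k\<bar> < int N \<and> tp k x \<in> E'" if x: "x \<in> \<Union>(insert U A)" for x
  proof (cases "x \<in> \<Union>A")
    case True
    then show ?thesis using E(4) by (auto simp: E'_def)
  next
    case False
    then have xU: "x \<in> U" using x by simp
    show ?thesis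
    proof (cases "x \<in> Z")
      case True
      then obtain k where k: "k \<in> {- int N<..<int N}" "tp (- k) x \<in> E" by (auto simp: Z_def sh_def)
      then show ?thesis by (intro exI[of _ "- k"]) (auto simp: E'_def)
    next
      case False
      then show ?thesis using xU \<open>0 < N\<close> by (intro exI[of _ 0]) (auto simp: E'_def)
    qed
  qed
  ultimately show ?case using E(2) by (intro exI[of _ E']) (auto simp: E'_def)
qed

text \<open>Points are sorted by their return time to the marker set; points that do not return
  before time \<open>2 * N\<close> get height \<open>N\<close>.\<close>
lemma return_partition:
  assumes E: "clop E" and N: "0 < N" and fr: "free_set N E"
  shows "\<exists>RH. (\<forall>h. clop (RH h) \<and> RH h \<subseteq> E) \<and>
    (\<forall>h y i. N \<le> h --> h < 2 * N --> y \<in> RH h --> 0 < i --> i < h --> tp (int i) y \<notin> E) \<and>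
    (\<forall>h h' y. N \<le> h --> h < 2 * N --> N \<le> h' --> h' < 2 * N --> y \<in> RH h --> y \<in> RH h' --> h = h') \<and>
    (\<forall>y r. y \<in> E --> 0 < r --> r < 2 * N --> tp (int r) y \<in> E --> (\<forall>i. 0 < i --> i < r --> tp (int i) y \<notin> E) --> N \<le> r \<and> y \<in> RH r) \<and>
    (\<forall>y\<in>E. \<exists>h. N \<le> h \<and> h < 2 * N \<and> y \<in> RH h)"
proof -
  define RH where "RH h = (if h = N then E - (\<Union>i\<in>{0<..<2 * N}. sh (- int i) E) else {}) \<union>
      ((E \<inter> sh (- int h) E) - (\<Union>i\<in>{0<..<h}. sh (- int i) E))" for h
  have m: "y \<in> RH h \<longleftrightarrow> y \<in> E \<and> ((h = N \<and> (\<forall>i. 0 < i --> i < 2 * N --> tp (int i) y \<notin> E)) \<or>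
      (tp (int h) y \<in> E \<and> (\<forall>i. 0 < i --> i < h --> tp (int i) y \<notin> E)))" for y h
    using clop_sub[OF E] by (auto simp: RH_def sh_def)
  have c: "clop (RH h)" for h
    unfolding RH_def by (cases "h = N") (auto intro!: clop_Un clop_Diff clop_Int clop_UN clop_sh E)
  have b: "tp (int i) y \<notin> E" if "N \<le> h" "h < 2 * N" "y \<in> RH h" "0 < i" "i < h" for h y i
    using that unfolding m by auto
  have un: "h = h'" if "N \<le> h" "h < 2 * N" "N \<le> h'" "h' < 2 * N" "y \<in> RH h" "y \<in> RH h'" for h h' y
  proof (rule ccontr)
    assume "h \<noteq> h'"
    then consider "h < h'" | "h' < h" by linarith
    then show False using that N unfolding m by cases (metis order_le_less_trans order_less_le_trans less_le_trans not_less)+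
  qed
  have d: "N \<le> r \<and> y \<in> RH r" if "y \<in> E" "0 < r" "r < 2 * N" "tp (int r) y \<in> E" "\<forall>i. 0 < i --> i < r --> tp (int i) y \<notin> E" for y r
  proof -
    have "\<not> r < N"
    proof
      assume "r < N"
      then have "0 < \<bar>int r\<bar>" "\<bar>int r\<bar> < int N" using that by auto
      then show False using fr that(1,4) unfolding free_set_def by blast
    qed
    then show ?thesis unfolding m using that by auto
  qed
  have e: "\<exists>h. N \<le> h \<and> h < 2 * N \<and> y \<in> RH h" if y: "y \<in> E" for y
  proof (cases "\<exists>i. 0 < i \<and> i < 2 * N \<and> tp (int i) y \<in> E")
    case True
    define r where "r = (LEAST i. 0 < i \<and> i < 2 * N \<and> tp (int i) y \<in> E)"
    have r: "0 < r \<and> r < 2 * N \<and> tp (int r) y \<in> E" unfolding r_def by (rule LeastI_ex[OF True])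
    have "\<forall>i. 0 < i --> i < r --> tp (int i) y \<notin> E"
      using not_less_Least[of _ "\<lambda>i. 0 < i \<and> i < 2 * N \<and> tp (int i) y \<in> E"] r unfolding r_def[symmetric] by (meson less_trans)
    then show ?thesis using d[of y r] y r by blast
  next
    case False
    then have "y \<in> RH N" unfolding m using y by blast
    then show ?thesis using N by (intro exI[of _ N]) auto
  qed
  have sub: "RH h \<subseteq> E" for h using m by blast
  show ?thesis
    by (intro exI[of _ RH] conjI allI impI ballI c sub) (use b un d e in \<open>blast+\<close>)
qed

text \<open>If \<open>M\<close> moves points at most \<open>D\<close> steps, a column cut to a set
  containing the \<open>D\<close>-neighbourhood of \<open>P\<close> is automatic.\<close>

lemma chi_sep:
  assumes M: "M \<in> MM" and D: "\<forall>i j x p y q. ent (ent M i j) (x, p) (y, q) \<noteq> 0 --> \<bar>p - q\<bar> \<le> int D"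
    and PQ: "\<And>z d. z \<in> P ==> \<bar>d\<bar> \<le> int D ==> tp d z \<in> Q"
  shows "chi P * M * chi Q = chi P * M"
proof (intro rfm_eqI)
  fix i j and z w :: "'x \<times> int"
  obtain x p y q where zw: "z = (x, p)" "w = (y, q)" by (cases z, cases w) auto
  have l: "ent (ent (chi P * M) i j) (x, p) (y, q) = (if x \<in> TX \<and> tp p x \<in> P then ent (ent M i j) (x, p) (y, q) else 0)"
    by (simp add: ent_chi_mult ent_gn_mult)
  have r: "ent (ent (Z * chi Q) i j) (x, p) (y, q) = (if y \<in> TX \<and> tp q y \<in> Q then ent (ent Z i j) (x, p) (y, q) else 0)" for Z
    unfolding ent_mult_chi by (subst ent_mult[of "{(y, q)}"]) (auto simp: ent_gn split: if_splits)
  show "ent (ent (chi P * M * chi Q) i j) z w = ent (ent (chi P * M) i j) z w"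
  proof (cases "x \<in> TX \<and> tp p x \<in> P \<and> ent (ent M i j) (x, p) (y, q) \<noteq> 0")
    case True
    then have xy: "x = y" using C_block[OF rmat_entry[OF M]] by blast
    have "\<bar>p - q\<bar> \<le> int D" using D True by blast
    then have "\<bar>q - p\<bar> \<le> int D" by linarith
    from PQ[OF _ this, of "tp p x"] True have "tp q x \<in> Q" using tp_add[of x "q - p" p] by simp
    then show ?thesis unfolding zw r using True xy by simp
  next
    case False
    then have "ent (ent (chi P * M) i j) (x, p) (y, q) = 0" unfolding l by auto
    then show ?thesis unfolding zw r by simp
  qed
qed

text \<open>Disjoint sets \<open>Q\<close> and \<open>Q'\<close> around the row cuts supply the
  column cuts that \<open>chi_orth\<close> demands.\<close>

lemma chi_orth_sep:
  assumes r: "arank MM r" and M: "M \<in> MM" and c: "clop P" "clop P'" "clop Q" "clop Q'"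
    and d: "P \<inter> P' = {}" "Q \<inter> Q' = {}" and s: "chi P * M * chi Q = chi P * M" "chi P' * M * chi Q' = chi P' * M"
  shows "r (chi (P \<union> P') * M) = r (chi P * M) + r (chi P' * M)"
  using chi_orth[OF r M M c d] unfolding s chi_Un[OF d(1)] .

lemma frm_deg:
  assumes M: "M \<in> mat_over CP n n" and D: "\<forall>i j d x. int D < \<bar>d\<bar> --> M i j d x = 0"
  shows "\<forall>i j x p y q. ent (ent (frm emb n n M) i j) (x, p) (y, q) \<noteq> 0 --> \<bar>p - q\<bar> \<le> int D"
proof (intro allI impI)
  fix i j x p y q assume a: "ent (ent (frm emb n n M) i j) (x, p) (y, q) \<noteq> 0"
  then have ij: "i < n" "j < n" by (auto simp: ent_frm split: if_splits)
  then have f: "finite (supp (M i j))" using M by (auto simp: mat_over_def carrier_CP)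
  have "M i j (p - q) (tp p x) \<noteq> 0" using a ij by (auto simp: ent_frm ent_emb[OF f] split: if_splits)
  then have "\<not> int D < \<bar>p - q\<bar>" using D by blast
  then show "\<bar>p - q\<bar> \<le> int D" by linarith
qed

end

section \<open>Approximation away from the periodic points\<close>

context dynF
begin

lemma nbs_approx:
  assumes "finite ZZ" "ZZ \<subseteq> MM" "0 < e"
  shows "\<exists>V\<in>nbs. \<forall>Z\<in>ZZ. rho (chi V * Z) \<le> rp Z + e"
  using assms
proof (induction ZZ rule: finite_induct)
  case empty
  then show ?case using TX_nbs by auto
next
  case (insert Z ZZ)
  then obtain V where V: "V \<in> nbs" "\<forall>Z\<in>ZZ. rho (chi V * Z) \<le> rp Z + e" by auto
  have Z: "Z \<in> MM" using insert.prems by simp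
  obtain W where W: "W \<in> nbs" "rho (chi W * Z) < rp Z + e" using rp_approx[OF Z insert.prems(2)] by blast
  have VW: "V \<inter> W \<in> nbs" by (rule nbs_Int[OF V(1) W(1)])
  have "rho (chi (V \<inter> W) * Y) \<le> rho (chi V * Y)" "rho (chi (V \<inter> W) * Y) \<le> rho (chi W * Y)" if "Y \<in> MM" for Y
    by (rule chi_mono[OF arank_rho that]; use VW V W nbs_clop in auto)+
  then have "\<forall>Y\<in>insert Z ZZ. rho (chi (V \<inter> W) * Y) \<le> rp Y + e"
    using V(2) W(2) Z insert.prems(1) by (smt (verit, best) insert_iff subset_iff)
  then show ?case using VW by blast
qed

text \<open>The space is split into tower interiors \<open>PP\<close>, a neighbourhood
  \<open>V2\<close> of \<open>Fx\<close>, and a rest \<open>R\<close> of small measure. The first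
  two have disjoint \<open>D\<close>-neighbourhoods, so their ranks add up. On \<open>V2\<close> the
  rank is close to \<open>rp\<close>, on the interiors \<open>Rokhlin_tower_rank\<close> computes
  it, and \<open>R\<close> costs at most its measure per row.\<close>

lemma Rokhlin_approximation:
  assumes FM: "finite FM" "FM \<subseteq> mat_over CP n n" and D: "\<forall>M\<in>FM. \<forall>i j d x. int D < \<bar>d\<bar> --> M i j d x = 0"
    and N: "0 < N" "2 * D \<le> N" and e: "0 < (e::real)"
    and off: "\<And>x k. x \<in> TX ==> x \<notin> Fx ==> 0 < k ==> k < N ==> tp (int k) x \<noteq> x"
  shows "\<exists>f. cone FM f \<and> (\<forall>M\<in>FM. \<bar>rho (frm emb n n M) - (rp (frm emb n n M) + f M)\<bar> \<le> real n * (4 * real D / real N + real N * e) + e)"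
proof -
  let ?F = "frm emb n n"
  have FMx: "?F M \<in> MM" if "M \<in> FM" for M using FM that frm_in by blast
  \<comment> \<open>The unit is put on the list because the rank of its cut is the measure of the
    set; shrinking \<open>V\<close> to \<open>V2\<close> then loses at most \<open>e\<close> of
    measure.\<close>
  obtain V where V: "V \<in> nbs" "\<forall>Z\<in>insert (un 0 0 u) (?F ` FM). rho (chi V * Z) \<le> rp Z + e"
    using nbs_approx[of "insert (un 0 0 u) (?F ` FM)" e] FM FMx e un_gn_in[OF clop_TX] by (auto simp: u_gn)
  have Vc: "clop V" using V(1) by (rule nbs_clop)
  \<comment> \<open>Tower levels are less than \<open>2 * N\<close> steps above their base, and the
    base avoids \<open>V\<close>. With this margin no point within \<open>D\<close> steps of
    \<open>V2\<close> lies in a tower.\<close>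
  define V2 where "V2 = margin (2 * N + D) V"
  have V2: "V2 \<in> nbs" "V2 \<subseteq> V" unfolding V2_def using margin_nbs margin_sub V(1) by auto
  have V2c: "clop V2" using V2(1) by (rule nbs_clop)
  have V2m: "tp d z \<in> V" if "z \<in> V2" "\<bar>d\<bar> \<le> int (2 * N + D)" for z d
  proof -
    have "- d \<in> {- int (2 * N + D)..int (2 * N + D)}" using that(2) by auto
    then have "z \<in> sh (- d) V" using that(1) unfolding V2_def margin_def by blast
    then show ?thesis by (simp add: sh_def)
  qed
  have rows: "\<forall>i j. n \<le> i --> ent (?F M) i j = 0" for M by (simp add: ent_frm)

  \<comment> \<open>A point outside \<open>V\<close> is outside \<open>Fx\<close>, so by
    \<open>off\<close> it has no return before \<open>N\<close>. A small neighbourhood inherits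
    this, and its translates have constant coefficients on all levels below
    \<open>2 * N\<close>.\<close>
  have "\<exists>U. clop U \<and> x \<in> U \<and> U \<inter> V = {} \<and> free_set N U \<and>
      (\<forall>M\<in>FM. \<forall>i j d k y. k < 2 * N --> y \<in> sh (int k) U --> M i j d y = M i j d (tp (int k) x))" if x: "x \<in> TX - V" for x
  proof -
    have xX: "x \<in> TX" "x \<notin> Fx" using x V(1) by (auto simp: nbs_def)
    have nf: "\<forall>k. 0 < k --> k < N --> tp (int k) x \<noteq> x" using off[OF xX] by blast
    obtain U1 where U1: "clop U1" "x \<in> U1" "\<forall>k. 0 < k --> k < int N --> U1 \<inter> sh k U1 = {}"
      using free_nbhd[OF xX(1) nf] by blast
    obtain U2 where U2: "clop U2" "x \<in> U2"
      "\<forall>M\<in>FM. \<forall>i j d k y. k < 2 * N --> y \<in> sh (int k) U2 --> M i j d y = M i j d (tp (int k) x)"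
      using coeff_nbhd[OF FM D xX(1), of "2 * N"] by (elim exE conjE)
    define U where "U = U1 \<inter> U2 - V"
    have "free_set N U" using free_setI[OF U1(1,3)] unfolding free_set_def U_def by blast
    moreover have "sh k U \<subseteq> sh k U2" for k by (auto simp: sh_def U_def)
    then have "\<forall>M\<in>FM. \<forall>i j d k y. k < 2 * N --> y \<in> sh (int k) U --> M i j d y = M i j d (tp (int k) x)"
      by (intro ballI allI impI, intro U2(3)[rule_format]) blast+
    moreover have "clop U" unfolding U_def by (intro clop_Diff clop_Int U1 U2 Vc)
    moreover have "x \<in> U" "U \<inter> V = {}" using U1(2) U2(2) x by (auto simp: U_def)
    ultimately show ?thesis by (intro exI[of _ U] conjI)
  qed
  then have "\<forall>x\<in>TX - V. \<exists>U. clop U \<and> x \<in> U \<and> U \<inter> V = {} \<and> free_set N U \<and>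
      (\<forall>M\<in>FM. \<forall>i j d k y. k < 2 * N --> y \<in> sh (int k) U --> M i j d y = M i j d (tp (int k) x))" by (intro ballI)
  from bchoice[OF this] obtain U where U: "\<forall>x\<in>TX - V. clop (U x) \<and> x \<in> U x \<and> U x \<inter> V = {} \<and> free_set N (U x) \<and>
      (\<forall>M\<in>FM. \<forall>i j d k y. k < 2 * N --> y \<in> sh (int k) (U x) --> M i j d y = M i j d (tp (int k) x))" by (elim exE)
  note Uc = U[THEN bspec, THEN conjunct1] and Ux = U[THEN bspec, THEN conjunct2, THEN conjunct1]
    and UV = U[THEN bspec, THEN conjunct2, THEN conjunct2, THEN conjunct1]
    and Uf = U[THEN bspec, THEN conjunct2, THEN conjunct2, THEN conjunct2, THEN conjunct1]
    and Uk = U[THEN bspec, THEN conjunct2, THEN conjunct2, THEN conjunct2, THEN conjunct2]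
  have "closedin X (TX - V)" using Vc by (simp add: clop_def closedin_diff)
  moreover have "clop (U x) \<and> x \<in> U x" if "x \<in> TX - V" for x using Uc Ux that by simp
  ultimately obtain P where P: "finite P" "P \<subseteq> TX - V" "TX - V \<subseteq> (\<Union>x\<in>P. U x)" by (rule clop_cover)
  have "\<forall>W\<in>U ` P. clop W \<and> free_set N W" using Uc Uf P(2) by auto
  from greedy_marker[OF finite_imageI[OF P(1)] N(1) this]
  obtain E where E: "clop E" "E \<subseteq> (\<Union>x\<in>P. U x)" "free_set N E" and Ecov: "\<forall>x\<in>(\<Union>x\<in>P. U x). \<exists>k. \<bar>k\<bar> < int N \<and> tp k x \<in> E"
    by auto
  have EV: "E \<inter> V = {}" using E(2) UV P(2) by blast
  have "clop (U x)" if "x \<in> P" for x using Uc that P(2) by blast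
  from finite_disjointify[OF P(1), of U, OF this]
  obtain U' where U': "\<forall>x\<in>P. clop (U' x) \<and> U' x \<subseteq> U x" "\<forall>x\<in>P. \<forall>y\<in>P. x \<noteq> y --> U' x \<inter> U' y = {}"
    "(\<Union>x\<in>P. U x) \<subseteq> (\<Union>x\<in>P. U' x)" by auto
  obtain RH where RH: "\<forall>h. clop (RH h) \<and> RH h \<subseteq> E"
    and RHb: "\<forall>h y i. N \<le> h --> h < 2 * N --> y \<in> RH h --> 0 < i --> i < h --> tp (int i) y \<notin> E"
    and RHc: "\<forall>h h' y. N \<le> h --> h < 2 * N --> N \<le> h' --> h' < 2 * N --> y \<in> RH h --> y \<in> RH h' --> h = h'"
    and RHd: "\<forall>y r. y \<in> E --> 0 < r --> r < 2 * N --> tp (int r) y \<in> E --> (\<forall>i. 0 < i --> i < r --> tp (int i) y \<notin> E) --> N \<le> r \<and> y \<in> RH r"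
    and RHe: "\<forall>y\<in>E. \<exists>h. N \<le> h \<and> h < 2 * N \<and> y \<in> RH h"
    using return_partition[OF E(1) N(1) E(3)] by (elim exE conjE)
  \<comment> \<open>One tower for each height and each set of the cover: the height is the return
    time, the set fixes the coefficients on the levels.\<close>
  define TI where "TI = {N..<2 * N} \<times> P"
  define ET where "ET t = RH (fst t) \<inter> U' (snd t)" for t
  have TI: "finite TI" unfolding TI_def using P(1) by simp
  have ETc: "clop (ET t)" if "t \<in> TI" for t
    unfolding ET_def by (rule clop_Int) (use RH U'(1) that in \<open>auto simp: TI_def\<close>)
  have ETE: "ET t \<subseteq> E" for t using RH by (auto simp: ET_def)
  have ETb: "tp (int i) y \<notin> E" if "t \<in> TI" "y \<in> ET t" "0 < i" "i < fst t" for t y i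
    using RHb that by (auto simp: TI_def ET_def)
  have disj: "k = k' \<and> t = t'"
    if t: "t \<in> TI" "t' \<in> TI" "k < fst t" "k' < fst t'" and z: "z \<in> sh (int k) (ET t)" "z \<in> sh (int k') (ET t')" for t t' k k' z
  proof -
    have zX: "z \<in> TX" "tp (- int k) z \<in> ET t" "tp (- int k') z \<in> ET t'" using z by (auto simp: sh_def)
    \<comment> \<open>If a point had two different levels, the base point of the higher one would
      meet \<open>E\<close> again before its height.\<close>
    have no: False if "s \<in> TI" "tp (- int a) z \<in> ET s" "tp (- int b) z \<in> E" "b < a" "a < fst s" for s a b
    proof -
      have eq: "tp (int (a - b)) (tp (- int a) z) = tp (- int b) z"
        using tp_add[OF zX(1), of "int (a - b)" "- int a"] that(4) by (simp add: of_nat_diff)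
      have "tp (int (a - b)) (tp (- int a) z) \<notin> E"
        by (rule ETb[OF that(1,2)]) (use that(4,5) in linarith)+
      then show False unfolding eq using that(3) by blast
    qed
    have "k = k'" using no[OF t(1) zX(2), of k'] no[OF t(2) zX(3), of k] ETE zX t by (metis nat_neq_iff subsetD)
    moreover have "fst t = fst t'" if "k = k'"
      using RHc t zX(2,3) that by (auto simp: TI_def ET_def)
    moreover have "snd t = snd t'" if "k = k'"
      using U'(2) t zX(2,3) that unfolding TI_def ET_def by fastforce
    ultimately show ?thesis by (simp add: prod_eq_iff)
  qed
  have ETf: "\<forall>d. 0 < d --> d < int (fst t) --> ET t \<inter> sh d (ET t) = {}" if t: "t \<in> TI" for t
  proof (intro allI impI equals0I)
    fix d y assume d: "0 < d" "d < int (fst t)" and y: "y \<in> ET t \<inter> sh d (ET t)"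
    have yX: "y \<in> TX" using y by (auto simp: sh_def)
    have "y \<in> sh (int 0) (ET t)" using y sh_0[OF clop_sub[OF ETc[OF t]]] by simp
    moreover have "y \<in> sh (int (nat d)) (ET t)" using y d by simp
    moreover have "nat d < fst t" "0 < fst t" using d by linarith+
    ultimately have "0 = nat d \<and> t = t" by (intro disj[OF t t, of 0 "nat d" y])
    then show False using d by simp
  qed
  \<comment> \<open>Interior levels and full tower: the \<open>D\<close>-neighbourhood of
    \<open>PT t\<close> lies in \<open>WT t\<close>, and the sets \<open>WT t\<close> are
    disjoint.\<close>
  define PT where "PT t = (\<Union>k\<in>{D..<fst t - D}. sh (int k) (ET t))" for t
  define WT where "WT t = (\<Union>k<fst t. sh (int k) (ET t))" for t
  define PP where "PP = (\<Union>t\<in>TI. PT t)"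
  define W where "W = (\<Union>t\<in>TI. WT t)"
  have PTc: "clop (PT t)" "clop (WT t)" if "t \<in> TI" for t
    unfolding PT_def WT_def by (rule clop_UN; use that ETc clop_sh in auto)+
  have PTUc: "clop (\<Union>t\<in>S. PT t)" "clop (\<Union>t\<in>S. WT t)" if "S \<subseteq> TI" for S
  proof -
    have "finite S" by (rule finite_subset[OF that TI])
    then show "clop (\<Union>t\<in>S. PT t)" "clop (\<Union>t\<in>S. WT t)"
      by (rule clop_UN; use that PTc in blast)+
  qed
  have PPc: "clop PP" "clop W" unfolding PP_def W_def using PTUc by auto
  have PW: "PT t \<subseteq> WT t" for t unfolding PT_def WT_def by (rule UN_mono) auto
  have WTd: "WT t \<inter> WT t' = {}" if "t \<in> TI" "t' \<in> TI" "t \<noteq> t'" for t t'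
    using disj[OF that(1,2)] that(3) unfolding WT_def by blast
  have PTs: "tp d z \<in> WT t" if "z \<in> PT t" "\<bar>d\<bar> \<le> int D" for z d t
  proof -
    have "z \<in> (\<Union>k\<in>{D..<fst t - D}. sh (int k) (ET t))" using that(1) by (simp only: PT_def)
    then obtain k where kk: "k \<in> {D..<fst t - D}" and z: "z \<in> sh (int k) (ET t)" by (rule UN_E)
    then have k: "D \<le> k" "k < fst t - D" "z \<in> sh (int k) (ET t)" by simp_all
    have zX: "z \<in> TX" using k by (simp add: sh_def)
    define k' where "k' = nat (int k + d)"
    have k': "int k' = int k + d" "k' < fst t" using k that(2) unfolding k'_def by linarith+
    have "tp (- int k') (tp d z) = tp (- int k) z" using tp_add[OF zX, of "- int k'" d] k' by simp
    then have "tp d z \<in> sh (int k') (ET t)" using k(3) tp_in[OF zX] by (simp add: sh_def)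
    then show ?thesis using k'(2) unfolding WT_def by blast
  qed
  have wE: "z \<in> W" if z: "z \<in> TX" "tp (- int j) z \<in> RH h" "N \<le> h" "h < 2 * N" "j < h" for z j h
  proof -
    have "tp (- int j) z \<in> E" using RH z by blast
    then obtain x where x: "x \<in> P" "tp (- int j) z \<in> U' x" using E(2) U'(3) by blast
    have "(h, x) \<in> TI" using z x by (simp add: TI_def)
    moreover have "z \<in> WT (h, x)" using z x by (auto simp: WT_def ET_def sh_def)
    ultimately show ?thesis unfolding W_def by blast
  qed
  have WV: "tp d z \<in> TX - W" if z: "z \<in> V2" and d: "\<bar>d\<bar> \<le> int D" for z d
  proof (rule ccontr)
    have zX: "z \<in> TX" using z clop_sub[OF V2c] by blast
    assume "tp d z \<notin> TX - W"
    then have "tp d z \<in> W" using tp_in[OF zX] by blast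
    then obtain t k where t: "t \<in> TI" "k < fst t" "tp (- int k) (tp d z) \<in> ET t" by (auto simp: W_def WT_def sh_def)
    then have "tp (- int k + d) z \<in> ET t" using tp_add[OF zX, of "- int k" d] by simp
    then have "tp (- int k + d) z \<in> E" using ETE by blast
    moreover have "\<bar>- int k + d\<bar> \<le> int (2 * N + D)" using t d by (auto simp: TI_def)
    ultimately show False using V2m[OF z] EV by blast
  qed
  \<comment> \<open>A point outside all towers and outside \<open>V2\<close> has been in
    \<open>V - V2\<close> fewer than \<open>N\<close> steps ago, possibly zero. So the uncovered set
    lies in \<open>N\<close> translates of a set of measure at most \<open>e\<close>.\<close>
  have gap: "\<exists>i<N. tp (- int i) z \<in> V - V2" if z: "z \<in> TX" "z \<notin> W" "z \<notin> V2" for z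
  proof (cases "z \<in> V")
    case True
    then show ?thesis using z N by (intro exI[of _ 0]) auto
  next
    case zV: False
    have noE: "tp (- int j) z \<notin> E" if "j < N" for j
    proof
      assume a: "tp (- int j) z \<in> E"
      then obtain h where "N \<le> h" "h < 2 * N" "tp (- int j) z \<in> RH h" using RHe by blast
      then show False using wE[OF z(1), of j h] that z(2) by simp
    qed
    have hit: "\<exists>k. \<bar>k\<bar> < int N \<and> tp k y \<in> E" if "y \<in> TX - V" for y using Ecov P(3) that by blast
    obtain k0 where k0: "\<bar>k0\<bar> < int N" "tp k0 z \<in> E" using hit z(1) zV by blast
    have "0 < k0"
    proof (rule ccontr)
      assume "\<not> 0 < k0"
      then have "k0 = - int (nat (- k0))" "nat (- k0) < N" using k0 by auto
      then show False using noE k0(2) by metis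
    qed
    then have k0': "tp (int (nat k0)) z \<in> E" "nat k0 < N" using k0 by auto
    define k where "k = (LEAST k. tp (int k) z \<in> E)"
    have k: "tp (int k) z \<in> E" unfolding k_def by (rule LeastI[of "\<lambda>k. tp (int k) z \<in> E"]) (rule k0')
    have kl: "tp (int i) z \<notin> E" if "i < k" for i using that not_less_Least unfolding k_def by blast
    have kN: "k < N" using Least_le[of "\<lambda>k. tp (int k) z \<in> E", OF k0'(1)] k0'(2) unfolding k_def by simp
    have k1: "0 < k"
    proof (rule ccontr)
      assume "\<not> 0 < k"
      then show False using noE[of 0] k N by simp
    qed
    \<comment> \<open>The next marker comes after \<open>k\<close> steps. If the point
      \<open>i\<close> steps back were outside \<open>V\<close>, it would have a marker within
      \<open>N\<close> steps, which by the choice of \<open>i\<close> must come before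
      \<open>z\<close>. The consecutive markers around \<open>z\<close> would then be fewer than
      \<open>2 * N\<close> steps apart, and \<open>z\<close> would lie on a tower level.\<close>
    define i where "i = N - k"
    have i: "i < N" "int i = int N - int k" using kN k1 by (auto simp: i_def)
    have yX: "tp (- int i) z \<in> TX" by (rule tp_in[OF z(1)])
    have "tp (- int i) z \<notin> V2"
    proof
      assume "tp (- int i) z \<in> V2"
      then have "tp (int i) (tp (- int i) z) \<in> V" using i by (intro V2m) auto
      then show False using zV z(1) by simp
    qed
    moreover have "tp (- int i) z \<in> V"
    proof (rule ccontr)
      assume "tp (- int i) z \<notin> V"
      then obtain l where l: "\<bar>l\<bar> < int N" "tp l (tp (- int i) z) \<in> E" using hit yX by blast
      then have j: "tp (l - int i) z \<in> E" using tp_add[OF z(1), of l "- int i"] by simp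
      have jk: "l - int i < int k" "- (2 * int N) + int k < l - int i" using l i by linarith+
      have "l - int i < 0"
      proof (rule ccontr)
        assume "\<not> l - int i < 0"
        then have "int (nat (l - int i)) = l - int i" "nat (l - int i) < k" using jk by auto
        then show False using kl j by metis
      qed
      define a0 where "a0 = nat (int i - l)"
      have a0: "int a0 = int i - l" using \<open>l - int i < 0\<close> by (simp add: a0_def)
      have ja: "tp (- int a0) z \<in> E" using j by (simp add: a0)
      \<comment> \<open>The most recent marker; together with \<open>k\<close> it gives the exact
        return time \<open>a + k\<close>.\<close>
      define a where "a = (LEAST a. tp (- int a) z \<in> E)"
      have a: "tp (- int a) z \<in> E" unfolding a_def by (rule LeastI[of "\<lambda>a. tp (- int a) z \<in> E"]) (rule ja)
      have al: "tp (- int b) z \<notin> E" if "b < a" for b using that not_less_Least unfolding a_def by blast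
      have "a \<le> a0" unfolding a_def by (rule Least_le) (rule ja)
      then have a2: "a + k < 2 * N" using jk(2) a0 by linarith
      have shift: "tp (int m) (tp (- int a) z) = tp (int m - int a) z" for m
        using tp_add[OF z(1), of "int m" "- int a"] by simp
      have "tp (int (a + k)) (tp (- int a) z) \<in> E" unfolding shift using k by simp
      moreover have "\<forall>m. 0 < m --> m < a + k --> tp (int m) (tp (- int a) z) \<notin> E"
      proof (intro allI impI)
        fix m assume m: "0 < m" "m < a + k"
        show "tp (int m) (tp (- int a) z) \<notin> E"
        proof (cases "m < a")
          case True
          then have "int m - int a = - int (a - m)" "a - m < a" using m by auto
          then show ?thesis unfolding shift using al by metis
        next
          case False
          then have "int m - int a = int (m - a)" "m - a < k" using m by auto
          then show ?thesis unfolding shift using kl by metis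
        qed
      qed
      ultimately have "N \<le> a + k \<and> tp (- int a) z \<in> RH (a + k)" using RHd a a2 k1 by simp
      then show False using wE[OF z(1), of a "a + k"] a2 k1 z(2) by simp
    qed
    ultimately show ?thesis using i(1) by blast
  qed
  define s where "s = (\<Sum>t\<in>TI. mu (ET t))"
  \<comment> \<open>Every tower has at least \<open>N\<close> levels, all levels are disjoint, and
    the whole space has measure 1.\<close>
  have sN: "real N * s \<le> 1"
  proof -
    let ?I = "{..<N} \<times> TI" and ?U = "\<lambda>z. sh (int (fst z)) (ET (snd z))"
    have "mu (\<Union>z\<in>?I. ?U z) = (\<Sum>z\<in>?I. mu (?U z))"
    proof (rule mu_UN)
      show "clop (?U z)" if "z \<in> ?I" for z using that ETc by (auto intro: clop_sh)
      show "?U z \<inter> ?U z' = {}" if zz: "z \<in> ?I" "z' \<in> ?I" "z \<noteq> z'" for z z'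
      proof (rule equals0I)
        fix y assume y: "y \<in> ?U z \<inter> ?U z'"
        have "fst z = fst z' \<and> snd z = snd z'"
          by (rule disj[of "snd z" "snd z'" "fst z" "fst z'" y]) (use zz y in \<open>auto simp: TI_def\<close>)
        then show False using zz(3) by (simp add: prod_eq_iff)
      qed
    qed (use TI in simp)
    also have "\<dots> = (\<Sum>z\<in>?I. mu (ET (snd z)))" by (rule sum.cong) (use ETc in \<open>auto simp: mu_sh\<close>)
    also have "\<dots> = (\<Sum>i<N. \<Sum>t\<in>TI. mu (ET t))"
      by (simp only: sum.cartesian_product) (simp add: case_prod_unfold)
    also have "\<dots> = real N * s" by (simp add: s_def)
    finally have "real N * s = mu (\<Union>z\<in>?I. ?U z)" by simp
    also have "\<dots> \<le> mu TX"
    proof (rule mu_mono)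
      show "clop (\<Union>z\<in>?I. ?U z)" by (rule clop_UN) (use TI ETc in \<open>auto intro: clop_sh\<close>)
    qed (auto simp: sh_def)
    finally show ?thesis by (simp add: mu_TX)
  qed
  have s0: "0 \<le> s" unfolding s_def by (rule sum_nonneg) (use ETc mu_nonneg in auto)
  have sle: "s \<le> 1 / real N" using sN N by (simp add: field_simps)
  have bd: "card ({..<fst t} - {D..<fst t - D}) \<le> 2 * D" if "t \<in> TI" for t
  proof -
    have "card ({..<fst t} - {D..<fst t - D}) \<le> card ({..<D} \<union> {fst t - D..<fst t})" by (rule card_mono) auto
    also have "\<dots> \<le> card {..<D} + card {fst t - D..<fst t}" by (rule card_Un_le)
    finally show ?thesis by simp
  qed
  \<comment> \<open>The rank \<open>rp\<close> of the unit is at most \<open>mu V2\<close>, and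
    \<open>mu V\<close> exceeds it by at most \<open>e\<close>.\<close>
  have VV: "mu (V - V2) \<le> e"
  proof -
    have c: "chi B * un 0 0 u = un 0 0 (gn B 0 1)" if "clop B" for B
      using clop_sub[OF that] by (simp add: chi_def dg_mult_un u_gn gn00 Int_absorb2)
    have uM: "un 0 0 u \<in> MM" using un_gn_in[OF clop_TX] by (simp add: u_gn)
    have "mu V \<le> rp (un 0 0 u) + e" using V(2) c[OF Vc] by (simp add: mu_def)
    moreover have "rp (un 0 0 u) \<le> mu V2" using rp_le[OF uM V2(1)] c[OF V2c] by (simp add: mu_def)
    moreover have "mu (V2 \<union> (V - V2)) = mu V2 + mu (V - V2)" by (rule mu_Un[OF V2c clop_Diff[OF Vc V2c]]) auto
    moreover have "V2 \<union> (V - V2) = V" using V2(2) by blast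
    ultimately show ?thesis by simp
  qed
  define R where "R = TX - (PP \<union> V2)"
  have Rc: "clop R" unfolding R_def by (intro clop_Diff clop_Un PPc V2c clop_TX)
  \<comment> \<open>\<open>R1\<close> collects the boundary levels of all towers, at most
    \<open>2 * D\<close> in each; \<open>R2\<close> collects the points described by
    \<open>gap\<close>.\<close>
  define R1 where "R1 = (\<Union>t\<in>TI. \<Union>k\<in>{..<fst t} - {D..<fst t - D}. sh (int k) (ET t))"
  define R2 where "R2 = (\<Union>i<N. sh (int i) (V - V2))"
  have R1c: "clop (\<Union>k\<in>{..<fst t} - {D..<fst t - D}. sh (int k) (ET t))" if "t \<in> TI" for t
    by (rule clop_UN) (use ETc[OF that] clop_sh in auto)
  have R12c: "clop R1" "clop R2" unfolding R1_def R2_def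
    by (rule clop_UN; use TI R1c Vc V2c in \<open>auto intro: clop_sh clop_Diff\<close>)+
  have "R \<subseteq> R1 \<union> R2"
  proof
    fix z assume z: "z \<in> R"
    show "z \<in> R1 \<union> R2"
    proof (cases "z \<in> W")
      case True
      then obtain t k where t: "t \<in> TI" "k < fst t" "z \<in> sh (int k) (ET t)" by (auto simp: W_def WT_def)
      have "k \<notin> {D..<fst t - D}" using z t by (auto simp: R_def PP_def PT_def)
      then have "k \<in> {..<fst t} - {D..<fst t - D}" using t(2) by blast
      then show ?thesis using t(1,3) unfolding R1_def by blast
    next
      case False
      then obtain i where "i < N" "tp (- int i) z \<in> V - V2" using gap[of z] z by (auto simp: R_def)
      then show ?thesis using z by (auto simp: R2_def R_def sh_def)
    qed
  qed
  then have "mu R \<le> mu (R1 \<union> R2)" by (rule mu_mono[OF Rc clop_Un[OF R12c]])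
  also have "\<dots> \<le> mu R1 + mu R2" by (rule mu_Un_le[OF R12c])
  also have "mu R2 \<le> (\<Sum>i<N. mu (sh (int i) (V - V2)))"
    unfolding R2_def by (rule mu_UN_le) (use Vc V2c in \<open>auto intro: clop_sh clop_Diff\<close>)
  also have "\<dots> \<le> real N * e" using VV by (simp add: mu_sh[OF clop_Diff[OF Vc V2c]] mult_left_mono)
  also have "mu R1 \<le> (\<Sum>t\<in>TI. 2 * real D * mu (ET t))"
  proof -
    have "mu R1 \<le> (\<Sum>t\<in>TI. mu (\<Union>k\<in>{..<fst t} - {D..<fst t - D}. sh (int k) (ET t)))"
      unfolding R1_def by (rule mu_UN_le) (use TI R1c in auto)
    also have "\<dots> \<le> (\<Sum>t\<in>TI. 2 * real D * mu (ET t))"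
    proof (rule sum_mono)
      fix t assume t: "t \<in> TI"
      have "mu (\<Union>k\<in>{..<fst t} - {D..<fst t - D}. sh (int k) (ET t)) \<le> (\<Sum>k\<in>{..<fst t} - {D..<fst t - D}. mu (sh (int k) (ET t)))"
        by (rule mu_UN_le) (use ETc[OF t] in \<open>auto intro: clop_sh\<close>)
      also have "\<dots> = real (card ({..<fst t} - {D..<fst t - D})) * mu (ET t)" by (simp add: mu_sh[OF ETc[OF t]])
      also have "\<dots> \<le> real (2 * D) * mu (ET t)"
        by (rule mult_right_mono) (use bd[OF t] mu_nonneg[OF ETc[OF t]] in auto)
      finally show "mu (\<Union>k\<in>{..<fst t} - {D..<fst t - D}. sh (int k) (ET t)) \<le> 2 * real D * mu (ET t)" by simp
    qed
    finally show ?thesis .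
  qed
  finally have muR: "mu R \<le> 2 * real D * s + real N * e" by (simp add: s_def sum_distrib_left)
  define f where "f M = (\<Sum>t\<in>TI. mu (ET t) * real (krank (flat (snd ({..<fst t} \<times> {0::nat}, phi0 (snd t) (fst t))) M)))" for M
  have PX: "snd t \<in> TX" if "t \<in> TI" for t using that P(2) by (auto simp: TI_def)
  have "cone FM f"
    unfolding f_def by (intro cone_sum cone_single TI phi0_apx PX mu_nonneg ETc)
  moreover have "\<bar>rho (?F M) - (rp (?F M) + f M)\<bar> \<le> real n * (4 * real D / real N + real N * e) + e" if M: "M \<in> FM" for M
  proof -
    have Mm: "M \<in> mat_over CP n n" using M FM by blast
    note Mx = FMx[OF M]
    have DM: "\<forall>i j d x. int D < \<bar>d\<bar> --> M i j d x = 0" by (rule bspec[OF D M])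
    note dgM = frm_deg[OF Mm DM]
    have ts: "rho (chi (\<Union>t\<in>S. PT t) * ?F M) = (\<Sum>t\<in>S. rho (chi (PT t) * ?F M))" if "finite S" "S \<subseteq> TI" for S
      using that
    proof (induction S rule: finite_induct)
      case empty
      then show ?case by (simp add: chi_def arank.zero[OF arank_rho])
    next
      case (insert t S)
      have t: "t \<in> TI" "S \<subseteq> TI" using insert.prems by auto
      have "rho (chi (PT t \<union> (\<Union>t\<in>S. PT t)) * ?F M) = rho (chi (PT t) * ?F M) + rho (chi (\<Union>t\<in>S. PT t) * ?F M)"
      proof (rule chi_orth_sep[OF arank_rho Mx PTc(1)[OF t(1)] PTUc(1)[OF t(2)] PTc(2)[OF t(1)] PTUc(2)[OF t(2)]])
        show d: "WT t \<inter> (\<Union>t\<in>S. WT t) = {}" using WTd[OF t(1)] t insert.hyps by blast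
        show "PT t \<inter> (\<Union>t\<in>S. PT t) = {}" using d PW by blast
        show "chi (PT t) * ?F M * chi (WT t) = chi (PT t) * ?F M"
          by (rule chi_sep[OF Mx dgM]) (rule PTs)
        show "chi (\<Union>t\<in>S. PT t) * ?F M * chi (\<Union>t\<in>S. WT t) = chi (\<Union>t\<in>S. PT t) * ?F M"
          by (rule chi_sep[OF Mx dgM]) (use PTs in blast)
      qed
      then show ?case using insert t by simp
    qed
    have r1: "rho (chi PP * ?F M) = (\<Sum>t\<in>TI. rho (chi (PT t) * ?F M))" unfolding PP_def by (rule ts[OF TI]) simp
    \<comment> \<open>The columns reached from the interiors lie over \<open>W\<close>, those
      reached from \<open>V2\<close> over its complement.\<close>
    have r2: "rho (chi (PP \<union> V2) * ?F M) = rho (chi PP * ?F M) + rho (chi V2 * ?F M)"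
    proof (rule chi_orth_sep[OF arank_rho Mx PPc(1) V2c PPc(2) clop_Diff[OF clop_TX PPc(2)]])
      have "PP \<subseteq> W" unfolding PP_def W_def using PW by blast
      then show "PP \<inter> V2 = {}" using WV[of _ 0] by fastforce
      show "chi PP * ?F M * chi W = chi PP * ?F M"
        by (rule chi_sep[OF Mx dgM]) (use PTs in \<open>unfold PP_def W_def, blast\<close>)
      show "chi V2 * ?F M * chi (TX - W) = chi V2 * ?F M"
        by (rule chi_sep[OF Mx dgM]) (rule WV)
    qed auto
    have r3: "rho (chi (PP \<union> V2) * ?F M) \<le> rho (?F M)" by (rule chi_le[OF arank_rho Mx clop_Un[OF PPc(1) V2c]])
    have "chi TX * ?F M = chi (PP \<union> V2) * ?F M + chi R * ?F M"
      using chi_Un[of "PP \<union> V2" R "?F M"] clop_sub[OF clop_Un[OF PPc(1) V2c]] by (simp add: R_def Un_absorb1)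
    then have "rho (?F M) \<le> rho (chi (PP \<union> V2) * ?F M) + rho (chi R * ?F M)"
      unfolding chi_TX(1)[OF Mx]
      using arank.add_le[OF arank_rho chi_in[OF Mx clop_Un[OF PPc(1) V2c]] chi_in[OF Mx Rc]] by simp
    also have "rho (chi R * ?F M) \<le> real n * mu R" by (rule chi_mu[OF Mx rows Rc])
    also have "real n * mu R \<le> real n * (2 * real D * s + real N * e)" by (rule mult_left_mono[OF muR]) simp
    finally have r4: "rho (?F M) \<le> rho (chi (PP \<union> V2) * ?F M) + real n * (2 * real D * s + real N * e)" by simp
    have r5: "rp (?F M) \<le> rho (chi V2 * ?F M)" by (rule rp_le[OF Mx V2(1)])
    have "rho (chi V2 * ?F M) \<le> rho (chi V * ?F M)" by (rule chi_mono[OF arank_rho Mx V2c Vc V2(2)])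
    moreover have "rho (chi V * ?F M) \<le> rp (?F M) + e" using V(2) M by blast
    ultimately have r6: "rho (chi V2 * ?F M) \<le> rp (?F M) + e" by simp
    \<comment> \<open>The interior rows are compared with all rows of the compression; at most
      \<open>2 * D * n\<close> rows differ in each tower.\<close>
    have r7: "\<bar>rho (chi PP * ?F M) - f M\<bar> \<le> 2 * real D * real n * s"
    proof -
      have "rho (chi (PT t) * ?F M) = real (krank (ent (WK {D..<fst t - D} (snd t) (fst t) n M))) * mu (ET t)" if t: "t \<in> TI" for t
        unfolding PT_def
      proof (rule Rokhlin_tower_rank[OF ETc[OF t] _ _ ETf[OF t] PX[OF t] Mm DM])
        show "0 < fst t" "2 * D \<le> fst t" using t N by (auto simp: TI_def)
        have sx: "snd t \<in> P" "snd t \<in> TX - V" "fst t < 2 * N" using t P(2) by (auto simp: TI_def)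
        have "sh k (ET t) \<subseteq> sh k (U (snd t))" for k using U'(1) sx(1) by (auto simp: sh_def ET_def)
        then show "\<forall>i j d k y. k < fst t --> y \<in> sh (int k) (ET t) --> M i j d y = M i j d (tp (int k) (snd t))"
          by (intro allI impI, intro Uk[OF sx(2), rule_format, OF M]) (use sx(3) in \<open>auto simp: subset_iff\<close>)
      qed
      then have "rho (chi PP * ?F M) - f M = (\<Sum>t\<in>TI. mu (ET t) * (real (krank (ent (WK {D..<fst t - D} (snd t) (fst t) n M))) - real (krank (flat (phi0 (snd t) (fst t)) M))))"
        unfolding r1 f_def by (simp add: sum_subtractf[symmetric] right_diff_distrib mult.commute)
      then have "\<bar>rho (chi PP * ?F M) - f M\<bar> \<le> (\<Sum>t\<in>TI. \<bar>mu (ET t) * (real (krank (ent (WK {D..<fst t - D} (snd t) (fst t) n M))) - real (krank (flat (phi0 (snd t) (fst t)) M)))\<bar>)"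
        by (simp only: sum_abs)
      also have "\<dots> \<le> (\<Sum>t\<in>TI. mu (ET t) * (2 * real D * real n))"
      proof (rule sum_mono)
        fix t assume t: "t \<in> TI"
        let ?a = "real (krank (ent (WK {D..<fst t - D} (snd t) (fst t) n M)))" and ?b = "real (krank (flat (phi0 (snd t) (fst t)) M))"
        have "card ({..<fst t} - {D..<fst t - D}) * n \<le> 2 * D * n" using bd[OF t] by simp
        then have "real (card ({..<fst t} - {D..<fst t - D}) * n) \<le> real (2 * D * n)" by (rule of_nat_mono)
        then have "\<bar>?a - ?b\<bar> \<le> real (2 * D * n)"
          using krank_WK[OF Mm, of "snd t" "fst t" "{D..<fst t - D}"] by linarith
        then have "mu (ET t) * \<bar>?a - ?b\<bar> \<le> mu (ET t) * real (2 * D * n)"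
          by (rule mult_left_mono) (rule mu_nonneg[OF ETc[OF t]])
        then show "\<bar>mu (ET t) * (?a - ?b)\<bar> \<le> mu (ET t) * (2 * real D * real n)"
          using mu_nonneg[OF ETc[OF t]] by (simp add: abs_mult)
      qed
      also have "\<dots> = 2 * real D * real n * s" by (simp add: s_def sum_distrib_right[symmetric] mult.commute)
      finally show ?thesis .
    qed
    have "real D * real n * s \<le> real D * real n * (1 / real N)" by (rule mult_left_mono[OF sle]) simp
    moreover have "real n * (4 * real D / real N) = 4 * (real D * real n * (1 / real N))" by simp
    \<comment> \<open>The factor 4 is 2 for the boundary levels contained in \<open>R\<close> and 2
      for the rows dropped in \<open>r7\<close>.\<close>
    ultimately have r8: "4 * (real D * real n * s) \<le> real n * (4 * real D / real N)" by linarith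
    have r9: "real n * (2 * real D * s + real N * e) = 2 * (real D * real n * s) + real n * (real N * e)" by (simp add: algebra_simps)
    have r10: "real n * (4 * real D / real N + real N * e) = real n * (4 * real D / real N) + real n * (real N * e)" by (simp add: distrib_left)
    have nn: "0 \<le> real D * real n * s" "0 \<le> real n * (real N * e)" using s0 e by auto
    have r7': "\<bar>rho (chi PP * ?F M) - f M\<bar> \<le> 2 * (real D * real n * s)" using r7 by (simp add: mult.assoc)
    show ?thesis using r2 r3 r4 r5 r6 r7' r8 nn e unfolding r9 r10 by linarith
  qed
  ultimately show ?thesis by blast
qed

end

section \<open>Choice of the constants and conclusion\<close>

context dyn
begin

lemma degree_bound:
  assumes FM: "finite FM" "FM \<subseteq> mat_over CP n n"
  shows "\<exists>D. \<forall>M\<in>FM. \<forall>i j d x. int D < \<bar>d\<bar> --> M i j d x = 0"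
proof -
  define S where "S = (\<Union>(M, i, j)\<in>FM \<times> {..<n} \<times> {..<n}. supp (M i j))"
  have "finite S" unfolding S_def using FM by (auto simp: mat_over_def carrier_CP)
  then obtain D where D: "\<forall>m\<in>(\<lambda>d. nat \<bar>d\<bar>) ` S. m \<le> D" using finite_nat_set_iff_bounded_le by blast
  have "M i j d x = 0" if M: "M \<in> FM" and d: "int D < \<bar>d\<bar>" for M i j d x
  proof (cases "i < n \<and> j < n")
    case True
    have "d \<notin> S" using D d by force
    then have "d \<notin> supp (M i j)" using True M unfolding S_def by blast
    then show ?thesis by (rule supp_out)
  next
    case False
    then have "M i j = \<zero>\<^bsub>CP\<^esub>" using FM M by (auto simp: mat_over_def not_less)
    then show ?thesis by (simp add: CP_simps)
  qed
  then show ?thesis by blast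
qed

text \<open>\<open>N\<close> is chosen first and makes the boundary error at most
  \<open>e / 2\<close>; \<open>dd\<close> depends on it and makes the error
  \<open>n * N * dd + dd\<close> equal to \<open>e / 2\<close>. The part at \<open>Fx\<close> needs
  no error, being in the cone exactly.\<close>

lemma rank_approximation:
  assumes FM: "finite FM" "FM \<subseteq> mat_over CP n n" and e: "0 < e"
  shows "\<exists>g. cone FM g \<and> (\<forall>M\<in>FM. \<bar>rk n n M - g M\<bar> \<le> e)"
proof -
  obtain D where D: "\<forall>M\<in>FM. \<forall>i j d x. int D < \<bar>d\<bar> --> M i j d x = 0" using degree_bound[OF FM] by (elim exE)
  obtain N0 :: nat where N0: "8 * real D * real n / e < real N0" using reals_Archimedean2 by blast
  define N where "N = N0 + 2 * D + 1"
  have N: "0 < N" "2 * D \<le> N" "real N0 \<le> real N" by (auto simp: N_def)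
  define dd where "dd = e / (2 * (real n * real N + 1))"
  have dd: "0 < dd" using e unfolding dd_def by (simp add: add_nonneg_pos)
  \<comment> \<open>Every positive \<open>k\<close> below \<open>N\<close> divides the factorial, so
    a point with a period below \<open>N\<close> is fixed by this power.\<close>
  define Fx where "Fx = {x \<in> TX. tp (int (fact N)) x = x}"
  have iv: "tp i x \<in> Fx" if x: "x \<in> Fx" for x i
  proof -
    have xX: "x \<in> TX" "tp (int (fact N)) x = x" using x by (auto simp: Fx_def)
    have "tp (int (fact N)) (tp i x) = tp i (tp (int (fact N)) x)"
      unfolding tp_add[OF xX(1), symmetric] by (simp only: add.commute)
    then show ?thesis using xX tp_in by (simp add: Fx_def)
  qed
  have Fs: "Fx \<subseteq> TX" by (auto simp: Fx_def)
  interpret F: dynF X T rk Fx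
    by (rule dynF.intro[OF dyn_axioms dynF_axioms.intro[OF Fs iv]])
  have cl: "closedin X Fx" unfolding Fx_def
    by (rule closedin_continuous_maps_eq[OF haus tp_cont]) (rule continuous_map_id[unfolded id_def])
  have off: "tp (int k) x \<noteq> x" if "x \<in> TX" "x \<notin> Fx" "0 < k" "k < N" for x k
  proof
    assume a: "tp (int k) x = x"
    have "k dvd fact N" using that by (intro dvd_fact) auto
    then obtain q where q: "fact N = k * q" by blast
    have "tp (int k * int m) x = x" for m
    proof (induction m)
      case (Suc m)
      have "tp (int k * int (Suc m)) x = tp (int k * int m) (tp (int k) x)"
        using tp_add[OF that(1), of "int k * int m" "int k"] by (simp add: algebra_simps)
      then show ?case by (simp only: a Suc.IH)
    qed simp
    from this[of q] have "tp (int (fact N)) x = x" unfolding q by simp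
    then show False using that by (simp add: Fx_def)
  qed
  obtain f where f: "cone FM f" "\<forall>M\<in>FM. \<bar>rho (frm emb n n M) - (F.rp (frm emb n n M) + f M)\<bar> \<le> real n * (4 * real D / real N + real N * dd) + dd"
    using F.Rokhlin_approximation[OF FM D N(1,2) dd off] by blast
  have "cone FM (\<lambda>M. F.rp (frm emb n n M))"
    by (rule F.cyclic_cone[OF FM D _ _ cl, of "fact N"]) (auto simp: Fx_def)
  then have c: "cone FM (\<lambda>M. F.rp (frm emb n n M) + f M)" using f(1) by (rule cone_add)
  have "real n * (4 * real D / real N + real N * dd) + dd = 4 * real D * real n / real N + (real n * real N + 1) * dd"
    by (simp add: algebra_simps)
  also have "(real n * real N + 1) * dd = e / 2"
  proof -
    have "real n * real N + 1 \<noteq> 0" by (metis add.commute add_nonneg_pos mult_nonneg_nonneg of_nat_0_le_iff zero_less_one less_irrefl)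
    then show ?thesis unfolding dd_def by (simp add: field_simps)
  qed
  also have "4 * real D * real n / real N \<le> e / 2"
  proof -
    have "8 * real D * real n / e \<le> real N" using N0 N(3) by linarith
    then have "8 * real D * real n \<le> real N * e" using e by (simp add: pos_divide_le_eq)
    moreover have "0 < real N" using N(1) by simp
    ultimately show ?thesis by (simp add: pos_divide_le_eq mult_ac)
  qed
  finally have "real n * (4 * real D / real N + real N * dd) + dd \<le> e" by simp
  then have "\<forall>M\<in>FM. \<bar>rk n n M - (F.rp (frm emb n n M) + f M)\<bar> \<le> e"
    using f(2) rho_frm FM(2) by (smt (verit, best) subsetD)
  then show ?thesis using c by blast
qed

end

theorem theorem5p5:
  fixes X :: "'x topology" and T :: "'x \<Rightarrow> 'x"
    and rk :: "nat \<Rightarrow> nat \<Rightarrow> (nat \<Rightarrow> nat \<Rightarrow> (int \<Rightarrow> 'x \<Rightarrow> 'k::field)) \<Rightarrow> real"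
  assumes "totally_disconnected_space X" and "compact_space X" and "metrizable_space X"
    and "homeomorphic_map X X T"
    and "sylvester_rank (crossed_product X T) rk"
  shows "regular_rank TYPE(int \<Rightarrow> 'x \<Rightarrow> 'k) (crossed_product X T) rk"
proof -
  interpret dyn X T rk by (rule dyn.intro) fact+
  \<comment> \<open>The integer index splits into even and odd positions, so two functions can be
    interleaved into one, and it makes the type infinite. This is the room needed for coding
    terms.\<close>
  define pr :: "(int \<Rightarrow> 'x \<Rightarrow> 'k) \<Rightarrow> (int \<Rightarrow> 'x \<Rightarrow> 'k) \<Rightarrow> int \<Rightarrow> 'x \<Rightarrow> 'k"
    where "pr f g = (\<lambda>i. if even i then f (i div 2) else g (i div 2))" for f g
  define tag :: "nat \<Rightarrow> int \<Rightarrow> 'x \<Rightarrow> 'k" where "tag m = (\<lambda>i x. if i = int m then 1 else 0)" for m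
  have pr2: "pr f g (2 * i) = f i" "pr f g (2 * i + 1) = g i" for f g i by (simp_all add: pr_def)
  show ?thesis
  proof (rule regular_criterion[where pr = pr and tag = tag, OF syl_axioms])
    show "pr a b = pr a' b' \<longleftrightarrow> a = a' \<and> b = b'" for a b a' b'
    proof
      assume e: "pr a b = pr a' b'"
      have "a i = a' i" "b i = b' i" for i using fun_cong[OF e, of "2 * i"] fun_cong[OF e, of "2 * i + 1"] by (simp_all add: pr2)
      then show "a = a' \<and> b = b'" by (auto intro: ext)
    qed simp
    show "tag m = tag m' \<longleftrightarrow> m = m'" for m m'
    proof
      assume "tag m = tag m'"
      then have "tag m (int m) undefined = tag m' (int m) undefined" by simp
      then show "m = m'" by (simp add: tag_def split: if_splits)
    qed simp
    fix n and FM :: "(nat \<Rightarrow> nat \<Rightarrow> int \<Rightarrow> 'x \<Rightarrow> 'k) set" and e :: real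
    assume "finite FM" "FM \<subseteq> mat_over (crossed_product X T) n n" "0 < e"
    from rank_approximation[OF this] obtain g where g: "cone FM g" "\<forall>M\<in>FM. \<bar>rk n n M - g M\<bar> \<le> e" by (elim exE conjE)
    from g(1) obtain K :: "(int \<Rightarrow> 'x \<Rightarrow> 'k, 'k) approximant set" and w where K: "finite K" "K \<subseteq> apx (crossed_product X T)" "\<forall>i\<in>K. 0 \<le> w i"
      "\<forall>M\<in>FM. g M = (\<Sum>i\<in>K. w i * real (krank (flat (snd i) M)))" unfolding cone_def by (elim exE conjE)
    have "\<forall>M\<in>FM. \<bar>rk n n M - (\<Sum>i\<in>K. w i * real (krank (flat (snd i) M)))\<bar> \<le> e"
    proof
      fix M assume M: "M \<in> FM"
      show "\<bar>rk n n M - (\<Sum>i\<in>K. w i * real (krank (flat (snd i) M)))\<bar> \<le> e"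
        unfolding K(4)[rule_format, OF M, symmetric] by (rule g(2)[rule_format, OF M])
    qed
    with K(1-3) show "\<exists>(K :: (int \<Rightarrow> 'x \<Rightarrow> 'k, 'k) approximant set) w. finite K \<and> K \<subseteq> apx (crossed_product X T) \<and> (\<forall>i\<in>K. 0 \<le> w i) \<and>
        (\<forall>M\<in>FM. \<bar>rk n n M - (\<Sum>i\<in>K. w i * real (krank (flat (snd i) M)))\<bar> \<le> e)"
      by (intro exI[of _ K] exI[of _ w] conjI)
  qed
qed

end
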